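(* Let $n\ge1$, $q=n-1$, and let $L[w]=w^{(n)}+\sum_{j=0}^{n-1}(a_j+b_jz)w^{(j)}$ with complex constants $a_j,b_j$ such that $a_0+b_0z\not\equiv0$ and $b_{n-1}=1$. Let $\Lambda_L$ be the Laplace contour integral solution of $L[w]=0$ defined in the context. Then either $\Lambda_L(z)=e^{-z^2/2}P(z)$ for some non-trivial polynomial $P$, or else the following is true: 1. for every $\epsilon>0$, $\displaystyle\frac{\log\Lambda_L(z)}{z^2}\to-\frac12$ as $z\to\infty$ on $|\arg z|<\frac34\pi-\epsilon$; 2. the Phragmén–Lindelöf indicator of $\Lambda_L$ of order $2$ is $h(\vartheta)=-\frac12\cos(2\vartheta)$ for $|\vartheta|<\frac34\pi$ and $h(\vartheta)=0$ for $\frac34\pi\le|\vartheta|\le\pi$; 3. for every $\epsilon>0$, $\Lambda_L$ has only finitely many zeros on $|\arg z|\le\frac34\pi-\epsilon$, and at most $o(r^2)$ zeros (as $r\to\infty$) on $\{|\arg z-\pi|<\frac\pi4-\epsilon,\ |z|<r\}$; 4. as $r\to\infty$, $T(r,\Lambda_L)\sim\frac1{2\pi}r^2$ and $N(r,1/\Lambda_L)\sim\frac1{4\pi}r^2$.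
   Context: Set $Q_0(t)=(-t)^n+\sum_{j=0}^{n-1}a_j(-t)^j$ and $Q_1(t)=\sum_{j=0}^{n-1}b_j(-t)^j$. Let $$\phi_L(t)=\frac1{Q_1(t)}\exp\Big[-\int\frac{Q_0(t)}{Q_1(t)}\,dt\Big],$$ determined up to a non-zero constant factor, where a single-valued holomorphic branch is fixed on $\{t:|t|>R_0,\ |\arg t|<\pi\}$ and $R_0$ exceeds the moduli of all zeros of $Q_1$. On this set $\phi_L(t)=\exp\big[\frac{t^{2}}{2}+\psi(t)\big]$ with $|\psi(t)|\le C|t|$ as $t\to\infty$. For $R>R_0$ let $\mathfrak C_{R,\pi/2}$ be the contour consisting of: the ray $t=ir$ with $r$ running from $+\infty$ to $R$; the circular arc on $|t|=R$ from $iR$ via $R$ to $-iR$; the ray $t=-ir$ with $r$ running from $R$ to $+\infty$. Then $$\Lambda_L(z)=\frac1{2\pi i}\int_{\mathfrak C_{R,\pi/2}}\phi_L(t)e^{-zt}\,dt,$$ which is an entire function, independent of the choice of $R>R_0$. $\log\Lambda_L$ denotes a holomorphic branch of the logarithm on the part of the sector with $|z|$ sufficiently large. The indicator of order $2$ of an entire function $f$ with $\log M(r,f)=O(r^2)$, where $M(r,f)=\max_{|z|=r}|f(z)|$, is $h(\vartheta)=\limsup_{r\to\infty}r^{-2}\log|f(re^{i\vartheta})|$. $T(r,f)$ is the Nevanlinna characteristic and $N(r,1/f)$ the integrated counting function of the zeros of $f$; $\sim$ means that the quotient tends to $1$.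
   Formalization: The exceptional case reads Λ_L(z)=e^{-z²/2-cz}P(z) with c=a_{n-1}-b_{n-2} (b_{-1}=0) instead of e^{-z²/2}P(z); as stated the claim fails, e.g. for n=1, b_0=1, a_0≠0, where Λ_L is a constant times e^{-z²/2-a_0 z} and has no zeros. *)

theory Defs
  imports "HOL-Complex_Analysis.Complex_Analysis" "HOL-Library.Landau_Symbols"
begin

(* Only the values a j, b j with j < n are used. *)
definition diff_operator ::
  "nat \<Rightarrow> (nat \<Rightarrow> complex) \<Rightarrow> (nat \<Rightarrow> complex) \<Rightarrow> (complex \<Rightarrow> complex) \<Rightarrow> complex \<Rightarrow> complex" where
  "diff_operator n a b w z = (deriv ^^ n) w z + (\<Sum>j<n. (a j + b j * z) * (deriv ^^ j) w z)"

definition symbol_Q0 :: "nat \<Rightarrow> (nat \<Rightarrow> complex) \<Rightarrow> complex \<Rightarrow> complex" where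
  "symbol_Q0 n a t = (- t) ^ n + (\<Sum>j<n. a j * (- t) ^ j)"

definition symbol_Q1 :: "nat \<Rightarrow> (nat \<Rightarrow> complex) \<Rightarrow> complex \<Rightarrow> complex" where
  "symbol_Q1 n b t = (\<Sum>j<n. b j * (- t) ^ j)"

(* The operator enters through its symbol Q0(t) + z * Q1(t). *)
lemma diff_operator_exp:
  "diff_operator n a b (\<lambda>z. exp (- z * t)) z
     = (symbol_Q0 n a t + z * symbol_Q1 n b t) * exp (- z * t)"
proof -
  have D: "(deriv ^^ j) (\<lambda>z. exp (- z * t)) = (\<lambda>z. (- t) ^ j * exp (- z * t))" for j
  proof (induction j)
    case 0
    then show ?case by simp
  next
    case (Suc j)
    have "deriv (\<lambda>z. (- t) ^ j * exp (- z * t)) z = (- t) ^ Suc j * exp (- z * t)" for z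
      by (rule DERIV_imp_deriv) (auto intro!: derivative_eq_intros)
    with Suc show ?case by auto
  qed
  show ?thesis
    unfolding diff_operator_def symbol_Q0_def symbol_Q1_def D
    by (simp add: algebra_simps sum.distrib sum_distrib_left sum_distrib_right)
qed

definition slit_exterior :: "real \<Rightarrow> complex set" where
  "slit_exterior R0 = {t. cmod t > R0 \<and> \<bar>Arg t\<bar> < pi}"

(* The primitive F of Q0/Q1 is arbitrary, so phi is fixed only up to a non-zero constant factor.
   Values of phi outside the slit exterior are unconstrained. *)
definition laplace_kernel ::
  "nat \<Rightarrow> (nat \<Rightarrow> complex) \<Rightarrow> (nat \<Rightarrow> complex) \<Rightarrow> real \<Rightarrow> (complex \<Rightarrow> complex) \<Rightarrow> bool" where
  "laplace_kernel n a b R0 \<phi> \<longleftrightarrow>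
     (\<exists>F. (\<forall>t\<in>slit_exterior R0.
             (F has_field_derivative symbol_Q0 n a t / symbol_Q1 n b t) (at t)) \<and>
          (\<forall>t\<in>slit_exterior R0. \<phi> t = 1 / symbol_Q1 n b t * exp (- F t)))"

(* The contour runs down the positive imaginary axis to i*R, clockwise along the arc through R
   to -i*R, and down the negative imaginary axis; the minus sign of the first summand
   is due to r running from infinity to R there. *)
definition laplace_contour_integral ::
  "real \<Rightarrow> (complex \<Rightarrow> complex) \<Rightarrow> complex \<Rightarrow> complex" where
  "laplace_contour_integral R \<phi> z =
     1 / (2 * of_real pi * \<i>) *
     (- integral {R..} (\<lambda>r. \<phi> (\<i> * of_real r) * exp (- z * (\<i> * of_real r)) * \<i>)
      + contour_integral (part_circlepath 0 R (pi / 2) (- (pi / 2))) (\<lambda>t. \<phi> t * exp (- z * t))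
      + integral {R..} (\<lambda>r. \<phi> (- \<i> * of_real r) * exp (- z * (- \<i> * of_real r)) * (- \<i>)))"

(* Constant term of Q0/Q1 at infinity when b (n - 1) = 1:
   Q0(t)/Q1(t) = - t + c + O(1/t), hence phi(t) = exp(t^2/2 - c*t + O(log |t|)).
   The translation of z by c reduces the equation to the case c = 0. *)
definition linear_coeff :: "nat \<Rightarrow> (nat \<Rightarrow> complex) \<Rightarrow> (nat \<Rightarrow> complex) \<Rightarrow> complex" where
  "linear_coeff n a b = a (n - 1) - (if n \<ge> 2 then b (n - 2) else 0)"

(* Extended real valued, with log 0 = -infinity (the library has ln 0 = 0). *)
definition pl_indicator :: "real \<Rightarrow> (complex \<Rightarrow> complex) \<Rightarrow> real \<Rightarrow> ereal" where
  "pl_indicator \<rho> f \<theta> =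
     Limsup at_top (\<lambda>r::real.
       if f (of_real r * cis \<theta>) = 0 then - \<infinity>
       else ereal (ln (cmod (f (of_real r * cis \<theta>))) / r powr \<rho>))"

(* Multiplicities are counted. *)
definition zero_count :: "(complex \<Rightarrow> complex) \<Rightarrow> complex set \<Rightarrow> nat" where
  "zero_count f S = (\<Sum>z\<in>{z\<in>S. f z = 0}. nat (zorder f z))"

(* Nevanlinna's functionals m(r,f), n(r,f), N(r,f), T(r,f) for meromorphic f.
   Poles are counted with multiplicity; N(r,1/f) is the functional N applied to 1/f. *)

definition nev_proximity :: "real \<Rightarrow> (complex \<Rightarrow> complex) \<Rightarrow> real" where
  "nev_proximity r f =
     1 / (2 * pi) * integral {0..2 * pi} (\<lambda>\<theta>. ln (max 1 (cmod (f (of_real r * cis \<theta>)))))"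

definition nev_pole_count :: "real \<Rightarrow> (complex \<Rightarrow> complex) \<Rightarrow> nat" where
  "nev_pole_count r f = (\<Sum>z\<in>{z. cmod z \<le> r \<and> is_pole f z}. nat (- zorder f z))"

definition nev_counting :: "real \<Rightarrow> (complex \<Rightarrow> complex) \<Rightarrow> real" where
  "nev_counting r f =
     integral {0..r} (\<lambda>t. (real (nev_pole_count t f) - real (nev_pole_count 0 f)) / t)
     + real (nev_pole_count 0 f) * ln r"

definition nev_characteristic :: "real \<Rightarrow> (complex \<Rightarrow> complex) \<Rightarrow> real" where
  "nev_characteristic r f = nev_proximity r f + nev_counting r f"

end

theory Submission
  imports Defs "HOL-Probability.Probability" "HOL-Real_Asymp.Real_Asymp"
begin

text \<open>Expanding \<open>Q\<^sub>0/Q\<^sub>1\<close> at infinity gives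
  \<open>\<phi>(t) = exp (t\<^sup>2/2 - c t) t\<^sup>\<kappa> U(1/t)\<close> with \<open>U\<close> holomorphic at \<open>0\<close> and \<open>U(0) \<noteq> 0\<close>, so that
  \<open>\<Lambda>(z) = L(z + c)\<close> for the transform \<open>L\<close> of the kernel without the factor \<open>exp (- c t)\<close>. Moving
  the contour to the vertical line through \<open>z\<close> shows that \<open>L(z)\<close> is asymptotic to a constant multiple of
  \<open>exp (- z\<^sup>2/2) z\<^sup>\<kappa>\<close> uniformly on sectors \<open>|arg z| \<le> 3\<pi>/4 - \<epsilon>\<close>, while \<open>L\<close> is of exponential type on the
  remaining sector.

  The point is that \<open>\<Lambda>\<close> is not too small there. Continuing the kernel from the upper half plane across
  the negative axis gives a second transform \<open>L'\<close>, and \<open>g(z) = L'(- z - c)\<close> is as small as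
  \<open>exp (- z\<^sup>2/2)\<close>, up to exponential type, around the negative real axis. The rays along
  \<open>i\<close> cancel in \<open>\<Lambda> - g\<close>, which is therefore of exponential type on the upper half plane. If \<open>\<Lambda>\<close> were of size \<open>exp (- \<delta> r\<^sup>2)\<close> on dilates of a ball in
  the left sector, the smallness of \<open>\<Lambda> - g\<close> would propagate through the upper half plane, forcing \<open>\<Lambda> = g\<close>.
  In that case \<open>L(w) exp (w\<^sup>2/2)\<close> has polynomial growth in all directions and Liouville's theorem
  yields the polynomial case. Otherwise the lower bound at many points, together with Jensen's formula and the
  Poisson kernel, gives the indicator, the number of zeros and the characteristic.\<close>

subsection \<open>Propagation of smallness\<close>

text \<open>The left sector has opening pi/2, which is critical for order 2:
  \<open>exp (- \<delta> z^2)\<close> is bounded there and decays like a Gaussian on every inner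
  ray, so no Phragmen-Lindelof argument inside the sector bounds \<open>\<Lambda>\<close> from
  below. The difference from \<open>g\<close> keeps exponential type on a half plane, of opening pi,
  and there Gaussian smallness forces vanishing. The negation of the desired lower bound speaks of
  an unbounded set of radii only, so smallness is carried along a filter finer than
  \<open>at_top\<close>. As the zeros crowd around the rays arg z = 3 pi/4 and arg z = - 3 pi/4, the
  lower bound is asked at one point of each dilated ball; inequalities of Jensen type turn this into
  statements on rays, on means over circles and on numbers of zeros. Contours are moved through
  primitives: for fixed \<open>z\<close> the integrand has a primitive on the slit exterior, the
  transform is the difference of its limits at the two ends of the contour, and a deformation
  amounts to computing such a limit along another vertical ray.\<close>

lemma eventually_affine_le_quadratic:
  assumes "(d::real) > 0"
  shows "\<forall>\<^sub>F r in at_top. C * r + D \<le> d * r ^ 2"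
  using assms by real_asymp

text \<open>Hadamard's three circles theorem in discrete form: the maximum principle for
  \<open>f z / (z - w) ^ k\<close> on the annulus between the radii \<open>a\<close> and
  \<open>b\<close>. An integer \<open>k\<close> keeps the quotient single valued, and the hypothesis
  on \<open>A * (b / a) ^ k\<close> makes the inner circle no worse than the outer one.\<close>

lemma small_on_inner_disc:
  assumes f: "f holomorphic_on cball w b" and ab: "0 < a" "a < b" and c: "a \<le> c"
    and A: "\<And>z. z \<in> cball w a \<Longrightarrow> norm (f z) \<le> A"
    and B: "\<And>z. z \<in> cball w b \<Longrightarrow> norm (f z) \<le> B"
    and k: "A * (b / a) ^ k \<le> B" and z: "norm (z - w) \<le> c" "c \<le> b"
  shows "norm (f z) \<le> B * (c / b) ^ k"
proof (cases "norm (z - w) \<le> a")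
  case True
  have Bp: "B \<ge> 0" using order_trans[OF norm_ge_zero B[of w]] ab by auto
  have "norm (f z) \<le> A" using A True by (auto simp: dist_norm norm_minus_commute)
  also have "A = A * (b / a) ^ k * (a / b) ^ k" using ab by (simp add: power_mult_distrib[symmetric])
  also have "\<dots> \<le> B * (a / b) ^ k" using k ab by (intro mult_right_mono) auto
  also have "\<dots> \<le> B * (c / b) ^ k" using Bp ab c by (intro mult_left_mono power_mono divide_right_mono) auto
  finally show ?thesis .
next
  case False
  define S where "S = cball w b - ball w a"
  define g where "g = (\<lambda>z. f z / (z - w) ^ k)"
  have ne: "u \<noteq> w" if "u \<in> S" for u using that ab by (auto simp: S_def)
  have hol: "g holomorphic_on S"
    unfolding g_def using ne by (intro holomorphic_intros holomorphic_on_subset[OF f]) (auto simp: S_def)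
  have clS: "closed S" unfolding S_def by (intro closed_Diff) auto
  have fr: "frontier S \<subseteq> sphere w a \<union> sphere w b"
  proof -
    have "ball w b - cball w a \<subseteq> interior S"
      by (rule interior_maximal) (auto simp: S_def)
    then have "x \<in> S \<and> x \<notin> ball w b - cball w a" if "x \<in> frontier S" for x
      using clS that by (auto simp: frontier_def)
    then show ?thesis by (fastforce simp: S_def)
  qed
  have "norm (g z) \<le> B / b ^ k"
  proof (rule maximum_modulus_frontier[of g S])
    show "g holomorphic_on interior S" using hol holomorphic_on_subset interior_subset by blast
    show "continuous_on (closure S) g" using hol clS by (simp add: holomorphic_on_imp_continuous_on)
    show "bounded S" by (auto simp: S_def intro: bounded_subset[of "cball w b"])
    show "z \<in> S" using False z by (auto simp: S_def dist_norm norm_minus_commute)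
    fix u assume "u \<in> frontier S"
    then consider "norm (u - w) = a" | "norm (u - w) = b" using fr by (auto simp: dist_norm norm_minus_commute)
    then show "norm (g u) \<le> B / b ^ k"
    proof cases
      case 1
      then have "norm (f u) \<le> A" by (intro A) (auto simp: dist_norm norm_minus_commute)
      then have "norm (g u) \<le> A / a ^ k" using 1 ab by (auto simp: g_def norm_divide norm_power divide_right_mono)
      also have "\<dots> = A * (b/a)^k / b^k" using ab by (simp add: power_divide)
      also have "\<dots> \<le> B / b ^ k" using k ab by (intro divide_right_mono) auto
      finally show ?thesis .
    next
      case 2
      then have "norm (f u) \<le> B" by (intro B) (auto simp: dist_norm norm_minus_commute)
      then show ?thesis using 2 ab by (auto simp: g_def norm_divide norm_power divide_right_mono)
    qed
  qed
  then have "norm (f z) \<le> B / b ^ k * norm (z - w) ^ k"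
  proof -
    have "norm (g z) * norm (z - w) ^ k \<le> B / b ^ k * norm (z - w) ^ k"
      using \<open>norm (g z) \<le> B / b ^ k\<close> by (intro mult_right_mono) auto
    moreover have "norm (z - w) > 0" using False ab by linarith
    ultimately show ?thesis by (simp add: g_def norm_divide norm_power)
  qed
  also have "\<dots> \<le> B / b ^ k * c ^ k"
  proof -
    have "B \<ge> 0" using order_trans[OF norm_ge_zero B[of w]] ab by auto
    then show ?thesis using z ab by (intro mult_left_mono power_mono) auto
  qed
  finally show ?thesis by (simp add: power_divide)
qed

text \<open>The filter is a parameter because a failed lower bound yields smallness along some
  unbounded set of radii only. \<open>F r\<close> stands for a rescaled function such as
  \<open>\<lambda>w. f (of_real r * w)\<close>.\<close>

definition uniformly_small :: "real filter \<Rightarrow> (real \<Rightarrow> complex \<Rightarrow> complex) \<Rightarrow> complex set \<Rightarrow> bool" where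
  "uniformly_small \<F> F S \<longleftrightarrow> (\<exists>\<delta>>0. \<forall>\<^sub>F r in \<F>. \<forall>w\<in>S. norm (F r w) \<le> exp (- \<delta> * r ^ 2))"

lemma uniformly_small_subset: "uniformly_small \<F> F S \<Longrightarrow> T \<subseteq> S \<Longrightarrow> uniformly_small \<F> F T"
  unfolding uniformly_small_def by (blast intro: eventually_mono)

lemma uniformly_small_Un:
  assumes "uniformly_small \<F> F S" "uniformly_small \<F> F T"
  shows "uniformly_small \<F> F (S \<union> T)"
proof -
  obtain d e where d: "d > 0" "\<forall>\<^sub>F r in \<F>. \<forall>w\<in>S. norm (F r w) \<le> exp (- d * r ^ 2)"
    and e: "e > 0" "\<forall>\<^sub>F r in \<F>. \<forall>w\<in>T. norm (F r w) \<le> exp (- e * r ^ 2)"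
    using assms by (auto simp: uniformly_small_def)
  have le: "exp (- d * r ^ 2) \<le> exp (- min d e * r ^ 2)" "exp (- e * r ^ 2) \<le> exp (- min d e * r ^ 2)" for r :: real
    by (auto intro!: mult_right_mono)
  have "\<forall>\<^sub>F r in \<F>. \<forall>w\<in>S \<union> T. norm (F r w) \<le> exp (- min d e * r ^ 2)"
    using d(2) e(2) by eventually_elim (use le in \<open>meson Un_iff order_trans\<close>)
  then show ?thesis using d(1) e(1) unfolding uniformly_small_def by (intro exI[of _ "min d e"]) auto
qed

lemma uniformly_small_compact:
  assumes K: "compact K" and sm: "\<And>w. w \<in> K \<Longrightarrow> \<exists>\<rho>>0. uniformly_small \<F> F (ball w \<rho>)"
  shows "uniformly_small \<F> F K"
proof -
  obtain \<rho> where \<rho>: "\<And>w. w \<in> K \<Longrightarrow> \<rho> w > 0 \<and> uniformly_small \<F> F (ball w (\<rho> w))" using sm by metis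
  obtain D where D: "D \<subseteq> K" "finite D" "K \<subseteq> (\<Union>w\<in>D. ball w (\<rho> w))"
    by (rule compactE_image[OF K, of K "\<lambda>w. ball w (\<rho> w)"]) (use \<rho> in auto)
  have "uniformly_small \<F> F (\<Union>w\<in>D. ball w (\<rho> w))"
    using D(2,1)
  proof (induction D)
    case empty
    show ?case by (auto simp: uniformly_small_def intro!: exI[of _ 1])
  next
    case (insert x D)
    then show ?case using \<rho> by (auto intro: uniformly_small_Un)
  qed
  then show ?thesis using D(3) uniformly_small_subset by blast
qed

text \<open>The a priori bound \<open>exp (C * r)\<close> is negligible against Gaussian decay, so
  each use of \<open>small_on_inner_disc\<close> moves smallness to a neighbouring disc and costs
  only a constant factor in the rate. Connectedness chains the discs.\<close>

lemma uniformly_small_propagates: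
  assumes \<F>: "\<F> \<le> at_top" and S: "open S" "connected S"
    and hol: "\<And>r. F r holomorphic_on S"
    and bd: "\<forall>\<^sub>F r in \<F>. \<forall>w\<in>S. norm (F r w) \<le> exp (C * r)"
    and w0: "w0 \<in> S" "\<rho> > 0" "uniformly_small \<F> F (ball w0 \<rho>)" and w: "w \<in> S"
  shows "\<exists>\<rho>>0. uniformly_small \<F> F (ball w \<rho>)"
proof (rule connected_induction_simple[OF S(2) w0(1) w])
  show "\<exists>\<rho>>0. uniformly_small \<F> F (ball w0 \<rho>)" using w0 by blast
next
  fix p assume "p \<in> S"
  then obtain e where e: "e > 0" "ball p e \<subseteq> S" using S(1) openE by blast
  \<comment> \<open>One quarter leaves enough room: for \<open>x\<close>, \<open>y\<close> in
    \<open>ball p d\<close> the disc of radius \<open>5/2 * d\<close> about \<open>x\<close> stays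
    inside \<open>ball p e\<close>, while the disc of radius \<open>9/4 * d\<close> about
    \<open>x\<close> contains \<open>ball y (d/4)\<close>.\<close>
  define d where "d = e / 4"
  have d: "d > 0" using e by (simp add: d_def)
  have "\<exists>\<rho>>0. uniformly_small \<F> F (ball y \<rho>)"
    if x: "x \<in> ball p d" and y: "y \<in> ball p d" and sx: "\<exists>\<rho>>0. uniformly_small \<F> F (ball x \<rho>)" for x y
  proof -
    from sx obtain \<rho> \<delta> where \<rho>: "\<rho> > 0" "\<delta> > 0"
      and ev: "\<forall>\<^sub>F r in \<F>. \<forall>w\<in>ball x \<rho>. norm (F r w) \<le> exp (- \<delta> * r ^ 2)"
      by (auto simp: uniformly_small_def)
    define a b c where "a = min (\<rho> / 2) d" and "b = 5/2 * d" and "c = 9/4 * d"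
    have abc: "0 < a" "a < b" "a \<le> c" "c < b" "0 < c" "a < \<rho>" using \<rho> d by (auto simp: a_def b_def c_def)
    have sub: "cball x b \<subseteq> S"
    proof -
      have "cball x b \<subseteq> ball p e"
      proof
        fix u assume "u \<in> cball x b"
        then show "u \<in> ball p e" using x d dist_triangle[of p u x] by (auto simp: d_def b_def)
      qed
      then show ?thesis using e by blast
    qed
    define L l where "L = ln (b / a)" and "l = ln (b / c)"
    have Ll: "L > 0" "l > 0" using abc by (auto simp: L_def l_def)
    have ex: "exp (of_nat k * L) = (b / a) ^ k" "exp (- (of_nat k * l)) = (c / b) ^ k" for k
      using abc by (auto simp: L_def l_def exp_of_nat_mult exp_minus power_divide)
    \<comment> \<open>The rate obtained is about \<open>\<delta> * l / L\<close>. Half of it is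
      kept, the other half absorbs \<open>\<bar>C\<bar> * r + l\<close>.\<close>
    define \<delta>' where "\<delta>' = \<delta> * l / (2 * L)"
    have \<delta>': "\<delta>' > 0" using \<rho> Ll by (simp add: \<delta>'_def)
    have "\<forall>\<^sub>F r in \<F>. \<bar>C\<bar> * r + l \<le> \<delta>' * r ^ 2"
      using eventually_affine_le_quadratic[OF \<delta>'] \<F> filter_leD by blast
    moreover have "\<forall>\<^sub>F r in \<F>. r \<ge> (0::real)" using eventually_ge_at_top \<F> filter_leD by blast
    ultimately have "\<forall>\<^sub>F r in \<F>. \<forall>u\<in>ball y (d/4). norm (F r u) \<le> exp (- \<delta>' * r ^ 2)"
      using ev bd
    proof eventually_elim
      case (elim r)
      \<comment> \<open>The largest exponent for which
        \<open>exp (- \<delta> * r^2) * (b / a) ^ k\<close> is still at most 1.\<close>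
      define k where "k = nat \<lfloor>\<delta> * r^2 / L\<rfloor>"
      have pos: "\<delta> * r^2 / L \<ge> 0" using \<rho> Ll by simp
      have k: "of_nat k * L \<le> \<delta> * r^2" "of_nat k * L \<ge> \<delta> * r^2 - L"
      proof -
        have *: "real k \<le> \<delta> * r^2 / L" "\<delta> * r^2 / L \<le> real k + 1" using pos unfolding k_def by linarith+
        from * show "of_nat k * L \<le> \<delta> * r^2" "of_nat k * L \<ge> \<delta> * r^2 - L"
          using Ll by (simp_all add: field_simps)
      qed
      have Cr: "C * r \<le> \<bar>C\<bar> * r" "\<bar>C\<bar> * r \<ge> 0" using elim(2) by (auto intro: mult_right_mono)
      have B: "norm (F r u) \<le> exp (\<bar>C\<bar> * r)" if "u \<in> cball x b" for u
        using elim(4) sub that Cr by (meson exp_le_cancel_iff order_trans subsetD)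
      show ?case
      proof
        fix u assume u: "u \<in> ball y (d/4)"
        have "dist x u \<le> c" using x y u dist_triangle[of x u y] dist_triangle[of x y p]
          by (auto simp: c_def dist_commute)
        then have "norm (F r u) \<le> exp (\<bar>C\<bar> * r) * (c / b) ^ k"
          using abc elim(3) B Cr k
          by (intro small_on_inner_disc[where w = x and a = a and A = "exp (- \<delta> * r ^ 2)"]
               holomorphic_on_subset[OF hol sub])
             (auto simp: dist_norm norm_minus_commute simp flip: ex exp_add)
        also have "\<dots> = exp (\<bar>C\<bar> * r - of_nat k * l)" by (simp flip: ex exp_add)
        also have "\<dots> \<le> exp (- \<delta>' * r ^ 2)"
        proof -
          have "(\<delta> * r^2 - L) * (l / L) \<le> (of_nat k * L) * (l / L)" using k Ll by (intro mult_right_mono) auto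
          then have "2 * \<delta>' * r^2 - l \<le> of_nat k * l" using Ll by (simp add: \<delta>'_def field_simps)
          then show ?thesis using elim(1) by simp
        qed
        finally show "norm (F r u) \<le> exp (- \<delta>' * r ^ 2)" .
      qed
    qed
    then have "uniformly_small \<F> F (ball y (d/4))" using \<delta>' by (auto simp: uniformly_small_def)
    then show ?thesis using d by (intro exI[of _ "d/4"]) auto
  qed
  moreover have "ball p d \<subseteq> S" using e d by (auto simp: d_def)
  moreover from this have "openin (top_of_set S) (ball p d)"
    by (simp add: openin_open_eq S(1))
  moreover have "p \<in> ball p d" using d by simp
  ultimately show "\<exists>T. openin (top_of_set S) T \<and> p \<in> T \<and> (\<forall>x\<in>T. \<forall>y\<in>T.
      (\<exists>\<rho>>0. uniformly_small \<F> F (ball x \<rho>)) \<longrightarrow> (\<exists>\<rho>>0. uniformly_small \<F> F (ball y \<rho>)))"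
    by meson
qed

lemma le_exp_diff: "a * exp b \<le> exp c \<Longrightarrow> a \<le> exp (c - b)" for a b c :: real
  by (simp add: exp_diff pos_le_divide_eq)

lemma norm_exp_le_of_Re: "Re z \<le> c \<Longrightarrow> norm (exp z) \<le> exp c"
  by simp

text \<open>With \<open>\<zeta> = - \<i> z\<close>, the weight \<open>exp (K (\<zeta> + \<zeta>\<^sup>2/r + 6 \<zeta>\<^sup>3/r\<^sup>2))\<close>
  is Gaussian on the diameter of the half disc of radius \<open>r\<close>, at most \<open>1\<close> on the part of the arc
  where nothing is known, and large at \<open>\<i> T\<close>.\<close>

lemma half_plane_uniqueness:
  assumes hol: "f holomorphic_on UNIV"
    and bd: "\<And>z. Im z \<ge> 0 \<Longrightarrow> norm (f z) \<le> exp (C * (norm z + 1))"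
    and \<F>: "\<F> \<le> at_top" "\<F> \<noteq> bot"
    and small: "uniformly_small \<F> (\<lambda>r w. f (of_real r * w)) {w. norm w = 1 \<and> (Im w)\<^sup>2 \<ge> 5/8 \<and> Im w \<ge> 0}"
  shows "f z = 0"
proof -
  define A where "A = {w::complex. norm w = 1 \<and> (Im w)\<^sup>2 \<ge> 5/8 \<and> Im w \<ge> 0}"
  define D where "D = max C 0"
  have D: "D \<ge> 0" "\<And>z. Im z \<ge> 0 \<Longrightarrow> norm (f z) \<le> exp (D * (norm z + 1))"
  proof -
    show "D \<ge> 0" by (simp add: D_def)
    fix z :: complex assume "Im z \<ge> 0"
    have "C * (norm z + 1) \<le> D * (norm z + 1)" by (intro mult_right_mono) (auto simp: D_def)
    then show "norm (f z) \<le> exp (D * (norm z + 1))" using bd[OF \<open>Im z \<ge> 0\<close>] by (meson exp_le_cancel_iff order_trans)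
  qed
  obtain \<delta> where \<delta>: "\<delta> > 0" and ev: "\<forall>\<^sub>F r in \<F>. \<forall>w\<in>A. norm (f (of_real r * w)) \<le> exp (- \<delta> * r ^ 2)"
    using small by (auto simp: uniformly_small_def A_def)
  \<comment> \<open>The maximum over \<open>y\<close> of
    \<open>D * y + D - \<delta> / 16 * y^2\<close>, the exponent met on the diameter.\<close>
  define M where "M = D + 4 * D\<^sup>2 / \<delta>"
  have M: "D * y + D - \<delta> / 16 * y^2 \<le> M" for y
  proof -
    have "0 \<le> (\<delta> / 4 * y - 2 * D)^2 / \<delta>" using \<delta> by simp
    also have "\<dots> = \<delta> / 16 * y^2 - D * y + 4 * D\<^sup>2 / \<delta>"
      using \<delta> by (simp add: power2_eq_square field_simps)
    finally show ?thesis by (simp add: M_def)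
  qed
  have M0: "M \<ge> 0" using D \<delta> by (simp add: M_def)
  \<comment> \<open>Above this height \<open>\<delta> * T / 16\<close> exceeds \<open>D\<close>, so
    the weight at \<open>\<i> * T\<close> beats the growth \<open>D * r\<close> of the boundary
    bound as \<open>r\<close> tends to infinity.\<close>
  have zero: "f (\<i> * of_real T) = 0" if T: "T > 16 * (D + 1) / \<delta>" "T > 0" for T
  proof (rule ccontr)
    assume ne: "f (\<i> * of_real T) \<noteq> 0"
    have key: "norm (f (\<i> * of_real T)) \<le> exp (M + D * (r + 1) - \<delta> / 16 * r * T)"
      if r: "r > T" and sm: "\<forall>w\<in>A. norm (f (of_real r * w)) \<le> exp (- \<delta> * r ^ 2)" for r
    proof -
      have rp: "r > 0" using r T by simp
      define g :: "complex \<Rightarrow> complex" where "g = (\<lambda>z. let \<zeta> = - \<i> * z in \<zeta> + \<zeta>^2 / of_real r + 6 * \<zeta>^3 / of_real r ^ 2)"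
      define K where "K = \<delta> * r / 16"
      define S where "S = {z. Im z > 0} \<inter> ball 0 r"
      have frS: "Im z \<ge> 0 \<and> norm z \<le> r \<and> (Im z = 0 \<or> norm z = r)" if "z \<in> frontier S" for z
      proof -
        have op: "open S" unfolding S_def by (intro open_Int open_halfspace_Im_gt) auto
        have "closed ({z. Im z \<ge> 0} \<inter> cball 0 r)" by (intro closed_Int closed_halfspace_Im_ge) auto
        then have "closure S \<subseteq> {z. Im z \<ge> 0} \<inter> cball 0 r"
          by (intro closure_minimal) (auto simp: S_def)
        then have "z \<in> {z. Im z \<ge> 0} \<inter> cball 0 r" "z \<notin> S"
          using that op by (auto simp: frontier_def interior_open)
        then show ?thesis by (auto simp: S_def)
      qed
      have holfg: "(\<lambda>z. f z * exp (of_real K * g z)) holomorphic_on X" for X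
        unfolding g_def Let_def using rp by (intro holomorphic_intros holomorphic_on_subset[OF hol]) auto
      have "norm (f (\<i> * of_real T) * exp (of_real K * g (\<i> * of_real T))) \<le> exp (M + D * (r + 1))"
      proof (rule maximum_modulus_frontier[where S = S and f = "\<lambda>z. f z * exp (of_real K * g z)"])
        show "continuous_on (closure S) (\<lambda>z. f z * exp (of_real K * g z))"
          using holfg holomorphic_on_imp_continuous_on by blast
        show "bounded S" by (auto simp: S_def)
        show "\<i> * of_real T \<in> S" using r T by (auto simp: S_def norm_mult)
        fix z assume z: "z \<in> frontier S"
        define x y where "x = Re z" and "y = Im z"
        have y0: "y \<ge> 0" using frS[OF z] by (simp add: y_def)
        have zxy: "- \<i> * z = Complex y (- x)" by (simp add: x_def y_def complex_eq_iff)
        have Reg: "Re (g z) = y + (y^2 - x^2) / r + 6 * (y^3 - 3 * x^2 * y) / r^2"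
          unfolding g_def Let_def zxy using rp
          by (simp add: power2_eq_square power3_eq_cube Re_divide_of_real flip: of_real_power)
             (simp add: field_simps)
        consider "y = 0" "norm z \<le> r" | "norm z = r" "y > 0" using frS[OF z] by (cases "y = 0") (auto simp: y_def)
        then show "norm (f z * exp (of_real K * g z)) \<le> exp (M + D * (r + 1))"
        proof cases
          case 1
          have "norm z = \<bar>x\<bar>" using 1 by (simp add: cmod_def x_def y_def)
          then have "norm (f z) \<le> exp (D * (\<bar>x\<bar> + 1))" using D(2)[of z] y0 by (simp add: y_def)
          moreover have "norm (exp (of_real K * g z)) = exp (- \<delta> / 16 * x^2)"
            using 1 rp by (simp add: Reg K_def)
          ultimately have "norm (f z * exp (of_real K * g z)) \<le> exp (D * (\<bar>x\<bar> + 1)) * exp (- \<delta> / 16 * x^2)"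
            by (simp add: norm_mult mult_right_mono)
          also have "\<dots> = exp (D * \<bar>x\<bar> + D - \<delta> / 16 * \<bar>x\<bar>^2)" by (simp add: algebra_simps flip: exp_add)
          also have "\<dots> \<le> exp (M + D * (r + 1))" using M[of "\<bar>x\<bar>"] D rp by (smt (verit) exp_le_cancel_iff mult_nonneg_nonneg)
          finally show ?thesis .
        next
          case 2
          have sq: "x^2 = r^2 - y^2" using 2(1) rp by (auto simp: cmod_def x_def y_def)
          define c where "c = y / r"
          have c: "0 < c" "c \<le> 1"
            using 2 rp abs_Im_le_cmod[of z] by (auto simp: c_def y_def)
          have yc: "y = c * r" using rp by (simp add: c_def)
          \<comment> \<open>With \<open>c = sin \<theta>\<close> on the arc this is \<open>r * (sin
            \<theta> - cos (2 * \<theta>) - 6 * sin (3 * \<theta>))\<close>.\<close>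
          have Reg': "Re (g z) = r * (c + (2 * c^2 - 1) + 6 * c * (4 * c^2 - 3))"
            unfolding Reg sq yc using rp by (simp add: field_simps power2_eq_square power3_eq_cube)
          show ?thesis
          proof (cases "c^2 \<ge> 5/8")
            case True
            define w where "w = z / of_real r"
            have "w \<in> A" using 2 True c rp by (auto simp: A_def w_def norm_divide c_def y_def)
            moreover have "z = of_real r * w" using rp by (simp add: w_def)
            ultimately have fz: "norm (f z) \<le> exp (- \<delta> * r ^ 2)" using sm by auto
            have "c^2 \<le> 1" using c by (simp add: power_le_one)
            then have "6 * c * (4 * c^2 - 3) \<le> 6"
            proof -
              have "c * (4 * c^2 - 3) \<le> c * 1" using c \<open>c^2 \<le> 1\<close> by (intro mult_left_mono) auto
              then have "6 * c * (4 * c^2 - 3) \<le> 6 * c" by (simp only: mult_1_right mult.assoc)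
              then show ?thesis using c by linarith
            qed
            \<comment> \<open>The bracket is at most 1 + 1 + 6, so with
              \<open>K = \<delta> * r / 16\<close> the weight uses up only half of the decay of
              \<open>f\<close>.\<close>
            then have "Re (g z) \<le> r * 8" unfolding Reg' using c \<open>c^2 \<le> 1\<close> rp by (intro mult_left_mono) auto
            then have "Re (of_real K * g z) \<le> \<delta> * r^2 / 2"
              using rp \<delta> mult_left_mono[of "Re (g z)" "r * 8" K] by (auto simp: K_def power2_eq_square)
            then have "norm (f z * exp (of_real K * g z)) \<le> exp (- \<delta> * r ^ 2) * exp (\<delta> * r^2 / 2)"
              unfolding norm_mult by (intro mult_mono fz norm_exp_le_of_Re) auto
            also have "\<dots> \<le> exp 0" unfolding exp_add[symmetric] using \<delta> by (subst exp_le_cancel_iff) auto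
            also have "\<dots> \<le> exp (M + D * (r + 1))" using M0 D rp by (subst exp_le_cancel_iff) auto
            finally show ?thesis .
          next
            case False
            \<comment> \<open>For \<open>c^2 < 5/8\<close> the term \<open>6 * (4 * c^2 - 3)\<close>
              is below -3 and outweighs \<open>1 + 2 * c\<close>. This is the origin of the bound
              5/8 in the smallness hypothesis.\<close>
            have "c * (1 + 2 * c + 6 * (4 * c^2 - 3)) \<le> 1"
            proof (cases "c \<le> 1/2")
              case True
              then have "c^2 \<le> 1/4" using c power_mono[of c "1/2" 2] by (simp add: power_divide)
              then have "1 + 2 * c + 6 * (4 * c^2 - 3) \<le> 1" using True by simp
              then have "c * (1 + 2 * c + 6 * (4 * c^2 - 3)) \<le> c * 1" using c by (intro mult_left_mono) auto
              then show ?thesis using c by linarith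
            next
              case cb: False
              have "1 + 2 * c + 6 * (4 * c^2 - 3) \<le> 0" using False c by simp
              then have "c * (1 + 2 * c + 6 * (4 * c^2 - 3)) \<le> 0" using c by (intro mult_nonneg_nonpos) auto
              then show ?thesis by linarith
            qed
            then have "c + (2 * c^2 - 1) + 6 * c * (4 * c^2 - 3) \<le> 0"
              by (simp add: algebra_simps power2_eq_square)
            then have "Re (of_real K * g z) \<le> 0"
              unfolding Reg' using rp \<delta> by (simp add: K_def Reg' mult_nonneg_nonpos)
            moreover have "norm (f z) \<le> exp (D * (r + 1))" using D(2)[of z] y0 2 by (simp add: y_def)
            ultimately have "norm (f z * exp (of_real K * g z)) \<le> exp (D * (r + 1)) * exp 0"
              unfolding norm_mult by (intro mult_mono norm_exp_le_of_Re) auto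
            also have "\<dots> \<le> exp (M + D * (r + 1))" using M0 by simp
            finally show ?thesis .
          qed
        qed
      qed (rule holfg)
      moreover have "Re (of_real K * g (\<i> * of_real T)) \<ge> K * T"
        using rp T \<delta> by (auto simp: g_def Let_def K_def Re_divide_of_real simp flip: of_real_power intro!: mult_left_mono)
      ultimately have "norm (f (\<i> * of_real T)) * exp (K * T) \<le> exp (M + D * (r + 1))"
        by (simp add: norm_mult) (smt (verit) exp_le_cancel_iff mult_left_mono norm_ge_zero)
      then have "norm (f (\<i> * of_real T)) \<le> exp (M + D * (r + 1) - K * T)" by (rule le_exp_diff)
      then show ?thesis by (simp add: K_def)
    qed
    have lim: "((\<lambda>r. exp (M + D * (r + 1) - \<delta> / 16 * r * T)) \<longlongrightarrow> 0) at_top"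
    proof -
      have "D - \<delta> / 16 * T < 0" using T \<delta> D by (simp add: field_simps)
      then have "((\<lambda>r. exp (M + D + (D - \<delta> / 16 * T) * r)) \<longlongrightarrow> 0) at_top" by real_asymp
      then show ?thesis by (simp add: algebra_simps)
    qed
    have "\<forall>\<^sub>F r in \<F>. exp (M + D * (r + 1) - \<delta> / 16 * r * T) < norm (f (\<i> * of_real T))"
    proof (rule filter_leD[OF \<F>(1)])
      show "\<forall>\<^sub>F r in at_top. exp (M + D * (r + 1) - \<delta> / 16 * r * T) < norm (f (\<i> * of_real T))"
        by (rule order_tendstoD(2)[OF lim]) (use ne in simp)
    qed
    moreover have "\<forall>\<^sub>F r in \<F>. r > T" using eventually_gt_at_top \<F> filter_leD by blast
    ultimately have "\<forall>\<^sub>F r in \<F>. False" using ev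
      by eventually_elim (use key in force)
    then show False using \<F> by (simp add: trivial_limit_def)
  qed
  define T0 where "T0 = 16 * (D + 1) / \<delta> + 1"
  have T0: "T0 > 0" using D(1) \<delta> by (simp add: T0_def add_nonneg_pos)
  show "f z = 0"
  proof (rule analytic_continuation[of f UNIV "(\<lambda>T. \<i> * of_real T) ` {T0..}" "\<i> * of_real T0"])
    show "\<i> * of_real T0 islimpt (\<lambda>T. \<i> * of_real T) ` {T0..}"
    proof (rule islimptI)
      fix X assume X: "\<i> * of_real T0 \<in> X" "open X"
      then obtain e where e: "e > 0" "ball (\<i> * of_real T0) e \<subseteq> X" using openE by blast
      have "\<i> * of_real (T0 + e/2) \<in> ball (\<i> * of_real T0) e"
        using e by (simp add: dist_norm norm_mult algebra_simps flip: right_diff_distrib)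
      then show "\<exists>y\<in>(\<lambda>T. \<i> * complex_of_real T) ` {T0..}. y \<in> X \<and> y \<noteq> \<i> * of_real T0"
        using e by (intro bexI[of _ "\<i> * of_real (T0 + e/2)"] imageI) (auto simp del: of_real_add)
    qed
    fix w assume "w \<in> (\<lambda>T. \<i> * of_real T) ` {T0..}"
    then show "f w = 0" using zero T0 by (auto simp: T0_def)
  qed (use hol in auto)
qed

section \<open>The left sector and lower bounds on it\<close>

definition left_sector :: "complex set" where
  "left_sector = {w. \<bar>Im w\<bar> < - Re w}"

lemma open_left_sector: "open left_sector"
  unfolding left_sector_def by (intro open_Collect_less continuous_intros)

lemma convex_left_sector: "convex left_sector"
proof -
  have "left_sector = {w. Re w + Im w < 0} \<inter> {w. Re w - Im w < 0}"
    by (auto simp: left_sector_def)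
  moreover have "convex {w::complex. Re w + Im w < 0}" "convex {w::complex. Re w - Im w < 0}"
    using convex_halfspace_lt[of "Complex 1 1" 0] convex_halfspace_lt[of "Complex 1 (-1)" 0]
    by (simp_all add: inner_complex_def)
  ultimately show ?thesis by (metis convex_Int)
qed

lemma left_sector_scale: "w \<in> left_sector \<Longrightarrow> r > 0 \<Longrightarrow> of_real r * w \<in> left_sector"
  using mult_strict_left_mono[of "\<bar>Im w\<bar>" "- Re w" r] by (simp add: left_sector_def abs_mult)

lemma closed_left_sector_scale:
  "\<bar>Im w\<bar> \<le> - Re w \<Longrightarrow> r \<ge> 0 \<Longrightarrow> \<bar>Im (of_real r * w)\<bar> \<le> - Re (of_real r * w)"
  using mult_left_mono[of "\<bar>Im w\<bar>" "- Re w" r] by (simp add: abs_mult)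

text \<open>Zeros in the sector rule out a pointwise lower bound. One good point in each dilated
  ball is what arguments of Jensen type need, and demanding it for all large \<open>r\<close> leaves
  no exceptional radii.\<close>

definition nowhere_small :: "(complex \<Rightarrow> complex) \<Rightarrow> bool" where
  "nowhere_small f \<longleftrightarrow> (\<forall>w \<rho> \<delta>. ball w \<rho> \<subseteq> left_sector \<longrightarrow> \<rho> > 0 \<longrightarrow> \<delta> > 0 \<longrightarrow>
     (\<forall>\<^sub>F r in at_top. \<exists>u\<in>ball w \<rho>. norm (f (of_real r * u)) > exp (- \<delta> * r\<^sup>2)))"

text \<open>Smallness along a ray is carried to an open set by the weight \<open>exp (K (1 + s \<i> \<zeta>)\<^sup>2)\<close>,
  which is at most \<open>1\<close> on the half circle over the ray.\<close>

lemma small_on_ray_imp_not_nowhere_small: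
  assumes hol: "f holomorphic_on UNIV"
    and bd: "\<And>z. \<bar>Im z\<bar> \<le> - Re z \<Longrightarrow> norm (f z) \<le> exp (C * (norm z + 1))" and C: "C \<ge> 0"
    and \<xi>: "norm \<xi> = 1" "\<bar>Im \<xi>\<bar> \<le> - Re \<xi>"
    and \<delta>: "\<delta> > 0" and small: "\<forall>\<^sub>F r in at_top. norm (f (of_real r * \<xi>)) \<le> exp (- \<delta> * r\<^sup>2)"
  shows "\<not> nowhere_small f"
proof
  assume ns: "nowhere_small f"
  obtain r0 where r0: "\<And>r. r \<ge> r0 \<Longrightarrow> norm (f (of_real r * \<xi>)) \<le> exp (- \<delta> * r\<^sup>2)"
    using small by (auto simp: eventually_at_top_linorder)
  \<comment> \<open>The sign selects the half disc over the ray that turns \<open>\<xi>\<close>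
    towards the negative real axis. This matters when the ray bounds the sector, since the other
    half disc then leaves it.\<close>
  define s :: real where "s = (if Im \<xi> \<ge> 0 then 1 else -1)"
  have s: "s = 1 \<or> s = -1" "s * s = 1" by (auto simp: s_def)
  define x y where "x = Re \<xi>" and "y = Im \<xi>"
  have xy: "\<bar>y\<bar> \<le> - x" "x < 0" using \<xi> by (cases "Re \<xi> = 0"; auto simp: x_def y_def cmod_def)+
  have mem: "\<bar>Im (\<xi> * (1 + \<zeta> / 2))\<bar> \<le> - Re (\<xi> * (1 + \<zeta> / 2))" 
       and mem': "s * Im \<zeta> > 0 \<Longrightarrow> \<xi> * (1 + \<zeta> / 2) \<in> left_sector"
    if \<zeta>: "norm \<zeta> \<le> 1" "s * Im \<zeta> \<ge> 0" for \<zeta>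
  proof -
    define u v where "u = 1 + Re \<zeta> / 2" and "v = s * Im \<zeta> / 2"
    have u: "u \<ge> 1/2" using abs_Re_le_cmod[of \<zeta>] \<zeta> by (auto simp: u_def)
    have v: "v \<ge> 0" "v \<le> 1/2" using abs_Im_le_cmod[of \<zeta>] \<zeta> s by (auto simp: v_def)
    have eq: "Re (\<xi> * (1 + \<zeta> / 2)) = x * u - s * y * v" "Im (\<xi> * (1 + \<zeta> / 2)) = y * u + s * x * v"
      using s by (auto simp: x_def y_def u_def v_def)
    have sy: "s * y \<ge> 0" "\<bar>y\<bar> = s * y" by (auto simp: s_def y_def)
    have i1: "y * u \<le> \<bar>y\<bar> * u" "- (y * u) \<le> \<bar>y\<bar> * u" "\<bar>y\<bar> * u \<le> - x * u"
      using mult_right_mono[of y "\<bar>y\<bar>" u] mult_right_mono[of "- y" "\<bar>y\<bar>" u] mult_right_mono[of "\<bar>y\<bar>" "- x" u] u xy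
      by auto
    have i2: "s * y * v \<ge> 0" "- x * v \<ge> 0" "- x * v \<le> - x * u"
      using sy v u xy by (auto intro!: mult_nonneg_nonneg mult_left_mono_neg mult_nonpos_nonneg)
    have yu: "s * (y * u) \<ge> 0" using sy u by (simp flip: mult.assoc)
    show "\<bar>Im (\<xi> * (1 + \<zeta> / 2))\<bar> \<le> - Re (\<xi> * (1 + \<zeta> / 2))"
      unfolding eq using i1 i2 s(1) yu by (auto simp: abs_le_iff)
    assume "s * Im \<zeta> > 0"
    then have "v > 0" by (simp add: v_def)
    \<comment> \<open>Equality would place \<open>\<zeta>\<close> at a point with real and imaginary
      parts of modulus 1, outside the unit disc. The strictness puts the image into the open sector
      even for a boundary ray.\<close>
    have "v < u" 
    proof (rule ccontr)
      assume "\<not> v < u"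
      then have "u = 1/2" "v = 1/2" using u v by auto
      then have "Re \<zeta> = -1" "s * Im \<zeta> = 1" by (auto simp: u_def v_def)
      then have "\<bar>Re \<zeta>\<bar> = 1" "\<bar>Im \<zeta>\<bar> = 1" using s by auto
      then have "(norm \<zeta>)^2 = 2" by (simp add: cmod_power2 flip: power2_abs[of "Re \<zeta>"] power2_abs[of "Im \<zeta>"])
      moreover have "(norm \<zeta>)^2 \<le> 1" using \<zeta> by (simp add: power_le_one)
      ultimately show False by simp
    qed
    then have "- x * v > 0" "- x * v < - x * u" using xy \<open>v > 0\<close> by (auto intro!: mult_neg_pos)
    then show "\<xi> * (1 + \<zeta> / 2) \<in> left_sector"
      unfolding left_sector_def mem_Collect_eq eq using i1 i2 s(1) yu by (auto simp: abs_less_iff)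
  qed
  have nrm: "norm (\<xi> * (1 + \<zeta> / 2)) \<le> 3/2" if "norm \<zeta> \<le> 1" for \<zeta>
    using norm_triangle_ineq[of 1 "\<zeta>/2"] that \<xi> by (simp add: norm_mult)
  define S where "S = {\<zeta>. s * Im \<zeta> > 0} \<inter> ball 0 1"
  have frS: "s * Im z \<ge> 0 \<and> norm z \<le> 1 \<and> (Im z = 0 \<or> norm z = 1)" if "z \<in> frontier S" for z
  proof -
    have op: "open S" unfolding S_def by (intro open_Int open_Collect_less continuous_intros) auto
    have "closed ({z. s * Im z \<ge> 0} \<inter> cball 0 1)" by (intro closed_Int closed_Collect_le continuous_intros) auto
    then have "closure S \<subseteq> {z. s * Im z \<ge> 0} \<inter> cball 0 1"
      by (intro closure_minimal) (auto simp: S_def)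
    then have "z \<in> {z. s * Im z \<ge> 0} \<inter> cball 0 1" "z \<notin> S"
      using that op by (auto simp: frontier_def interior_open)
    then show ?thesis using s by (auto simp: S_def)
  qed
  have bound: "norm (f (of_real r * (\<xi> * (1 + \<zeta> / 2)))) \<le> exp (C * (2 * r + 1) - \<delta> * r\<^sup>2 / 20)"
    if r: "r \<ge> 2 * r0" "r \<ge> 1" and \<zeta>: "\<zeta> \<in> ball (\<i> * of_real s / 4) (1/10)" for r \<zeta>
  proof -
    \<comment> \<open>The diameter is mapped to points \<open>t * \<xi>\<close> with
      \<open>t \<ge> r / 2\<close>; there \<open>f\<close> is at most \<open>exp (- (2 * K))\<close>
      and the weight at most \<open>exp K\<close>.\<close>
    define K where "K = \<delta> * r\<^sup>2 / 8"
    have K: "K > 0" using \<delta> r by (simp add: K_def)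
    define F where "F = (\<lambda>\<zeta>. f (of_real r * (\<xi> * (1 + \<zeta> / 2))) * exp (of_real K * (1 + of_real s * \<i> * \<zeta>)^2))"
    have Re2: "Re (of_real K * (1 + of_real s * \<i> * z)^2) = K * ((1 - s * Im z)^2 - (Re z)^2)" for z
      using s by (auto simp: power2_eq_square algebra_simps)
    have all: "norm (f (of_real r * (\<xi> * (1 + z / 2)))) \<le> exp (C * (2 * r + 1))"
      if "norm z \<le> 1" "s * Im z \<ge> 0" for z
    proof -
      have "norm (f (of_real r * (\<xi> * (1 + z / 2)))) \<le> exp (C * (norm (of_real r * (\<xi> * (1 + z / 2))) + 1))"
        using mem[OF that] r by (intro bd closed_left_sector_scale) auto
      also have "\<dots> \<le> exp (C * (2 * r + 1))"
        using nrm[OF that(1)] r C by (simp add: norm_mult mult_left_mono)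
      finally show ?thesis .
    qed
    have u: "\<bar>Re \<zeta>\<bar> \<le> 1/10" "\<bar>Im \<zeta> - s/4\<bar> \<le> 1/10"
    proof -
      have q: "norm (\<zeta> - \<i> * of_real s / 4) \<le> 1/10" using \<zeta> by (simp add: dist_norm norm_minus_commute)
      show "\<bar>Re \<zeta>\<bar> \<le> 1/10" "\<bar>Im \<zeta> - s/4\<bar> \<le> 1/10"
        using order_trans[OF abs_Re_le_cmod q] order_trans[OF abs_Im_le_cmod q] by auto
    qed
    have sI: "s * Im \<zeta> \<ge> 3/20" "s * Im \<zeta> \<le> 7/20" using u s by (auto simp: abs_if split: if_splits)
    have "\<bar>Im \<zeta>\<bar> \<le> 7/20" proof -
      have "\<bar>s / 4\<bar> = 1/4" using s by auto
      then show ?thesis using u(2) by linarith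
    qed
    then have "norm \<zeta> < 1" using cmod_le[of \<zeta>] u by linarith
    then have \<zeta>S: "\<zeta> \<in> S" using sI by (auto simp: S_def)
    have holF: "F holomorphic_on X" for X
      unfolding F_def
      by (intro holomorphic_intros holomorphic_on_compose_gen[OF _ hol, unfolded o_def]) auto
    have "norm (F \<zeta>) \<le> exp (C * (2 * r + 1))"
    proof (rule maximum_modulus_frontier[where S = S and f = F])
      show "continuous_on (closure S) F"
        using holF holomorphic_on_imp_continuous_on by blast
      show "bounded S" by (auto simp: S_def)
      fix z assume z: "z \<in> frontier S"
      note z' = frS[OF z]
      show "norm (F z) \<le> exp (C * (2 * r + 1))"
      proof (cases "norm z = 1")
        case True
        have "(Re z)^2 = 1 - (s * Im z)^2" using True cmod_power2[of z] s by auto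
        then have "(1 - s * Im z)^2 - (Re z)^2 = 2 * (s * Im z) * (s * Im z - 1)"
          by (simp add: power2_eq_square algebra_simps)
        also have "\<dots> \<le> 0"
          using z' abs_Im_le_cmod[of z] s by (intro mult_nonneg_nonpos) auto
        finally have "Re (of_real K * (1 + of_real s * \<i> * z)^2) \<le> 0"
          unfolding Re2 using K by (simp add: mult_nonneg_nonpos)
        then have "norm (F z) \<le> exp (C * (2 * r + 1)) * exp 0"
          unfolding F_def norm_mult using z' by (intro mult_mono all norm_exp_le_of_Re) auto
        then show ?thesis by simp
      next
        case False
        then have I0: "Im z = 0" using z' by auto
        define t where "t = r * (1 + Re z / 2)"
        have "\<bar>Re z\<bar> \<le> 1" using z' abs_Re_le_cmod[of z] by auto
        then have t: "t \<ge> r / 2" using mult_left_mono[of "1/2" "1 + Re z/2" r] r by (auto simp: t_def)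
        have eq: "of_real r * (\<xi> * (1 + z / 2)) = of_real t * \<xi>"
          using I0 by (auto simp: t_def complex_eq_iff algebra_simps)
        have "norm (f (of_real r * (\<xi> * (1 + z / 2)))) \<le> exp (- \<delta> * t^2)"
          unfolding eq using t r by (intro r0) simp
        also have "\<dots> \<le> exp (- \<delta> * (r/2)^2)"
          using t r \<delta> by (simp add: power_mono del: power_divide)
        finally have "norm (f (of_real r * (\<xi> * (1 + z / 2)))) \<le> exp (- (2 * K))" by (simp add: K_def power_divide)
        moreover have "Re (of_real K * (1 + of_real s * \<i> * z)^2) \<le> K"
          unfolding Re2 I0 using K by auto
        ultimately have "norm (F z) \<le> exp (- (2 * K)) * exp K"
          unfolding F_def norm_mult by (intro mult_mono norm_exp_le_of_Re) auto
        also have "\<dots> \<le> exp (C * (2 * r + 1))"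
          unfolding exp_add[symmetric] using K C r by (subst exp_le_cancel_iff) (smt (verit) mult_nonneg_nonneg)
        finally show ?thesis .
      qed
    qed (use \<zeta>S holF in auto)
    \<comment> \<open>On the ball about \<open>\<i> * s / 4\<close> the square bracket is at least
      \<open>(13/20)^2 - (1/10)^2 > 2/5\<close>, which gives the gain
      \<open>2/5 * K = \<delta> * r\<^sup>2 / 20\<close>.\<close>
    moreover have "Re (of_real K * (1 + of_real s * \<i> * \<zeta>)^2) \<ge> \<delta> * r\<^sup>2 / 20"
    proof -
      have "(13/20)^2 \<le> (1 - s * Im \<zeta>)^2" using sI by (intro power_mono) auto
      moreover have "(Re \<zeta>)^2 \<le> (1/10)^2" using u by (intro power2_le_iff_abs_le[THEN iffD2]) auto
      ultimately have "2/5 \<le> (1 - s * Im \<zeta>)^2 - (Re \<zeta>)^2" by (simp add: power2_eq_square)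
      then have "K * (2/5) \<le> Re (of_real K * (1 + of_real s * \<i> * \<zeta>)^2)" unfolding Re2 using K by (intro mult_left_mono) auto
      then show ?thesis by (simp add: K_def)
    qed
    ultimately have "norm (f (of_real r * (\<xi> * (1 + \<zeta> / 2)))) * exp (\<delta> * r\<^sup>2 / 20) \<le> exp (C * (2 * r + 1))"
      unfolding F_def norm_mult norm_exp_eq_Re
      by (smt (verit) exp_le_cancel_iff mult_left_mono norm_ge_zero)
    then show ?thesis by (rule le_exp_diff)
  qed
  define c where "c = \<xi> * (1 + \<i> * of_real s / 8)"
  have ball: "\<exists>\<zeta>\<in>ball (\<i> * of_real s / 4) (1/10). w = \<xi> * (1 + \<zeta> / 2)" if "w \<in> ball c (1/20)" for w
  proof (rule bexI[of _ "2 * (w / \<xi> - 1)"])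
    have x0: "\<xi> \<noteq> 0" using \<xi> by auto
    show "w = \<xi> * (1 + 2 * (w / \<xi> - 1) / 2)" using x0 by (simp add: field_simps)
    have eq: "\<i> * of_real s / 4 - 2 * (w / \<xi> - 1) = 2 * ((c - w) / \<xi>)" using x0 by (simp add: c_def field_simps)
    show "2 * (w / \<xi> - 1) \<in> ball (\<i> * of_real s / 4) (1/10)"
      using that \<xi> unfolding mem_ball dist_norm eq norm_mult norm_divide by simp
  qed
  have sub: "ball c (1/20) \<subseteq> left_sector"
  proof
    fix w assume "w \<in> ball c (1/20)"
    then obtain \<zeta> where \<zeta>: "\<zeta> \<in> ball (\<i> * of_real s / 4) (1/10)" and w: "w = \<xi> * (1 + \<zeta> / 2)" using ball by blast
    have u: "\<bar>Re \<zeta>\<bar> \<le> 1/10" "\<bar>Im \<zeta> - s/4\<bar> \<le> 1/10"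
    proof -
      have q: "norm (\<zeta> - \<i> * of_real s / 4) \<le> 1/10" using \<zeta> by (simp add: dist_norm norm_minus_commute)
      show "\<bar>Re \<zeta>\<bar> \<le> 1/10" "\<bar>Im \<zeta> - s/4\<bar> \<le> 1/10"
        using order_trans[OF abs_Re_le_cmod q] order_trans[OF abs_Im_le_cmod q] by auto
    qed
    have sI: "s * Im \<zeta> > 0" using u s by (auto simp: abs_if split: if_splits)
    have "\<bar>Im \<zeta>\<bar> \<le> 7/20" proof -
      have "\<bar>s / 4\<bar> = 1/4" using s by auto
      then show ?thesis using u(2) by linarith
    qed
    then have "norm \<zeta> \<le> 1" using cmod_le[of \<zeta>] u by linarith
    then show "w \<in> left_sector" unfolding w using sI by (intro mem') auto
  qed
  have "\<forall>\<^sub>F r in at_top. \<exists>u\<in>ball c (1/20). norm (f (of_real r * u)) > exp (- (\<delta>/40) * r\<^sup>2)"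
    using ns[unfolded nowhere_small_def, rule_format, OF sub, of "\<delta>/40"] \<delta> by simp
  moreover have "\<forall>\<^sub>F r in at_top. r \<ge> 2 * r0" "\<forall>\<^sub>F r::real in at_top. r \<ge> 1" by (auto intro: eventually_ge_at_top)
  moreover have "\<forall>\<^sub>F r in at_top. (2 * C) * r + C \<le> (\<delta> / 40) * r\<^sup>2"
    using \<delta> by (intro eventually_affine_le_quadratic) auto
  ultimately have "\<forall>\<^sub>F r::real in at_top. False"
  proof eventually_elim
    case (elim r)
    then obtain u where u: "u \<in> ball c (1/20)" "norm (f (of_real r * u)) > exp (- (\<delta>/40) * r\<^sup>2)" by blast
    obtain \<zeta> where "\<zeta> \<in> ball (\<i> * of_real s / 4) (1/10)" "u = \<xi> * (1 + \<zeta> / 2)" using ball[OF u(1)] by blast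
    then have "norm (f (of_real r * u)) \<le> exp (C * (2 * r + 1) - \<delta> * r\<^sup>2 / 20)" using bound elim by auto
    also have "\<dots> \<le> exp (- (\<delta>/40) * r\<^sup>2)" using elim by (simp add: algebra_simps)
    finally show False using u by simp
  qed
  then show False by (simp add: trivial_limit_def[symmetric])
qed

text \<open>The two bounds of exponential type live on different regions: \<open>f\<close> has one
  on the left sector, \<open>f - g\<close> on the upper half plane. Smallness changes from
  \<open>f\<close> to \<open>f - g\<close> in the overlap, at a place where \<open>g\<close> is
  Gaussian small by itself.\<close>

lemma nowhere_small_or_eq:
  assumes hol: "f holomorphic_on UNIV" "g holomorphic_on UNIV" and C: "C \<ge> 0"
    and f: "\<And>z. \<bar>Im z\<bar> \<le> - Re z \<Longrightarrow> norm (f z) \<le> exp (C * (norm z + 1))"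
    and g: "\<And>z. Re z \<le> - X \<Longrightarrow> norm (g z) \<le> exp (- Re (z\<^sup>2) / 2 + C * (norm z + 1))"
    and fg: "\<And>z. Im z \<ge> 0 \<Longrightarrow> norm (f z - g z) \<le> exp (C * (norm z + 1))"
  shows "nowhere_small f \<or> f = g"
proof (rule disjCI)
  assume "f \<noteq> g"
  show "nowhere_small f"
    unfolding nowhere_small_def
  proof (intro allI impI, rule ccontr)
    fix w \<rho> \<delta>
    assume w: "ball w \<rho> \<subseteq> left_sector" "\<rho> > 0" and \<delta>: "(\<delta>::real) > 0"
      and ne: "\<not> (\<forall>\<^sub>F r in at_top. \<exists>u\<in>ball w \<rho>. norm (f (of_real r * u)) > exp (- \<delta> * r\<^sup>2))"
    \<comment> \<open>The radii for which \<open>f\<close> is small on the whole dilated ball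
      generate this filter; it is proper because the lower bound is not eventually true.\<close>
    define \<F> where "\<F> = inf at_top (principal {r. \<forall>u\<in>ball w \<rho>. norm (f (of_real r * u)) \<le> exp (- \<delta> * r\<^sup>2)})"
    have \<F>: "\<F> \<le> at_top" by (simp add: \<F>_def)
    have evF: "eventually P \<F>" if "eventually P at_top" for P using that \<F> filter_leD by blast
    have "\<F> \<noteq> bot"
    proof
      assume "\<F> = bot"
      then have "eventually (\<lambda>_. False) \<F>" by simp
      then show False using ne unfolding \<F>_def eventually_inf_principal
        by (auto elim!: eventually_mono simp: not_le)
    qed
    define fr gr where "fr = (\<lambda>(r::real) u. f (of_real r * u))" and "gr = (\<lambda>(r::real) u. g (of_real r * u))"
    have hf: "fr r holomorphic_on Y" and hg: "gr r holomorphic_on Y" for r Y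
      unfolding fr_def gr_def
      by (auto intro!: holomorphic_intros holomorphic_on_compose_gen[OF _ hol(1), unfolded o_def]
          holomorphic_on_compose_gen[OF _ hol(2), unfolded o_def])
    have s0: "uniformly_small \<F> fr (ball w \<rho>)"
      unfolding uniformly_small_def using \<delta>
      by (intro exI[of _ \<delta>]) (auto simp: \<F>_def fr_def eventually_inf_principal)
    have ge1: "\<forall>\<^sub>F r::real in \<F>. r \<ge> 1" by (intro evF eventually_ge_at_top)
    have expb: "exp (C * (norm (of_real r * u) + 1)) \<le> exp (C * (B + 1) * r)" if "r \<ge> 1" "norm u \<le> B" for r B and u :: complex
    proof -
      have "r * norm u \<le> r * B" using that by (intro mult_left_mono) auto
      then have "norm (of_real r * u) + 1 \<le> (B + 1) * r"
        using that unfolding norm_mult norm_of_real ring_distribs mult.commute[of B r] by linarith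
      from mult_left_mono[OF this C] show ?thesis by (simp add: mult.assoc)
    qed
    \<comment> \<open>A point common to the left sector and the upper half plane, with
      \<open>Re (w1\<^sup>2) = 3 > 0\<close>, which makes \<open>g\<close> Gaussian small around
      it.\<close>
    define w1 where "w1 = Complex (-2) 1"
    define B where "B = norm w + norm w1 + 1"
    have "\<exists>\<rho>>0. uniformly_small \<F> fr (ball w1 \<rho>)"
    proof (rule uniformly_small_propagates[OF \<F> _ _ hf _ _ w(2) s0])
      show "open (left_sector \<inter> ball 0 B)" using open_left_sector by auto
      show "connected (left_sector \<inter> ball 0 B)" by (intro convex_connected convex_Int convex_left_sector) auto
      show "w \<in> left_sector \<inter> ball 0 B" using w by (auto simp: B_def add_nonneg_pos)
      show "w1 \<in> left_sector \<inter> ball 0 B" by (auto simp: B_def left_sector_def add_nonneg_pos) (simp_all add: w1_def)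
      show "\<forall>\<^sub>F r in \<F>. \<forall>u\<in>left_sector \<inter> ball 0 B. norm (fr r u) \<le> exp (C * (B + 1) * r)"
        using ge1
      proof eventually_elim
        case (elim r)
        show ?case
        proof
          fix u assume u: "u \<in> left_sector \<inter> ball 0 B"
          then have "of_real r * u \<in> left_sector" using elim left_sector_scale by auto
          then have "norm (fr r u) \<le> exp (C * (norm (of_real r * u) + 1))"
            unfolding fr_def by (intro f) (auto simp: left_sector_def)
          then show "norm (fr r u) \<le> exp (C * (B + 1) * r)" by (rule order_trans) (rule expb, use elim u in auto)
        qed
      qed
    qed
    then obtain \<rho>1 where \<rho>1: "\<rho>1 > 0" "uniformly_small \<F> fr (ball w1 \<rho>1)" by blast
    \<comment> \<open>Radius at most 1/4 keeps
      \<open>Re (u\<^sup>2) \<ge> (7/4)\<^sup>2 - (5/4)\<^sup>2 = 3/2\<close> and the disc inside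
      the upper half plane.\<close>
    define \<rho>2 where "\<rho>2 = min \<rho>1 (1/4)"
    have \<rho>2: "\<rho>2 > 0" using \<rho>1 by (simp add: \<rho>2_def)
    have sf: "uniformly_small \<F> fr (ball w1 \<rho>2)" by (rule uniformly_small_subset[OF \<rho>1(2)]) (auto simp: \<rho>2_def)
    have w1b: "Re u \<le> -7/4 \<and> \<bar>Im u\<bar> \<le> 5/4 \<and> Im u > 0 \<and> norm u \<le> 4 \<and> Re (u\<^sup>2) \<ge> 3/2" if "u \<in> ball w1 \<rho>2" for u
    proof -
      have d: "norm (w1 - u) < 1/4" using that by (auto simp: \<rho>2_def dist_norm)
      have 1: "Re u \<le> -7/4" "Re u \<ge> -9/4" "\<bar>Im u\<bar> \<le> 5/4" "Im u > 0"
        using abs_Re_le_cmod[of "w1 - u"] abs_Im_le_cmod[of "w1 - u"] d by (auto simp: w1_def)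
      have "(7/4)^2 \<le> (- Re u)^2" using 1 by (intro power_mono) auto
      moreover have "\<bar>Im u\<bar>^2 \<le> (5/4)^2" using 1 by (intro power_mono) auto
      ultimately have "Re (u\<^sup>2) \<ge> 3/2" by (simp add: power2_eq_square)
      moreover have "norm u \<le> 4" using cmod_le[of u] 1 by auto
      ultimately show ?thesis using 1 by auto
    qed
    obtain \<delta>1 where \<delta>1: "\<delta>1 > 0" and ev1: "\<forall>\<^sub>F r in \<F>. \<forall>u\<in>ball w1 \<rho>2. norm (fr r u) \<le> exp (- \<delta>1 * r\<^sup>2)"
      using sf by (auto simp: uniformly_small_def)
    define \<delta>2 where "\<delta>2 = min \<delta>1 (1/2)"
    have \<delta>2: "\<delta>2 > 0" using \<delta>1 by (simp add: \<delta>2_def)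
    have sh: "uniformly_small \<F> (\<lambda>r u. fr r u - gr r u) (ball w1 \<rho>2)"
      unfolding uniformly_small_def
    proof (intro exI[of _ "\<delta>2/2"] conjI)
      have "\<forall>\<^sub>F r in \<F>. (5 * C) * r + 0 \<le> (1/4) * r\<^sup>2" "\<forall>\<^sub>F r::real in \<F>. r \<ge> X" "\<forall>\<^sub>F r in \<F>. 0 * r + ln 2 \<le> (\<delta>2/2) * r\<^sup>2"
        using \<delta>2 by (intro evF eventually_ge_at_top eventually_affine_le_quadratic; simp)+
      then show "\<forall>\<^sub>F r in \<F>. \<forall>u\<in>ball w1 \<rho>2. norm (fr r u - gr r u) \<le> exp (- (\<delta>2/2) * r\<^sup>2)"
        using ev1 ge1
      proof eventually_elim
        case (elim r)
        show ?case
        proof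
          fix u assume u: "u \<in> ball w1 \<rho>2"
          note uu = w1b[OF u]
          have "r * Re u \<le> r * (-7/4)" using uu elim by (intro mult_left_mono) auto
          then have "Re (of_real r * u) \<le> - X" using elim by simp
          then have "norm (gr r u) \<le> exp (- Re ((of_real r * u)\<^sup>2) / 2 + C * (norm (of_real r * u) + 1))"
            unfolding gr_def by (rule g)
          also have "\<dots> \<le> exp (- (3/4) * r\<^sup>2 + C * 5 * r)"
          proof -
            have "Re ((of_real r * u)\<^sup>2) = r\<^sup>2 * Re (u\<^sup>2)" by (simp add: power2_eq_square algebra_simps)
            moreover have "r\<^sup>2 * (3/2) \<le> r\<^sup>2 * Re (u\<^sup>2)" using uu by (intro mult_left_mono) auto
            moreover have "C * (norm (of_real r * u) + 1) \<le> C * 5 * r" using expb[of r u 4] uu elim by simp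
            ultimately show ?thesis by simp
          qed
          also have "\<dots> \<le> exp (- \<delta>2 * r\<^sup>2)"
          proof -
            have "\<delta>2 * r\<^sup>2 \<le> 1/2 * r\<^sup>2" by (intro mult_right_mono) (auto simp: \<delta>2_def)
            then show ?thesis using elim by (subst exp_le_cancel_iff) linarith
          qed
          finally have 1: "norm (gr r u) \<le> exp (- \<delta>2 * r\<^sup>2)" .
          have "norm (fr r u) \<le> exp (- \<delta>1 * r\<^sup>2)" using elim u by blast
          also have "\<dots> \<le> exp (- \<delta>2 * r\<^sup>2)" by (auto simp: \<delta>2_def intro!: mult_right_mono)
          finally have "norm (fr r u - gr r u) \<le> 2 * exp (- \<delta>2 * r\<^sup>2)" using 1 norm_triangle_ineq4[of "fr r u" "gr r u"] by linarith
          also have "\<dots> = exp (ln 2 - \<delta>2 * r\<^sup>2)" by (simp add: exp_diff exp_minus field_simps)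
          also have "\<dots> \<le> exp (- (\<delta>2/2) * r\<^sup>2)" using elim by (simp add: field_simps)
          finally show "norm (fr r u - gr r u) \<le> exp (- (\<delta>2/2) * r\<^sup>2)" .
        qed
      qed
    qed (use \<delta>2 in auto)
    define A where "A = {w::complex. norm w = 1 \<and> (Im w)\<^sup>2 \<ge> 5/8 \<and> Im w \<ge> 0}"
    define S where "S = {z::complex. Im z > 0} \<inter> ball 0 5"
    have AS: "A \<subseteq> S"
    proof
      fix w assume "w \<in> A"
      then have "norm w = 1" "(Im w)^2 > 0" "Im w \<ge> 0" by (auto simp: A_def)
      then show "w \<in> S" by (cases "Im w = 0") (auto simp: S_def)
    qed
    have sA: "uniformly_small \<F> (\<lambda>r u. fr r u - gr r u) A"
    proof (rule uniformly_small_compact)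
      have "A = sphere 0 1 \<inter> {w. (Im w)\<^sup>2 \<ge> 5/8 \<and> Im w \<ge> 0}" by (auto simp: A_def)
      moreover have "closed {w::complex. (Im w)\<^sup>2 \<ge> 5/8 \<and> Im w \<ge> 0}"
        by (intro closed_Collect_conj closed_Collect_le continuous_intros)
      ultimately show "compact A" using compact_Int_closed[OF compact_sphere] by simp
      fix v assume "v \<in> A"
      then have v: "v \<in> S" using AS by blast
      show "\<exists>\<rho>>0. uniformly_small \<F> (\<lambda>r u. fr r u - gr r u) (ball v \<rho>)"
      proof (rule uniformly_small_propagates[OF \<F> _ _ _ _ _ \<rho>2 sh v])
        show "open S" unfolding S_def by (intro open_Int open_halfspace_Im_gt) auto
        show "connected S" unfolding S_def by (intro convex_connected convex_Int convex_halfspace_Im_gt) auto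
        show "(\<lambda>u. fr r u - gr r u) holomorphic_on S" for r by (intro holomorphic_intros hf hg)
        show "w1 \<in> S" using w1b[of w1] \<rho>2 by (auto simp: S_def)
        show "\<forall>\<^sub>F r in \<F>. \<forall>u\<in>S. norm (fr r u - gr r u) \<le> exp (C * (5 + 1) * r)"
          using ge1
        proof eventually_elim
          case (elim r)
          show ?case
          proof
            fix u assume u: "u \<in> S"
            then have "norm (fr r u - gr r u) \<le> exp (C * (norm (of_real r * u) + 1))"
              unfolding fr_def gr_def using elim by (intro fg) (auto simp: S_def)
            then show "norm (fr r u - gr r u) \<le> exp (C * (5 + 1) * r)" by (rule order_trans) (rule expb, use elim u in \<open>auto simp: S_def\<close>)
          qed
        qed
      qed
    qed
    have "f z - g z = 0" for z
    proof (rule half_plane_uniqueness[where f = "\<lambda>z. f z - g z" and \<F> = \<F> and C = C])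
      show "uniformly_small \<F> (\<lambda>r w. f (of_real r * w) - g (of_real r * w)) {w. norm w = 1 \<and> (Im w)\<^sup>2 \<ge> 5/8 \<and> Im w \<ge> 0}"
        using sA by (simp add: A_def fr_def gr_def)
    qed (use hol fg \<F> \<open>\<F> \<noteq> bot\<close> in \<open>auto intro: holomorphic_intros\<close>)
    then show False using \<open>f \<noteq> g\<close> by auto
  qed
qed

subsection \<open>Zeros and the Poisson formula\<close>

definition zmult :: "(complex \<Rightarrow> complex) \<Rightarrow> complex \<Rightarrow> nat" where
  "zmult f a = nat (zorder f a)"

lemma zero_count_zmult: "zero_count f S = (\<Sum>z\<in>{z\<in>S. f z = 0}. zmult f z)"
  by (simp add: zero_count_def zmult_def)

lemma local_factor:
  assumes "f holomorphic_on UNIV" "f w \<noteq> 0"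
  obtains h r where "r > 0" "h holomorphic_on ball a r" "\<And>z. z \<in> ball a r \<Longrightarrow> f z = h z * (z - a) ^ zmult f a \<and> h z \<noteq> 0"
proof -
  obtain r where r: "r > 0" "zor_poly f a holomorphic_on cball a r"
     "\<forall>w\<in>cball a r. f w = zor_poly f a w * (w - a) ^ nat (zorder f a) \<and> zor_poly f a w \<noteq> 0"
    using zorder_exist_zero[OF assms(1) open_UNIV connected_UNIV UNIV_I, of a] assms(2) by auto
  show thesis
    by (rule that[of r "zor_poly f a"]) (use r in \<open>auto simp: zmult_def intro: holomorphic_on_subset\<close>)
qed

text \<open>The zeros are divided out one at a time. A point of \<open>Z\<close> at which
  \<open>f\<close> does not vanish has \<open>zmult f a = 0\<close> and does no harm, so that 0 can
  be added to the set in Jensen's formula.\<close>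

lemma factor_zeros:
  assumes f: "f holomorphic_on UNIV" "f w \<noteq> 0" and Z: "finite Z"
  shows "\<exists>G. G holomorphic_on UNIV \<and> (\<forall>z. f z = G z * (\<Prod>a\<in>Z. (z - a) ^ zmult f a)) \<and> (\<forall>a\<in>Z. G a \<noteq> 0)"
  using Z
proof (induction Z)
  case empty
  show ?case using f by (intro exI[of _ f]) auto
next
  case (insert a Z)
  then obtain G where G: "G holomorphic_on UNIV" "\<And>z. f z = G z * (\<Prod>a\<in>Z. (z - a) ^ zmult f a)" "\<And>a. a \<in> Z \<Longrightarrow> G a \<noteq> 0"
    by auto
  define p where "p = (\<lambda>z. \<Prod>a\<in>Z. (z - a) ^ zmult f a)"
  define m where "m = zmult f a"
  obtain h r where r: "r > 0" and h: "h holomorphic_on ball a r" "\<And>z. z \<in> ball a r \<Longrightarrow> f z = h z * (z - a) ^ m \<and> h z \<noteq> 0"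
    unfolding m_def using local_factor[OF f, of a] by metis
  have p: "p holomorphic_on X" for X unfolding p_def by (intro holomorphic_intros)
  have pa: "p a \<noteq> 0" using insert by (auto simp: p_def)
  have "\<exists>s>0. \<forall>z\<in>ball a s. p z \<noteq> 0"
  proof -
    have "isCont p a" using p[of UNIV] holomorphic_on_imp_continuous_on continuous_on_eq_continuous_at by blast
    then show ?thesis using continuous_at_avoid[of a p 0] pa by auto
  qed
  then obtain s where s: "s > 0" "\<And>z. z \<in> ball a s \<Longrightarrow> p z \<noteq> 0" by blast
  define t where "t = min r s"
  have t: "t > 0" using r s by (auto simp: t_def)
  \<comment> \<open>The singularity at \<open>a\<close> is removed by hand: around \<open>a\<close>
    the quotient equals \<open>h / p\<close>, which is holomorphic there.\<close>
  define G' where "G' = (\<lambda>z. if z = a then h a / p a else G z / (z - a) ^ m)"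
  have G'eq: "G' z = h z / p z" if "z \<in> ball a t" for z
  proof (cases "z = a")
    case False
    have "G z * p z = h z * (z - a) ^ m" using G(2)[of z] h(2)[of z] that by (auto simp: p_def t_def)
    then show ?thesis using False s(2)[of z] that by (auto simp: G'_def t_def field_simps)
  qed (simp add: G'_def)
  have "G' holomorphic_on (- {a}) \<union> ball a t"
  proof (rule holomorphic_on_Un)
    have "(\<lambda>z. G z / (z - a) ^ m) holomorphic_on - {a}"
      by (intro holomorphic_intros holomorphic_on_subset[OF G(1)]) auto
    then show "G' holomorphic_on - {a}" by (rule holomorphic_transform) (auto simp: G'_def)
    have "(\<lambda>z. h z / p z) holomorphic_on ball a t"
      using s by (intro holomorphic_intros holomorphic_on_subset[OF h(1)] p) (auto simp: t_def)
    then show "G' holomorphic_on ball a t" by (rule holomorphic_transform) (use G'eq in auto)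
  qed auto
  moreover have "(- {a}) \<union> ball a t = UNIV" using t by auto
  ultimately have hol: "G' holomorphic_on UNIV" by simp
  show ?case
  proof (intro exI[of _ G'] conjI hol allI ballI)
    fix z show "f z = G' z * (\<Prod>a\<in>insert a Z. (z - a) ^ zmult f a)"
    proof (cases "z = a")
      case True
      then show ?thesis using h(2)[of a] r insert pa by (simp add: G'_def p_def m_def)
    next
      case False
      then show ?thesis using G(2)[of z] insert by (simp add: G'_def m_def)
    qed
  next
    fix b assume "b \<in> insert a Z"
    then show "G' b \<noteq> 0" using h(2)[of a] r pa G(3)[of b] by (auto simp: G'_def)
  qed
qed

lemma finite_zeros_compact:
  assumes "f holomorphic_on UNIV" "f w \<noteq> 0" "compact K"
  shows "finite {z\<in>K. f z = 0}"
proof (cases "f constant_on UNIV")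
  case True
  then have "f z \<noteq> 0" for z using assms(2) by (auto simp: constant_on_def)
  then show ?thesis by simp
next
  case False
  then show ?thesis using holomorphic_compact_finite_zeros[OF assms(1) open_UNIV connected_UNIV assms(3)] by auto
qed

text \<open>Finiteness of the larger zero set is essential, because a sum over an infinite set is
  0.\<close>

lemma zero_count_mono:
  assumes "finite {z\<in>T. f z = 0}" "S \<subseteq> T"
  shows "zero_count f S \<le> zero_count f T"
  unfolding zero_count_def by (rule sum_mono2) (use assms in auto)

lemma zero_count_Union:
  assumes "finite I" "\<And>i. i \<in> I \<Longrightarrow> finite {z\<in>A i. f z = 0}" "S \<subseteq> (\<Union>i\<in>I. A i)"
  shows "zero_count f S \<le> (\<Sum>i\<in>I. zero_count f (A i))"
  using assms
proof (induction I arbitrary: S)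
  case empty
  then show ?case by (simp add: zero_count_def)
next
  case (insert i I)
  define U where "U = (\<Union>i\<in>I. A i)"
  have fU: "finite {z\<in>U. f z = 0}"
  proof -
    have "{z\<in>U. f z = 0} = (\<Union>i\<in>I. {z\<in>A i. f z = 0})" by (auto simp: U_def)
    then show ?thesis using insert by auto
  qed
  have fA: "finite {z\<in>A i. f z = 0}" using insert by auto
  have "zero_count f S \<le> zero_count f (A i \<union> U)"
  proof (rule zero_count_mono)
    have "{z\<in>A i \<union> U. f z = 0} = {z\<in>A i. f z = 0} \<union> {z\<in>U. f z = 0}" by auto
    then show "finite {z\<in>A i \<union> U. f z = 0}" using fU fA by simp
  qed (use insert in \<open>auto simp: U_def\<close>)
  also have "\<dots> \<le> zero_count f (A i) + zero_count f U"
  proof -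
    have "{z\<in>A i \<union> U. f z = 0} = {z\<in>A i. f z = 0} \<union> {z\<in>U. f z = 0}" by auto
    then show ?thesis unfolding zero_count_def by (simp add: sum_Un_nat fA fU)
  qed
  also have "zero_count f U \<le> (\<Sum>i\<in>I. zero_count f (A i))" using insert by (intro insert.IH) (auto simp: U_def)
  finally show ?case using insert by simp
qed

text \<open>A zero in the inner disc is at distance at least \<open>2 * \<rho> / 3\<close> from the
  outer circle and at most \<open>\<rho> / 3\<close> from the centre. By the maximum principle for
  the zero-free quotient each zero therefore costs a factor 2 at \<open>z0\<close>.\<close>

lemma zero_count_disc_le:
  assumes f: "f holomorphic_on UNIV" "f z0 \<noteq> 0" and \<rho>: "\<rho> > 0"
    and M: "\<And>z. z \<in> cball z0 \<rho> \<Longrightarrow> norm (f z) \<le> exp M"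
  shows "real (zero_count f (cball z0 (\<rho> / 3))) * ln 2 \<le> M - ln (norm (f z0))"
proof -
  define Z where "Z = {z\<in>cball z0 (\<rho>/3). f z = 0}"
  have fin: "finite Z" unfolding Z_def using f by (intro finite_zeros_compact) auto
  define m where "m = zmult f"
  obtain G where G: "G holomorphic_on UNIV" "\<And>z. f z = G z * (\<Prod>a\<in>Z. (z - a) ^ m a)"
    using factor_zeros[OF f fin] by (auto simp: m_def)
  define N where "N = zero_count f (cball z0 (\<rho>/3))"
  have N: "N = (\<Sum>a\<in>Z. m a)" by (simp add: N_def zero_count_zmult Z_def m_def)
  have pw: "c ^ N = (\<Prod>a\<in>Z. c ^ m a)" for c :: real by (simp add: N power_sum)
  have "norm (G z0) \<le> exp M / (2 * \<rho> / 3) ^ N"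
  proof (rule maximum_modulus_frontier[of G "cball z0 \<rho>"])
    fix z assume "z \<in> frontier (cball z0 \<rho>)"
    then have z: "norm (z - z0) = \<rho>" "z \<in> cball z0 \<rho>" using \<rho> by (auto simp: dist_norm norm_minus_commute)
    have "(2 * \<rho> / 3) ^ N \<le> (\<Prod>a\<in>Z. norm (z - a) ^ m a)"
      unfolding pw
    proof (intro prod_mono conjI power_mono)
      fix a assume "a \<in> Z"
      then have "norm (z0 - a) \<le> \<rho> / 3" by (auto simp: Z_def dist_norm)
      then show "2 * \<rho> / 3 \<le> norm (z - a)" using norm_triangle_ineq[of "z - a" "a - z0"] z by (simp add: norm_minus_commute)
    qed (use \<rho> in auto)
    then have "norm (G z) * (2 * \<rho> / 3) ^ N \<le> norm (G z) * (\<Prod>a\<in>Z. norm (z - a) ^ m a)"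
      by (intro mult_left_mono) auto
    also have "\<dots> = norm (f z)" unfolding G(2)[of z] by (simp add: norm_mult norm_power flip: prod_norm)
    also have "\<dots> \<le> exp M" using M z by auto
    finally show "norm (G z) \<le> exp M / (2 * \<rho> / 3) ^ N" using \<rho> by (simp add: pos_le_divide_eq)
  qed (use G \<rho> in \<open>auto intro: holomorphic_on_subset holomorphic_on_imp_continuous_on\<close>)
  moreover have "(\<Prod>a\<in>Z. norm (z0 - a) ^ m a) \<le> (\<rho> / 3) ^ N"
    unfolding pw by (intro prod_mono conjI power_mono) (auto simp: Z_def dist_norm)
  ultimately have "norm (f z0) \<le> exp M / (2 * \<rho> / 3) ^ N * (\<rho> / 3) ^ N"
  proof -
    have "norm (f z0) = norm (G z0) * (\<Prod>a\<in>Z. norm (z0 - a) ^ m a)"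
      unfolding G(2)[of z0] by (simp add: norm_mult norm_power flip: prod_norm)
    then show ?thesis
      using \<open>norm (G z0) \<le> _\<close> \<open>(\<Prod>a\<in>Z. norm (z0 - a) ^ m a) \<le> _\<close> \<rho>
      by (simp only:) (intro mult_mono prod_nonneg, auto)
  qed
  also have "\<dots> = exp M / 2 ^ N" using \<rho> by (simp add: power_divide power_mult_distrib)
  finally have "norm (f z0) * 2 ^ N \<le> exp M" by (simp add: pos_le_divide_eq)
  then have "ln (norm (f z0) * 2 ^ N) \<le> ln (exp M)" using f(2) by (subst ln_le_cancel_iff) auto
  then show ?thesis using f(2) by (simp add: ln_mult ln_realpow N_def)
qed

text \<open>On the circle \<open>cnj \<zeta>\<close> equals \<open>r\<^sup>2 / \<zeta>\<close>, so
  the kernel is the restriction of a rational function of \<open>\<zeta>\<close> and becomes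
  accessible to Cauchy's formula.\<close>

lemma poisson_kernel_eq:
  assumes "norm \<zeta> = r" "norm p < r"
  shows "of_real ((r\<^sup>2 - (norm p)\<^sup>2) / (norm (\<zeta> - p))\<^sup>2) = \<zeta> * of_real (r\<^sup>2 - (norm p)\<^sup>2) / ((\<zeta> - p) * (of_real (r\<^sup>2) - cnj p * \<zeta>))"
proof -
  have r: "r > 0" using assms norm_ge_zero[of p] by linarith
  have z0: "\<zeta> \<noteq> 0" using assms r by auto
  have ne: "\<zeta> - p \<noteq> 0" using assms by auto
  obtain D where D: "D = cnj (\<zeta> - p)" by simp
  have 1: "of_real (r\<^sup>2) - cnj p * \<zeta> = \<zeta> * D"
    using complex_norm_square[of \<zeta>] assms by (simp add: algebra_simps D)
  have 2: "of_real ((norm (\<zeta> - p))\<^sup>2) = (\<zeta> - p) * D" unfolding D by (rule complex_norm_square)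
  have "D \<noteq> 0" using ne unfolding D by (simp only: complex_cnj_zero_iff) simp
  then show ?thesis unfolding of_real_divide 1 2 using z0 ne by (simp add: divide_simps)
qed

text \<open>Cauchy's formula at \<open>p\<close> for \<open>L\<close> times a factor that equals 1
  at \<open>p\<close> and that turns the Cauchy kernel into the Poisson kernel on the
  circle.\<close>

lemma poisson_formula:
  assumes L: "L holomorphic_on cball 0 r" and p: "norm p < r"
  shows "((\<lambda>\<theta>. (r\<^sup>2 - (norm p)\<^sup>2) / (norm (of_real r * cis \<theta> - p))\<^sup>2 * Re (L (of_real r * cis \<theta>)))
           has_integral (2 * pi * Re (L p))) {0..2 * pi}"
proof -
  have r: "r > 0" using p norm_ge_zero[of p] by linarith
  define q where "q = (\<lambda>u. L u * (of_real (r\<^sup>2 - (norm p)\<^sup>2) / (of_real (r\<^sup>2) - cnj p * u)))"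
  have ne: "of_real (r\<^sup>2) - cnj p * u \<noteq> 0" if "u \<in> cball 0 r" for u
  proof
    assume "of_real (r\<^sup>2) - cnj p * u = 0"
    then have "norm (complex_of_real (r\<^sup>2)) = norm (cnj p * u)" by simp
    then have "r\<^sup>2 = norm p * norm u" by (simp add: norm_mult norm_power)
    also have "\<dots> \<le> norm p * r" using that by (intro mult_left_mono) auto
    also have "\<dots> < r * r" using p r by (intro mult_strict_right_mono) auto
    finally show False by (simp add: power2_eq_square)
  qed
  have hol: "q holomorphic_on cball 0 r" unfolding q_def using ne by (intro holomorphic_intros L) auto
  have qp: "q p = L p"
  proof -
    have "of_real (r\<^sup>2) - cnj p * p = of_real (r\<^sup>2 - (norm p)\<^sup>2)"
      using complex_norm_square[of p] by (simp add: mult.commute)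
    moreover have "of_real (r\<^sup>2) - cnj p * p \<noteq> 0" using ne[of p] p by auto
    ultimately show ?thesis by (simp add: q_def)
  qed
  have "((\<lambda>u. q u / (u - p)) has_contour_integral (2 * of_real pi * \<i> * q p)) (circlepath 0 r)"
    by (rule Cauchy_integral_circlepath)
       (use hol p in \<open>auto intro: holomorphic_on_imp_continuous_on holomorphic_on_subset\<close>)
  then have "((\<lambda>t. q (of_real r * cis t) / (of_real r * cis t - p) * of_real r * \<i> * cis t) has_integral (2 * of_real pi * \<i> * L p)) {0..2 * pi}"
    by (simp add: circlepath_def has_contour_integral_part_circlepath_iff qp)
  moreover have e: "- \<i> * (2 * of_real pi * \<i> * L p) = 2 * of_real pi * L p" by (simp add: complex_eq_iff)
  ultimately have "((\<lambda>t. - \<i> * (q (of_real r * cis t) / (of_real r * cis t - p) * of_real r * \<i> * cis t))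
      has_integral - \<i> * (2 * of_real pi * \<i> * L p)) {0..2 * pi}"
    by (intro has_integral_mult_right)
  then
  have "((\<lambda>t. - \<i> * (q (of_real r * cis t) / (of_real r * cis t - p) * of_real r * \<i> * cis t)) has_integral (2 * of_real pi * L p)) {0..2 * pi}"
    by (simp only: e)
  moreover have "- \<i> * (q (of_real r * cis t) / (of_real r * cis t - p) * of_real r * \<i> * cis t)
      = of_real ((r\<^sup>2 - (norm p)\<^sup>2) / (norm (of_real r * cis t - p))\<^sup>2) * L (of_real r * cis t)" for t
    by (subst poisson_kernel_eq) (use r p in \<open>auto simp: q_def norm_mult field_simps\<close>)
  ultimately have "((\<lambda>t. of_real ((r\<^sup>2 - (norm p)\<^sup>2) / (norm (of_real r * cis t - p))\<^sup>2) * L (of_real r * cis t)) has_integral (2 * of_real pi * L p)) {0..2 * pi}"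
    by simp
  from has_integral_linear[OF this bounded_linear_Re] show ?thesis
    by (simp add: o_def)
qed

text \<open>Each factor \<open>z - a\<close> is replaced by
  \<open>(r\<^sup>2 - cnj a * z) / r\<close>, which has the same modulus on the circle and no zero
  in the disc. The modified function has a holomorphic logarithm, whose real part obeys the Poisson
  formula.\<close>

lemma poisson_log:
  assumes G: "G holomorphic_on UNIV" "\<And>z. norm z \<le> r \<Longrightarrow> G z \<noteq> 0"
    and Z: "finite Z" "\<And>a. a \<in> Z \<Longrightarrow> norm a < r"
    and f: "\<And>z. f z = G z * (\<Prod>a\<in>Z. (z - a) ^ m a)" and p: "norm p < r"
  shows "((\<lambda>\<theta>. (r\<^sup>2 - (norm p)\<^sup>2) / (norm (of_real r * cis \<theta> - p))\<^sup>2 * ln (norm (f (of_real r * cis \<theta>))))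
           has_integral (2 * pi * (ln (norm (G p)) + (\<Sum>a\<in>Z. real (m a) * ln (norm ((of_real (r\<^sup>2) - cnj a * p) / of_real r)))))) {0..2 * pi}"
proof -
  have r: "r > 0" using p norm_ge_zero[of p] by linarith
  define g where "g = (\<lambda>z. G z * (\<Prod>a\<in>Z. ((of_real (r\<^sup>2) - cnj a * z) / of_real r) ^ m a))"
  have ne: "of_real (r\<^sup>2) - cnj a * u \<noteq> 0" if "a \<in> Z" "norm u \<le> r" for a u
  proof
    assume "of_real (r\<^sup>2) - cnj a * u = 0"
    then have "norm (complex_of_real (r\<^sup>2)) = norm (cnj a * u)" by simp
    then have "r\<^sup>2 = norm a * norm u" by (simp add: norm_mult norm_power)
    also have "\<dots> \<le> norm a * r" using that by (intro mult_left_mono) auto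
    also have "\<dots> < r * r" using Z(2)[OF that(1)] r by (intro mult_strict_right_mono) auto
    finally show False by (simp add: power2_eq_square)
  qed
  have gnz: "g z \<noteq> 0" if "z \<in> cball 0 r" for z using that ne G(2) r Z by (auto simp: g_def)
  have "g holomorphic_on cball 0 r"
    unfolding g_def using r by (intro holomorphic_intros holomorphic_on_subset[OF G(1)]) auto
  then obtain L where L: "L holomorphic_on cball 0 r" "\<And>z. z \<in> cball 0 r \<Longrightarrow> g z = exp (L z)"
    using contractible_imp_holomorphic_log[of g "cball 0 r"] gnz convex_imp_contractible[OF convex_cball] by metis
  have ReL: "Re (L z) = ln (norm (g z))" if "z \<in> cball 0 r" for z using L(2)[OF that] by simp
  have bd: "ln (norm (f (of_real r * cis t))) = Re (L (of_real r * cis t))" for t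
  proof -
    define \<zeta> where "\<zeta> = of_real r * cis t"
    have \<zeta>: "norm \<zeta> = r" using r by (simp add: \<zeta>_def norm_mult)
    have "norm ((of_real (r\<^sup>2) - cnj a * \<zeta>) / of_real r) = norm (\<zeta> - a)" for a
    proof -
      have "of_real (r\<^sup>2) - cnj a * \<zeta> = \<zeta> * cnj (\<zeta> - a)"
        using complex_norm_square[of \<zeta>] \<zeta> by (simp add: algebra_simps)
      then have "norm (of_real (r\<^sup>2) - cnj a * \<zeta>) = r * norm (\<zeta> - a)"
        by (simp only: norm_mult complex_mod_cnj \<zeta>)
      then show ?thesis using r by (simp add: norm_divide)
    qed
    then have "norm (f \<zeta>) = norm (g \<zeta>)"
      unfolding f g_def by (simp add: norm_mult norm_power flip: prod_norm)
    then show ?thesis using ReL[of \<zeta>] \<zeta> by (simp add: \<zeta>_def)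
  qed
  have "ln (norm (g p)) = ln (norm (G p)) + (\<Sum>a\<in>Z. real (m a) * ln (norm ((of_real (r\<^sup>2) - cnj a * p) / of_real r)))"
  proof -
    have "norm (g p) = norm (G p) * (\<Prod>a\<in>Z. norm ((of_real (r\<^sup>2) - cnj a * p) / of_real r) ^ m a)"
      by (simp add: g_def norm_mult norm_power flip: prod_norm)
    moreover have "(of_real (r\<^sup>2) - cnj a * p) / of_real r \<noteq> 0" if "a \<in> Z" for a
      using ne[OF that, of p] p r by simp
    then have "ln (\<Prod>a\<in>Z. norm ((of_real (r\<^sup>2) - cnj a * p) / of_real r) ^ m a)
       = (\<Sum>a\<in>Z. real (m a) * ln (norm ((of_real (r\<^sup>2) - cnj a * p) / of_real r)))"
      by (subst ln_prod) (auto simp: Z ln_realpow intro!: sum.cong)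
    moreover have "(\<Prod>a\<in>Z. norm ((of_real (r\<^sup>2) - cnj a * p) / of_real r) ^ m a) > 0"
      using ne p r by (intro prod_pos) auto
    ultimately show ?thesis using G(2)[of p] p by (simp add: ln_mult)
  qed
  then show ?thesis using poisson_formula[OF L(1) p] ReL[of p] p by (simp add: bd)
qed

lemma reciprocal_pole_order:
  assumes f: "f holomorphic_on UNIV" "f w \<noteq> 0"
  shows "is_pole (\<lambda>z. 1 / f z) a \<longleftrightarrow> f a = 0" "nat (- zorder (\<lambda>z. 1 / f z) a) = zmult f a"
proof -
  obtain h r where r: "r > 0" and h: "h holomorphic_on ball a r" "\<And>z. z \<in> ball a r \<Longrightarrow> f z = h z * (z - a) ^ zmult f a \<and> h z \<noteq> 0"
    using local_factor[OF f, of a] by metis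
  have "zorder (\<lambda>z. 1 / f z) a = - int (zmult f a)"
  proof (rule zorder_eqI[of "ball a r" a "\<lambda>z. 1 / h z"])
    show "(\<lambda>z. 1 / h z) holomorphic_on ball a r" using h by (intro holomorphic_intros) auto
    fix u assume "u \<in> ball a r" "u \<noteq> a"
    then show "1 / f u = 1 / h u * (u - a) powi (- int (zmult f a))"
      using h(2)[of u] by (simp add: power_int_minus divide_inverse)
  qed (use r h(2)[of a] in auto)
  then show "nat (- zorder (\<lambda>z. 1 / f z) a) = zmult f a" by simp
  have cont: "isCont f a" using f(1) holomorphic_on_imp_continuous_on continuous_on_eq_continuous_at by blast
  show "is_pole (\<lambda>z. 1 / f z) a \<longleftrightarrow> f a = 0"
  proof
    assume "is_pole (\<lambda>z. 1 / f z) a"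
    show "f a = 0"
    proof (rule ccontr)
      assume "f a \<noteq> 0"
      then obtain e where e: "e > 0" "\<And>z. z \<in> ball a e \<Longrightarrow> f z \<noteq> 0" using continuous_at_avoid[OF cont, of 0] by auto
      then have "(\<lambda>z. 1 / f z) holomorphic_on ball a e"
        by (intro holomorphic_intros holomorphic_on_subset[OF f(1)]) auto
      then show False using not_is_pole_holomorphic[of "ball a e" a] e \<open>is_pole _ a\<close> by auto
    qed
  next
    assume "f a = 0"
    have "\<forall>\<^sub>F z in at a. f z \<noteq> 0" using non_zero_neighbour_alt[OF f(1) open_UNIV connected_UNIV UNIV_I UNIV_I f(2)] by (auto elim: eventually_mono)
    then have "filterlim f (at 0) (at a)" using cont \<open>f a = 0\<close> by (auto simp: filterlim_at isCont_def)
    then show "is_pole (\<lambda>z. 1 / f z) a"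
      unfolding is_pole_def using filterlim_compose[OF filterlim_inverse_at_infinity] by (simp add: divide_inverse)
  qed
qed

text \<open>A zero \<open>a\<close> contributes \<open>zmult f a / t\<close> to the integrand from
  \<open>t = norm a\<close> on, which integrates to a logarithm. The zero at the origin is the part
  split off in \<open>nev_counting\<close>.\<close>

lemma nev_counting_reciprocal:
  assumes f: "f holomorphic_on UNIV" "f w \<noteq> 0" and r: "r > 0"
  shows "nev_counting r (\<lambda>z. 1 / f z) =
    (\<Sum>a\<in>{z. norm z \<le> r \<and> f z = 0 \<and> z \<noteq> 0}. real (zmult f a) * ln (r / norm a)) + real (zmult f 0) * ln r"
proof -
  define Z where "Z = {z. norm z \<le> r \<and> f z = 0 \<and> z \<noteq> 0}"
  have fin: "finite {z. norm z \<le> t \<and> f z = 0}" for t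
    using finite_zeros_compact[OF f compact_cball[of 0 t]] by simp
  have finZ: "finite Z" by (rule finite_subset[OF _ fin[of r]]) (auto simp: Z_def)
  define N where "N = (\<lambda>t. nev_pole_count t (\<lambda>z. 1 / f z))"
  have N: "N t = (\<Sum>z\<in>{z. norm z \<le> t \<and> f z = 0}. zmult f z)" for t
    unfolding N_def nev_pole_count_def reciprocal_pole_order[OF f] ..
  have N0: "N 0 = zmult f 0"
  proof (cases "f 0 = 0")
    case True
    then have "{z. norm z \<le> 0 \<and> f z = 0} = {0}" by auto
    then show ?thesis by (simp add: N)
  next
    case False
    then have "{z. norm z \<le> 0 \<and> f z = 0} = {}" by auto
    moreover have "zmult f 0 = 0"
    proof -
      have "\<exists>w\<in>UNIV. f w \<noteq> 0" using f(2) by blast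
      from zorder_exist_zero[OF f(1) open_UNIV connected_UNIV UNIV_I this, THEN conjunct1, of 0] False
      show ?thesis by (simp add: zmult_def)
    qed
    ultimately show ?thesis by (simp add: N)
  qed
  have Nt: "real (N t) - real (N 0) = (\<Sum>a\<in>Z. if norm a \<le> t then real (zmult f a) else 0)" if t: "0 \<le> t" "t \<le> r" for t
  proof -
    have "{z. norm z \<le> t \<and> f z = 0} = {z. norm z \<le> 0 \<and> f z = 0} \<union> {a\<in>Z. norm a \<le> t}" using t by (auto simp: Z_def)
    moreover have "finite {a\<in>Z. norm a \<le> t}" using finZ by simp
    moreover have "{z. norm z \<le> 0 \<and> f z = 0} \<inter> {a\<in>Z. norm a \<le> t} = {}" by (auto simp: Z_def)
    ultimately have "N t = N 0 + (\<Sum>a\<in>{a\<in>Z. norm a \<le> t}. zmult f a)"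
      unfolding N using sum.union_disjoint[of "{z. norm z \<le> 0 \<and> f z = 0}" "{a\<in>Z. norm a \<le> t}" "zmult f"] fin[of 0] by simp
    moreover have "(\<Sum>a\<in>{a\<in>Z. norm a \<le> t}. real (zmult f a)) = (\<Sum>a\<in>Z. if norm a \<le> t then real (zmult f a) else 0)"
      using finZ by (simp add: sum.inter_filter)
    ultimately show ?thesis by simp
  qed
  have "((\<lambda>t. \<Sum>a\<in>Z. (if norm a \<le> t then real (zmult f a) / t else 0)) has_integral (\<Sum>a\<in>Z. real (zmult f a) * ln (r / norm a))) {0..r}"
  proof (rule has_integral_sum[OF finZ])
    fix a assume "a \<in> Z"
    then have a: "0 < norm a" "norm a \<le> r" by (auto simp: Z_def)
    have "((\<lambda>t. real (zmult f a) / t) has_integral (real (zmult f a) * ln r - real (zmult f a) * ln (norm a))) {norm a..r}"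
    proof (intro fundamental_theorem_of_calculus)
      fix x assume "x \<in> {norm a..r}"
      then have "x > 0" using a(1) by (meson atLeastAtMost_iff less_le_trans)
      then show "((\<lambda>t. real (zmult f a) * ln t) has_vector_derivative real (zmult f a) / x) (at x within {norm a..r})"
        by (auto simp: has_real_derivative_iff_has_vector_derivative[symmetric] intro!: derivative_eq_intros)
    qed (use a in auto)
    then have "((\<lambda>t. if t \<in> {norm a..r} then real (zmult f a) / t else 0) has_integral (real (zmult f a) * ln (r / norm a))) {0..r}"
      using a r by (subst has_integral_restrict) (auto simp: ln_div algebra_simps)
    then show "((\<lambda>t. if norm a \<le> t then real (zmult f a) / t else 0) has_integral (real (zmult f a) * ln (r / norm a))) {0..r}"
      by (rule has_integral_eq[rotated]) auto
  qed
  then have "((\<lambda>t. (real (N t) - real (N 0)) / t) has_integral (\<Sum>a\<in>Z. real (zmult f a) * ln (r / norm a))) {0..r}"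
    by (rule has_integral_eq[rotated]) (auto simp: Nt sum_divide_distrib intro!: sum.cong)
  then show ?thesis
    unfolding nev_counting_def using N0 by (simp add: N_def Z_def integral_unique)
qed

text \<open>Monotonicity will fill in the radii with zeros on the circle, where Jensen's formula
  below is not stated.\<close>

lemma nev_counting_reciprocal_mono:
  assumes f: "f holomorphic_on UNIV" "f w \<noteq> 0" and r: "1 \<le> r" "r \<le> s"
  shows "nev_counting r (\<lambda>z. 1 / f z) \<le> nev_counting s (\<lambda>z. 1 / f z)"
proof -
  define Z where "Z = (\<lambda>r. {z. norm z \<le> r \<and> f z = 0 \<and> z \<noteq> 0})"
  have fin: "finite (Z t)" for t
    using finite_subset[OF _ finite_zeros_compact[OF f compact_cball[of 0 t]], of "Z t"] by (auto simp: Z_def)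
  have "(\<Sum>a\<in>Z r. real (zmult f a) * ln (r / norm a)) \<le> (\<Sum>a\<in>Z r. real (zmult f a) * ln (s / norm a))"
    using r by (intro sum_mono mult_left_mono) (auto simp: Z_def divide_right_mono)
  also have "\<dots> \<le> (\<Sum>a\<in>Z s. real (zmult f a) * ln (s / norm a))"
    using r by (intro sum_mono2 fin) (auto simp: Z_def)
  finally have "(\<Sum>a\<in>Z r. real (zmult f a) * ln (r / norm a)) \<le> (\<Sum>a\<in>Z s. real (zmult f a) * ln (s / norm a))" .
  moreover have "real (zmult f 0) * ln r \<le> real (zmult f 0) * ln s" using r by (intro mult_left_mono) auto
  ultimately show ?thesis
    using nev_counting_reciprocal[OF f, of r] nev_counting_reciprocal[OF f, of s] r by (simp add: Z_def)
qed

text \<open>The Poisson formula at the centre. The constant is the logarithm of the modulus of the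
  first non-zero Taylor coefficient at 0, hence the same for all radii.\<close>

lemma jensen_formula:
  assumes f: "f holomorphic_on UNIV" "f w \<noteq> 0"
  obtains c where "\<And>r. r > 0 \<Longrightarrow> (\<And>z. norm z = r \<Longrightarrow> f z \<noteq> 0) \<Longrightarrow>
    ((\<lambda>\<theta>. ln (norm (f (of_real r * cis \<theta>)))) has_integral 2 * pi * (nev_counting r (\<lambda>z. 1 / f z) + c)) {0..2 * pi}"
proof -
  obtain G0 where G0: "G0 holomorphic_on UNIV" "\<And>z. f z = G0 z * z ^ zmult f 0" "G0 0 \<noteq> 0"
    using factor_zeros[OF f, of "{0}"] by auto
  have "((\<lambda>\<theta>. ln (norm (f (of_real r * cis \<theta>)))) has_integral 2 * pi * (nev_counting r (\<lambda>z. 1 / f z) + ln (norm (G0 0)))) {0..2 * pi}"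
    if r: "r > 0" and nz: "\<And>z. norm z = r \<Longrightarrow> f z \<noteq> 0" for r
  proof -
    define Z where "Z = {z. norm z \<le> r \<and> f z = 0 \<and> z \<noteq> 0}"
    have finZ: "finite Z"
      using finite_subset[OF _ finite_zeros_compact[OF f compact_cball[of 0 r]], of Z] by (auto simp: Z_def)
    have Z: "norm a < r" "a \<noteq> 0" if "a \<in> Z" for a using that nz[of a] by (auto simp: Z_def less_le)
    have 0: "0 \<notin> Z" by (simp add: Z_def)
    obtain G where G: "G holomorphic_on UNIV" "\<And>z. f z = G z * (\<Prod>a\<in>insert 0 Z. (z - a) ^ zmult f a)" "\<And>a. a \<in> insert 0 Z \<Longrightarrow> G a \<noteq> 0"
      using factor_zeros[OF f, of "insert 0 Z"] finZ by auto
    have Gnz: "G z \<noteq> 0" if "norm z \<le> r" for z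
      using G(3)[of z] G(2)[of z] that by (cases "f z = 0") (auto simp: Z_def)
    \<comment> \<open>The two factorisations can be compared only away from 0, where
      \<open>z ^ zmult f 0\<close> cancels; continuity gives the value at 0.\<close>
    have "G0 0 = G 0 * (\<Prod>a\<in>Z. (0 - a) ^ zmult f a)"
    proof -
      define P where "P = (\<lambda>z. G z * (\<Prod>a\<in>Z. (z - a) ^ zmult f a))"
      have eq: "G0 z = P z" if "z \<noteq> 0" for z
        using G(2)[of z] G0(2)[of z] that finZ 0 by (simp add: P_def)
      have "P holomorphic_on UNIV" unfolding P_def by (intro holomorphic_intros G)
      then have "isCont P 0" "isCont G0 0" using G0(1) holomorphic_on_imp_continuous_on continuous_on_eq_continuous_at by blast+
      then have "P \<midarrow>0\<rightarrow> P 0" "G0 \<midarrow>0\<rightarrow> G0 0" by (simp_all add: isCont_def)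
      moreover have "P \<midarrow>0\<rightarrow> G0 0"
        using \<open>G0 \<midarrow>0\<rightarrow> G0 0\<close> by (rule Lim_transform_eventually) (use eq in \<open>auto simp: eventually_at_filter\<close>)
      ultimately have "P 0 = G0 0" using LIM_unique by blast
      then show ?thesis by (simp add: P_def)
    qed
    then have nG0: "ln (norm (G0 0)) = ln (norm (G 0)) + (\<Sum>a\<in>Z. real (zmult f a) * ln (norm a))"
    proof -
      have "norm (G0 0) = norm (G 0) * (\<Prod>a\<in>Z. norm a ^ zmult f a)"
        using \<open>G0 0 = _\<close> by (simp add: norm_mult norm_power flip: prod_norm)
      moreover have "ln (\<Prod>a\<in>Z. norm a ^ zmult f a) = (\<Sum>a\<in>Z. real (zmult f a) * ln (norm a))"
        using Z by (subst ln_prod) (auto simp: finZ ln_realpow intro!: sum.cong)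
      moreover have "(\<Prod>a\<in>Z. norm a ^ zmult f a) > 0" using Z by (intro prod_pos) auto
      ultimately show ?thesis using Gnz[of 0] r by (simp add: ln_mult)
    qed
    have "((\<lambda>\<theta>. (r\<^sup>2 - (norm (0::complex))\<^sup>2) / (norm (of_real r * cis \<theta> - 0))\<^sup>2 * ln (norm (f (of_real r * cis \<theta>))))
           has_integral (2 * pi * (ln (norm (G 0)) + (\<Sum>a\<in>insert 0 Z. real (zmult f a) * ln (norm ((of_real (r\<^sup>2) - cnj a * 0) / of_real r)))))) {0..2 * pi}"
      by (rule poisson_log[OF G(1) Gnz _ _ G(2)]) (use finZ Z r in auto)
    moreover have "(r\<^sup>2 - (norm (0::complex))\<^sup>2) / (norm (of_real r * cis \<theta> - 0))\<^sup>2 = 1" for \<theta>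
      using r by (simp add: norm_mult)
    moreover have "norm ((complex_of_real (r\<^sup>2) - cnj a * 0) / of_real r) = r" for a
      using r by (simp add: norm_divide norm_power power2_eq_square)
    ultimately have "((\<lambda>\<theta>. ln (norm (f (of_real r * cis \<theta>))))
           has_integral (2 * pi * (ln (norm (G 0)) + (\<Sum>a\<in>insert 0 Z. real (zmult f a) * ln r)))) {0..2 * pi}"
      by simp
    moreover have "ln (norm (G 0)) + (\<Sum>a\<in>insert 0 Z. real (zmult f a) * ln r) = nev_counting r (\<lambda>z. 1 / f z) + ln (norm (G0 0))"
    proof -
      have "(\<Sum>a\<in>Z. real (zmult f a) * ln (r / norm a)) = (\<Sum>a\<in>Z. real (zmult f a) * ln r) - (\<Sum>a\<in>Z. real (zmult f a) * ln (norm a))"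
        unfolding sum_subtractf[symmetric] using Z r by (intro sum.cong) (auto simp: ln_div algebra_simps)
      then show ?thesis using nev_counting_reciprocal[OF f r] finZ 0 nG0 by (simp add: Z_def)
    qed
    ultimately show ?thesis by simp
  qed
  then show thesis using that by blast
qed

text \<open>Every zero enters the exact formula through the Green function of the disc, which has a
  sign. Dropping these terms leaves an inequality that needs no knowledge of the zeros.\<close>

lemma poisson_jensen_inequality:
  assumes f: "f holomorphic_on UNIV" "f p \<noteq> 0" and p: "norm p < r" and nz: "\<And>z. norm z = r \<Longrightarrow> f z \<noteq> 0"
  obtains I where "((\<lambda>\<theta>. (r\<^sup>2 - (norm p)\<^sup>2) / (norm (of_real r * cis \<theta> - p))\<^sup>2 * ln (norm (f (of_real r * cis \<theta>)))) has_integral I) {0..2 * pi}"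
    "2 * pi * ln (norm (f p)) \<le> I"
proof -
  have r: "r > 0" using p norm_ge_zero[of p] by linarith
  define Z where "Z = {z. norm z \<le> r \<and> f z = 0}"
  have finZ: "finite Z"
    using finite_subset[OF _ finite_zeros_compact[OF f compact_cball[of 0 r]], of Z] by (auto simp: Z_def)
  have Z: "norm a < r" "a \<noteq> p" if "a \<in> Z" for a using that nz[of a] f(2) by (auto simp: Z_def less_le)
  obtain G where G: "G holomorphic_on UNIV" "\<And>z. f z = G z * (\<Prod>a\<in>Z. (z - a) ^ zmult f a)" "\<And>a. a \<in> Z \<Longrightarrow> G a \<noteq> 0"
    using factor_zeros[OF f, of Z] finZ by auto
  have Gnz: "G z \<noteq> 0" if "norm z \<le> r" for z
    using G(3)[of z] G(2)[of z] that by (cases "f z = 0") (auto simp: Z_def)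
  have "ln (norm (f p)) = ln (norm (G p)) + (\<Sum>a\<in>Z. real (zmult f a) * ln (norm (p - a)))"
  proof -
    have "norm (f p) = norm (G p) * (\<Prod>a\<in>Z. norm (p - a) ^ zmult f a)"
      unfolding G(2)[of p] by (simp add: norm_mult norm_power flip: prod_norm)
    moreover have "ln (\<Prod>a\<in>Z. norm (p - a) ^ zmult f a) = (\<Sum>a\<in>Z. real (zmult f a) * ln (norm (p - a)))"
      using Z by (subst ln_prod) (auto simp: finZ ln_realpow intro!: sum.cong)
    moreover have "(\<Prod>a\<in>Z. norm (p - a) ^ zmult f a) > 0"
    proof (intro prod_pos zero_less_power)
      fix a assume "a \<in> Z"
      then show "norm (p - a) > 0" using Z(2)[of a] by auto
    qed
    ultimately show ?thesis using Gnz[of p] p by (simp add: ln_mult)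
  qed
  also have "(\<Sum>a\<in>Z. real (zmult f a) * ln (norm (p - a))) \<le> (\<Sum>a\<in>Z. real (zmult f a) * ln (norm ((of_real (r\<^sup>2) - cnj a * p) / of_real r)))"
  proof (intro sum_mono mult_left_mono)
    fix a assume a: "a \<in> Z"
    have "0 \<le> (r\<^sup>2 - (norm a)\<^sup>2) * (r\<^sup>2 - (norm p)\<^sup>2)"
      using Z(1)[OF a] p by (intro mult_nonneg_nonneg) (auto intro!: power_mono)
    also have "\<dots> = (norm (of_real (r\<^sup>2) - cnj a * p))\<^sup>2 - r\<^sup>2 * (norm (p - a))\<^sup>2"
      unfolding cmod_power2 by (simp add: power2_eq_square algebra_simps)
    finally have "(r * norm (p - a))\<^sup>2 \<le> (norm (of_real (r\<^sup>2) - cnj a * p))\<^sup>2" by (simp add: power_mult_distrib)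
    then have "r * norm (p - a) \<le> norm (of_real (r\<^sup>2) - cnj a * p)" by (rule power2_le_imp_le) simp
    then have "norm (p - a) \<le> norm ((of_real (r\<^sup>2) - cnj a * p) / of_real r)" using r by (simp add: norm_divide field_simps)
    moreover have "norm (p - a) > 0" using Z(2)[OF a] by simp
    ultimately show "ln (norm (p - a)) \<le> ln (norm ((of_real (r\<^sup>2) - cnj a * p) / of_real r))" by (subst ln_le_cancel_iff) auto
  qed auto
  finally have "2 * pi * ln (norm (f p)) \<le> 2 * pi * (ln (norm (G p)) + (\<Sum>a\<in>Z. real (zmult f a) * ln (norm ((of_real (r\<^sup>2) - cnj a * p) / of_real r))))"
    by (intro mult_left_mono) auto
  then show thesis using that poisson_log[OF G(1) Gnz finZ Z(1) G(2) p] by blast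
qed

subsection \<open>Functions with one-sided Gaussian asymptotics\<close>

text \<open>The expected indicator, extended as a function homogeneous of degree 2. The first factor
  cuts off the closed left sector, and beyond it the product is
  \<open>((Im w)\<^sup>2 - (Re w)\<^sup>2) / 2\<close>; in this form continuity is evident.\<close>

definition stokes_indicator :: "complex \<Rightarrow> real" where
  "stokes_indicator w = max 0 (Re w + \<bar>Im w\<bar>) * (\<bar>Im w\<bar> - Re w) / 2"

lemma continuous_on_stokes_indicator [continuous_intros]:
  "continuous_on A g \<Longrightarrow> continuous_on A (\<lambda>x. stokes_indicator (g x))"
  unfolding stokes_indicator_def by (intro continuous_intros) auto

lemma stokes_indicator_left: "Re w + \<bar>Im w\<bar> \<le> 0 \<Longrightarrow> stokes_indicator w = 0"
  by (simp add: stokes_indicator_def)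

lemma stokes_indicator_right: "Re w + \<bar>Im w\<bar> \<ge> 0 \<Longrightarrow> stokes_indicator w = - Re (w\<^sup>2) / 2"
proof -
  assume "Re w + \<bar>Im w\<bar> \<ge> 0"
  then have "stokes_indicator w = (\<bar>Im w\<bar>\<^sup>2 - (Re w)\<^sup>2) / 2"
    by (simp add: stokes_indicator_def power2_eq_square algebra_simps)
  then show ?thesis by (simp add: power2_eq_square)
qed

lemma Re_square_neg: "- Re (w\<^sup>2) / 2 = (\<bar>Im w\<bar> + Re w) * (\<bar>Im w\<bar> - Re w) / 2"
  by (simp add: power2_eq_square algebra_simps)

lemma max_stokes_indicator: "max 0 (stokes_indicator w) = max 0 (- Re (w\<^sup>2) / 2)"
proof (cases "Re w + \<bar>Im w\<bar> \<ge> 0")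
  case False
  then have "- Re (w\<^sup>2) / 2 \<le> 0" unfolding Re_square_neg using mult_nonpos_nonneg[of "\<bar>Im w\<bar> + Re w" "\<bar>Im w\<bar> - Re w"] by linarith
  then show ?thesis using False by (simp add: stokes_indicator_left)
qed (simp add: stokes_indicator_right)

lemma stokes_indicator_le_max: "Re w \<le> 0 \<Longrightarrow> stokes_indicator w = max 0 (- Re (w\<^sup>2) / 2)"
  using max_stokes_indicator[of w] mult_nonneg_nonneg[of "max 0 (Re w + \<bar>Im w\<bar>)" "\<bar>Im w\<bar> - Re w"]
  by (simp add: stokes_indicator_def)

text \<open>The cut-off factor grows at most linearly with the distance from the left sector, and
  the other factor is at most 2. This keeps Poisson averages of the indicator small near a left
  direction.\<close>

lemma stokes_indicator_near_left:
  assumes "norm w \<le> 1" "norm \<xi> \<le> 1" "\<bar>Im \<xi>\<bar> \<le> - Re \<xi>"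
  shows "stokes_indicator w \<le> 2 * norm (w - \<xi>)"
proof -
  have a: "\<bar>Re w - Re \<xi>\<bar> \<le> norm (w - \<xi>)" "\<bar>Im w - Im \<xi>\<bar> \<le> norm (w - \<xi>)"
    using abs_Re_le_cmod[of "w - \<xi>"] abs_Im_le_cmod[of "w - \<xi>"] by auto
  then have "max 0 (Re w + \<bar>Im w\<bar>) \<le> 2 * norm (w - \<xi>)" using assms(3) norm_ge_zero[of "w - \<xi>"] by linarith
  moreover have "\<bar>Im w\<bar> - Re w \<le> 2" using abs_Re_le_cmod[of w] abs_Im_le_cmod[of w] assms by linarith
  ultimately have "max 0 (Re w + \<bar>Im w\<bar>) * (\<bar>Im w\<bar> - Re w) \<le> (2 * norm (w - \<xi>)) * 2"
  proof -
    have "max 0 (Re w + \<bar>Im w\<bar>) * (\<bar>Im w\<bar> - Re w) \<le> max 0 (Re w + \<bar>Im w\<bar>) * 2"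
      using \<open>\<bar>Im w\<bar> - Re w \<le> 2\<close> by (intro mult_left_mono) auto
    also have "\<dots> \<le> (2 * norm (w - \<xi>)) * 2" using \<open>max 0 _ \<le> _\<close> by (intro mult_right_mono) auto
    finally show ?thesis .
  qed
  then show ?thesis by (simp add: stokes_indicator_def)
qed

lemma cos_add_sin: "cos x + sin x = sqrt 2 * cos (x - pi / 4)"
  by (simp add: cos_diff cos_45 sin_45 algebra_simps)

lemma cos_diff_sin: "cos x - sin x = sqrt 2 * cos (x + pi / 4)"
  by (simp add: cos_add cos_45 sin_45 algebra_simps)

text \<open>The slope \<open>k\<close> is minus the cotangent of
  \<open>3 / 4 * pi - \<alpha>\<close>. Conditions on arguments become conditions on real and
  imaginary parts, in which the asymptotics are stated.\<close>

lemma sector_slope: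
  assumes "0 < \<alpha>" "\<alpha> < pi / 4"
  obtains k where "0 < k" "k < 1" "\<And>\<theta>. \<bar>\<theta>\<bar> < 3 / 4 * pi - \<alpha> \<Longrightarrow> cos \<theta> > - k * \<bar>sin \<theta>\<bar>"
proof -
  define \<beta> where "\<beta> = 3 / 4 * pi - \<alpha>"
  define k where "k = - cos \<beta> / sin \<beta>"
  have \<beta>: "pi / 2 < \<beta>" "\<beta> < 3 / 4 * pi" using assms by (auto simp: \<beta>_def)
  have s: "sin \<beta> > 0" using \<beta> by (intro sin_gt_zero) auto
  have c: "cos \<beta> < 0" using \<beta> cos_gt_zero[of "\<beta> - pi"] cos_gt_zero_pi[of "\<beta> - pi"] by (simp add: cos_diff)
  have "sin \<beta> + cos \<beta> > 0"
    using cos_add_sin[of \<beta>] cos_gt_zero_pi[of "\<beta> - pi / 4"] \<beta> by (simp add: zero_less_mult_iff add.commute)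
  then have k: "0 < k" "k < 1" using s c by (auto simp: k_def divide_neg_pos field_simps)
  have *: "cos \<theta> > - k * sin \<theta>" if "0 \<le> \<theta>" "\<theta> < \<beta>" for \<theta>
  proof -
    have "sin (\<beta> - \<theta>) > 0" using that \<beta> by (intro sin_gt_zero) auto
    then have "(sin \<beta> * cos \<theta> - cos \<beta> * sin \<theta>) / sin \<beta> > 0" using s by (simp add: sin_diff)
    then show ?thesis using s by (simp add: k_def diff_divide_distrib)
  qed
  have "cos \<theta> > - k * \<bar>sin \<theta>\<bar>" if "\<bar>\<theta>\<bar> < 3 / 4 * pi - \<alpha>" for \<theta>
  proof (cases "\<theta> \<ge> 0")
    case True
    then have "sin \<theta> \<ge> 0" using that assms by (intro sin_ge_zero) auto
    then show ?thesis using *[of \<theta>] True that by (simp add: \<beta>_def)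
  next
    case False
    then have "sin (- \<theta>) \<ge> 0" using that assms by (intro sin_ge_zero) auto
    then show ?thesis using *[of "- \<theta>"] False that by (simp add: \<beta>_def)
  qed
  then show thesis using that k by blast
qed

lemma left_arc:
  assumes "3 / 4 * pi \<le> \<theta>" "\<theta> \<le> 5 / 4 * pi"
  shows "cos \<theta> + \<bar>sin \<theta>\<bar> \<le> 0"
proof -
  have "cos (\<theta> - pi / 4 - pi) \<ge> 0" using assms by (intro cos_ge_zero) auto
  moreover have "cos (\<theta> + pi / 4 - pi) \<ge> 0" using assms by (intro cos_ge_zero) auto
  ultimately have "cos (\<theta> - pi / 4) \<le> 0" "cos (\<theta> + pi / 4) \<le> 0"
    by (simp_all only: cos_diff[of _ pi] cos_pi sin_pi)
  then have "sqrt 2 * cos (\<theta> - pi / 4) \<le> 0" "sqrt 2 * cos (\<theta> + pi / 4) \<le> 0" by (simp_all add: mult_nonneg_nonpos)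
  then have "cos \<theta> + sin \<theta> \<le> 0" "cos \<theta> - sin \<theta> \<le> 0" by (simp_all only: cos_add_sin cos_diff_sin)
  then show ?thesis by linarith
qed

lemma right_arc:
  assumes "\<bar>\<theta>\<bar> \<le> 3 / 4 * pi"
  shows "cos \<theta> + \<bar>sin \<theta>\<bar> \<ge> 0"
proof -
  have "cos \<bar>\<theta>\<bar> + sin \<bar>\<theta>\<bar> \<ge> 0" unfolding cos_add_sin using assms by (intro mult_nonneg_nonneg cos_ge_zero) auto
  moreover have "sin \<bar>\<theta>\<bar> \<le> \<bar>sin \<theta>\<bar>" "cos \<bar>\<theta>\<bar> = cos \<theta>" by (auto simp: abs_if)
  ultimately show ?thesis by linarith
qed

lemma stokes_indicator_cis:
  "3 / 4 * pi \<le> \<theta> \<Longrightarrow> \<theta> \<le> 5 / 4 * pi \<Longrightarrow> stokes_indicator (cis \<theta>) = 0"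
  "\<bar>\<theta>\<bar> \<le> 3 / 4 * pi \<Longrightarrow> stokes_indicator (cis \<theta>) = - cos (2 * \<theta>) / 2"
  "5 / 4 * pi \<le> \<theta> \<Longrightarrow> \<theta> \<le> 2 * pi \<Longrightarrow> stokes_indicator (cis \<theta>) = - cos (2 * \<theta>) / 2"
proof -
  have sq: "Re ((cis \<theta>)\<^sup>2) = cos (2 * \<theta>)" for \<theta> by (simp add: power2_eq_square cis_mult)
  show "3 / 4 * pi \<le> \<theta> \<Longrightarrow> \<theta> \<le> 5 / 4 * pi \<Longrightarrow> stokes_indicator (cis \<theta>) = 0"
    using left_arc[of \<theta>] by (intro stokes_indicator_left) auto
  have R: "stokes_indicator (cis \<theta>) = - cos (2 * \<theta>) / 2" if "\<bar>\<theta>\<bar> \<le> 3 / 4 * pi" for \<theta>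
    using right_arc[OF that] stokes_indicator_right[of "cis \<theta>"] by (simp add: sq)
  then show "\<bar>\<theta>\<bar> \<le> 3 / 4 * pi \<Longrightarrow> stokes_indicator (cis \<theta>) = - cos (2 * \<theta>) / 2" .
  assume "5 / 4 * pi \<le> \<theta>" "\<theta> \<le> 2 * pi"
  then have "stokes_indicator (cis (\<theta> - 2 * pi)) = - cos (2 * (\<theta> - 2 * pi)) / 2" by (intro R) auto
  moreover have "cis (\<theta> - 2 * pi) = cis \<theta>" by (simp flip: cis_divide)
  moreover have "cos (2 * (\<theta> - 2 * pi)) = cos (2 * \<theta>)"
    using sq[of "\<theta> - 2 * pi"] sq[of \<theta>] \<open>cis (\<theta> - 2 * pi) = cis \<theta>\<close> by simp
  ultimately show "stokes_indicator (cis \<theta>) = - cos (2 * \<theta>) / 2" by simp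
qed

lemma has_integral_cos2:
  fixes g :: "real \<Rightarrow> real"
  assumes "a \<le> b" "\<And>\<theta>. \<theta> \<in> {a..b} \<Longrightarrow> g \<theta> = - cos (2 * \<theta>) / 2"
  shows "(g has_integral ((sin (2 * a) - sin (2 * b)) / 4)) {a..b}"
proof -
  have "((\<lambda>\<theta>. - cos (2 * \<theta>) / 2) has_integral (- sin (2 * b) / 4 - (- sin (2 * a) / 4))) {a..b}"
    using assms(1) by (intro fundamental_theorem_of_calculus)
      (auto simp: has_real_derivative_iff_has_vector_derivative[symmetric] intro!: derivative_eq_intros)
  then have "((\<lambda>\<theta>. - cos (2 * \<theta>) / 2) has_integral ((sin (2 * a) - sin (2 * b)) / 4)) {a..b}" by (simp add: diff_divide_distrib)
  then show ?thesis by (rule has_integral_eq[rotated]) (use assms(2) in auto)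
qed

lemma sin_odd_multiples_half_pi: "sin (3 / 2 * pi) = -1" "sin (5 / 2 * pi) = 1" "sin (7 / 2 * pi) = -1"
proof -
  have "sin (3 / 2 * pi) = sin (pi / 2 + pi)" "sin (5 / 2 * pi) = sin (pi / 2 + 2 * pi)" "sin (7 / 2 * pi) = sin (3 / 2 * pi + 2 * pi)"
    by (simp_all add: field_simps)
  then show "sin (3 / 2 * pi) = -1" "sin (5 / 2 * pi) = 1" "sin (7 / 2 * pi) = -1"
    by (simp_all only: sin_periodic sin_periodic_pi sin_pi_half)
qed

text \<open>Its mean \<open>1 / (4 * pi)\<close> over the circle is the coefficient in the
  asymptotics of \<open>N(r, 1/f)\<close>.\<close>

lemma has_integral_stokes_indicator: "((\<lambda>\<theta>. stokes_indicator (cis \<theta>)) has_integral 1 / 2) {0..2 * pi}"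
proof -
  have 1: "((\<lambda>\<theta>. stokes_indicator (cis \<theta>)) has_integral ((sin (2 * 0) - sin (2 * (3 / 4 * pi))) / 4)) {0..3 / 4 * pi}"
    by (rule has_integral_cos2, simp, rule stokes_indicator_cis(2)) (simp add: abs_if)
  have 2: "((\<lambda>\<theta>. stokes_indicator (cis \<theta>)) has_integral 0) {3 / 4 * pi..5 / 4 * pi}"
    by (rule has_integral_is_0) (auto intro!: stokes_indicator_cis)
  have 3: "((\<lambda>\<theta>. stokes_indicator (cis \<theta>)) has_integral ((sin (2 * (5 / 4 * pi)) - sin (2 * (2 * pi))) / 4)) {5 / 4 * pi..2 * pi}"
    by (rule has_integral_cos2, simp, rule stokes_indicator_cis(3)) simp_all
  have s: "sin (2 * (3 / 4 * pi)) = -1" "sin (2 * (5 / 4 * pi)) = 1" "sin (2 * (2 * pi)) = 0"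
    using sin_odd_multiples_half_pi sin_npi[of 4] by (simp_all add: mult.assoc)
  show ?thesis using has_integral_combine[OF _ _ has_integral_combine[OF _ _ 1 2] 3, unfolded s] by simp
qed

text \<open>Its mean \<open>1 / (2 * pi)\<close> is the coefficient in the asymptotics of
  \<open>T(r, f)\<close>; the two coefficients differ because the indicator is negative around the
  positive axis.\<close>

lemma has_integral_max_stokes_indicator: "((\<lambda>\<theta>. max 0 (stokes_indicator (cis \<theta>))) has_integral 1) {0..2 * pi}"
proof -
  define g where "g = (\<lambda>\<theta>. max 0 (stokes_indicator (cis \<theta>)))"
  have g: "g \<theta> = max 0 (- cos (2 * \<theta>) / 2)" for \<theta>
    unfolding g_def max_stokes_indicator by (simp add: power2_eq_square cis_mult)
  have pos: "cos (2 * \<theta>) \<ge> 0" if "\<bar>\<theta>\<bar> \<le> pi / 4" for \<theta> using that by (intro cos_ge_zero) auto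
  have sh: "cos (2 * (\<theta> - pi)) = cos (2 * \<theta>)" "cos (2 * (\<theta> - 2 * pi)) = cos (2 * \<theta>)" "cos (2 * (\<theta> - pi / 2)) = - cos (2 * \<theta>)" "cos (2 * (\<theta> - 3 / 2 * pi)) = - cos (2 * \<theta>)" for \<theta>
  proof -
    have *: "cos (2 * (\<theta> - pi)) = cos (2 * \<theta>)" for \<theta> using cos_periodic[of "2 * \<theta> - 2 * pi"] by (simp add: algebra_simps)
    show "cos (2 * (\<theta> - pi)) = cos (2 * \<theta>)" by (rule *)
    show "cos (2 * (\<theta> - 2 * pi)) = cos (2 * \<theta>)" using *[of "\<theta> - pi"] *[of \<theta>] by (simp add: algebra_simps)
    have **: "cos (2 * (\<theta> - pi / 2)) = - cos (2 * \<theta>)" for \<theta> by (simp add: right_diff_distrib cos_diff)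
    show "cos (2 * (\<theta> - pi / 2)) = - cos (2 * \<theta>)" by (rule **)
    show "cos (2 * (\<theta> - 3 / 2 * pi)) = - cos (2 * \<theta>)" using **[of "\<theta> - pi"] *[of \<theta>] by (simp add: algebra_simps)
  qed
  have 1: "(g has_integral 0) {0..pi / 4}"
    by (rule has_integral_is_0) (use pos in \<open>auto simp: g\<close>)
  have 2: "(g has_integral ((sin (2 * (pi / 4)) - sin (2 * (3 / 4 * pi))) / 4)) {pi / 4..3 / 4 * pi}"
  proof (rule has_integral_cos2)
    fix \<theta> assume "\<theta> \<in> {pi / 4..3 / 4 * pi}"
    then have "cos (2 * (\<theta> - pi / 2)) \<ge> 0" by (intro pos abs_leI) simp_all
    then have "- cos (2 * \<theta>) \<ge> 0" by (simp only: sh)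
    then show "g \<theta> = - cos (2 * \<theta>) / 2" by (simp add: g)
  qed auto
  have 3: "(g has_integral 0) {3 / 4 * pi..5 / 4 * pi}"
    by (rule has_integral_is_0) (auto simp: g_def stokes_indicator_cis)
  have 4: "(g has_integral ((sin (2 * (5 / 4 * pi)) - sin (2 * (7 / 4 * pi))) / 4)) {5 / 4 * pi..7 / 4 * pi}"
  proof (rule has_integral_cos2)
    fix \<theta> assume "\<theta> \<in> {5 / 4 * pi..7 / 4 * pi}"
    then have "cos (2 * (\<theta> - 3 / 2 * pi)) \<ge> 0" by (intro pos abs_leI) simp_all
    then have "- cos (2 * \<theta>) \<ge> 0" by (simp only: sh)
    then show "g \<theta> = - cos (2 * \<theta>) / 2" by (simp add: g)
  qed auto
  have 5: "(g has_integral 0) {7 / 4 * pi..2 * pi}"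
  proof (rule has_integral_is_0)
    fix \<theta> assume "\<theta> \<in> {7 / 4 * pi..2 * pi}"
    then have "cos (2 * (\<theta> - 2 * pi)) \<ge> 0" by (intro pos abs_leI) simp_all
    then have "cos (2 * \<theta>) \<ge> 0" by (simp only: sh)
    then show "g \<theta> = 0" by (simp add: g)
  qed
  have s: "sin (2 * (pi / 4)) = 1" "sin (2 * (3 / 4 * pi)) = -1" "sin (2 * (5 / 4 * pi)) = 1" "sin (2 * (7 / 4 * pi)) = -1"
    using sin_odd_multiples_half_pi by (simp_all add: mult.assoc)
  show ?thesis unfolding g_def[symmetric]
    using has_integral_combine[OF _ _ has_integral_combine[OF _ _ has_integral_combine[OF _ _ has_integral_combine[OF _ _ 1 2] 3] 4] 5, unfolded s]
    by simp
qed

lemma Re_scale: "Re ((of_real r * w)\<^sup>2) = r\<^sup>2 * Re (w\<^sup>2)"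
  by (simp add: power2_eq_square algebra_simps)

text \<open>The properties from which all four assertions follow, without reference to the contour
  integral. As \<open>k\<close> tends to 1 the regions \<open>Re z > - k * \<bar>Im z\<bar>\<close>
  exhaust the open sector bounded by the rays with argument 3 pi/4 and - 3 pi/4.\<close>

locale stokes_function =
  fixes f :: "complex \<Rightarrow> complex" and C :: real
  assumes holo: "f holomorphic_on UNIV"
    and C: "C \<ge> 0"
    and upper: "norm (f z) \<le> exp (max 0 (- Re (z\<^sup>2) / 2) + C * (norm z + 1))"
    and asymp: "0 < k \<Longrightarrow> k < 1 \<Longrightarrow> \<exists>r0>0. \<exists>E D. E holomorphic_on {z. norm z > r0 \<and> Re z > - k * \<bar>Im z\<bar>} \<and>
        (\<forall>z. norm z > r0 \<longrightarrow> Re z > - k * \<bar>Im z\<bar> \<longrightarrow> f z = exp (- z\<^sup>2 / 2 + E z) \<and> norm (E z) \<le> D * norm z)"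
    and nowhere: "nowhere_small f"
begin

lemma upper_left: "\<bar>Im z\<bar> \<le> - Re z \<Longrightarrow> norm (f z) \<le> exp (C * (norm z + 1))"
  using upper[of z] max_stokes_indicator[of z] stokes_indicator_left[of z] by simp

lemma asymp_log:
  assumes "0 < k" "k < 1"
  obtains r0 D where "r0 > 0" "D \<ge> 0"
    "\<And>z. norm z > r0 \<Longrightarrow> Re z > - k * \<bar>Im z\<bar> \<Longrightarrow> f z \<noteq> 0 \<and> \<bar>ln (norm (f z)) + Re (z\<^sup>2) / 2\<bar> \<le> D * norm z"
proof -
  obtain r0 E D where r0: "r0 > 0" and
    E: "\<And>z. norm z > r0 \<Longrightarrow> Re z > - k * \<bar>Im z\<bar> \<Longrightarrow> f z = exp (- z\<^sup>2 / 2 + E z) \<and> norm (E z) \<le> D * norm z"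
    using asymp[OF assms] by blast
  show thesis
  proof (rule that[of r0 "max D 0"])
    fix z assume z: "norm z > r0" "Re z > - k * \<bar>Im z\<bar>"
    have fz: "f z = exp (- z\<^sup>2 / 2 + E z)" "norm (E z) \<le> D * norm z" using E[OF z] by auto
    have "ln (norm (f z)) + Re (z\<^sup>2) / 2 = Re (E z)" unfolding fz(1) by simp
    moreover have "D * norm z \<le> max D 0 * norm z" by (intro mult_right_mono) auto
    ultimately show "f z \<noteq> 0 \<and> \<bar>ln (norm (f z)) + Re (z\<^sup>2) / 2\<bar> \<le> max D 0 * norm z"
      using fz abs_Re_le_cmod[of "E z"] by auto
  qed (use r0 in auto)
qed

lemma not_identically_zero: "\<exists>w. f w \<noteq> 0"
proof -
  obtain k :: real where k: "0 < k" "k < 1" by (rule that[of "1/2"]) auto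
  obtain r0 D where "r0 > 0" "D \<ge> 0" and *: "\<And>z. norm z > r0 \<Longrightarrow> Re z > - k * \<bar>Im z\<bar> \<Longrightarrow> f z \<noteq> 0 \<and> \<bar>ln (norm (f z)) + Re (z\<^sup>2) / 2\<bar> \<le> D * norm z"
    using asymp_log[OF k] by blast
  then have "f (of_real (r0 + 1)) \<noteq> 0" using *[of "of_real (r0 + 1)"] by (auto simp del: of_real_add)
  then show ?thesis by blast
qed

definition w0 where "w0 = (SOME w. f w \<noteq> 0)"

lemma w0: "f w0 \<noteq> 0"
  unfolding w0_def using not_identically_zero by (rule someI_ex)

text \<open>The error, linear in \<open>norm z\<close>, is absorbed by
  \<open>r\<^sup>2 * \<eta>\<close> after rescaling to the unit circle, uniformly in the
  direction.\<close>

lemma asymp_unit: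
  assumes k: "0 < k" "k < 1" and \<eta>: "\<eta> > 0"
  shows "\<forall>\<^sub>F r in at_top. \<forall>w. norm w = 1 \<longrightarrow> Re w > - k * \<bar>Im w\<bar> \<longrightarrow>
     f (of_real r * w) \<noteq> 0 \<and> \<bar>ln (norm (f (of_real r * w))) - r\<^sup>2 * stokes_indicator w\<bar> \<le> r\<^sup>2 * \<eta>"
proof -
  obtain r0 D where r0: "r0 > 0" "D \<ge> 0"
    and *: "\<And>z. norm z > r0 \<Longrightarrow> Re z > - k * \<bar>Im z\<bar> \<Longrightarrow> f z \<noteq> 0 \<and> \<bar>ln (norm (f z)) + Re (z\<^sup>2) / 2\<bar> \<le> D * norm z"
    using asymp_log[OF k] by blast
  have "\<forall>\<^sub>F r in at_top. D * r + 0 \<le> \<eta> * r\<^sup>2" using \<eta> by (rule eventually_affine_le_quadratic)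
  then show ?thesis using eventually_gt_at_top[of r0]
  proof eventually_elim
    case (elim r)
    show ?case
    proof (intro allI impI)
      fix w :: complex assume w: "norm w = 1" "Re w > - k * \<bar>Im w\<bar>"
      have r: "r > 0" using elim r0 by simp
      have "r * (- k * \<bar>Im w\<bar>) < r * Re w" using w r by (intro mult_strict_left_mono) auto
      then have s: "Re (of_real r * w) > - k * \<bar>Im (of_real r * w)\<bar>" using r by (simp add: abs_mult algebra_simps)
      have n: "norm (of_real r * w) = r" using r w by (simp add: norm_mult)
      have "k * \<bar>Im w\<bar> \<le> 1 * \<bar>Im w\<bar>" using k by (intro mult_right_mono) auto
      then have "Re w + \<bar>Im w\<bar> \<ge> 0" using w by linarith
      then have "stokes_indicator w = - Re (w\<^sup>2) / 2" by (rule stokes_indicator_right)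
      then have "r\<^sup>2 * stokes_indicator w = - Re ((of_real r * w)\<^sup>2) / 2" unfolding Re_scale by simp
      then show "f (of_real r * w) \<noteq> 0 \<and> \<bar>ln (norm (f (of_real r * w))) - r\<^sup>2 * stokes_indicator w\<bar> \<le> r\<^sup>2 * \<eta>"
        using *[of "of_real r * w"] s n elim by (simp add: mult.commute)
    qed
  qed
qed

lemma upper_unit:
  assumes \<eta>: "\<eta> > 0"
  shows "\<forall>\<^sub>F r in at_top. \<forall>w. norm w = 1 \<longrightarrow> f (of_real r * w) \<noteq> 0 \<longrightarrow>
     ln (norm (f (of_real r * w))) \<le> r\<^sup>2 * (stokes_indicator w + \<eta>)"
proof -
  have "\<forall>\<^sub>F r in at_top. C * r + C \<le> \<eta> * r\<^sup>2" using \<eta> by (rule eventually_affine_le_quadratic)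
  then show ?thesis using asymp_unit[of "1/2" \<eta>, OF _ _ \<eta>, simplified] eventually_gt_at_top[of 0]
  proof eventually_elim
    case (elim r)
    show ?case
    proof (intro allI impI)
      fix w :: complex assume w: "norm w = 1" "f (of_real r * w) \<noteq> 0"
      show "ln (norm (f (of_real r * w))) \<le> r\<^sup>2 * (stokes_indicator w + \<eta>)"
      \<comment> \<open>Around the positive axis the indicator is negative and the general bound,
        with its maximum with 0, is too weak. There the asymptotics supply the upper bound.\<close>
      proof (cases "Re w > 0")
        case True
        then have "Re w > - (\<bar>Im w\<bar> / 2)" using abs_ge_zero[of "Im w"] by linarith
        then show ?thesis using elim(2) w by (auto simp: algebra_simps)
      next
        case False
        have "ln (norm (f (of_real r * w))) \<le> ln (exp (max 0 (- Re ((of_real r * w)\<^sup>2) / 2) + C * (norm (of_real r * w) + 1)))"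
          using upper[of "of_real r * w"] w(2) by (subst ln_le_cancel_iff) auto
        also have "\<dots> = max 0 (- Re ((of_real r * w)\<^sup>2) / 2) + C * (norm (of_real r * w) + 1)" by simp
        also have "max 0 (- Re ((of_real r * w)\<^sup>2) / 2) = r\<^sup>2 * max 0 (- Re (w\<^sup>2) / 2)"
          unfolding Re_scale using max_mult_distrib_left[of "r\<^sup>2" 0 "- Re (w\<^sup>2) / 2"] by simp
        also have "max 0 (- Re (w\<^sup>2) / 2) = stokes_indicator w" using False stokes_indicator_le_max[of w] by simp
        finally show ?thesis using elim w by (simp add: norm_mult algebra_simps)
      qed
    qed
  qed
qed

section \<open>Logarithm, finitely many zeros and the indicator\<close>

lemma holomorphic_log_branch:
  assumes "\<epsilon> > 0"
  shows "\<exists>r0>0. \<exists>logL. let S = {z. cmod z > r0 \<and> \<bar>Arg z\<bar> < 3 / 4 * pi - \<epsilon>} in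
           logL holomorphic_on S \<and> (\<forall>z\<in>S. exp (logL z) = f z) \<and>
           ((\<lambda>z. logL z / z ^ 2) \<longlongrightarrow> - 1 / 2) (inf at_infinity (principal S))"
proof -
  \<comment> \<open>The slope lemma needs an angle below pi/4, while \<open>\<epsilon>\<close> may
    be arbitrarily large.\<close>
  define \<alpha> where "\<alpha> = min \<epsilon> (pi / 8)"
  have "0 < \<alpha>" using assms by (simp add: \<alpha>_def)
  moreover have "\<alpha> \<le> pi / 8" unfolding \<alpha>_def by (rule min.cobounded2)
  then have "\<alpha> < pi / 4" using pi_gt_zero by linarith
  ultimately
  obtain k where k: "0 < k" "k < 1" "\<And>\<theta>. \<bar>\<theta>\<bar> < 3 / 4 * pi - \<alpha> \<Longrightarrow> cos \<theta> > - k * \<bar>sin \<theta>\<bar>"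
    using sector_slope by blast
  obtain r0 E D where r0: "r0 > 0" and hE: "E holomorphic_on {z. norm z > r0 \<and> Re z > - k * \<bar>Im z\<bar>}" and
    E: "\<And>z. norm z > r0 \<Longrightarrow> Re z > - k * \<bar>Im z\<bar> \<Longrightarrow> f z = exp (- z\<^sup>2 / 2 + E z) \<and> norm (E z) \<le> D * norm z"
    using asymp[OF k(1,2)] by blast
  define S where "S = {z. cmod z > r0 \<and> \<bar>Arg z\<bar> < 3 / 4 * pi - \<epsilon>}"
  have sub: "S \<subseteq> {z. norm z > r0 \<and> Re z > - k * \<bar>Im z\<bar>}"
  proof
    fix z assume z: "z \<in> S"
    then have nz: "norm z > 0" using r0 by (simp only: S_def mem_Collect_eq) linarith
    have "cos (Arg z) > - k * \<bar>sin (Arg z)\<bar>" using z by (intro k) (auto simp: S_def \<alpha>_def)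
    then have "norm z * cos (Arg z) > norm z * (- k * \<bar>sin (Arg z)\<bar>)" using nz by (rule mult_strict_left_mono)
    moreover have "Re z = norm z * cos (Arg z)" "Im z = norm z * sin (Arg z)"
      using nz by (auto simp: cos_Arg sin_Arg)
    ultimately show "z \<in> {z. norm z > r0 \<and> Re z > - k * \<bar>Im z\<bar>}"
      using z nz by (simp add: S_def abs_mult algebra_simps)
  qed
  define logL where "logL = (\<lambda>z. - z\<^sup>2 / 2 + E z)"
  have "((\<lambda>z. D / norm z) \<longlongrightarrow> 0) at_infinity"
    by (intro tendsto_divide_0[OF tendsto_const] filterlim_at_top_imp_at_infinity filterlim_norm_at_top)
  then have lim: "((\<lambda>z. D / norm z) \<longlongrightarrow> 0) (inf at_infinity (principal S))" by (rule tendsto_mono[rotated]) simp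
  have "((\<lambda>z. logL z / z ^ 2 - (- 1 / 2)) \<longlongrightarrow> 0) (inf at_infinity (principal S))"
  proof (rule Lim_null_comparison[OF _ lim])
    show "\<forall>\<^sub>F z in inf at_infinity (principal S). norm (logL z / z ^ 2 - (- 1 / 2)) \<le> D / norm z"
      unfolding eventually_inf_principal
    proof (intro always_eventually allI impI)
      fix z assume "z \<in> S"
      then have z: "norm z > r0" "Re z > - k * \<bar>Im z\<bar>" using sub by auto
      then have "z \<noteq> 0" using r0 by auto
      then have "logL z / z ^ 2 - (- 1 / 2) = E z / z^2" by (simp add: logL_def field_simps)
      moreover have "norm (E z) \<le> D * norm z" using E[OF z] by auto
      ultimately show "norm (logL z / z ^ 2 - (- 1 / 2)) \<le> D / norm z"
        using \<open>z \<noteq> 0\<close> divide_right_mono[of "norm (E z)" "D * norm z" "norm z ^ 2"]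
        by (simp only: norm_divide norm_power) (simp add: power2_eq_square)
    qed
  qed
  then have "((\<lambda>z. logL z / z ^ 2) \<longlongrightarrow> - 1 / 2) (inf at_infinity (principal S))"
    unfolding LIM_zero_iff .
  moreover have "logL holomorphic_on S"
    unfolding logL_def by (intro holomorphic_intros holomorphic_on_subset[OF hE sub]) auto
  moreover have "\<forall>z\<in>S. exp (logL z) = f z" using E sub by (auto simp: logL_def)
  ultimately show ?thesis using r0 unfolding S_def Let_def by blast
qed

text \<open>Far out the function is an exponential. Passing to \<open>\<epsilon> / 2\<close> turns
  the closed sector into a part of the open one.\<close>

lemma finite_zeros_sector:
  assumes "\<epsilon> > 0"
  shows "finite {z. \<bar>Arg z\<bar> \<le> 3 / 4 * pi - \<epsilon> \<and> f z = 0}"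
proof -
  obtain r0 logL where "r0 > 0"
    and L: "\<And>z. cmod z > r0 \<Longrightarrow> \<bar>Arg z\<bar> < 3 / 4 * pi - \<epsilon> / 2 \<Longrightarrow> exp (logL z) = f z"
    using holomorphic_log_branch[of "\<epsilon> / 2"] assms by (auto simp: Let_def)
  have "{z. \<bar>Arg z\<bar> \<le> 3 / 4 * pi - \<epsilon> \<and> f z = 0} \<subseteq> {z\<in>cball 0 r0. f z = 0}"
  proof safe
    fix z assume z: "\<bar>Arg z\<bar> \<le> 3 / 4 * pi - \<epsilon>" "f z = 0"
    then have "\<not> cmod z > r0" using L[of z] assms by (metis exp_not_eq_zero add_divide_distrib diff_strict_left_mono field_sum_of_halves less_add_same_cancel1 half_gt_zero_iff order_le_less_trans)
    then show "z \<in> cball 0 r0" by simp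
  qed
  then show ?thesis using finite_zeros_compact[OF holo w0 compact_cball] finite_subset by blast
qed

lemma pl_indicator_right:
  assumes "\<bar>\<theta>\<bar> < 3 / 4 * pi"
  shows "pl_indicator 2 f \<theta> = ereal (- 1 / 2 * cos (2 * \<theta>))"
proof -
  define t where "t = \<bar>\<theta>\<bar>"
  have t: "t < 3 / 4 * pi" using assms by (simp add: t_def)
  obtain \<alpha> where "0 < \<alpha>" "\<alpha> < pi / 4" "\<alpha> < 3 / 4 * pi - t"
    using field_lbound_gt_zero[of "pi / 4" "3 / 4 * pi - t"] t by auto
  then have \<alpha>: "0 < \<alpha>" "\<alpha> < pi / 4" "\<bar>\<theta>\<bar> < 3 / 4 * pi - \<alpha>" by (simp_all add: t_def)
  obtain k where k: "0 < k" "k < 1" "cos \<theta> > - k * \<bar>sin \<theta>\<bar>"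
    using sector_slope[OF \<alpha>(1,2)] \<alpha>(3) by metis
  define F where "F = (\<lambda>r. if f (of_real r * cis \<theta>) = 0 then - \<infinity> else ereal (ln (cmod (f (of_real r * cis \<theta>))) / r powr 2))"
  define h where "h = - 1 / 2 * cos (2 * \<theta>)"
  have h: "stokes_indicator (cis \<theta>) = h" using stokes_indicator_cis(2)[of \<theta>] assms by (simp add: h_def)
  have ev: "\<forall>\<^sub>F r in at_top. f (of_real r * cis \<theta>) \<noteq> 0 \<and> \<bar>ln (cmod (f (of_real r * cis \<theta>))) / r powr 2 - h\<bar> \<le> \<eta>" if "\<eta> > 0" for \<eta>
    using asymp_unit[OF k(1,2) that] eventually_gt_at_top[of 0]
  proof eventually_elim
    case (elim r)
    from elim(1) have "f (of_real r * cis \<theta>) \<noteq> 0 \<and> \<bar>ln (norm (f (of_real r * cis \<theta>))) - r\<^sup>2 * stokes_indicator (cis \<theta>)\<bar> \<le> r\<^sup>2 * \<eta>"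
      using k(3) by auto
    moreover have "ln (cmod (f (of_real r * cis \<theta>))) / r powr 2 - h = (ln (norm (f (of_real r * cis \<theta>))) - r\<^sup>2 * stokes_indicator (cis \<theta>)) / r\<^sup>2"
      using elim(2) by (simp add: h diff_divide_distrib)
    ultimately show ?case using elim(2) by (simp add: abs_divide divide_le_eq mult.commute)
  qed
  have "((\<lambda>r. ln (cmod (f (of_real r * cis \<theta>))) / r powr 2) \<longlongrightarrow> h) at_top"
  proof (rule tendstoI)
    fix e :: real assume "e > 0"
    then have "\<forall>\<^sub>F r in at_top. f (of_real r * cis \<theta>) \<noteq> 0 \<and> \<bar>ln (cmod (f (of_real r * cis \<theta>))) / r powr 2 - h\<bar> \<le> e / 2"
      by (intro ev) auto
    then show "\<forall>\<^sub>F r in at_top. dist (ln (cmod (f (of_real r * cis \<theta>))) / r powr 2) h < e"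
      by eventually_elim (use \<open>e > 0\<close> in \<open>auto simp: dist_real_def\<close>)
  qed
  then have "((\<lambda>r. ereal (ln (cmod (f (of_real r * cis \<theta>))) / r powr 2)) \<longlongrightarrow> ereal h) at_top" by simp
  then have "(F \<longlongrightarrow> ereal h) at_top"
    by (rule Lim_transform_eventually) (use ev[of 1] in \<open>auto simp: F_def elim!: eventually_mono\<close>)
  then have "Limsup at_top F = ereal h" by (intro lim_imp_Limsup) auto
  then show ?thesis by (simp add: pl_indicator_def F_def h_def)
qed

text \<open>A negative upper limit would mean Gaussian smallness on the whole ray from some radius
  on, which contradicts \<open>nowhere_small\<close> even for the two boundary rays.\<close>

lemma pl_indicator_left:
  assumes "3 / 4 * pi \<le> \<bar>\<theta>\<bar>" "\<bar>\<theta>\<bar> \<le> pi"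
  shows "pl_indicator 2 f \<theta> = 0"
proof -
  define F where "F = (\<lambda>r. if f (of_real r * cis \<theta>) = 0 then - \<infinity> else ereal (ln (cmod (f (of_real r * cis \<theta>))) / r powr 2))"
  have arc: "cos \<theta> + \<bar>sin \<theta>\<bar> \<le> 0"
    using left_arc[of "\<bar>\<theta>\<bar>"] assms by (simp add: abs_if split: if_splits)
  have h: "stokes_indicator (cis \<theta>) = 0" using arc by (intro stokes_indicator_left) auto
  have "Limsup at_top F \<le> 0"
  proof (rule ereal_le_epsilon2)
    fix e :: real assume e: "e > 0"
    have "\<forall>\<^sub>F r in at_top. F r \<le> ereal e"
      using upper_unit[OF e] eventually_gt_at_top[of 0]
    proof eventually_elim
      case (elim r)
      then show ?case using elim(1)[rule_format, of "cis \<theta>"] by (auto simp: F_def h divide_le_eq mult.commute)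
    qed
    then have "Limsup at_top F \<le> ereal e" by (rule Limsup_bounded)
    then show "Limsup at_top F \<le> 0 + ereal e" by simp
  qed
  moreover have "Limsup at_top F \<ge> 0"
  proof (rule ccontr)
    assume "\<not> Limsup at_top F \<ge> 0"
    then have "Limsup at_top F < 0" by simp
    then obtain x where x: "Limsup at_top F < ereal x" "ereal x < 0" using ereal_dense2 by blast
    then have "x < 0" by simp
    have "\<forall>\<^sub>F r in at_top. F r < ereal x" using x(1) by (rule Limsup_lessD)
    then have "\<forall>\<^sub>F r in at_top. norm (f (of_real r * cis \<theta>)) \<le> exp (- (- x) * r\<^sup>2)"
      using eventually_gt_at_top[of 0]
    proof eventually_elim
      case (elim r)
      show ?case
      proof (cases "f (of_real r * cis \<theta>) = 0")
        case False
        then have "ln (cmod (f (of_real r * cis \<theta>))) < x * r\<^sup>2" using elim by (simp add: F_def divide_less_eq)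
        then have "exp (ln (cmod (f (of_real r * cis \<theta>)))) < exp (x * r\<^sup>2)" by (subst exp_less_cancel_iff)
        then show ?thesis using False by simp
      qed simp
    qed
    then have "\<not> nowhere_small f"
      using arc \<open>x < 0\<close> by (intro small_on_ray_imp_not_nowhere_small[OF holo upper_left C, of "cis \<theta>" "- x"]) auto
    then show False using nowhere by simp
  qed
  ultimately show ?thesis by (simp add: pl_indicator_def F_def)
qed

section \<open>Nevanlinna characteristic and the mean of the logarithm over circles\<close>

lemma continuous_on_circle: "continuous_on A (\<lambda>\<theta>. f (of_real r * cis \<theta>))"
proof -
  have "continuous_on UNIV f" using holo by (rule holomorphic_on_imp_continuous_on)
  then show ?thesis by (rule continuous_on_compose2) (auto intro!: continuous_intros)
qed

lemma integrable_log_circle: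
  assumes "\<And>z. norm z = r \<Longrightarrow> f z \<noteq> 0" "r > 0"
  shows "continuous_on A (\<lambda>\<theta>. ln (norm (f (of_real r * cis \<theta>))))"
proof (intro continuous_on_ln continuous_on_norm continuous_on_circle ballI)
  fix \<theta> show "norm (f (of_real r * cis \<theta>)) \<noteq> 0" using assms(1)[of "of_real r * cis \<theta>"] assms(2) by (simp add: norm_mult)
qed

lemma nev_characteristic_asymp: "(\<lambda>r. nev_characteristic r f) \<sim>[at_top] (\<lambda>r. 1 / (2 * pi) * r ^ 2)"
proof (rule asymp_equivI')
  have prox: "nev_characteristic r f = 1 / (2 * pi) * integral {0..2 * pi} (\<lambda>\<theta>. ln (max 1 (cmod (f (of_real r * cis \<theta>)))))" for r
  proof -
    have "\<not> is_pole f z" for z using not_is_pole_holomorphic[OF open_UNIV UNIV_I holo] .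
    then have "nev_pole_count t f = 0" for t by (simp add: nev_pole_count_def)
    then show ?thesis by (simp add: nev_characteristic_def nev_proximity_def nev_counting_def)
  qed
  show "((\<lambda>r. nev_characteristic r f / (1 / (2 * pi) * r ^ 2)) \<longlongrightarrow> 1) at_top"
  proof (rule tendstoI)
    fix e :: real assume e: "e > 0"
    define \<eta> where "\<eta> = min (e / (4 * pi)) (1 / 2)"
    have \<eta>: "\<eta> > 0" "\<eta> < 1" using e by (auto simp: \<eta>_def)
    have \<eta>e: "2 * pi * \<eta> < e"
    proof -
      have "\<eta> \<le> e / (4 * pi)" unfolding \<eta>_def by (rule min.cobounded1)
      then have "2 * pi * \<eta> \<le> 2 * pi * (e / (4 * pi))" by (intro mult_left_mono) auto
      also have "\<dots> < e" using e by simp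
      finally show ?thesis .
    qed
    \<comment> \<open>The directions left over between slope \<open>k\<close> and the boundary rays,
      as well as those of the left sector, have indicator at most \<open>\<eta>\<close>, so they
      need no lower bound for \<open>f\<close>.\<close>
    define k where "k = 1 - \<eta>"
    have k: "0 < k" "k < 1" using \<eta> by (auto simp: k_def)
    show "\<forall>\<^sub>F r in at_top. dist (nev_characteristic r f / (1 / (2 * pi) * r ^ 2)) 1 < e"
      using upper_unit[OF \<eta>(1)] asymp_unit[OF k \<eta>(1)] eventually_gt_at_top[of 0]
    proof eventually_elim
      case (elim r)
      define g where "g = (\<lambda>\<theta>. ln (max 1 (cmod (f (of_real r * cis \<theta>)))))"
      define h where "h = (\<lambda>\<theta>. max 0 (stokes_indicator (cis \<theta>)))"
      have bnd: "\<bar>g \<theta> - r\<^sup>2 * h \<theta>\<bar> \<le> r\<^sup>2 * \<eta>" for \<theta>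
      proof -
        define w where "w = cis \<theta>"
        have w: "norm w = 1" by (simp add: w_def)
        have g0: "g \<theta> \<ge> 0" by (simp add: g_def)
        have h0: "h \<theta> \<ge> 0" "h \<theta> \<ge> stokes_indicator w" by (auto simp: h_def w_def)
        have up: "g \<theta> \<le> r\<^sup>2 * (h \<theta> + \<eta>)"
        proof (cases "cmod (f (of_real r * w)) \<le> 1")
          case True
          then show ?thesis using h0 \<eta> by (simp add: g_def w_def)
        next
          case False
          then have "f (of_real r * w) \<noteq> 0" by auto
          then have "ln (norm (f (of_real r * w))) \<le> r\<^sup>2 * (stokes_indicator w + \<eta>)" using elim(1) w by blast
          also have "\<dots> \<le> r\<^sup>2 * (h \<theta> + \<eta>)" using h0 by (intro mult_left_mono) auto
          finally show ?thesis using False by (simp add: g_def w_def max_def)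
        qed
        moreover have "g \<theta> \<ge> r\<^sup>2 * (h \<theta> - \<eta>)"
        proof (cases "Re w > - k * \<bar>Im w\<bar>")
          case True
          then have l: "f (of_real r * w) \<noteq> 0" "\<bar>ln (norm (f (of_real r * w))) - r\<^sup>2 * stokes_indicator w\<bar> \<le> r\<^sup>2 * \<eta>"
            using elim(2) w by auto
          have "ln (norm (f (of_real r * w))) \<le> g \<theta>" unfolding g_def w_def[symmetric] using l(1) by (subst ln_le_cancel_iff) auto
          then have "r\<^sup>2 * (stokes_indicator w - \<eta>) \<le> g \<theta>" using l(2) unfolding right_diff_distrib by linarith
          moreover have "r\<^sup>2 * (0 - \<eta>) \<le> g \<theta>" using g0 \<eta> by (smt (verit) mult_nonneg_nonpos zero_le_power2)
          ultimately show ?thesis unfolding h_def w_def[symmetric] max_def by auto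
        next
          case False
          have i1: "\<bar>Im w\<bar> \<le> 1" using abs_Im_le_cmod[of w] w by simp
          have r1: "\<bar>Re w\<bar> \<le> 1" using abs_Re_le_cmod[of w] w by simp
          have "\<eta> * \<bar>Im w\<bar> \<le> \<eta> * 1" using i1 \<eta> by (intro mult_left_mono) auto
          moreover have "Re w + \<bar>Im w\<bar> \<le> \<eta> * \<bar>Im w\<bar>" using False by (simp add: k_def algebra_simps)
          ultimately have p: "max 0 (Re w + \<bar>Im w\<bar>) \<le> \<eta>" using \<eta> by (intro max.boundedI) linarith+
          have q: "\<bar>Im w\<bar> - Re w \<le> 2" using i1 r1 by linarith
          have "max 0 (Re w + \<bar>Im w\<bar>) * (\<bar>Im w\<bar> - Re w) \<le> max 0 (Re w + \<bar>Im w\<bar>) * 2" using q by (intro mult_left_mono) auto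
          also have "\<dots> \<le> \<eta> * 2" using p by (intro mult_right_mono) auto
          finally have "stokes_indicator w \<le> \<eta>" by (simp add: stokes_indicator_def)
          then have "h \<theta> \<le> \<eta>" using \<eta> by (simp add: h_def w_def)
          then have "r\<^sup>2 * (h \<theta> - \<eta>) \<le> 0" by (intro mult_nonneg_nonpos) auto
          then show ?thesis using g0 by linarith
        qed
        ultimately show ?thesis by (simp add: abs_le_iff algebra_simps)
      qed
      have "continuous_on {0..2*pi} g"
        unfolding g_def by (intro continuous_on_ln continuous_on_max continuous_on_norm continuous_on_circle continuous_intros) (auto simp: max_def)
      then have gi: "(g has_integral integral {0..2*pi} g) {0..2*pi}" by (intro integrable_integral integrable_continuous_interval)
      have hi: "((\<lambda>\<theta>. r\<^sup>2 * h \<theta>) has_integral r\<^sup>2 * 1) {0..2*pi}"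
        unfolding h_def by (intro has_integral_mult_right has_integral_max_stokes_indicator)
      have di: "((\<lambda>\<theta>. g \<theta> - r\<^sup>2 * h \<theta>) has_integral (integral {0..2*pi} g - r\<^sup>2 * 1)) {0..2*pi}"
        by (rule has_integral_diff[OF gi hi])
      have "norm (integral {0..2*pi} g - r\<^sup>2 * 1) \<le> (r\<^sup>2 * \<eta>) * measure lborel {0..2*pi}"
        by (rule has_integral_bound_real[OF _ _ di, where S = "{}"]) (use bnd \<eta> in auto)
      then have "\<bar>integral {0..2*pi} g - r\<^sup>2\<bar> \<le> r\<^sup>2 * (2 * pi * \<eta>)" by (simp add: mult_ac)
      then have "\<bar>(integral {0..2*pi} g - r\<^sup>2) / r\<^sup>2\<bar> \<le> 2 * pi * \<eta>" using elim(3) by (simp add: abs_divide divide_le_eq mult.commute)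
      moreover have "nev_characteristic r f / (1 / (2 * pi) * r ^ 2) - 1 = (integral {0..2*pi} g - r\<^sup>2) / r\<^sup>2"
        using elim(3) unfolding prox g_def[symmetric] by (simp add: field_simps)
      ultimately show ?case using \<eta>e by (simp add: dist_real_def)
    qed
  qed
qed

text \<open>Near each \<open>\<xi>\<close> of a \<open>\<tau>\<close>-net of the left arc there is a point where \<open>f\<close> is not small.
  The Poisson kernel at this point is of size \<open>1/\<tau>\<close> near \<open>\<xi>\<close>, so it transfers the lower bound
  to the mean of \<open>ln \<bar>f\<bar>\<close> over that part of the circle.\<close>

lemma poisson_defect:
  assumes \<tau>: "0 < \<tau>" "\<tau> \<le> 1" and \<eta>: "\<eta> > 0" and r: "r > 0"
    and \<xi>: "norm \<xi> = 1" "\<bar>Im \<xi>\<bar> \<le> - Re \<xi>"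
    and w: "w \<in> ball ((1 - of_real \<tau> / 2) * \<xi> - of_real \<tau> / 8) (\<tau> / 32)" "norm (f (of_real r * w)) > exp (- \<eta> * r\<^sup>2)"
    and nz: "\<And>z. norm z = r \<Longrightarrow> f z \<noteq> 0"
    and up: "\<And>u. norm u = 1 \<Longrightarrow> ln (norm (f (of_real r * u))) \<le> r\<^sup>2 * (stokes_indicator u + \<eta>)"
  obtains g I where "(g has_integral I) {0..2 * pi}" "I \<le> 2 * pi * r\<^sup>2 * (2 * sqrt (2 * \<tau>) + 2 * \<tau> + 2 * \<eta>)"
    "\<And>\<theta>. g \<theta> \<ge> 0"
    "\<And>\<theta>. dist (cis \<theta>) \<xi> < \<tau> \<Longrightarrow> r\<^sup>2 * (stokes_indicator (cis \<theta>) + \<eta>) - ln (norm (f (of_real r * cis \<theta>))) \<le> 16 * \<tau> * g \<theta>"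
proof -
  \<comment> \<open>The factor moves \<open>\<xi>\<close> into the disc, so that \<open>w\<close>
    has distance of order \<open>\<tau>\<close> both from \<open>\<xi>\<close> and from the circle;
    the shift by \<open>\<tau> / 8\<close> moves it away from the boundary of the sector.\<close>
  define c where "c = (1 - of_real \<tau> / 2) * \<xi> - of_real \<tau> / 8"
  have wc: "norm (w - c) < \<tau> / 32" using w(1) by (simp add: c_def dist_norm norm_minus_commute)
  have cx: "norm (c - \<xi>) \<le> 5 / 8 * \<tau>"
  proof -
    have "c - \<xi> = - (of_real \<tau> / 2 * \<xi> + of_real \<tau> / 8)" by (simp add: c_def algebra_simps)
    then have "norm (c - \<xi>) \<le> norm (of_real \<tau> / 2 * \<xi>) + norm (of_real \<tau> / 8 :: complex)"
      by (simp only: norm_minus_cancel norm_triangle_ineq)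
    also have "\<dots> = 5 / 8 * \<tau>" using \<tau> \<xi> by (simp add: norm_mult norm_divide)
    finally show ?thesis .
  qed
  have wx: "norm (w - \<xi>) < \<tau>" using norm_triangle_ineq[of "w - c" "c - \<xi>"] wc cx \<tau> by simp
  have cn: "norm c \<le> 1 - 3 / 8 * \<tau>"
  proof -
    have "norm c \<le> norm ((1 - of_real \<tau> / 2) * \<xi>) + norm (of_real \<tau> / 8 :: complex)"
      unfolding c_def by (rule norm_triangle_ineq4)
    also have "1 - complex_of_real \<tau> / 2 = of_real (1 - \<tau> / 2)" by simp
    also have "norm (of_real (1 - \<tau> / 2) * \<xi>) = 1 - \<tau> / 2" using \<tau> \<xi> by (simp only: norm_mult norm_of_real) simp
    also have "1 - \<tau> / 2 + norm (of_real \<tau> / 8 :: complex) = 1 - 3 / 8 * \<tau>" using \<tau> by (simp add: norm_divide)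
    finally show ?thesis .
  qed
  have wn: "norm w \<le> 1 - \<tau> / 4" using norm_triangle_ineq[of "w - c" c] wc cn \<tau> by simp
  have w1: "norm w < 1" using wn \<tau> by simp
  have w2: "1 - norm w < \<tau>" using norm_triangle_ineq2[of \<xi> w] wx \<xi> by (simp add: norm_minus_commute)
  define q where "q = 1 - (norm w)\<^sup>2"
  have q: "q = (1 - norm w) * (1 + norm w)" by (simp add: q_def power2_eq_square algebra_simps)
  have q1: "q \<ge> \<tau> / 4"
  proof -
    have "(1 - norm w) * 1 \<le> q" unfolding q using w1 by (intro mult_left_mono) auto
    then show ?thesis using wn by simp
  qed
  have q2: "q \<le> 2 * \<tau>"
  proof -
    have "q \<le> (1 - norm w) * 2" unfolding q using w1 by (intro mult_left_mono) auto
    then show ?thesis using w2 by simp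
  qed
  have q0: "q > 0" using q1 \<tau> by linarith
  have cw: "cis \<theta> - w \<noteq> 0" for \<theta> using w1 by auto
  define K where "K = (\<lambda>\<theta>. q / (norm (cis \<theta> - w))\<^sup>2)"
  have K0: "K \<theta> \<ge> 0" for \<theta> using q0 by (simp add: K_def)
  have Kc: "continuous_on A K" for A
    unfolding K_def using cw by (intro continuous_intros) auto
  have Keq: "(r\<^sup>2 - (norm (of_real r * w))\<^sup>2) / (norm (of_real r * cis \<theta> - of_real r * w))\<^sup>2 = K \<theta>" for \<theta>
  proof -
    have "norm (of_real r * cis \<theta> - of_real r * w) = r * norm (cis \<theta> - w)"
      using r by (simp add: norm_mult flip: right_diff_distrib)
    moreover have "r\<^sup>2 - (norm (of_real r * w))\<^sup>2 = r\<^sup>2 * q" using r by (simp add: norm_mult q_def power_mult_distrib algebra_simps)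
    ultimately show ?thesis using r by (simp add: K_def power_mult_distrib)
  qed
  have int1: "(K has_integral 2 * pi) {0..2 * pi}"
    using poisson_formula[of "\<lambda>_. 1" 1 w] w1 by (simp add: K_def q_def)
  define u where "u = (\<lambda>\<theta>. ln (norm (f (of_real r * cis \<theta>))))"
  have fw: "f (of_real r * w) \<noteq> 0" using w(2) by (smt (verit) exp_gt_zero norm_zero)
  have "norm (of_real r * w) < r" using w1 r by (simp add: norm_mult)
  from poisson_jensen_inequality[OF holo fw this nz]
  obtain J where J: "((\<lambda>\<theta>. K \<theta> * u \<theta>) has_integral J) {0..2 * pi}" "2 * pi * ln (norm (f (of_real r * w))) \<le> J"
    unfolding Keq u_def by blast
  have "ln (exp (- \<eta> * r\<^sup>2)) \<le> ln (norm (f (of_real r * w)))" using w(2) fw by (subst ln_le_cancel_iff) auto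
  then have "2 * pi * (- \<eta> * r\<^sup>2) \<le> 2 * pi * ln (norm (f (of_real r * w)))" by (intro mult_left_mono) auto
  then have Jl: "J \<ge> - (2 * pi * \<eta> * r\<^sup>2)" using J(2) by simp
  \<comment> \<open>The linear growth \<open>2 * x\<close> of the indicator is split as
    \<open>x\<^sup>2 / \<sigma> + \<sigma>\<close>. Since
    \<open>K \<theta> * x\<^sup>2 = q \<le> 2 * \<tau>\<close>, this \<open>\<sigma>\<close>
    balances the two contributions to the integral.\<close>
  define \<sigma> where "\<sigma> = sqrt (2 * \<tau>)"
  have \<sigma>: "\<sigma> > 0" "\<sigma>\<^sup>2 = 2 * \<tau>" using \<tau> by (auto simp: \<sigma>_def)
  define B where "B = (\<lambda>\<theta>. (2 * \<tau> / \<sigma> + (\<sigma> + 2 * \<tau> + \<eta>) * K \<theta>))"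
  have KB: "K \<theta> * (stokes_indicator (cis \<theta>) + \<eta>) \<le> B \<theta>" for \<theta>
  proof -
    define x where "x = norm (cis \<theta> - w)"
    have "stokes_indicator (cis \<theta>) \<le> 2 * norm (cis \<theta> - \<xi>)"
      by (rule stokes_indicator_near_left) (use \<xi> in auto)
    also have "norm (cis \<theta> - \<xi>) \<le> x + \<tau>" using norm_triangle_ineq[of "cis \<theta> - w" "w - \<xi>"] wx by (simp add: x_def)
    also have "2 * (x + \<tau>) \<le> x\<^sup>2 / \<sigma> + \<sigma> + 2 * \<tau>"
    proof -
      have "0 \<le> (x - \<sigma>)\<^sup>2 / \<sigma>" using \<sigma> by simp
      also have "\<dots> = x\<^sup>2 / \<sigma> + \<sigma> - 2 * x" using \<sigma>(1) by (simp add: power2_eq_square field_simps)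
      finally show ?thesis by simp
    qed
    finally have "K \<theta> * (stokes_indicator (cis \<theta>) + \<eta>) \<le> K \<theta> * (x\<^sup>2 / \<sigma> + \<sigma> + 2 * \<tau> + \<eta>)"
      using K0 by (intro mult_left_mono) auto
    also have "\<dots> = K \<theta> * x\<^sup>2 / \<sigma> + (\<sigma> + 2 * \<tau> + \<eta>) * K \<theta>" by (simp add: algebra_simps)
    also have "K \<theta> * x\<^sup>2 = q" using cw[of \<theta>] by (simp add: K_def x_def)
    also have "q / \<sigma> \<le> 2 * \<tau> / \<sigma>" using q2 \<sigma> by (intro divide_right_mono) auto
    finally show ?thesis by (simp add: B_def)
  qed
  have Bi: "(B has_integral (2 * pi * (2 * \<sigma> + 2 * \<tau> + \<eta>))) {0..2 * pi}"
  proof -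
    have "((\<lambda>\<theta>. 2 * \<tau> / \<sigma>) has_integral (2 * pi) * (2 * \<tau> / \<sigma>)) {0..2 * pi}"
      using has_integral_const_real[of "2 * \<tau> / \<sigma>" 0 "2 * pi"] by simp
    from has_integral_add[OF this has_integral_mult_right[OF int1, of "\<sigma> + 2 * \<tau> + \<eta>"]]
    have "(B has_integral (2 * pi * (2 * \<tau> / \<sigma>) + (\<sigma> + 2 * \<tau> + \<eta>) * (2 * pi))) {0..2 * pi}" by (simp add: B_def)
    moreover have eq: "2 * \<tau> / \<sigma> = \<sigma>" using \<sigma> by (simp add: power2_eq_square field_simps)
    moreover have "2 * pi * \<sigma> + (\<sigma> + 2 * \<tau> + \<eta>) * (2 * pi) = 2 * pi * (2 * \<sigma> + 2 * \<tau> + \<eta>)" by (simp add: algebra_simps)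
    ultimately show ?thesis by (simp only: eq)
  qed
  define g where "g = (\<lambda>\<theta>. K \<theta> * (r\<^sup>2 * (stokes_indicator (cis \<theta>) + \<eta>) - u \<theta>))"
  have Si: "((\<lambda>\<theta>. K \<theta> * (stokes_indicator (cis \<theta>) + \<eta>)) has_integral integral {0..2*pi} (\<lambda>\<theta>. K \<theta> * (stokes_indicator (cis \<theta>) + \<eta>))) {0..2*pi}"
    by (intro integrable_integral integrable_continuous_interval continuous_intros Kc) 
  have Sl: "integral {0..2*pi} (\<lambda>\<theta>. K \<theta> * (stokes_indicator (cis \<theta>) + \<eta>)) \<le> 2 * pi * (2 * \<sigma> + 2 * \<tau> + \<eta>)"
    by (rule has_integral_le[OF Si Bi]) (use KB in auto)
  have gi: "(g has_integral (r\<^sup>2 * integral {0..2*pi} (\<lambda>\<theta>. K \<theta> * (stokes_indicator (cis \<theta>) + \<eta>)) - J)) {0..2*pi}"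
    using has_integral_diff[OF has_integral_mult_right[OF Si, of "r\<^sup>2"] J(1)]
    by (simp add: g_def algebra_simps)
  show thesis
  proof (rule that[OF gi])
    have "r\<^sup>2 * integral {0..2*pi} (\<lambda>\<theta>. K \<theta> * (stokes_indicator (cis \<theta>) + \<eta>)) \<le> r\<^sup>2 * (2 * pi * (2 * \<sigma> + 2 * \<tau> + \<eta>))"
      using Sl by (intro mult_left_mono) auto
    then show "r\<^sup>2 * integral {0..2*pi} (\<lambda>\<theta>. K \<theta> * (stokes_indicator (cis \<theta>) + \<eta>)) - J \<le> 2 * pi * r\<^sup>2 * (2 * sqrt (2 * \<tau>) + 2 * \<tau> + 2 * \<eta>)"
      using Jl unfolding \<sigma>_def[symmetric] by (simp add: algebra_simps)
    fix \<theta>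
    have v0: "r\<^sup>2 * (stokes_indicator (cis \<theta>) + \<eta>) - u \<theta> \<ge> 0" using up[of "cis \<theta>"] by (simp add: u_def)
    then show "g \<theta> \<ge> 0" unfolding g_def using K0 by (intro mult_nonneg_nonneg)
    assume "dist (cis \<theta>) \<xi> < \<tau>"
    \<comment> \<open>At distance at most \<open>2 * \<tau>\<close> from \<open>w\<close> the kernel
      is at least \<open>(\<tau> / 4) / (2 * \<tau>)\<^sup>2 = 1 / (16 * \<tau>)\<close>.\<close>
    then have "norm (cis \<theta> - w) \<le> 2 * \<tau>"
      using norm_triangle_ineq[of "cis \<theta> - \<xi>" "\<xi> - w"] wx by (simp add: dist_norm norm_minus_commute)
    then have "(norm (cis \<theta> - w))\<^sup>2 \<le> (2 * \<tau>)\<^sup>2" by (intro power_mono) auto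
    also have "\<dots> = 16 * \<tau> * (\<tau> / 4)" by (simp add: power2_eq_square)
    also have "\<dots> \<le> 16 * \<tau> * q" using q1 \<tau> by (intro mult_left_mono) auto
    finally have "1 \<le> 16 * \<tau> * K \<theta>" using cw[of \<theta>] by (simp add: K_def field_simps)
    from mult_right_mono[OF this v0]
    show "r\<^sup>2 * (stokes_indicator (cis \<theta>) + \<eta>) - ln (norm (f (of_real r * cis \<theta>))) \<le> 16 * \<tau> * g \<theta>"
      by (simp add: g_def u_def mult.assoc)
  qed
qed

end

lemma norm_cis_diff_le: "norm (cis a - cis b) \<le> \<bar>a - b\<bar>"
proof -
  have "cis a - cis b = cis b * (exp (\<i> * of_real (a - b)) - 1)"
    unfolding cis_conv_exp[symmetric] by (simp add: cis_mult right_diff_distrib)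
  then have "norm (cis a - cis b) = 2 * \<bar>sin ((a - b) / 2)\<bar>"
    by (simp only: norm_mult norm_cis dist_exp_i_1 mult_1)
  also have "\<dots> \<le> 2 * \<bar>(a - b) / 2\<bar>" by (intro mult_left_mono abs_sin_x_le_abs_x) auto
  finally show ?thesis by simp
qed

context stokes_function
begin

text \<open>The shift by \<open>\<tau> / 8\<close> gives the centre that much room between
  \<open>\<bar>Im c\<bar>\<close> and \<open>- Re c\<close>, also for \<open>\<xi>\<close> on a
  boundary ray; the ball of radius \<open>\<tau> / 32\<close> fits in.\<close>

lemma left_net_points:
  assumes \<tau>: "0 < \<tau>" "\<tau> \<le> 1" and \<xi>: "norm \<xi> = 1" "\<bar>Im \<xi>\<bar> \<le> - Re \<xi>" and \<eta>: "\<eta> > 0"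
  shows "\<forall>\<^sub>F r in at_top. \<exists>w\<in>ball ((1 - of_real \<tau> / 2) * \<xi> - of_real \<tau> / 8) (\<tau> / 32). norm (f (of_real r * w)) > exp (- \<eta> * r\<^sup>2)"
proof -
  define c where "c = (1 - of_real \<tau> / 2) * \<xi> - of_real \<tau> / 8"
  have "ball c (\<tau> / 32) \<subseteq> left_sector"
  proof
    fix w assume "w \<in> ball c (\<tau> / 32)"
    then have d: "norm (w - c) < \<tau> / 32" by (simp add: dist_norm norm_minus_commute)
    have 1: "\<bar>Re w - Re c\<bar> < \<tau> / 32" "\<bar>Im w - Im c\<bar> < \<tau> / 32"
      using abs_Re_le_cmod[of "w - c"] abs_Im_le_cmod[of "w - c"] d by auto
    have c: "Re c = (1 - \<tau> / 2) * Re \<xi> - \<tau> / 8" "Im c = (1 - \<tau> / 2) * Im \<xi>" by (simp_all add: c_def)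
    have "(1 - \<tau> / 2) * \<bar>Im \<xi>\<bar> \<le> (1 - \<tau> / 2) * (- Re \<xi>)" using \<tau> \<xi> by (intro mult_left_mono) auto
    moreover have "\<bar>Im c\<bar> = (1 - \<tau> / 2) * \<bar>Im \<xi>\<bar>" using \<tau> by (simp add: c abs_mult)
    ultimately have "\<bar>Im c\<bar> \<le> - Re c - \<tau> / 8" using c by simp
    then show "w \<in> left_sector" using 1 \<tau> unfolding left_sector_def mem_Collect_eq by arith
  qed
  then show ?thesis using nowhere \<tau> \<eta> by (auto simp: nowhere_small_def c_def)
qed

text \<open>The defect \<open>V\<close> between upper bound and \<open>ln \<bar>f\<bar>\<close> is
  non-negative, so it is enough to bound its integral. Outside the left arc the asymptotics do so,
  and on the arc the weighted integrals of \<open>poisson_defect\<close> are summed over a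
  net.\<close>

lemma log_mean_asymp:
  assumes e: "e > 0"
  shows "\<forall>\<^sub>F r in at_top. (\<forall>z. norm z = r \<longrightarrow> f z \<noteq> 0) \<longrightarrow>
     \<bar>integral {0..2 * pi} (\<lambda>\<theta>. ln (norm (f (of_real r * cis \<theta>)))) - r\<^sup>2 / 2\<bar> \<le> e * r\<^sup>2"
proof -
  \<comment> \<open>The total error per \<open>r\<^sup>2\<close>, with 64 pi^2 arising from the
    factor 16 \<open>\<tau>\<close>, the integrals over 2 pi and
    \<open>\<tau> * (M + 1) \<le> 2 * pi\<close>. It tends to 0 with \<open>\<tau>\<close> when
    \<open>\<eta> = \<tau>\<close>.\<close>
  define P where "P = (\<lambda>\<tau> \<eta>. 64 * pi\<^sup>2 * (2 * sqrt (2 * \<tau>) + 2 * \<tau> + 2 * \<eta>) + 4 * pi * \<eta>)"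
  have "((\<lambda>\<tau>. P \<tau> \<tau>) \<longlongrightarrow> 0) (at_right 0)" unfolding P_def by (auto intro!: tendsto_eq_intros)
  then have "\<forall>\<^sub>F \<tau> in at_right 0. P \<tau> \<tau> < e" using e by (auto dest: order_tendstoD)
  then obtain b where b: "b > 0" "\<And>\<tau>. 0 < \<tau> \<Longrightarrow> \<tau> < b \<Longrightarrow> P \<tau> \<tau> < e"
    unfolding eventually_at_right_field by auto
  define m where "m = min b 1"
  \<comment> \<open>With \<open>\<tau> = pi / M\<close> and step
    \<open>\<alpha> = \<tau> / 2\<close>, exactly \<open>M\<close> steps cover the left arc of
    length pi/2, so the first and the last point of the net lie on the boundary rays.\<close>
  obtain M :: nat where M: "pi / m < real M" using reals_Archimedean2 by blast
  have mb: "m > 0" using b by (simp add: m_def)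
  then have M0: "real M > 0" using M by (meson divide_pos_pos less_trans pi_gt_zero)
  define \<tau> where "\<tau> = pi / real M"
  define \<eta> where "\<eta> = \<tau>"
  have "\<tau> < m" using M M0 mb by (simp add: \<tau>_def field_simps)
  then have \<tau>: "0 < \<tau>" "\<tau> \<le> 1" "\<tau> < b" using M0 by (auto simp: \<tau>_def m_def)
  have \<eta>: "\<eta> > 0" using \<tau> by (simp add: \<eta>_def)
  have Pe: "P \<tau> \<eta> < e" unfolding \<eta>_def using b(2) \<tau> by auto
  define \<alpha> where "\<alpha> = \<tau> / 2"
  have \<alpha>: "0 < \<alpha>" "\<alpha> < pi / 4" using \<tau> pi_gt3 by (auto simp: \<alpha>_def)
  obtain k where k: "0 < k" "k < 1" "\<And>\<theta>. \<bar>\<theta>\<bar> < 3 / 4 * pi - \<alpha> \<Longrightarrow> cos \<theta> > - k * \<bar>sin \<theta>\<bar>"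
    using sector_slope[OF \<alpha>] by blast
  define \<xi> where "\<xi> = (\<lambda>j::nat. cis (3 / 4 * pi + real j * \<alpha>))"
  have M\<alpha>: "real M * \<alpha> = pi / 2" using M0 by (simp add: \<alpha>_def \<tau>_def)
  have \<xi>: "norm (\<xi> j) = 1" "\<bar>Im (\<xi> j)\<bar> \<le> - Re (\<xi> j)" if "j \<le> M" for j
  proof -
    have "real j * \<alpha> \<le> real M * \<alpha>" using that \<alpha> by (intro mult_right_mono) auto
    then have "cos (3 / 4 * pi + real j * \<alpha>) + \<bar>sin (3 / 4 * pi + real j * \<alpha>)\<bar> \<le> 0"
      using M\<alpha> mult_nonneg_nonneg[of "real j" \<alpha>] \<alpha> by (intro left_arc) linarith+
    then show "norm (\<xi> j) = 1" "\<bar>Im (\<xi> j)\<bar> \<le> - Re (\<xi> j)" by (auto simp: \<xi>_def)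
  qed
  \<comment> \<open>The end points of the net also take care of the gaps of width
    \<open>\<alpha>\<close> between the left arc and the region of the asymptotics.\<close>
  have cover: "Re (cis \<theta>) > - k * \<bar>Im (cis \<theta>)\<bar> \<or> (\<exists>j\<le>M. dist (cis \<theta>) (\<xi> j) < \<tau>)" if \<theta>: "0 \<le> \<theta>" "\<theta> \<le> 2 * pi" for \<theta>
  proof -
    consider "\<theta> < 3 / 4 * pi - \<alpha>" | "3 / 4 * pi - \<alpha> \<le> \<theta>" "\<theta> < 3 / 4 * pi"
      | "3 / 4 * pi \<le> \<theta>" "\<theta> \<le> 5 / 4 * pi + \<alpha>" | "\<theta> > 5 / 4 * pi + \<alpha>" by linarith
    then show ?thesis
    proof cases
      case 1
      then have "cos \<theta> > - k * \<bar>sin \<theta>\<bar>" using \<theta> by (intro k) auto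
      then show ?thesis by simp
    next
      case 4
      then have "cos (\<theta> - 2 * pi) > - k * \<bar>sin (\<theta> - 2 * pi)\<bar>" using \<theta> by (intro k abs_less_iff[THEN iffD2]) auto
      moreover have "cis (\<theta> - 2 * pi) = cis \<theta>" by (simp flip: cis_divide)
      then have "cos (\<theta> - 2 * pi) = cos \<theta>" "sin (\<theta> - 2 * pi) = sin \<theta>" by (simp_all add: complex_eq_iff)
      ultimately show ?thesis by simp
    next
      case 2
      have "dist (cis \<theta>) (\<xi> 0) \<le> \<bar>\<theta> - 3 / 4 * pi\<bar>" unfolding \<xi>_def dist_norm using norm_cis_diff_le[of \<theta> "3 / 4 * pi"] by simp
      also have "\<dots> < \<tau>" using 2 \<tau> by (auto simp: \<alpha>_def abs_less_iff)
      finally show ?thesis by blast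
    next
      case 3
      define j where "j = min M (nat \<lfloor>(\<theta> - 3 / 4 * pi) / \<alpha>\<rfloor>)"
      define x where "x = (\<theta> - 3 / 4 * pi) / \<alpha>"
      have x: "x \<ge> 0" "x * \<alpha> = \<theta> - 3 / 4 * pi" using 3 \<alpha> by (auto simp: x_def)
      have "x * \<alpha> \<le> (real M + 1) * \<alpha>" using 3 M\<alpha> x by (simp add: algebra_simps)
      then have xM: "x \<le> real M + 1" using \<alpha> by simp
      have "real j \<le> x" "x \<le> real j + 1"
        unfolding j_def x_def[symmetric] using x(1) xM by (auto simp: min_def) linarith+
      then have "\<bar>(x - real j) * \<alpha>\<bar> \<le> 1 * \<alpha>" unfolding abs_mult using \<alpha> by (intro mult_mono) auto
      moreover have "\<theta> - (3 / 4 * pi + real j * \<alpha>) = (x - real j) * \<alpha>" using x by (simp add: algebra_simps)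
      ultimately have "dist (cis \<theta>) (\<xi> j) \<le> \<alpha>" unfolding \<xi>_def dist_norm
        using norm_cis_diff_le[of \<theta> "3 / 4 * pi + real j * \<alpha>"] by simp
      also have "\<alpha> < \<tau>" using \<tau> by (simp add: \<alpha>_def)
      finally show ?thesis by (intro disjI2 exI[of _ j]) (auto simp: j_def)
    qed
  qed
  have "\<forall>\<^sub>F r in at_top. \<forall>j\<in>{..M}. \<exists>w\<in>ball ((1 - of_real \<tau> / 2) * \<xi> j - of_real \<tau> / 8) (\<tau> / 32). norm (f (of_real r * w)) > exp (- \<eta> * r\<^sup>2)"
    by (intro eventually_ball_finite ballI left_net_points \<tau> \<xi> \<eta>) auto
  then show ?thesis using upper_unit[OF \<eta>] asymp_unit[OF k(1,2) \<eta>] eventually_gt_at_top[of 0]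
  proof eventually_elim
    case (elim r)
    show ?case
    proof (intro impI)
      assume "\<forall>z. norm z = r \<longrightarrow> f z \<noteq> 0"
      then have nz: "\<And>z. norm z = r \<Longrightarrow> f z \<noteq> 0" by blast
      have r: "r > 0" using elim by simp
      define u where "u = (\<lambda>\<theta>. ln (norm (f (of_real r * cis \<theta>))))"
      define V where "V = (\<lambda>\<theta>. r\<^sup>2 * (stokes_indicator (cis \<theta>) + \<eta>) - u \<theta>)"
      have up: "ln (norm (f (of_real r * v))) \<le> r\<^sup>2 * (stokes_indicator v + \<eta>)" if "norm v = 1" for v
        using elim(2) that nz[of "of_real r * v"] r by (simp add: norm_mult)
      have V0: "V \<theta> \<ge> 0" for \<theta> using up[of "cis \<theta>"] by (simp add: V_def u_def)
      have ex: "\<exists>g I. (g has_integral I) {0..2 * pi} \<and> I \<le> 2 * pi * r\<^sup>2 * (2 * sqrt (2 * \<tau>) + 2 * \<tau> + 2 * \<eta>) \<and>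
          (\<forall>\<theta>. g \<theta> \<ge> 0) \<and> (\<forall>\<theta>. dist (cis \<theta>) (\<xi> j) < \<tau> \<longrightarrow> V \<theta> \<le> 16 * \<tau> * g \<theta>)" if j: "j \<in> {..M}" for j
      proof -
        obtain w where w: "w \<in> ball ((1 - of_real \<tau> / 2) * \<xi> j - of_real \<tau> / 8) (\<tau> / 32)" "norm (f (of_real r * w)) > exp (- \<eta> * r\<^sup>2)"
          using elim(1) j by blast
        show ?thesis
          by (rule poisson_defect[OF \<tau>(1,2) \<eta> r \<xi> w nz up]) (use j in \<open>auto simp: V_def u_def\<close>)
      qed
      then obtain g I where g: "\<And>j. j \<in> {..M} \<Longrightarrow> (g j has_integral I j) {0..2 * pi}"
        "\<And>j. j \<in> {..M} \<Longrightarrow> I j \<le> 2 * pi * r\<^sup>2 * (2 * sqrt (2 * \<tau>) + 2 * \<tau> + 2 * \<eta>)"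
        "\<And>j \<theta>. j \<in> {..M} \<Longrightarrow> g j \<theta> \<ge> 0"
        "\<And>j \<theta>. j \<in> {..M} \<Longrightarrow> dist (cis \<theta>) (\<xi> j) < \<tau> \<Longrightarrow> V \<theta> \<le> 16 * \<tau> * g j \<theta>"
        by metis
      have Vle: "V \<theta> \<le> 16 * \<tau> * (\<Sum>j\<in>{..M}. g j \<theta>) + 2 * \<eta> * r\<^sup>2" if \<theta>: "\<theta> \<in> {0..2*pi}" for \<theta>
      proof -
        have sg: "(\<Sum>j\<in>{..M}. g j \<theta>) \<ge> 0" using g(3) by (intro sum_nonneg)
        consider "Re (cis \<theta>) > - k * \<bar>Im (cis \<theta>)\<bar>" | j where "j \<le> M" "dist (cis \<theta>) (\<xi> j) < \<tau>"
          using cover[of \<theta>] \<theta> by auto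
        then show ?thesis
        proof cases
          case 1
          then have "\<bar>u \<theta> - r\<^sup>2 * stokes_indicator (cis \<theta>)\<bar> \<le> r\<^sup>2 * \<eta>" using elim(3) by (simp add: u_def)
          then have "V \<theta> \<le> 2 * \<eta> * r\<^sup>2" unfolding V_def by (simp add: algebra_simps)
          moreover have "16 * \<tau> * (\<Sum>j\<in>{..M}. g j \<theta>) \<ge> 0" using sg \<tau> by simp
          ultimately show ?thesis by linarith
        next
          case 2
          have "V \<theta> \<le> 16 * \<tau> * g j \<theta>" using g(4) 2 by auto
          also have "\<dots> \<le> 16 * \<tau> * (\<Sum>j\<in>{..M}. g j \<theta>)"
            using \<tau> g(3) 2 by (intro mult_left_mono member_le_sum) auto
          also have "\<dots> \<le> 16 * \<tau> * (\<Sum>j\<in>{..M}. g j \<theta>) + 2 * \<eta> * r\<^sup>2" using \<eta> by simp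
          finally show ?thesis .
        qed
      qed
      have ui: "(u has_integral integral {0..2*pi} u) {0..2*pi}"
        unfolding u_def by (intro integrable_integral integrable_continuous_interval integrable_log_circle nz r)
      have cst: "((\<lambda>\<theta>. c) has_integral (2 * pi * c)) {0..2 * pi}" for c :: real
        using has_integral_const_real[of c 0 "2 * pi"] by simp
      have si: "((\<lambda>\<theta>. r\<^sup>2 * (stokes_indicator (cis \<theta>) + \<eta>)) has_integral r\<^sup>2 * (1 / 2 + 2 * pi * \<eta>)) {0..2*pi}"
        by (intro has_integral_mult_right has_integral_add has_integral_stokes_indicator cst)
      have Vi: "(V has_integral (r\<^sup>2 * (1 / 2 + 2 * pi * \<eta>) - integral {0..2*pi} u)) {0..2*pi}"
        unfolding V_def by (rule has_integral_diff[OF si ui])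
      have "((\<lambda>\<theta>. 16 * \<tau> * (\<Sum>j\<in>{..M}. g j \<theta>) + 2 * \<eta> * r\<^sup>2) has_integral (16 * \<tau> * (\<Sum>j\<in>{..M}. I j) + 2 * pi * (2 * \<eta> * r\<^sup>2))) {0..2*pi}"
        by (intro has_integral_add has_integral_mult_right has_integral_sum g cst) auto
      from has_integral_le[OF Vi this Vle]
      have "r\<^sup>2 * (1 / 2 + 2 * pi * \<eta>) - integral {0..2*pi} u \<le> 16 * \<tau> * (\<Sum>j\<in>{..M}. I j) + 2 * pi * (2 * \<eta> * r\<^sup>2)" by simp
      also have "(\<Sum>j\<in>{..M}. I j) \<le> real (card {..M}) * (2 * pi * r\<^sup>2 * (2 * sqrt (2 * \<tau>) + 2 * \<tau> + 2 * \<eta>))"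
        by (rule sum_bounded_above) (use g(2) in auto)
      also have "16 * \<tau> * (real (card {..M}) * (2 * pi * r\<^sup>2 * (2 * sqrt (2 * \<tau>) + 2 * \<tau> + 2 * \<eta>))) = 
           (\<tau> * (real M + 1)) * (32 * pi * r\<^sup>2 * (2 * sqrt (2 * \<tau>) + 2 * \<tau> + 2 * \<eta>))" by (simp add: algebra_simps)
      \<comment> \<open>The number of arcs times their size stays bounded as \<open>\<tau>\<close>
        tends to 0, so a defect of order \<open>sqrt \<tau>\<close> on each of them is small in
        total.\<close>
      also have "\<dots> \<le> (2 * pi) * (32 * pi * r\<^sup>2 * (2 * sqrt (2 * \<tau>) + 2 * \<tau> + 2 * \<eta>))"
      proof (intro mult_right_mono)
        have "real M \<ge> 1" using M0 by simp
        then show "\<tau> * (real M + 1) \<le> 2 * pi" using M0 by (simp add: \<tau>_def field_simps)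
      qed (use \<tau> \<eta> in auto)
      finally have "r\<^sup>2 * (1 / 2 + 2 * pi * \<eta>) - integral {0..2*pi} u \<le> P \<tau> \<eta> * r\<^sup>2"
        using \<tau> by (simp add: P_def algebra_simps power2_eq_square)
      moreover have "P \<tau> \<eta> * r\<^sup>2 \<le> e * r\<^sup>2" using Pe by (intro mult_right_mono) auto
      moreover have "2 * pi * \<eta> * r\<^sup>2 \<le> e * r\<^sup>2"
      proof (intro mult_right_mono)
        have "4 * pi * \<eta> \<le> P \<tau> \<eta>" using \<tau> \<eta> by (simp add: P_def)
        moreover have "2 * pi * \<eta> \<le> 4 * pi * \<eta>" using \<eta> by simp
        ultimately show "2 * pi * \<eta> \<le> e" using Pe by linarith
      qed auto
      moreover have "r\<^sup>2 * (1 / 2 + 2 * pi * \<eta>) - integral {0..2*pi} u \<ge> 0"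
        by (rule has_integral_nonneg[OF Vi]) (use V0 in auto)
      moreover have "2 * pi * \<eta> * r\<^sup>2 \<ge> 0" using \<eta> by simp
      ultimately show "\<bar>integral {0..2 * pi} (\<lambda>\<theta>. ln (norm (f (of_real r * cis \<theta>)))) - r\<^sup>2 / 2\<bar> \<le> e * r\<^sup>2"
        unfolding u_def[symmetric] abs_le_iff by (simp add: algebra_simps)
    qed
  qed
qed

section \<open>From Jensen's formula to the counting function\<close>

lemma zero_free_radius:
  assumes "0 \<le> a" "a < b"
  obtains s where "a < s" "s < b" "\<And>z. norm z = s \<Longrightarrow> f z \<noteq> 0"
proof -
  have "finite (norm ` {z\<in>cball 0 b. f z = 0})" by (intro finite_imageI finite_zeros_compact[OF holo w0]) auto
  then have "infinite ({a<..<b} - norm ` {z\<in>cball 0 b. f z = 0})"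
    using assms by (simp add: infinite_Ioo Diff_infinite_finite)
  then obtain s where "s \<in> {a<..<b} - norm ` {z\<in>cball 0 b. f z = 0}" by (metis all_not_in_conv finite.emptyI)
  then show thesis by (intro that[of s]) auto
qed

text \<open>Jensen's formula and \<open>log_mean_asymp\<close> treat zero-free radii. An arbitrary
  \<open>r\<close> is enclosed between two of them, in \<open>((1 - h) * r, r)\<close> and
  \<open>(r, (1 + h) * r)\<close>, and monotonicity does the rest.\<close>

lemma nev_counting_asymp: "(\<lambda>r. nev_counting r (\<lambda>z. 1 / f z)) \<sim>[at_top] (\<lambda>r. 1 / (4 * pi) * r ^ 2)"
proof (rule asymp_equivI')
  define N where "N = (\<lambda>r. nev_counting r (\<lambda>z. 1 / f z))"
  obtain c where c: "\<And>r. r > 0 \<Longrightarrow> (\<And>z. norm z = r \<Longrightarrow> f z \<noteq> 0) \<Longrightarrow>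
    ((\<lambda>\<theta>. ln (norm (f (of_real r * cis \<theta>)))) has_integral 2 * pi * (N r + c)) {0..2 * pi}"
    using jensen_formula[OF holo w0] unfolding N_def by blast
  have mono: "N r \<le> N s" if "1 \<le> r" "r \<le> s" for r s
    unfolding N_def using nev_counting_reciprocal_mono[OF holo w0 that] .
  show "((\<lambda>r. nev_counting r (\<lambda>z. 1 / f z) / (1 / (4 * pi) * r ^ 2)) \<longlongrightarrow> 1) at_top"
  proof (rule tendstoI)
    fix e :: real assume e: "e > 0"
    define p where "p = 1 / (4 * pi)"
    have p: "p > 0" by (simp add: p_def)
    have "((\<lambda>h. (p + h) * (1 + h)\<^sup>2) \<longlongrightarrow> (p + 0) * (1 + 0)\<^sup>2) (at_right 0)" 
      "((\<lambda>h. (p - h) * (1 - h)\<^sup>2) \<longlongrightarrow> (p - 0) * (1 - 0)\<^sup>2) (at_right 0)" by (intro tendsto_intros)+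
    moreover have "(p + 0) * (1 + 0)\<^sup>2 < p * (1 + e)" "(p - 0) * (1 - 0)\<^sup>2 > p * (1 - e)" using p e by auto
    ultimately have "\<forall>\<^sub>F h in at_right 0. (p + h) * (1 + h)\<^sup>2 < p * (1 + e)" "\<forall>\<^sub>F h in at_right 0. (p - h) * (1 - h)\<^sup>2 > p * (1 - e)"
      by (blast dest: order_tendstoD)+
    then have "\<forall>\<^sub>F h in at_right 0. (p + h) * (1 + h)\<^sup>2 < p * (1 + e) \<and> (p - h) * (1 - h)\<^sup>2 > p * (1 - e)" by (rule eventually_conj)
    then obtain b where b: "b > 0" "\<And>h. 0 < h \<Longrightarrow> h < b \<Longrightarrow> (p + h) * (1 + h)\<^sup>2 < p * (1 + e) \<and> (p - h) * (1 - h)\<^sup>2 > p * (1 - e)"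
      unfolding eventually_at_right_field by auto
    obtain h where h0: "0 < h" "h < b" "h < min p (1 / 2)" using field_lbound_gt_zero[of b "min p (1 / 2)"] b p by auto
    then have h: "0 < h" "h < 1" "h < p" by auto
    have h': "(p + h) * (1 + h)\<^sup>2 < p * (1 + e)" "(p - h) * (1 - h)\<^sup>2 > p * (1 - e)" using b(2)[of h] h0 by auto
    have "\<forall>\<^sub>F r in at_top. (\<forall>z. norm z = r \<longrightarrow> f z \<noteq> 0) \<longrightarrow> \<bar>N r - p * r\<^sup>2\<bar> \<le> h * r\<^sup>2"
    proof -
      have "h / 2 > 0" using h by simp
      then have "\<forall>\<^sub>F r in at_top. 0 * r + \<bar>c\<bar> \<le> (h / 2) * r\<^sup>2" by (rule eventually_affine_le_quadratic)
      then show ?thesis using log_mean_asymp[OF \<open>h / 2 > 0\<close>] eventually_gt_at_top[of 0]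
      proof eventually_elim
        case (elim r)
        show ?case
        proof (intro impI)
          assume "\<forall>z. norm z = r \<longrightarrow> f z \<noteq> 0"
          then have "((\<lambda>\<theta>. ln (norm (f (of_real r * cis \<theta>)))) has_integral 2 * pi * (N r + c)) {0..2 * pi}"
            using c elim by blast
          then have "\<bar>2 * pi * (N r + c) - r\<^sup>2 / 2\<bar> \<le> h / 2 * r\<^sup>2"
            using elim \<open>\<forall>z. norm z = r \<longrightarrow> f z \<noteq> 0\<close> by (auto dest: integral_unique)
          moreover have "2 * pi * (N r + c) - r\<^sup>2 / 2 = 2 * pi * (N r + c - p * r\<^sup>2)" by (simp add: p_def field_simps)
          ultimately have 1: "2 * pi * \<bar>N r + c - p * r\<^sup>2\<bar> \<le> h / 2 * r\<^sup>2" by (simp add: abs_mult)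
          have 2: "1 * \<bar>N r + c - p * r\<^sup>2\<bar> \<le> 2 * pi * \<bar>N r + c - p * r\<^sup>2\<bar>"
            using pi_gt3 by (intro mult_right_mono) auto
          have "\<bar>N r + c - p * r\<^sup>2\<bar> \<le> h / 2 * r\<^sup>2" using order_trans[OF 2 1] by simp
          moreover have "\<bar>N r - p * r\<^sup>2\<bar> \<le> \<bar>N r + c - p * r\<^sup>2\<bar> + \<bar>c\<bar>"
            using abs_triangle_ineq4[of "N r + c - p * r\<^sup>2" c] by simp
          ultimately show "\<bar>N r - p * r\<^sup>2\<bar> \<le> h * r\<^sup>2" using elim(1) by simp
        qed
      qed
    qed
    then obtain r1 where r1: "\<And>r. r \<ge> r1 \<Longrightarrow> (\<forall>z. norm z = r \<longrightarrow> f z \<noteq> 0) \<Longrightarrow> \<bar>N r - p * r\<^sup>2\<bar> \<le> h * r\<^sup>2"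
      unfolding eventually_at_top_linorder by blast
    \<comment> \<open>Dividing by \<open>1 - h\<close> keeps the smaller of the two radii beyond
      \<open>r1\<close> and 1.\<close>
    define r2 where "r2 = max r1 1 / (1 - h)"
    have "\<bar>N r / (p * r\<^sup>2) - 1\<bar> < e" if r: "r \<ge> r2" for r
    proof -
      have "max r1 1 \<le> (1 - h) * r" using r h by (simp add: r2_def divide_le_eq mult.commute)
      then have hr: "(1 - h) * r \<ge> r1" "(1 - h) * r \<ge> 1" by auto
      have "h * r \<ge> 0 \<or> r < 0" using h by (simp add: zero_le_mult_iff) linarith
      moreover have rp: "r > 0" using hr h by (smt (verit) mult_nonneg_nonpos)
      ultimately have hr0: "h * r > 0" using h by simp
      have "0 \<le> (1 - h) * r" using hr(2) by linarith
      moreover have "(1 - h) * r < r" using hr0 by (simp add: algebra_simps)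
      ultimately obtain s where s: "(1 - h) * r < s" "s < r" "\<And>z. norm z = s \<Longrightarrow> f z \<noteq> 0"
        using zero_free_radius by blast
      have "0 \<le> r" "r < (1 + h) * r" using rp hr0 by (simp_all add: algebra_simps)
      then obtain t where t: "r < t" "t < (1 + h) * r" "\<And>z. norm z = t \<Longrightarrow> f z \<noteq> 0"
        using zero_free_radius by blast
      have "N r \<le> N t" using mono[of r t] t s hr by linarith
      also have "N t \<le> (p + h) * t\<^sup>2" using r1[of t] t s hr by (simp add: algebra_simps)
      also have "\<dots> \<le> (p + h) * ((1 + h) * r)\<^sup>2" using t rp p h by (intro mult_left_mono power_mono) auto
      also have "\<dots> = (p + h) * (1 + h)\<^sup>2 * r\<^sup>2" by (simp add: power_mult_distrib)
      also have "\<dots> < p * (1 + e) * r\<^sup>2" using h' rp by (intro mult_strict_right_mono) auto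
      finally have up: "N r < p * (1 + e) * r\<^sup>2" .
      have "p * (1 - e) * r\<^sup>2 < (p - h) * (1 - h)\<^sup>2 * r\<^sup>2" using h' rp by (intro mult_strict_right_mono) auto
      also have "\<dots> = (p - h) * ((1 - h) * r)\<^sup>2" by (simp add: power_mult_distrib)
      also have "\<dots> \<le> (p - h) * s\<^sup>2" using s hr h by (intro mult_left_mono power_mono) auto
      also have "\<dots> \<le> N s" using r1[of s] s hr by (simp add: algebra_simps)
      also have "\<dots> \<le> N r" using mono[of s r] s hr by linarith
      finally have lo: "N r > p * (1 - e) * r\<^sup>2" .
      have pr: "p * r\<^sup>2 > 0" using p rp by simp
      have "N r / (p * r\<^sup>2) < 1 + e" using up pr by (simp add: divide_less_eq algebra_simps)
      moreover have "N r / (p * r\<^sup>2) > 1 - e" using lo pr by (simp add: less_divide_eq algebra_simps)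
      ultimately show ?thesis by (simp add: abs_less_iff)
    qed
    then show "\<forall>\<^sub>F r in at_top. dist (nev_counting r (\<lambda>z. 1 / f z) / (1 / (4 * pi) * r ^ 2)) 1 < e"
      unfolding eventually_at_top_linorder N_def p_def dist_real_def by blast
  qed
qed

section \<open>Counting zeros in discs and in the left sector\<close>

lemma norm_le_exp_square: "norm (f z) \<le> exp ((norm z)\<^sup>2 / 2 + C * (norm z + 1))"
proof -
  have "- Re (z\<^sup>2) \<le> norm (z\<^sup>2)" using abs_Re_le_cmod[of "z\<^sup>2"] by linarith
  then have "max 0 (- Re (z\<^sup>2) / 2) \<le> (norm z)\<^sup>2 / 2" by (intro max.boundedI) (auto simp: norm_power)
  then show ?thesis using upper[of z] by (smt (verit) exp_le_cancel_iff)
qed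

text \<open>The quadratic growth of \<open>ln \<bar>f\<bar>\<close> on radius about
  \<open>4 * \<sigma> * r\<close> yields \<open>8 * \<sigma>\<^sup>2 * r\<^sup>2\<close>; one more
  \<open>\<sigma>\<^sup>2 * r\<^sup>2\<close> absorbs all lower order terms. The factor
  \<open>\<sigma>\<^sup>2\<close> makes zeros of relatively small modulus negligible.\<close>

lemma zero_count_cball_upper:
  assumes "\<sigma> > 0"
  shows "\<forall>\<^sub>F r in at_top. real (zero_count f (cball 0 (\<sigma> * r))) * ln 2 \<le> 9 * \<sigma>\<^sup>2 * r\<^sup>2"
proof -
  define a where "a = norm w0"
  define l where "l = ln (norm (f w0))"
  have "\<forall>\<^sub>F r in at_top. (4 * (\<sigma> * r + a))\<^sup>2 / 2 + C * (4 * (\<sigma> * r + a) + 1) - l \<le> 9 * \<sigma>\<^sup>2 * r\<^sup>2"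
  proof -
    have "\<forall>\<^sub>F r in at_top. (16 * \<sigma> * a + 4 * C * \<sigma>) * r + (8 * a\<^sup>2 + C * (4 * a + 1) - l) \<le> \<sigma>\<^sup>2 * r\<^sup>2"
      using assms by (intro eventually_affine_le_quadratic) auto
    then show ?thesis
    proof eventually_elim
      case (elim r)
      have "(4 * (\<sigma> * r + a))\<^sup>2 / 2 + C * (4 * (\<sigma> * r + a) + 1) - l
          = 8 * (\<sigma>\<^sup>2 * r\<^sup>2) + ((16 * \<sigma> * a + 4 * C * \<sigma>) * r + (8 * a\<^sup>2 + C * (4 * a + 1) - l))"
        by (simp add: power2_eq_square field_simps)
      then show ?case using elim by linarith
    qed
  qed
  then show ?thesis using eventually_gt_at_top[of 0]
  proof eventually_elim
    case (elim r)
    \<comment> \<open>The counting lemma needs a centre where \<open>f\<close> does not vanish. A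
      third of this radius about \<open>w0\<close> still covers
      \<open>cball 0 (\<sigma> * r)\<close>.\<close>
    define \<rho> where "\<rho> = 3 * (\<sigma> * r + a)"
    have \<rho>: "\<rho> > 0" using elim assms by (simp add: \<rho>_def a_def add_pos_nonneg)
    have "real (zero_count f (cball w0 (\<rho> / 3))) * ln 2 \<le> ((4 * (\<sigma> * r + a))\<^sup>2 / 2 + C * (4 * (\<sigma> * r + a) + 1)) - ln (norm (f w0))"
    proof (rule zero_count_disc_le[OF holo w0 \<rho>])
      fix z assume "z \<in> cball w0 \<rho>"
      then have "norm z \<le> \<rho> + a" using norm_triangle_ineq[of "z - w0" w0] by (simp add: a_def dist_norm norm_minus_commute)
      also have "\<dots> \<le> 4 * (\<sigma> * r + a)" using elim assms by (simp add: \<rho>_def a_def)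
      finally have nz: "norm z \<le> 4 * (\<sigma> * r + a)" .
      have "(norm z)\<^sup>2 / 2 + C * (norm z + 1) \<le> (4 * (\<sigma> * r + a))\<^sup>2 / 2 + C * (4 * (\<sigma> * r + a) + 1)"
        using nz C by (intro add_mono divide_right_mono mult_left_mono power_mono) auto
      then show "norm (f z) \<le> exp ((4 * (\<sigma> * r + a))\<^sup>2 / 2 + C * (4 * (\<sigma> * r + a) + 1))"
        using norm_le_exp_square[of z] by (meson exp_le_cancel_iff order_trans)
    qed
    moreover have "cball 0 (\<sigma> * r) \<subseteq> cball w0 (\<rho> / 3)"
    proof
      fix z :: complex assume "z \<in> cball 0 (\<sigma> * r)"
      then show "z \<in> cball w0 (\<rho> / 3)" using norm_triangle_ineq4[of w0 z] by (simp add: \<rho>_def a_def dist_norm)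
    qed
    then have "zero_count f (cball 0 (\<sigma> * r)) \<le> zero_count f (cball w0 (\<rho> / 3))"
      by (intro zero_count_mono finite_zeros_compact[OF holo w0]) auto
    then have "real (zero_count f (cball 0 (\<sigma> * r))) * ln 2 \<le> real (zero_count f (cball w0 (\<rho> / 3))) * ln 2"
      by (intro mult_right_mono) auto
    ultimately show ?case using elim(1) unfolding l_def by linarith
  qed
qed

text \<open>A point \<open>u\<close> of the ball where \<open>f\<close> is not small serves as
  centre. A disc of radius \<open>2 * e\<close> about it covers \<open>ball w e\<close>, and the
  tripled radius \<open>6 * e\<close> stays within \<open>ball w (7 * e)\<close>, where
  \<open>f\<close> is of exponential type only.\<close>

lemma zero_count_left_disc:
  assumes e: "e > 0" and sub: "ball w (7 * e) \<subseteq> left_sector" and \<delta>: "\<delta> > 0"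
  shows "\<forall>\<^sub>F r in at_top. finite {z\<in>((*) (of_real r)) ` ball w e. f z = 0} \<and> real (zero_count f (((*) (of_real r)) ` ball w e)) * ln 2 \<le> \<delta> * r\<^sup>2"
proof -
  define B where "B = norm w + 7 * e"
  have "\<forall>\<^sub>F r in at_top. \<exists>u\<in>ball w e. norm (f (of_real r * u)) > exp (- (\<delta> / 2) * r\<^sup>2)"
  proof -
    have "ball w e \<subseteq> ball w (7 * e)" using e by (intro subset_ball) auto
    with sub have "ball w e \<subseteq> left_sector" by blast
    moreover have "\<delta> / 2 > 0" using \<delta> by simp
    ultimately show ?thesis using nowhere[unfolded nowhere_small_def, rule_format] e by blast
  qed
  moreover have "\<forall>\<^sub>F r in at_top. (C * B) * r + C \<le> (\<delta> / 2) * r\<^sup>2" using \<delta> by (intro eventually_affine_le_quadratic) auto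
  ultimately show ?thesis using eventually_gt_at_top[of 0]
  proof eventually_elim
    case (elim r)
    then obtain u where u: "u \<in> ball w e" "norm (f (of_real r * u)) > exp (- (\<delta> / 2) * r\<^sup>2)" by blast
    define z0 where "z0 = of_real r * u"
    have fz0: "f z0 \<noteq> 0" using u(2) unfolding z0_def by (smt (verit) exp_gt_zero norm_zero)
    have "real (zero_count f (cball z0 ((6 * e * r) / 3))) * ln 2 \<le> C * (B * r + 1) - ln (norm (f z0))"
    proof (rule zero_count_disc_le[OF holo fz0])
      show "6 * e * r > 0" using e elim by simp
      fix z assume z: "z \<in> cball z0 (6 * e * r)"
      define v where "v = z / of_real r"
      have zv: "z = of_real r * v" using elim by (simp add: v_def)
      have "r * norm (u - v) \<le> r * (6 * e)"
      proof -
        have "norm (z0 - z) = r * norm (u - v)" unfolding z0_def zv using elim by (simp add: norm_mult flip: right_diff_distrib)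
        then show ?thesis using z by (simp add: dist_norm mult_ac)
      qed
      then have "norm (u - v) \<le> 6 * e" using elim by simp
      then have vb: "v \<in> ball w (7 * e)" using u(1) dist_triangle[of w v u] by (simp add: dist_norm)
      then have "of_real r * v \<in> left_sector" using sub elim left_sector_scale by blast
      then have "norm (f z) \<le> exp (C * (norm z + 1))" unfolding zv by (intro upper_left) (auto simp: left_sector_def)
      also have "\<dots> \<le> exp (C * (B * r + 1))"
      proof -
        have "norm v \<le> B" using vb norm_triangle_ineq[of "v - w" w] by (simp add: B_def dist_norm norm_minus_commute)
        then have "norm z \<le> B * r" unfolding zv using elim by (simp add: norm_mult mult.commute)
        then show ?thesis using C by (simp add: mult_left_mono)
      qed
      finally show "norm (f z) \<le> exp (C * (B * r + 1))" .
    qed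
    moreover have "ln (norm (f z0)) \<ge> - (\<delta> / 2) * r\<^sup>2"
    proof -
      have "ln (exp (- (\<delta> / 2) * r\<^sup>2)) \<le> ln (norm (f z0))" using u(2) fz0 unfolding z0_def by (subst ln_le_cancel_iff) auto
      then show ?thesis by simp
    qed
    ultimately have cnt: "real (zero_count f (cball z0 ((6 * e * r) / 3))) * ln 2 \<le> \<delta> * r\<^sup>2"
      using elim(2) by (simp add: algebra_simps)
    have sb: "((*) (of_real r)) ` ball w e \<subseteq> cball z0 ((6 * e * r) / 3)"
    proof (intro image_subsetI)
      fix v assume v: "v \<in> ball w e"
      have "norm (z0 - of_real r * v) = r * norm (u - v)" unfolding z0_def using elim by (simp add: norm_mult flip: right_diff_distrib)
      also have "norm (u - v) \<le> 2 * e" using u(1) v dist_triangle[of u v w] by (simp add: dist_norm norm_minus_commute)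
      finally show "of_real r * v \<in> cball z0 ((6 * e * r) / 3)" using elim by (simp add: dist_norm mult_ac)
    qed
    have fin: "finite {z\<in>cball z0 ((6 * e * r) / 3). f z = 0}" by (intro finite_zeros_compact[OF holo w0]) auto
    have "real (zero_count f (((*) (of_real r)) ` ball w e)) \<le> real (zero_count f (cball z0 ((6 * e * r) / 3)))"
      using zero_count_mono[OF fin sb] by simp
    then have "real (zero_count f (((*) (of_real r)) ` ball w e)) * ln 2 \<le> real (zero_count f (cball z0 ((6 * e * r) / 3))) * ln 2"
      by (intro mult_right_mono) auto
    moreover have "finite {z\<in>((*) (of_real r)) ` ball w e. f z = 0}" by (rule finite_subset[OF _ fin]) (use sb in auto)
    ultimately show ?case using cnt by linarith
  qed
qed

text \<open>Zeros with modulus at most \<open>\<sigma> * r\<close> are few by the crude bound. The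
  remaining part of the sector is a dilate of a compact subset of the left sector, covered by
  finitely many discs with \<open>o(r\<^sup>2)\<close> zeros each.\<close>

lemma zero_count_left_sector:
  assumes \<epsilon>: "\<epsilon> > 0"
  shows "(\<lambda>r. real (zero_count f {z. \<bar>Arg2pi z - pi\<bar> < pi / 4 - \<epsilon> \<and> cmod z < r})) \<in> o[at_top](\<lambda>r. r ^ 2)"
proof (rule landau_o.smallI)
  fix c :: real assume c: "c > 0"
  \<comment> \<open>Chosen so that the small disc uses half of the allowance
    \<open>c * ln 2\<close>; the discs of the cover share the other half.\<close>
  define \<sigma> where "\<sigma> = sqrt (c * ln 2 / 18)"
  have \<sigma>: "\<sigma> > 0" "9 * \<sigma>\<^sup>2 = c * ln 2 / 2" using c by (auto simp: \<sigma>_def)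
  define K where "K = (\<lambda>(\<rho>, \<theta>). of_real \<rho> * cis \<theta>) ` ({\<sigma>..1} \<times> {pi - (pi / 4 - \<epsilon>)..pi + (pi / 4 - \<epsilon>)})"
  have "compact K" unfolding K_def
    by (intro compact_continuous_image compact_Times) (auto intro!: continuous_intros simp: case_prod_unfold)
  have KS: "K \<subseteq> left_sector"
  proof
    fix w assume "w \<in> K"
    then obtain \<rho> \<theta> where w: "w = of_real \<rho> * cis \<theta>" "\<sigma> \<le> \<rho>" "pi - (pi / 4 - \<epsilon>) \<le> \<theta>" "\<theta> \<le> pi + (pi / 4 - \<epsilon>)"
      by (auto simp: K_def)
    have "cos (\<theta> - pi / 4 - pi) > 0" using w \<epsilon> by (intro cos_gt_zero_pi) auto
    moreover have "cos (\<theta> + pi / 4 - pi) > 0" using w \<epsilon> by (intro cos_gt_zero_pi) auto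
    ultimately have "cos (\<theta> - pi / 4) < 0" "cos (\<theta> + pi / 4) < 0"
      by (simp_all only: cos_diff[of _ pi] cos_pi sin_pi)
    then have "sqrt 2 * cos (\<theta> - pi / 4) < 0" "sqrt 2 * cos (\<theta> + pi / 4) < 0" by (simp_all add: mult_pos_neg)
    then have "cos \<theta> + sin \<theta> < 0" "cos \<theta> - sin \<theta> < 0" by (simp_all only: cos_add_sin cos_diff_sin)
    then have "cis \<theta> \<in> left_sector" by (auto simp: left_sector_def)
    then show "w \<in> left_sector" unfolding w using \<sigma> w by (intro left_sector_scale) auto
  qed
  have "\<exists>e>0. ball w (7 * e) \<subseteq> left_sector" if "w \<in> K" for w
  proof -
    have "w \<in> left_sector" using KS that by blast
    then obtain e where "e > 0" "ball w e \<subseteq> left_sector"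
      using open_left_sector[unfolded open_contains_ball] by blast
    then show ?thesis by (intro exI[of _ "e / 7"]) auto
  qed
  then obtain e where e: "\<And>w. w \<in> K \<Longrightarrow> e w > 0 \<and> ball w (7 * e w) \<subseteq> left_sector" by metis
  obtain D where D: "D \<subseteq> K" "finite D" "K \<subseteq> (\<Union>w\<in>D. ball w (e w))"
    by (rule compactE_image[OF \<open>compact K\<close>, of K "\<lambda>w. ball w (e w)"]) (use e in auto)
  \<comment> \<open>One is added to the cardinality because the cover is empty when
    \<open>\<epsilon>\<close> is at least as large as to make \<open>K\<close> empty.\<close>
  define \<delta> where "\<delta> = c * ln 2 / (2 * (real (card D) + 1))"
  have \<delta>: "\<delta> > 0" using c by (simp add: \<delta>_def)
  have cD: "real (card D) * \<delta> \<le> c * ln 2 / 2"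
  proof -
    have "real (card D) * \<delta> \<le> (real (card D) + 1) * \<delta>" using \<delta> by (intro mult_right_mono) auto
    also have "\<dots> = c * ln 2 / 2"
    proof -
      obtain m where m: "m = real (card D) + 1" by simp
      then have "m > 0" by simp
      then show ?thesis unfolding \<delta>_def m[symmetric] by simp
    qed
    finally show ?thesis .
  qed
  have "\<forall>\<^sub>F r in at_top. \<forall>w\<in>D. finite {z\<in>((*) (of_real r)) ` ball w (e w). f z = 0} \<and> real (zero_count f (((*) (of_real r)) ` ball w (e w))) * ln 2 \<le> \<delta> * r\<^sup>2"
    using D e \<delta> by (intro eventually_ball_finite ballI zero_count_left_disc) auto
  then show "\<forall>\<^sub>F r in at_top. norm (real (zero_count f {z. \<bar>Arg2pi z - pi\<bar> < pi / 4 - \<epsilon> \<and> cmod z < r})) \<le> c * norm (r ^ 2)"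
    using zero_count_cball_upper[OF \<sigma>(1)] eventually_gt_at_top[of 0]
  proof eventually_elim
    case (elim r)
    define S where "S = {z. \<bar>Arg2pi z - pi\<bar> < pi / 4 - \<epsilon> \<and> cmod z < r}"
    define A where "A = (\<lambda>i. case i of None \<Rightarrow> cball 0 (\<sigma> * r) | Some w \<Rightarrow> ((*) (of_real r)) ` ball w (e w))"
    define I where "I = insert None (Some ` D)"
    have "S \<subseteq> (\<Union>i\<in>I. A i)"
    proof
      fix z assume z: "z \<in> S"
      show "z \<in> (\<Union>i\<in>I. A i)"
      proof (cases "norm z \<le> \<sigma> * r")
        case True
        then show ?thesis by (auto simp: I_def A_def)
      next
        case False
        define w where "w = of_real (norm z / r) * cis (Arg2pi z)"
        have "norm z / r \<in> {\<sigma>..1}" using False z elim by (auto simp: S_def field_simps)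
        moreover have "Arg2pi z \<in> {pi - (pi / 4 - \<epsilon>)..pi + (pi / 4 - \<epsilon>)}" using z unfolding S_def abs_less_iff by auto
        ultimately have "w \<in> K" unfolding K_def w_def by (intro image_eqI[of _ _ "(norm z / r, Arg2pi z)"]) auto
        then obtain v where v: "v \<in> D" "w \<in> ball v (e v)" using D by auto
        have "z = of_real r * w" using Arg2pi_eq[of z] elim unfolding w_def by (simp add: cis_conv_exp)
        then have "z \<in> A (Some v)" using v by (auto simp: A_def)
        then show ?thesis using v by (auto simp: I_def)
      qed
    qed
    moreover have "finite {z\<in>A i. f z = 0}" if "i \<in> I" for i
      using that elim(1) finite_zeros_compact[OF holo w0, of "cball 0 (\<sigma> * r)"] by (auto simp: I_def A_def)
    ultimately have "zero_count f S \<le> (\<Sum>i\<in>I. zero_count f (A i))" using D by (intro zero_count_Union) (auto simp: I_def)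
    also have "\<dots> = zero_count f (A None) + (\<Sum>w\<in>D. zero_count f (A (Some w)))"
      unfolding I_def using D by (subst sum.insert) (auto simp: sum.reindex)
    finally have "real (zero_count f S) \<le> real (zero_count f (A None)) + (\<Sum>w\<in>D. real (zero_count f (A (Some w))))"
      by (metis of_nat_add of_nat_le_iff of_nat_sum)
    then have "real (zero_count f S) * ln 2 \<le> (real (zero_count f (A None)) + (\<Sum>w\<in>D. real (zero_count f (A (Some w))))) * ln 2"
      by (intro mult_right_mono) auto
    also have "\<dots> = real (zero_count f (A None)) * ln 2 + (\<Sum>w\<in>D. real (zero_count f (A (Some w))) * ln 2)"
      by (simp add: distrib_right sum_distrib_right)
    also have "\<dots> \<le> 9 * \<sigma>\<^sup>2 * r\<^sup>2 + real (card D) * (\<delta> * r\<^sup>2)"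
      using elim by (intro add_mono sum_bounded_above) (auto simp: A_def)
    also have "9 * \<sigma>\<^sup>2 * r\<^sup>2 = c * ln 2 / 2 * r\<^sup>2" unfolding \<sigma>(2) ..
    also have "real (card D) * (\<delta> * r\<^sup>2) = (real (card D) * \<delta>) * r\<^sup>2" by (simp add: mult.assoc)
    also have "\<dots> \<le> (c * ln 2 / 2) * r\<^sup>2" using cD by (intro mult_right_mono) auto
    also have "c * ln 2 / 2 * r\<^sup>2 + c * ln 2 / 2 * r\<^sup>2 = (c * r\<^sup>2) * ln 2" by (simp add: algebra_simps)
    finally have "real (zero_count f S) \<le> c * r\<^sup>2" by simp
    then show ?case by (simp add: S_def)
  qed
qed

end

subsection \<open>Gaussian contour integrals\<close>

lemma integrable_gaussian: "integrable lborel (\<lambda>y. exp (- (y - m)\<^sup>2 / 2) :: real)"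
  and integral_gaussian: "(LINT y|lborel. exp (- (y - m)\<^sup>2 / 2)) = sqrt (2 * pi)"
proof -
  have eq: "exp (- (y - m)\<^sup>2 / 2) = sqrt (2 * pi) * normal_density m 1 y" for y
    by (simp add: normal_density_def)
  show "integrable lborel (\<lambda>y. exp (- (y - m)\<^sup>2 / 2) :: real)" unfolding eq by simp
  show "(LINT y|lborel. exp (- (y - m)\<^sup>2 / 2)) = sqrt (2 * pi)" unfolding eq by simp
qed

lemma set_integrable_gaussian_bound:
  fixes g :: "real \<Rightarrow> complex"
  assumes g: "continuous_on {a..} g" and bd: "\<And>y. y \<ge> a \<Longrightarrow> norm (g y) \<le> M * exp (- (y - m)\<^sup>2 / 2)"
  shows "set_integrable lborel {a..} g" "norm (LINT y:{a..}|lborel. g y) \<le> M * sqrt (2 * pi)"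
proof -
  have M: "M \<ge> 0"
    using order_trans[OF norm_ge_zero bd[of a]] by (simp add: zero_le_mult_iff)
  have int: "integrable lborel (\<lambda>y. M * exp (- (y - m)\<^sup>2 / 2))" by (intro integrable_mult_right integrable_gaussian)
  have le: "norm (indicator {a..} y *\<^sub>R g y) \<le> M * exp (- (y - m)\<^sup>2 / 2)" for y
    using bd[of y] M by (auto simp: indicator_def)
  have meas: "(\<lambda>y. indicator {a..} y *\<^sub>R g y) \<in> borel_measurable lborel"
    using borel_measurable_continuous_on_indicator[OF _ g] by simp
  show si: "set_integrable lborel {a..} g"
    unfolding set_integrable_def using le M by (intro Bochner_Integration.integrable_bound[OF int meas] AE_I2) (auto simp: abs_mult intro: order_trans)
  have "norm (LINT y:{a..}|lborel. g y) \<le> (LINT y|lborel. M * exp (- (y - m)\<^sup>2 / 2))"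
    unfolding set_lebesgue_integral_def by (rule Bochner_Integration.integral_norm_bound_integral[OF _ int le]) (use si in \<open>simp add: set_integrable_def\<close>)
  then show "norm (LINT y:{a..}|lborel. g y) \<le> M * sqrt (2 * pi)" by (simp only: integral_mult_right_zero integral_gaussian)
qed

text \<open>Improper integrals become limits of primitives, so that moving a contour reduces to
  comparing such limits. The Gaussian majorant provides both convergence and the estimate.\<close>

lemma ray_primitive_limit:
  fixes f W :: "complex \<Rightarrow> complex"
  assumes W: "\<And>t. t \<in> S \<Longrightarrow> (W has_field_derivative f t) (at t)" and f: "continuous_on S f"
    and ray: "\<And>y. y \<ge> a \<Longrightarrow> p + d * of_real y \<in> S"
    and bd: "\<And>y. y \<ge> a \<Longrightarrow> norm (f (p + d * of_real y)) \<le> M * exp (- (y - m)\<^sup>2 / 2)"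
  shows "set_integrable lborel {a..} (\<lambda>y. f (p + d * of_real y))"
    "((\<lambda>N. W (p + d * of_real N)) \<longlongrightarrow> W (p + d * of_real a) + d * (LINT y:{a..}|lborel. f (p + d * of_real y))) at_top"
    "norm (LINT y:{a..}|lborel. f (p + d * of_real y)) \<le> M * sqrt (2 * pi)"
proof -
  have cont: "continuous_on {a..} (\<lambda>y. f (p + d * of_real y))"
    by (rule continuous_on_compose2[OF f]) (use ray in \<open>auto intro!: continuous_intros\<close>)
  note si = set_integrable_gaussian_bound[OF cont bd, simplified]
  show "set_integrable lborel {a..} (\<lambda>y. f (p + d * of_real y))" "norm (LINT y:{a..}|lborel. f (p + d * of_real y)) \<le> M * sqrt (2 * pi)"
    using si by blast+
  have fin: "d * (LINT y:{a..N}|lborel. f (p + d * of_real y)) = W (p + d * of_real N) - W (p + d * of_real a)" if N: "N \<ge> a" for N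
  proof -
    have "((\<lambda>y. d * f (p + d * of_real y)) has_integral W (p + d * of_real N) - W (p + d * of_real a)) {a..N}"
    proof (rule fundamental_theorem_of_calculus[OF N])
      fix y assume y: "y \<in> {a..N}"
      have "((\<lambda>y. p + d * of_real y) has_vector_derivative d) (at y within {a..N})"
        by (auto intro!: derivative_eq_intros simp: has_vector_derivative_def scaleR_conv_of_real mult.commute)
      from field_vector_diff_chain_within[OF this, of W "f (p + d * of_real y)"] W[of "p + d * of_real y"] ray[of y] y
      show "((\<lambda>y. W (p + d * of_real y)) has_vector_derivative d * f (p + d * of_real y)) (at y within {a..N})"
        by (auto simp: o_def has_field_derivative_at_within)
    qed
    then have "integral {a..N} (\<lambda>y. d * f (p + d * of_real y)) = W (p + d * of_real N) - W (p + d * of_real a)"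
      by (rule integral_unique)
    moreover have "set_integrable lborel {a..N} (\<lambda>y. f (p + d * of_real y))"
      by (rule set_integrable_subset[OF si(1)]) auto
    ultimately show ?thesis by (simp add: set_borel_integral_eq_integral)
  qed
  have "((\<lambda>N. LINT y:{a..N}|lborel. f (p + d * of_real y)) \<longlongrightarrow> (LINT y:{a..}|lborel. f (p + d * of_real y))) at_top"
    by (rule tendsto_set_lebesgue_integral_at_top[OF _ si(1)]) auto
  then have "((\<lambda>N. W (p + d * of_real a) + d * (LINT y:{a..N}|lborel. f (p + d * of_real y))) \<longlongrightarrow> W (p + d * of_real a) + d * (LINT y:{a..}|lborel. f (p + d * of_real y))) at_top"
    by (intro tendsto_intros)
  then show "((\<lambda>N. W (p + d * of_real N)) \<longlongrightarrow> W (p + d * of_real a) + d * (LINT y:{a..}|lborel. f (p + d * of_real y))) at_top"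
    by (rule Lim_transform_eventually) (use fin in \<open>auto intro!: eventually_mono[OF eventually_ge_at_top[of a]]\<close>)
qed

lemma gaussian_decay:
  "((\<lambda>N. A * exp (c - N\<^sup>2 / 2 + b * (x + N)) * x) \<longlongrightarrow> (0::real)) at_top"
proof -
  have "((\<lambda>N. exp (c - N\<^sup>2 / 2 + b * (x + N))) \<longlongrightarrow> (0::real)) at_top" by real_asymp
  then have "((\<lambda>N. A * exp (c - N\<^sup>2 / 2 + b * (x + N)) * x) \<longlongrightarrow> A * 0 * x) at_top" by (intro tendsto_intros)
  then show ?thesis by simp
qed

section \<open>Primitives on the slit exterior\<close>

lemma slit_exterior_iff:
  assumes "R \<ge> 0"
  shows "t \<in> slit_exterior R \<longleftrightarrow> cmod t > R \<and> t \<notin> \<real>\<^sub>\<le>\<^sub>0"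
proof (cases "cmod t > R")
  case True
  then have "t \<noteq> 0" using assms by auto
  then have "t \<in> \<real>\<^sub>\<le>\<^sub>0 \<longleftrightarrow> Arg t = pi"
    by (auto simp: Arg_eq_pi complex_nonpos_Reals_iff less_le complex_eq_iff)
  moreover have "- pi < Arg t" "Arg t \<le> pi" using Arg_bounded[of t] by auto
  then have "\<bar>Arg t\<bar> < pi \<longleftrightarrow> Arg t \<noteq> pi" by (auto simp: abs_less_iff)
  ultimately show ?thesis using True by (simp add: slit_exterior_def)
qed (simp add: slit_exterior_def)

lemma slit_exterior_strip:
  assumes R: "R > 0"
  shows "t \<in> slit_exterior R \<Longrightarrow> Ln t \<in> {w. Re w > ln R \<and> Im w > - pi \<and> Im w < pi}"
    "w \<in> {w. Re w > ln R \<and> Im w > - pi \<and> Im w < pi} \<Longrightarrow> exp w \<in> slit_exterior R \<and> Ln (exp w) = w"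
proof -
  assume t: "t \<in> slit_exterior R"
  then have "t \<noteq> 0" using R by (auto simp: slit_exterior_def)
  then show "Ln t \<in> {w. Re w > ln R \<and> Im w > - pi \<and> Im w < pi}"
    using t R by (auto simp: slit_exterior_def Arg_eq_Im_Ln abs_less_iff)
next
  assume w: "w \<in> {w. Re w > ln R \<and> Im w > - pi \<and> Im w < pi}"
  then have L: "Ln (exp w) = w" by (intro Ln_exp) auto
  have "exp (ln R) < exp (Re w)" using w by simp
  then have "exp (Re w) > R" using R by simp
  moreover have "Arg (exp w) = Im w" using L by (simp add: Arg_eq_Im_Ln)
  ultimately show "exp w \<in> slit_exterior R \<and> Ln (exp w) = w" using w L by (auto simp: slit_exterior_def)
qed

lemma convex_strip: "convex {w. Re w > a \<and> Im w > b \<and> Im w < c}" and open_strip: "open {w. Re w > a \<and> Im w > b \<and> Im w < c}"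
proof -
  have eq: "{w. Re w > a \<and> Im w > b \<and> Im w < c} = {w. Re w > a} \<inter> {w. Im w > b} \<inter> {w. Im w < c}" by auto
  show "convex {w. Re w > a \<and> Im w > b \<and> Im w < c}" unfolding eq
    by (intro convex_Int convex_halfspace_Re_gt convex_halfspace_Im_gt convex_halfspace_Im_lt)
  show "open {w. Re w > a \<and> Im w > b \<and> Im w < c}" unfolding eq
    by (intro open_Int open_halfspace_Re_gt open_halfspace_Im_gt open_halfspace_Im_lt)
qed

text \<open>The slit exterior is not convex, but \<open>Ln\<close> maps it onto a half strip that
  is. The primitive is taken there, of \<open>f (exp w) * exp w\<close>, and pulled back.\<close>

lemma slit_exterior_primitive:
  assumes R: "R > 0" and f: "f holomorphic_on slit_exterior R"
  obtains W where "\<And>t. t \<in> slit_exterior R \<Longrightarrow> (W has_field_derivative f t) (at t)"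
proof -
  define T where "T = {w. Re w > ln R \<and> Im w > - pi \<and> Im w < pi}"
  have "(\<lambda>w. f (exp w) * exp w) holomorphic_on T"
    using slit_exterior_strip(2)[OF R]
    by (intro holomorphic_intros holomorphic_on_compose_gen[OF _ f, unfolded o_def]) (auto simp: T_def)
  then obtain V where V: "\<And>w. w \<in> T \<Longrightarrow> (V has_field_derivative f (exp w) * exp w) (at w within T)"
    using holomorphic_convex_primitive'[of T "\<lambda>w. f (exp w) * exp w"] convex_strip open_strip unfolding T_def by blast
  show thesis
  proof (rule that[of "\<lambda>t. V (Ln t)"])
    fix t assume t: "t \<in> slit_exterior R"
    have t': "t \<notin> \<real>\<^sub>\<le>\<^sub>0" "t \<noteq> 0" using t R slit_exterior_iff[of R t] by auto
    have mem: "Ln t \<in> T" using slit_exterior_strip(1)[OF R t] by (simp add: T_def)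
    have "open T" unfolding T_def by (rule open_strip)
    have "(V has_field_derivative f (exp (Ln t)) * exp (Ln t)) (at (Ln t))"
      using V[OF mem] unfolding at_within_open[OF mem \<open>open T\<close>] .
    from DERIV_chain2[OF this has_field_derivative_Ln[OF t'(1)]]
    show "((\<lambda>t. V (Ln t)) has_field_derivative f t) (at t)" using t' by (simp add: field_simps)
  qed
qed

lemma slit_exterior_constant:
  assumes R: "R > 0" and D: "\<And>t. t \<in> slit_exterior R \<Longrightarrow> (D has_field_derivative 0) (at t)"
  obtains c where "\<And>t. t \<in> slit_exterior R \<Longrightarrow> D t = c"
proof -
  define T where "T = {w. Re w > ln R \<and> Im w > - pi \<and> Im w < pi}"
  have "\<And>w. w \<in> T \<Longrightarrow> ((\<lambda>w. D (exp w)) has_field_derivative 0) (at w within T)"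
  proof -
    fix w assume "w \<in> T"
    then have "exp w \<in> slit_exterior R" using slit_exterior_strip(2)[OF R] by (simp add: T_def)
    from DERIV_chain2[OF D[OF this] DERIV_exp]
    show "((\<lambda>w. D (exp w)) has_field_derivative 0) (at w within T)" by (simp add: has_field_derivative_at_within)
  qed
  then obtain c where c: "\<And>w. w \<in> T \<Longrightarrow> D (exp w) = c"
    using has_field_derivative_zero_constant[of T "\<lambda>w. D (exp w)"] convex_strip unfolding T_def by blast
  show thesis
  proof (rule that[of c])
    fix t assume t: "t \<in> slit_exterior R"
    then have "t \<noteq> 0" using R by (auto simp: slit_exterior_def)
    then show "D t = c" using c[of "Ln t"] slit_exterior_strip(1)[OF R t] by (simp add: T_def)
  qed
qed

section \<open>The transform of the normalised kernel\<close>

definition gauss_kernel :: "complex \<Rightarrow> (complex \<Rightarrow> complex) \<Rightarrow> complex \<Rightarrow> complex" where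
  "gauss_kernel \<kappa> U t = exp (t\<^sup>2 / 2) * t powr \<kappa> * U (1 / t)"

lemma gaussian_complete: "- y\<^sup>2 / 2 + b * y = b\<^sup>2 / 2 + (- (y - b)\<^sup>2 / 2)" for y b :: real
  by (simp add: power2_eq_square field_simps)

text \<open>Two radii are kept apart so that \<open>1 / t\<close> stays in a compact part of the
  domain of \<open>U\<close> for \<open>cmod t \<ge> R\<close>, which bounds
  \<open>U (1 / t)\<close> along all contours.\<close>

locale gauss_laplace =
  fixes \<kappa> :: complex and U :: "complex \<Rightarrow> complex" and R0 R :: real
  assumes R0: "0 < R0" and R: "R0 < R" and U: "U holomorphic_on ball 0 (1 / R0)" and U0: "U 0 \<noteq> 0"
begin

abbreviation "S \<equiv> slit_exterior R0"

definition integrand :: "complex \<Rightarrow> complex \<Rightarrow> complex" where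
  "integrand z t = gauss_kernel \<kappa> U t * exp (- z * t)"

definition L :: "complex \<Rightarrow> complex" where
  "L z = laplace_contour_integral R (gauss_kernel \<kappa> U) z"

lemma S_iff: "t \<in> S \<longleftrightarrow> cmod t > R0 \<and> t \<notin> \<real>\<^sub>\<le>\<^sub>0"
  using R0 by (intro slit_exterior_iff) auto

lemma S_Im: "cmod t > R0 \<Longrightarrow> Im t \<noteq> 0 \<Longrightarrow> t \<in> S"
  by (auto simp: S_iff complex_nonpos_Reals_iff)

lemma S_Re: "cmod t > R0 \<Longrightarrow> Re t > 0 \<Longrightarrow> t \<in> S"
  by (auto simp: S_iff complex_nonpos_Reals_iff)

lemma holomorphic_integrand: "integrand z holomorphic_on S"
proof -
  have "(\<lambda>t. U (1 / t)) holomorphic_on S"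
  proof (rule holomorphic_on_compose_gen[OF _ U, unfolded o_def])
    show "(\<lambda>t. 1 / t) ` S \<subseteq> ball 0 (1 / R0)"
    proof (intro image_subsetI)
      fix t assume "t \<in> S"
      then have "cmod t > R0" by (simp add: S_iff)
      then have "1 / cmod t < 1 / R0" using R0 by (intro frac_less2) auto
      then show "1 / t \<in> ball 0 (1 / R0)" by (simp add: norm_divide)
    qed
    show "(\<lambda>t. 1 / t) holomorphic_on S" using R0 by (intro holomorphic_intros) (auto simp: S_iff)
  qed
  then show ?thesis unfolding integrand_def gauss_kernel_def
    by (intro holomorphic_intros) (auto simp: S_iff)
qed

lemma continuous_integrand: "continuous_on S (integrand z)"
  using holomorphic_integrand by (rule holomorphic_on_imp_continuous_on)

text \<open>An arbitrary primitive is chosen for each \<open>z\<close>; nothing is known about its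
  dependence on \<open>z\<close>, and only differences of its values are estimated.\<close>

definition prim :: "complex \<Rightarrow> complex \<Rightarrow> complex" where
  "prim z = (SOME W. \<forall>t\<in>S. (W has_field_derivative integrand z t) (at t))"

lemma prim: "t \<in> S \<Longrightarrow> (prim z has_field_derivative integrand z t) (at t)"
proof -
  have "\<exists>W. \<forall>t\<in>S. (W has_field_derivative integrand z t) (at t)"
    using slit_exterior_primitive[OF R0 holomorphic_integrand] by metis
  from someI_ex[OF this] show "t \<in> S \<Longrightarrow> (prim z has_field_derivative integrand z t) (at t)"
    unfolding prim_def by blast
qed

lemma U_bounded: "\<exists>B>0. \<forall>t. cmod t \<ge> R \<longrightarrow> norm (U (1 / t)) \<le> B"
proof -
  have "1 / R < 1 / R0" using R R0 by (intro frac_less2) auto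
  then have "cball 0 (1 / R) \<subseteq> ball (0::complex) (1 / R0)" by auto
  then have "continuous_on (cball 0 (1 / R)) U" using U by (meson holomorphic_on_imp_continuous_on continuous_on_subset)
  then have "compact (U ` cball 0 (1 / R))" by (intro compact_continuous_image) auto
  then obtain B where B: "B > 0" "\<And>s. s \<in> cball 0 (1 / R) \<Longrightarrow> norm (U s) \<le> B"
    using compact_imp_bounded[of "U ` cball 0 (1 / R)"]
    by (auto simp: bounded_pos)
  have "norm (U (1 / t)) \<le> B" if "cmod t \<ge> R" for t
  proof (rule B(2))
    have "1 / cmod t \<le> 1 / R" using that R R0 by (intro frac_le) auto
    then show "1 / t \<in> cball 0 (1 / R)" by (simp add: norm_divide)
  qed
  then show ?thesis using B(1) by blast
qed

text \<open>The power \<open>t powr \<kappa>\<close> is bounded by an exponential of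
  \<open>cmod t\<close>, through \<open>ln (cmod t) \<le> cmod t\<close>. Losses of exponential type
  are harmless in the upper bounds.\<close>

lemma kernel_bound: "\<exists>M>0. \<forall>t. cmod t \<ge> R \<longrightarrow> norm (gauss_kernel \<kappa> U t) \<le> M * exp (Re (t\<^sup>2) / 2 + cmod \<kappa> * cmod t)"
proof -
  obtain B where B: "B > 0" "\<And>t. cmod t \<ge> R \<Longrightarrow> norm (U (1 / t)) \<le> B" using U_bounded by blast
  define M where "M = exp (cmod \<kappa> * (\<bar>ln R\<bar> + pi)) * B"
  have "norm (gauss_kernel \<kappa> U t) \<le> M * exp (Re (t\<^sup>2) / 2 + cmod \<kappa> * cmod t)" if t: "cmod t \<ge> R" for t
  proof -
    have tp: "cmod t > 0" "t \<noteq> 0" using t R R0 by auto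
    have "norm (Ln t) \<le> \<bar>ln (cmod t)\<bar> + \<bar>Im (Ln t)\<bar>" using cmod_le[of "Ln t"] tp by simp
    also have "\<bar>Im (Ln t)\<bar> \<le> pi" using Im_Ln_le_pi[OF tp(2)] mpi_less_Im_Ln[OF tp(2)] by simp
    also have "\<bar>ln (cmod t)\<bar> \<le> cmod t + \<bar>ln R\<bar>"
    proof -
      have "ln (cmod t) \<le> cmod t" using ln_le_minus_one[OF tp(1)] by simp
      moreover have "ln R \<le> ln (cmod t)" using t R R0 tp by (subst ln_le_cancel_iff) auto
      ultimately show ?thesis using tp by linarith
    qed
    finally have "cmod \<kappa> * norm (Ln t) \<le> cmod \<kappa> * (cmod t + \<bar>ln R\<bar> + pi)" by (intro mult_left_mono) auto
    moreover have "Re (\<kappa> * Ln t) \<le> cmod \<kappa> * norm (Ln t)" using complex_Re_le_cmod[of "\<kappa> * Ln t"] by (simp add: norm_mult)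
    ultimately have "norm (t powr \<kappa>) \<le> exp (cmod \<kappa> * (cmod t + \<bar>ln R\<bar> + pi))" using tp by (simp add: powr_def)
    then have "norm (gauss_kernel \<kappa> U t) \<le> exp (Re (t\<^sup>2) / 2) * exp (cmod \<kappa> * (cmod t + \<bar>ln R\<bar> + pi)) * B"
      unfolding gauss_kernel_def norm_mult by (intro mult_mono B t) auto
    also have "\<dots> = M * exp (Re (t\<^sup>2) / 2 + cmod \<kappa> * cmod t)"
      by (simp add: M_def ring_distribs mult_ac flip: exp_add)
    finally show ?thesis .
  qed
  moreover have "M > 0" using B by (simp add: M_def)
  ultimately show ?thesis by blast
qed

definition M :: real where
  "M = (SOME M. M > 0 \<and> (\<forall>t. cmod t \<ge> R \<longrightarrow> norm (gauss_kernel \<kappa> U t) \<le> M * exp (Re (t\<^sup>2) / 2 + cmod \<kappa> * cmod t)))"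

lemma M: "M > 0" and norm_kernel: "cmod t \<ge> R \<Longrightarrow> norm (gauss_kernel \<kappa> U t) \<le> M * exp (Re (t\<^sup>2) / 2 + cmod \<kappa> * cmod t)"
  using someI_ex[OF kernel_bound] unfolding M_def by blast+

lemma norm_integrand: "cmod t \<ge> R \<Longrightarrow> norm (integrand z t) \<le> M * exp (Re (t\<^sup>2) / 2 + cmod \<kappa> * cmod t - Re (z * t))"
proof -
  assume t: "cmod t \<ge> R"
  have "norm (integrand z t) = norm (gauss_kernel \<kappa> U t) * exp (- Re (z * t))" by (simp add: integrand_def norm_mult)
  also have "\<dots> \<le> M * exp (Re (t\<^sup>2) / 2 + cmod \<kappa> * cmod t) * exp (- Re (z * t))"
    by (intro mult_right_mono norm_kernel t) simp
  also have "\<dots> = M * exp (Re (t\<^sup>2) / 2 + cmod \<kappa> * cmod t - Re (z * t))"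
    by (simp only: mult.assoc exp_add[symmetric] diff_conv_add_uminus)
  finally show ?thesis .
qed

lemma prim_diff_bound:
  assumes "closed_segment a b \<subseteq> S" "\<And>t. t \<in> closed_segment a b \<Longrightarrow> norm (integrand z t) \<le> B"
  shows "norm (prim z b - prim z a) \<le> B * norm (b - a)"
  by (rule field_differentiable_bound[of "closed_segment a b" _ "integrand z"])
     (use assms in \<open>auto intro!: has_field_derivative_at_within[OF prim]\<close>)

lemma vertical_bound:
  assumes d: "d = \<i> \<or> d = - \<i>" and y: "y \<ge> 0" "cmod (of_real x + d * of_real y) \<ge> R"
  shows "norm (integrand z (of_real x + d * of_real y)) \<le> M * exp (x\<^sup>2 / 2 - y\<^sup>2 / 2 + (cmod \<kappa> + cmod z) * (\<bar>x\<bar> + y))"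
proof -
  define t where "t = of_real x + d * of_real y"
  have 1: "Re (t\<^sup>2) = x\<^sup>2 - y\<^sup>2" using d by (auto simp: t_def power2_eq_square)
  have 2: "cmod t \<le> \<bar>x\<bar> + y" using norm_triangle_ineq[of "of_real x" "d * of_real y"] d y by (auto simp: t_def norm_mult)
  have "- Re (z * t) \<le> cmod z * cmod t" using abs_Re_le_cmod[of "z * t"] by (simp add: norm_mult)
  then have "Re (t\<^sup>2) / 2 + cmod \<kappa> * cmod t - Re (z * t) \<le> x\<^sup>2 / 2 - y\<^sup>2 / 2 + (cmod \<kappa> + cmod z) * cmod t"
    by (simp add: 1 distrib_right diff_divide_distrib)
  also have "\<dots> \<le> x\<^sup>2 / 2 - y\<^sup>2 / 2 + (cmod \<kappa> + cmod z) * (\<bar>x\<bar> + y)"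
    using 2 by (intro add_left_mono mult_left_mono) auto
  finally have "M * exp (Re (t\<^sup>2) / 2 + cmod \<kappa> * cmod t - Re (z * t)) \<le> M * exp (x\<^sup>2 / 2 - y\<^sup>2 / 2 + (cmod \<kappa> + cmod z) * (\<bar>x\<bar> + y))"
    using M by (intro mult_left_mono) auto
  then show ?thesis using norm_integrand[of t z] y unfolding t_def by linarith
qed

lemma vertical_in_S: "d = \<i> \<or> d = - \<i> \<Longrightarrow> y \<ge> R \<Longrightarrow> of_real x + d * of_real y \<in> S \<and> cmod (of_real x + d * of_real y) \<ge> R"
proof -
  assume d: "d = \<i> \<or> d = - \<i>" and y: "y \<ge> R"
  have "\<bar>Im (of_real x + d * of_real y)\<bar> = y" using d y R R0 by auto
  then have "cmod (of_real x + d * of_real y) \<ge> R" "Im (of_real x + d * of_real y) \<noteq> 0"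
    using abs_Im_le_cmod[of "of_real x + d * of_real y"] y R R0 by auto
  then show ?thesis using S_Im R by auto
qed

text \<open>A horizontal segment at height \<open>N\<close> contributes a Gaussian small amount,
  hence the primitive has the same limit on every vertical line. This is the deformation of the
  contour.\<close>

lemma vertical_limit:
  assumes d: "d = \<i> \<or> d = - \<i>"
  shows "set_integrable lborel {R..} (\<lambda>y. integrand z (d * of_real y))"
    "((\<lambda>N. prim z (of_real x + d * of_real N)) \<longlongrightarrow> prim z (d * of_real R) + d * (LINT y:{R..}|lborel. integrand z (d * of_real y))) at_top"
proof -
  define b where "b = cmod \<kappa> + cmod z"
  have ray: "0 + d * of_real y \<in> S" if "y \<ge> R" for y using vertical_in_S[OF d that, of 0] by simp
  have bd: "norm (integrand z (0 + d * of_real y)) \<le> (M * exp (b\<^sup>2 / 2)) * exp (- (y - b)\<^sup>2 / 2)" if "y \<ge> R" for y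
  proof -
    have "norm (integrand z (of_real 0 + d * of_real y)) \<le> M * exp (0\<^sup>2 / 2 - y\<^sup>2 / 2 + b * (\<bar>0\<bar> + y))"
      unfolding b_def using vertical_in_S[OF d that, of 0] that R R0 by (intro vertical_bound d) auto
    also have "0\<^sup>2 / 2 - y\<^sup>2 / 2 + b * (\<bar>0\<bar> + y) = b\<^sup>2 / 2 + (- (y - b)\<^sup>2 / 2)" using gaussian_complete[of y b] by simp
    finally show ?thesis by (simp only: exp_add mult.assoc of_real_0)
  qed
  note lim = ray_primitive_limit[OF prim continuous_integrand ray bd, simplified]
  show "set_integrable lborel {R..} (\<lambda>y. integrand z (d * of_real y))" using lim(1) .
  have "((\<lambda>N. prim z (of_real x + d * of_real N) - prim z (d * of_real N)) \<longlongrightarrow> 0) at_top"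
  proof (rule Lim_null_comparison)
    show "\<forall>\<^sub>F N in at_top. norm (prim z (of_real x + d * of_real N) - prim z (d * of_real N))
        \<le> M * exp (x\<^sup>2 / 2 - N\<^sup>2 / 2 + b * (\<bar>x\<bar> + N)) * \<bar>x\<bar>"
      using eventually_ge_at_top[of R]
    proof eventually_elim
      case (elim N)
      have seg: "\<exists>u. \<bar>u\<bar> \<le> \<bar>x\<bar> \<and> t = of_real u + d * of_real N" if "t \<in> closed_segment (d * of_real N) (of_real x + d * of_real N)" for t
      proof -
        from that obtain u where u: "0 \<le> u" "u \<le> 1" "t = (1 - u) *\<^sub>R (d * of_real N) + u *\<^sub>R (of_real x + d * of_real N)"
          by (auto simp: in_segment)
        then have "t = of_real (u * x) + d * of_real N" by (simp add: scaleR_conv_of_real algebra_simps)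
        moreover have "\<bar>u * x\<bar> \<le> \<bar>x\<bar>" using u by (simp add: abs_mult mult_left_le_one_le)
        ultimately show ?thesis by blast
      qed
      have "norm (prim z (of_real x + d * of_real N) - prim z (d * of_real N)) \<le>
        M * exp (x\<^sup>2 / 2 - N\<^sup>2 / 2 + b * (\<bar>x\<bar> + N)) * norm (of_real x + d * of_real N - d * of_real N)"
      proof (rule prim_diff_bound)
        show "closed_segment (d * of_real N) (of_real x + d * of_real N) \<subseteq> S"
          using seg vertical_in_S[OF d elim] by blast
        fix t assume "t \<in> closed_segment (d * of_real N) (of_real x + d * of_real N)"
        then obtain u where u: "\<bar>u\<bar> \<le> \<bar>x\<bar>" "t = of_real u + d * of_real N" using seg by blast
        have "norm (integrand z t) \<le> M * exp (u\<^sup>2 / 2 - N\<^sup>2 / 2 + b * (\<bar>u\<bar> + N))"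
          unfolding u(2) b_def using elim R R0 vertical_in_S[OF d elim] by (intro vertical_bound d) auto
        also have "\<dots> \<le> M * exp (x\<^sup>2 / 2 - N\<^sup>2 / 2 + b * (\<bar>x\<bar> + N))"
        proof -
          have "u\<^sup>2 \<le> x\<^sup>2" using u(1) by (simp add: abs_le_square_iff)
          moreover have "b * (\<bar>u\<bar> + N) \<le> b * (\<bar>x\<bar> + N)" using u(1) by (intro mult_left_mono) (auto simp: b_def)
          ultimately show ?thesis using M by (intro mult_left_mono) auto
        qed
        finally show "norm (integrand z t) \<le> M * exp (x\<^sup>2 / 2 - N\<^sup>2 / 2 + b * (\<bar>x\<bar> + N))" .
      qed
      then show ?case by simp
    qed
    show "((\<lambda>N. M * exp (x\<^sup>2 / 2 - N\<^sup>2 / 2 + b * (\<bar>x\<bar> + N)) * \<bar>x\<bar>) \<longlongrightarrow> 0) at_top" by (rule gaussian_decay)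
  qed
  from tendsto_add[OF this lim(2)]
  show "((\<lambda>N. prim z (of_real x + d * of_real N)) \<longlongrightarrow> prim z (d * of_real R) + d * (LINT y:{R..}|lborel. integrand z (d * of_real y))) at_top"
    by simp
qed

text \<open>This is the limit of \<open>prim z\<close> at infinity along the ray in direction \<open>d\<close>.\<close>

definition end_value :: "complex \<Rightarrow> complex \<Rightarrow> complex" where
  "end_value z d = prim z (d * of_real R) + d * (LINT y:{R..}|lborel. integrand z (d * of_real y))"

text \<open>The three pieces of the contour telescope for a primitive. From here on each end value
  may be computed along any convenient path.\<close>

lemma L_eq_ends: "2 * of_real pi * \<i> * L z = end_value z (- \<i>) - end_value z \<i>"
proof -
  have "integral {R..} (\<lambda>r. integrand z (d * of_real r)) = (LINT y:{R..}|lborel. integrand z (d * of_real y))" if "d = \<i> \<or> d = - \<i>" for d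
    using set_borel_integral_eq_integral(2)[OF vertical_limit(1)[OF that, of z]] by simp
  then have 1: "integral {R..} (\<lambda>r. gauss_kernel \<kappa> U (d * of_real r) * exp (- z * (d * of_real r)) * d) = d * (LINT y:{R..}|lborel. integrand z (d * of_real y))"
    if "d = \<i> \<or> d = - \<i>" for d using that by (simp only: integrand_def[symmetric]) (simp add: mult.commute[of _ d])
  have "(integrand z has_contour_integral (prim z (pathfinish (part_circlepath 0 R (pi / 2) (- (pi / 2)))) - prim z (pathstart (part_circlepath 0 R (pi / 2) (- (pi / 2))))))
     (part_circlepath 0 R (pi / 2) (- (pi / 2)))"
  proof (rule contour_integral_primitive[where S = S])
    show "path_image (part_circlepath 0 R (pi / 2) (- (pi / 2))) \<subseteq> S"
    proof
      fix t assume "t \<in> path_image (part_circlepath 0 R (pi / 2) (- (pi / 2)))"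
      then have "t \<in> (\<lambda>\<theta>. of_real R * cis \<theta>) ` {- (pi / 2)..pi / 2}"
        using pi_gt_zero by (simp add: path_image_part_circlepath' closed_segment_eq_real_ivl split: if_splits)
      then obtain \<theta> where t: "t = of_real R * cis \<theta>" "\<theta> \<in> {- (pi / 2)..pi / 2}"
        by (rule imageE)
      have n: "cmod t = R" using t R R0 by (simp add: norm_mult)
      have "Re t = R * cos \<theta>" "Im t = R * sin \<theta>" using t(1) by simp_all
      moreover have "cos \<theta> \<ge> 0" using t by (intro cos_ge_zero) auto
      moreover have "cos \<theta> = 0 \<Longrightarrow> sin \<theta> \<noteq> 0" using sin_cos_squared_add[of \<theta>] by auto
      ultimately have "Re t > 0 \<or> Im t \<noteq> 0" using R R0 by (auto simp: less_le)
      then show "t \<in> S" using S_Re S_Im n R by auto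
    qed
  qed (auto intro: prim has_field_derivative_at_within)
  moreover have "pathfinish (part_circlepath 0 R (pi / 2) (- (pi / 2))) = - \<i> * of_real R"
      "pathstart (part_circlepath 0 R (pi / 2) (- (pi / 2))) = \<i> * of_real R"
    unfolding pathfinish_part_circlepath pathstart_part_circlepath cis_conv_exp[symmetric] by (simp_all add: complex_eq_iff)
  moreover have "integrand z = (\<lambda>t. gauss_kernel \<kappa> U t * exp (- z * t))" by (simp add: integrand_def fun_eq_iff)
  ultimately have 2: "contour_integral (part_circlepath 0 R (pi / 2) (- (pi / 2))) (\<lambda>t. gauss_kernel \<kappa> U t * exp (- z * t)) = prim z (- \<i> * of_real R) - prim z (\<i> * of_real R)"
    by (intro contour_integral_unique) (simp only:)
  show ?thesis
    unfolding L_def laplace_contour_integral_def 2 using 1[of \<i>] 1[of "- \<i>"]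
    by (simp add: end_value_def)
qed

end

text \<open>The summand 1 lets a single constant absorb multiplicative factors, and makes the notion
  stable under sums and multiples.\<close>

definition exp_type_on :: "complex set \<Rightarrow> (complex \<Rightarrow> complex) \<Rightarrow> bool" where
  "exp_type_on Z f \<longleftrightarrow> (\<exists>C\<ge>0. \<forall>z\<in>Z. norm (f z) \<le> exp (C * (norm z + 1)))"

lemma exp_type_onI:
  assumes "\<And>z. z \<in> Z \<Longrightarrow> norm (f z) \<le> A * exp (B * norm z)"
  shows "exp_type_on Z f"
proof -
  define C where "C = max \<bar>A\<bar> \<bar>B\<bar>"
  have "norm (f z) \<le> exp (C * (norm z + 1))" if "z \<in> Z" for z
  proof -
    have "A \<le> exp \<bar>A\<bar>" using exp_ge_add_one_self[of "\<bar>A\<bar>"] by linarith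
    also have "\<dots> \<le> exp C" by (simp add: C_def)
    finally have "A * exp (B * norm z) \<le> exp C * exp (C * norm z)"
      by (intro mult_mono) (auto simp: C_def max_def intro!: mult_right_mono)
    also have "\<dots> = exp (C * (norm z + 1))" by (simp add: algebra_simps flip: exp_add)
    finally show ?thesis using assms[OF that] by linarith
  qed
  moreover have "C \<ge> 0" by (simp add: C_def)
  ultimately show ?thesis unfolding exp_type_on_def by blast
qed

lemma exp_type_on_add:
  assumes "exp_type_on Z f" "exp_type_on Z g"
  shows "exp_type_on Z (\<lambda>z. f z + g z)"
proof -
  obtain C D where C: "C \<ge> 0" "\<And>z. z \<in> Z \<Longrightarrow> norm (f z) \<le> exp (C * (norm z + 1))"
    and D: "D \<ge> 0" "\<And>z. z \<in> Z \<Longrightarrow> norm (g z) \<le> exp (D * (norm z + 1))"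
    using assms unfolding exp_type_on_def by blast
  show ?thesis
  proof (rule exp_type_onI[where A = "2 * exp (C + D)" and B = "C + D"])
    fix z assume z: "z \<in> Z"
    have "norm (f z + g z) \<le> exp (C * (norm z + 1)) + exp (D * (norm z + 1))"
      using norm_triangle_ineq[of "f z" "g z"] C(2)[OF z] D(2)[OF z] by linarith
    also have "\<dots> \<le> exp ((C + D) * (norm z + 1)) + exp ((C + D) * (norm z + 1))"
      using C(1) D(1) by (intro add_mono) (auto intro!: mult_right_mono)
    also have "\<dots> = 2 * exp (C + D) * exp ((C + D) * norm z)" by (simp add: algebra_simps flip: exp_add)
    finally show "norm (f z + g z) \<le> 2 * exp (C + D) * exp ((C + D) * norm z)" .
  qed
qed

lemma exp_type_on_cmult:
  assumes "exp_type_on Z f"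
  shows "exp_type_on Z (\<lambda>z. c * f z)"
proof -
  obtain C where C: "C \<ge> 0" "\<And>z. z \<in> Z \<Longrightarrow> norm (f z) \<le> exp (C * (norm z + 1))"
    using assms unfolding exp_type_on_def by blast
  show ?thesis
  proof (rule exp_type_onI[where A = "norm c * exp C" and B = C])
    fix z assume "z \<in> Z"
    then have "norm (c * f z) \<le> norm c * exp (C * (norm z + 1))" unfolding norm_mult by (intro mult_left_mono C) auto
    then show "norm (c * f z) \<le> norm c * exp C * exp (C * norm z)" by (simp add: algebra_simps exp_add)
  qed
qed

lemma exp_type_on_diff: "exp_type_on Z f \<Longrightarrow> exp_type_on Z g \<Longrightarrow> exp_type_on Z (\<lambda>z. f z - g z)"
  using exp_type_on_add[of Z f "\<lambda>z. (- 1) * g z"] exp_type_on_cmult[of Z g "- 1"] by simp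

lemma exp_type_on_subset: "exp_type_on Z f \<Longrightarrow> Y \<subseteq> Z \<Longrightarrow> exp_type_on Y f"
  unfolding exp_type_on_def by blast

text \<open>The integrals truncated at \<open>a + n\<close> are holomorphic by differentiation under
  the integral sign. A common Gaussian majorant for \<open>z\<close> in a unit disc makes them
  converge uniformly there.\<close>

lemma holomorphic_gaussian_transform:
  fixes g p :: "real \<Rightarrow> complex"
  assumes g: "continuous_on {a..} g" "\<And>y. y \<ge> a \<Longrightarrow> norm (g y) \<le> A * exp (- y\<^sup>2 / 2 + B * y)"
    and p: "continuous_on {a..} p" "\<And>y. y \<ge> a \<Longrightarrow> norm (p y) \<le> D + y" and a: "a \<ge> 0"
  shows "(\<lambda>z. LINT y:{a..}|lborel. g y * exp (- z * p y)) holomorphic_on UNIV"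
proof (rule holomorphic_uniform_sequence[OF open_UNIV])
  define F where "F = (\<lambda>(n::nat) z. LINT y:{a..a + real n}|lborel. g y * exp (- z * p y))"
  have A: "A \<ge> 0" using order_trans[OF norm_ge_zero g(2)[of a]] by (simp add: zero_le_mult_iff)
  have cont: "continuous_on {a..} (\<lambda>y. g y * exp (- z * p y))" for z by (intro continuous_intros g p)
  fix n
  have hol: "(\<lambda>z. integral (cbox a (a + real n)) (\<lambda>y. g y * exp (- z * p y))) holomorphic_on UNIV"
  proof (rule leibniz_rule_holomorphic[where fx = "\<lambda>z y. g y * (- p y) * exp (- z * p y)"])
    show "((\<lambda>z. g y * exp (- z * p y)) has_field_derivative g y * (- p y) * exp (- z * p y)) (at z within UNIV)" for z y
      by (auto intro!: derivative_eq_intros)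
    show "(\<lambda>y. g y * exp (- z * p y)) integrable_on cbox a (a + real n)" for z
      by (intro integrable_continuous continuous_on_subset[OF cont]) auto
    have sub: "UNIV \<times> cbox a (a + real n) \<subseteq> UNIV \<times> {a..}" by auto
    have "continuous_on (UNIV \<times> {a..}) (\<lambda>x. g (snd x))" "continuous_on (UNIV \<times> {a..}) (\<lambda>x. p (snd x))"
      by (rule continuous_on_compose2[OF g(1)]; auto intro!: continuous_intros)
         (rule continuous_on_compose2[OF p(1)]; auto intro!: continuous_intros)
    then have "continuous_on (UNIV \<times> {a..}) (\<lambda>(z, y). g y * (- p y) * exp (- z * p y))"
      unfolding case_prod_unfold by (intro continuous_intros)
    then show "continuous_on (UNIV \<times> cbox a (a + real n)) (\<lambda>(z, y). g y * (- p y) * exp (- z * p y))"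
      using sub continuous_on_subset by blast
  qed auto
  show "F n holomorphic_on UNIV"
  proof (rule holomorphic_transform[OF hol])
    fix z
    have "set_integrable lborel {a..a + real n} (\<lambda>y. g y * exp (- z * p y))"
      by (intro borel_integrable_atLeastAtMost' continuous_on_subset[OF cont]) auto
    then show "integral (cbox a (a + real n)) (\<lambda>y. g y * exp (- z * p y)) = F n z"
      by (simp add: F_def set_borel_integral_eq_integral)
  qed
next
  define F where "F = (\<lambda>(n::nat) z. LINT y:{a..a + real n}|lborel. g y * exp (- z * p y))"
  have A: "A \<ge> 0" using order_trans[OF norm_ge_zero g(2)[of a]] by (simp add: zero_le_mult_iff)
  have cont: "continuous_on {a..} (\<lambda>y. g y * exp (- z * p y))" for z by (intro continuous_intros g p)
  fix x :: complex
  define K where "K = norm x + 1"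
  define b where "b = B + K"
  define A' where "A' = A * exp (K * D + b\<^sup>2 / 2)"
  define G where "G = (\<lambda>y. A' * exp (- (y - b)\<^sup>2 / 2))"
  have bd: "norm (g y * exp (- z * p y)) \<le> G y" if y: "y \<ge> a" and z: "z \<in> cball x 1" for y z
  proof -
    have zK: "norm z \<le> K" using z norm_triangle_ineq2[of z x] by (simp add: K_def dist_norm norm_minus_commute)
    have "- Re (z * p y) \<le> norm z * norm (p y)" using abs_Re_le_cmod[of "z * p y"] by (simp add: norm_mult)
    also have "\<dots> \<le> K * (D + y)" using zK p(2)[OF y] by (intro mult_mono) (auto simp: K_def)
    finally have "norm (g y * exp (- z * p y)) \<le> (A * exp (- y\<^sup>2 / 2 + B * y)) * exp (K * (D + y))"
      unfolding norm_mult using A by (intro mult_mono g y) auto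
    also have "\<dots> = A * exp (K * D + (- y\<^sup>2 / 2 + b * y))" by (simp add: b_def algebra_simps flip: exp_add)
    also have "- y\<^sup>2 / 2 + b * y = b\<^sup>2 / 2 + (- (y - b)\<^sup>2 / 2)" by (simp add: power2_eq_square field_simps)
    also have "A * exp (K * D + (b\<^sup>2 / 2 + (- (y - b)\<^sup>2 / 2))) = G y" by (simp only: G_def A'_def exp_add mult.assoc)
    finally show ?thesis .
  qed
  have intG: "integrable lborel G" unfolding G_def by (intro integrable_mult_right integrable_gaussian)
  have sG: "set_integrable lborel X G" if "X \<in> sets lborel" for X
    unfolding set_integrable_def using that by (intro integrable_mult_indicator intG) auto
  have sg: "set_integrable lborel {a..} (\<lambda>y. g y * exp (- z * p y))" if z: "z \<in> cball x 1" for z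
    by (rule set_integrable_gaussian_bound(1)[OF cont, where M = A' and m = b]) (use bd z in \<open>auto simp: G_def\<close>)
  have "((\<lambda>t. LINT y:{a..t}|lborel. G y) \<longlongrightarrow> (LINT y:{a..}|lborel. G y)) at_top"
    by (rule tendsto_set_lebesgue_integral_at_top) (use sG in auto)
  then have "(\<lambda>n. LINT y:{a..a + real n}|lborel. G y) \<longlonglongrightarrow> (LINT y:{a..}|lborel. G y)"
    by (rule filterlim_compose) (auto intro!: filterlim_tendsto_add_at_top filterlim_real_sequentially)
  then have "(\<lambda>n. (LINT y:{a..}|lborel. G y) - (LINT y:{a..a + real n}|lborel. G y)) \<longlonglongrightarrow> (LINT y:{a..}|lborel. G y) - (LINT y:{a..}|lborel. G y)"
    by (intro tendsto_intros)
  then have lim: "(\<lambda>n. (LINT y:{a..}|lborel. G y) - (LINT y:{a..a + real n}|lborel. G y)) \<longlonglongrightarrow> 0" by simp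
  have diff: "norm (F n z - (LINT y:{a..}|lborel. g y * exp (- z * p y))) \<le> (LINT y:{a..}|lborel. G y) - (LINT y:{a..a + real n}|lborel. G y)"
    if z: "z \<in> cball x 1" for z n
  proof -
    have s1: "set_integrable lborel {a..a + real n} (\<lambda>y. g y * exp (- z * p y))" by (rule set_integrable_subset[OF sg[OF z]]) auto
    have i1: "integrable lborel (\<lambda>y. indicator {a..a + real n} y *\<^sub>R (g y * exp (- z * p y)) - indicator {a..} y *\<^sub>R (g y * exp (- z * p y)))"
      using s1 sg[OF z] unfolding set_integrable_def by (intro Bochner_Integration.integrable_diff)
    have i2: "integrable lborel (\<lambda>y. indicator {a..} y *\<^sub>R G y - indicator {a..a + real n} y *\<^sub>R G y)"
      using sG unfolding set_integrable_def by (intro Bochner_Integration.integrable_diff) auto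
    have "norm (LINT y|lborel. indicator {a..a + real n} y *\<^sub>R (g y * exp (- z * p y)) - indicator {a..} y *\<^sub>R (g y * exp (- z * p y)))
       \<le> (LINT y|lborel. indicator {a..} y *\<^sub>R G y - indicator {a..a + real n} y *\<^sub>R G y)"
      by (rule Bochner_Integration.integral_norm_bound_integral[OF i1 i2]) (use bd z in \<open>auto simp: indicator_def\<close>)
    then show ?thesis
      using s1 sg[OF z] sG unfolding F_def set_lebesgue_integral_def set_integrable_def
      by (simp add: Bochner_Integration.integral_diff)
  qed
  have "uniform_limit (cball x 1) F (\<lambda>z. LINT y:{a..}|lborel. g y * exp (- z * p y)) sequentially"
  proof (rule uniform_limitI)
    fix e :: real assume "e > 0"
    with lim have "\<forall>\<^sub>F n in sequentially. (LINT y:{a..}|lborel. G y) - (LINT y:{a..a + real n}|lborel. G y) < e"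
      by (rule order_tendstoD(2))
    then show "\<forall>\<^sub>F n in sequentially. \<forall>z\<in>cball x 1. dist (F n z) (LINT y:{a..}|lborel. g y * exp (- z * p y)) < e"
    proof eventually_elim
      case (elim n)
      show ?case
        unfolding dist_norm using le_less_trans[OF diff elim] by blast
    qed
  qed
  then show "\<exists>d>0. cball x d \<subseteq> UNIV \<and> uniform_limit (cball x d) (\<lambda>n z. LINT y:{a..a + real n}|lborel. g y * exp (- z * p y)) (\<lambda>z. LINT y:{a..}|lborel. g y * exp (- z * p y)) sequentially"
    unfolding F_def by (intro exI[of _ 1]) auto
qed

section \<open>Upper bounds by choice of the contour\<close>

context gauss_laplace
begin

text \<open>The vertical line through \<open>z\<close> passes through the saddle
  \<open>t = z\<close> of \<open>t\<^sup>2 / 2 - z * t\<close>. Completing the square in the height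
  produces \<open>- Re (z\<^sup>2) / 2\<close> and a Gaussian centred near
  \<open>\<bar>Im z\<bar>\<close>.\<close>

lemma norm_vertical_piece:
  assumes d: "d = \<i> \<or> d = - \<i>" and t: "cmod (of_real (Re z) + d * of_real y) \<ge> R" "y \<ge> 0"
  shows "norm (integrand z (of_real (Re z) + d * of_real y)) \<le>
     M * exp (- Re (z\<^sup>2) / 2 + cmod \<kappa> * (\<bar>Re z\<bar> + \<bar>Im z\<bar>) + (cmod \<kappa>)\<^sup>2 / 2) * exp (- (y - (\<bar>Im z\<bar> + cmod \<kappa>))\<^sup>2 / 2)"
proof -
  define x v b where "x = Re z" and "v = Im z" and "b = cmod \<kappa>"
  define u where "u = of_real x + d * of_real y"
  have 1: "Re (u\<^sup>2) = x\<^sup>2 - y\<^sup>2" using d by (auto simp: u_def power2_eq_square)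
  have 2: "cmod u \<le> \<bar>x\<bar> + y" using norm_triangle_ineq[of "of_real x" "d * of_real y"] d t by (auto simp: u_def norm_mult)
  have 3: "- Re (z * u) \<le> - x\<^sup>2 + \<bar>v\<bar> * y"
  proof -
    have "- Re (z * u) = - x\<^sup>2 + v * y \<or> - Re (z * u) = - x\<^sup>2 + (- v) * y" using d by (auto simp: u_def x_def v_def power2_eq_square)
    moreover have "v * y \<le> \<bar>v\<bar> * y" "(- v) * y \<le> \<bar>v\<bar> * y" using t(2) by (intro mult_right_mono; simp)+
    ultimately show ?thesis by linarith
  qed
  have 4: "b * cmod u \<le> b * (\<bar>x\<bar> + y)" using 2 by (intro mult_left_mono) (auto simp: b_def)
  have "Re (u\<^sup>2) / 2 + b * cmod u - Re (z * u) \<le> - x\<^sup>2 / 2 + b * \<bar>x\<bar> + (- y\<^sup>2 / 2 + (\<bar>v\<bar> + b) * y)"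
    using 1 3 4 by (simp add: algebra_simps)
  also have "- y\<^sup>2 / 2 + (\<bar>v\<bar> + b) * y = (\<bar>v\<bar> + b)\<^sup>2 / 2 + (- (y - (\<bar>v\<bar> + b))\<^sup>2 / 2)" by (rule gaussian_complete)
  also have "- x\<^sup>2 / 2 + b * \<bar>x\<bar> + ((\<bar>v\<bar> + b)\<^sup>2 / 2 + (- (y - (\<bar>v\<bar> + b))\<^sup>2 / 2))
     = (- Re (z\<^sup>2) / 2 + b * (\<bar>x\<bar> + \<bar>v\<bar>) + b\<^sup>2 / 2) + (- (y - (\<bar>v\<bar> + b))\<^sup>2 / 2)"
    by (simp add: x_def v_def power2_eq_square algebra_simps add_divide_distrib diff_divide_distrib)
  finally have "M * exp (Re (u\<^sup>2) / 2 + b * cmod u - Re (z * u)) \<le> M * exp ((- Re (z\<^sup>2) / 2 + b * (\<bar>x\<bar> + \<bar>v\<bar>) + b\<^sup>2 / 2) + (- (y - (\<bar>v\<bar> + b))\<^sup>2 / 2))"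
    using M by (intro mult_left_mono) auto
  also have "\<dots> = M * exp (- Re (z\<^sup>2) / 2 + b * (\<bar>x\<bar> + \<bar>v\<bar>) + b\<^sup>2 / 2) * exp (- (y - (\<bar>v\<bar> + b))\<^sup>2 / 2)" by (simp only: exp_add mult.assoc)
  finally show ?thesis using norm_integrand[of u z] t(1) unfolding u_def x_def v_def b_def by linarith
qed

lemma end_value_line:
  assumes d: "d = \<i> \<or> d = - \<i>" and a: "a \<ge> 0"
    and ray: "\<And>y. y \<ge> a \<Longrightarrow> of_real x + d * of_real y \<in> S \<and> cmod (of_real x + d * of_real y) \<ge> R"
  shows "end_value z d = prim z (of_real x + d * of_real a) + d * (LINT y:{a..}|lborel. integrand z (of_real x + d * of_real y))"
proof -
  define b where "b = cmod \<kappa> + cmod z"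
  have bd: "norm (integrand z (of_real x + d * of_real y)) \<le> (M * exp (x\<^sup>2 / 2 + b * \<bar>x\<bar> + b\<^sup>2 / 2)) * exp (- (y - b)\<^sup>2 / 2)" if "y \<ge> a" for y
  proof -
    have "norm (integrand z (of_real x + d * of_real y)) \<le> M * exp (x\<^sup>2 / 2 - y\<^sup>2 / 2 + b * (\<bar>x\<bar> + y))"
      unfolding b_def using ray[OF that] that a by (intro vertical_bound d) auto
    also have "x\<^sup>2 / 2 - y\<^sup>2 / 2 + b * (\<bar>x\<bar> + y) = (x\<^sup>2 / 2 + b * \<bar>x\<bar> + b\<^sup>2 / 2) + (- (y - b)\<^sup>2 / 2)"
      using gaussian_complete[of y b] by (simp add: algebra_simps)
    finally show ?thesis by (simp only: exp_add mult.assoc)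
  qed
  have r: "of_real x + d * of_real y \<in> S" if "y \<ge> a" for y using ray[OF that] by blast
  show ?thesis
    unfolding end_value_def
    using tendsto_unique[OF _ vertical_limit(2)[OF d, of z x] ray_primitive_limit(2)[OF prim continuous_integrand r bd]] by simp
qed

lemma norm_end_value_line:
  assumes d: "d = \<i> \<or> d = - \<i>" and a: "a \<ge> 0"
    and ray: "\<And>y. y \<ge> a \<Longrightarrow> of_real (Re z) + d * of_real y \<in> S \<and> cmod (of_real (Re z) + d * of_real y) \<ge> R"
  shows "norm (end_value z d - prim z (of_real (Re z) + d * of_real a)) \<le>
     M * exp (- Re (z\<^sup>2) / 2 + cmod \<kappa> * (\<bar>Re z\<bar> + \<bar>Im z\<bar>) + (cmod \<kappa>)\<^sup>2 / 2) * sqrt (2 * pi)"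
proof -
  have r: "of_real (Re z) + d * of_real y \<in> S" if "y \<ge> a" for y using ray[OF that] by blast
  have bd: "norm (integrand z (of_real (Re z) + d * of_real y)) \<le>
     M * exp (- Re (z\<^sup>2) / 2 + cmod \<kappa> * (\<bar>Re z\<bar> + \<bar>Im z\<bar>) + (cmod \<kappa>)\<^sup>2 / 2) * exp (- (y - (\<bar>Im z\<bar> + cmod \<kappa>))\<^sup>2 / 2)"
    if "y \<ge> a" for y using ray[OF that] that a by (intro norm_vertical_piece d) auto
  have "end_value z d - prim z (of_real (Re z) + d * of_real a) = d * (LINT y:{a..}|lborel. integrand z (of_real (Re z) + d * of_real y))"
    using end_value_line[OF d a ray] by simp
  then show ?thesis using ray_primitive_limit(3)[OF prim continuous_integrand r bd] d by (auto simp: norm_mult)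
qed

lemma right_ray: "x \<ge> R \<Longrightarrow> d = \<i> \<or> d = - \<i> \<Longrightarrow> of_real x + d * of_real y \<in> S \<and> cmod (of_real x + d * of_real y) \<ge> R"
proof -
  assume x: "x \<ge> R" and d: "d = \<i> \<or> d = - \<i>"
  have "Re (of_real x + d * of_real y) = x" using d by auto
  then have "cmod (of_real x + d * of_real y) \<ge> R" "Re (of_real x + d * of_real y) > 0"
    using complex_Re_le_cmod[of "of_real x + d * of_real y"] x R R0 by auto
  then show ?thesis using S_Re R by auto
qed

text \<open>For \<open>Re z \<ge> R\<close> the whole vertical line through \<open>z\<close> avoids
  the disc, and the values at its foot cancel between the two ends. No maximum with 0 occurs in this
  bound.\<close>

lemma L_right_bound: "\<exists>C\<ge>0. \<forall>z. Re z \<ge> R \<longrightarrow> norm (L z) \<le> exp (- Re (z\<^sup>2) / 2 + C * (norm z + 1))"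
proof -
  define b where "b = cmod \<kappa>"
  have *: "norm (L z * exp (z\<^sup>2 / 2)) \<le> (M * exp (b\<^sup>2 / 2) * sqrt (2 * pi)) * exp (2 * b * norm z)" if z: "Re z \<ge> R" for z
  proof -
    define E where "E = M * exp (- Re (z\<^sup>2) / 2 + b * (\<bar>Re z\<bar> + \<bar>Im z\<bar>) + b\<^sup>2 / 2) * sqrt (2 * pi)"
    have e: "norm (end_value z d - prim z (of_real (Re z))) \<le> E" if d: "d = \<i> \<or> d = - \<i>" for d
      using norm_end_value_line[OF d _ right_ray[OF z d], of 0] by (simp add: E_def b_def)
    have "norm (2 * of_real pi * \<i> * L z) \<le> norm (end_value z (- \<i>) - prim z (of_real (Re z))) + norm (end_value z \<i> - prim z (of_real (Re z)))"
      unfolding L_eq_ends using norm_triangle_ineq4[of "end_value z (- \<i>) - prim z (of_real (Re z))" "end_value z \<i> - prim z (of_real (Re z))"] by simp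
    also have "\<dots> \<le> E + E" by (intro add_mono e) auto
    finally have "2 * pi * norm (L z) \<le> 2 * E" by (simp add: norm_mult)
    moreover have "2 * norm (L z) \<le> 2 * pi * norm (L z)" using pi_gt3 by (intro mult_right_mono) auto
    ultimately have "norm (L z) \<le> E" by linarith
    then have "norm (L z * exp (z\<^sup>2 / 2)) \<le> E * exp (Re (z\<^sup>2) / 2)" by (simp add: norm_mult)
    also have "\<dots> = M * exp (b * (\<bar>Re z\<bar> + \<bar>Im z\<bar>) + b\<^sup>2 / 2) * sqrt (2 * pi)"
    proof -
      have "exp (- Re (z\<^sup>2) / 2 + b * (\<bar>Re z\<bar> + \<bar>Im z\<bar>) + b\<^sup>2 / 2) * exp (Re (z\<^sup>2) / 2) = exp (b * (\<bar>Re z\<bar> + \<bar>Im z\<bar>) + b\<^sup>2 / 2)"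
        unfolding exp_add[symmetric] by simp
      then show ?thesis by (simp only: E_def mult_ac)
    qed
    also have "\<dots> \<le> M * exp (2 * b * norm z + b\<^sup>2 / 2) * sqrt (2 * pi)"
    proof -
      have "b * (\<bar>Re z\<bar> + \<bar>Im z\<bar>) \<le> b * (2 * norm z)"
        using abs_Re_le_cmod[of z] abs_Im_le_cmod[of z] by (intro mult_left_mono) (auto simp: b_def)
      then show ?thesis using M by (intro mult_right_mono mult_left_mono) auto
    qed
    finally show ?thesis by (simp add: exp_add mult_ac)
  qed
  have "exp_type_on {z. Re z \<ge> R} (\<lambda>z. L z * exp (z\<^sup>2 / 2))" by (rule exp_type_onI) (use * in auto)
  then obtain C where C: "C \<ge> 0" "\<And>z. Re z \<ge> R \<Longrightarrow> norm (L z * exp (z\<^sup>2 / 2)) \<le> exp (C * (norm z + 1))"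
    unfolding exp_type_on_def by auto
  have "norm (L z) \<le> exp (- Re (z\<^sup>2) / 2 + C * (norm z + 1))" if "Re z \<ge> R" for z
    using le_exp_diff[of "norm (L z)" "Re (z\<^sup>2) / 2" "C * (norm z + 1)"] C(2)[OF that] by (simp add: norm_mult algebra_simps)
  then show ?thesis using C(1) by blast
qed

text \<open>Both rays are moved to the fixed line of abscissa \<open>R\<close>. There the
  unspecified primitives cancel and only integrals depending holomorphically on \<open>z\<close> are
  left.\<close>

lemma L_entire: "L holomorphic_on UNIV"
proof -
  have hol: "(\<lambda>z. LINT y:{0..}|lborel. integrand z (of_real R + d * of_real y)) holomorphic_on UNIV" if d: "d = \<i> \<or> d = - \<i>" for d
  proof -
    have ray: "of_real R + d * of_real y \<in> S \<and> cmod (of_real R + d * of_real y) \<ge> R" for y using right_ray[OF order_refl d] .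
    have n: "cmod (of_real R + d * of_real y) \<le> R + y" if "y \<ge> 0" for y
      using norm_triangle_ineq[of "of_real R" "d * of_real y"] d that R R0 by (auto simp: norm_mult)
    have cg: "continuous_on S (gauss_kernel \<kappa> U)" using continuous_integrand[of 0] by (simp add: integrand_def[abs_def])
    show ?thesis
      unfolding integrand_def
    proof (rule holomorphic_gaussian_transform[where A = "M * exp (R\<^sup>2 / 2 + cmod \<kappa> * R)" and B = "cmod \<kappa>" and D = R])
      show "continuous_on {0..} (\<lambda>y. gauss_kernel \<kappa> U (of_real R + d * of_real y))"
        by (rule continuous_on_compose2[OF cg]) (use ray in \<open>auto intro!: continuous_intros\<close>)
      show "continuous_on {0..} (\<lambda>y. of_real R + d * of_real y)" by (intro continuous_intros)
      fix y :: real assume y: "0 \<le> y"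
      have "norm (gauss_kernel \<kappa> U (of_real R + d * of_real y)) \<le> M * exp (Re ((of_real R + d * of_real y)\<^sup>2) / 2 + cmod \<kappa> * cmod (of_real R + d * of_real y))"
        using ray by (intro norm_kernel) auto
      also have "\<dots> \<le> M * exp ((R\<^sup>2 / 2 + cmod \<kappa> * R) + (- y\<^sup>2 / 2 + cmod \<kappa> * y))"
      proof -
        have "Re ((of_real R + d * of_real y)\<^sup>2) = R\<^sup>2 - y\<^sup>2" using d by (auto simp: power2_eq_square)
        moreover have "cmod \<kappa> * cmod (of_real R + d * of_real y) \<le> cmod \<kappa> * (R + y)" using n[OF y] by (intro mult_left_mono) auto
        ultimately show ?thesis using M by (intro mult_left_mono) (auto simp: algebra_simps)
      qed
      finally show "norm (gauss_kernel \<kappa> U (of_real R + d * of_real y)) \<le> M * exp (R\<^sup>2 / 2 + cmod \<kappa> * R) * exp (- y\<^sup>2 / 2 + cmod \<kappa> * y)"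
        by (simp only: exp_add mult.assoc)
      show "cmod (of_real R + d * of_real y) \<le> R + y" using n[OF y] .
    qed simp
  qed
  have e: "end_value z d = prim z (of_real R) + d * (LINT y:{0..}|lborel. integrand z (of_real R + d * of_real y))" if d: "d = \<i> \<or> d = - \<i>" for d z
    using end_value_line[OF d _ right_ray[OF order_refl d], of 0 z] by simp
  have "L z = (1 / (2 * of_real pi * \<i>)) * ((- \<i>) * (LINT y:{0..}|lborel. integrand z (of_real R + (- \<i>) * of_real y)) - \<i> * (LINT y:{0..}|lborel. integrand z (of_real R + \<i> * of_real y)))" for z
    using L_eq_ends[of z] e[of "- \<i>" z] e[of \<i> z] by (simp add: field_simps)
  moreover have "(\<lambda>z. (1 / (2 * of_real pi * \<i>)) * ((- \<i>) * (LINT y:{0..}|lborel. integrand z (of_real R + (- \<i>) * of_real y)) - \<i> * (LINT y:{0..}|lborel. integrand z (of_real R + \<i> * of_real y)))) holomorphic_on UNIV"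
    by (intro holomorphic_intros hol) auto
  ultimately show ?thesis by (simp add: holomorphic_transform)
qed

text \<open>On this half plane \<open>exp (- z * t)\<close> grows at most like
  \<open>exp (\<bar>B\<bar> * y)\<close> along the ray, uniformly in \<open>z\<close>. The margin
  \<open>B\<close> leaves room for a later translation of \<open>z\<close>.\<close>

lemma ray_exp_type:
  assumes d: "d = \<i> \<or> d = - \<i>"
  shows "exp_type_on {z. Re (z * d) \<ge> - B} (\<lambda>z. LINT y:{R..}|lborel. integrand z (d * of_real y))"
proof -
  define b where "b = cmod \<kappa> + \<bar>B\<bar>"
  have *: "norm (LINT y:{R..}|lborel. integrand z (d * of_real y)) \<le> M * exp (b\<^sup>2 / 2) * sqrt (2 * pi)" if z: "Re (z * d) \<ge> - B" for z
  proof (rule set_integrable_gaussian_bound(2))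
    have ray: "d * of_real y \<in> S \<and> cmod (d * of_real y) \<ge> R" if "y \<ge> R" for y using vertical_in_S[OF d that, of 0] by simp
    show "continuous_on {R..} (\<lambda>y. integrand z (d * of_real y))"
      by (rule continuous_on_compose2[OF continuous_integrand]) (use ray in \<open>auto intro!: continuous_intros\<close>)
    fix y assume y: "y \<ge> R"
    then have y0: "y \<ge> 0" using R R0 by simp
    have "Re (z * (d * of_real y)) = Re (z * d) * y" by (simp add: mult.assoc[symmetric])
    moreover have "Re (z * d) * y \<ge> - \<bar>B\<bar> * y" using z y0 by (intro mult_right_mono) auto
    moreover have "Re ((d * of_real y)\<^sup>2) = - y\<^sup>2" "cmod (d * of_real y) = y" using d y0 by (auto simp: power2_eq_square norm_mult)
    ultimately have "Re ((d * of_real y)\<^sup>2) / 2 + cmod \<kappa> * cmod (d * of_real y) - Re (z * (d * of_real y)) \<le> - y\<^sup>2 / 2 + b * y"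
      by (simp add: b_def algebra_simps)
    also have "\<dots> = b\<^sup>2 / 2 + (- (y - b)\<^sup>2 / 2)" by (rule gaussian_complete)
    finally have "M * exp (Re ((d * of_real y)\<^sup>2) / 2 + cmod \<kappa> * cmod (d * of_real y) - Re (z * (d * of_real y))) \<le> M * exp (b\<^sup>2 / 2 + (- (y - b)\<^sup>2 / 2))"
      using M by (intro mult_left_mono) auto
    moreover have "norm (integrand z (d * of_real y)) \<le> M * exp (Re ((d * of_real y)\<^sup>2) / 2 + cmod \<kappa> * cmod (d * of_real y) - Re (z * (d * of_real y)))"
      using ray[OF y] by (intro norm_integrand) auto
    ultimately show "norm (integrand z (d * of_real y)) \<le> M * exp (b\<^sup>2 / 2) * exp (- (y - b)\<^sup>2 / 2)"
      by (simp only: exp_add mult.assoc)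
  qed
  then show ?thesis by (intro exp_type_onI[where A = "M * exp (b\<^sup>2 / 2) * sqrt (2 * pi)" and B = 0]) auto
qed

lemma segment_exp_type:
  assumes seg: "\<And>t. t \<in> closed_segment p q \<Longrightarrow> t \<in> S \<and> R \<le> cmod t \<and> cmod t \<le> K"
  shows "exp_type_on UNIV (\<lambda>z. prim z q - prim z p)"
proof (rule exp_type_onI)
  fix z
  have "cmod p \<le> K" using seg[of p] by auto
  then have K: "K \<ge> 0" by (rule order_trans[OF norm_ge_zero])
  have "norm (prim z q - prim z p) \<le> (M * exp (K\<^sup>2 / 2 + cmod \<kappa> * K + K * norm z)) * norm (q - p)"
  proof (rule prim_diff_bound)
    fix t assume t: "t \<in> closed_segment p q"
    have "Re (t\<^sup>2) \<le> (cmod t)\<^sup>2" using complex_Re_le_cmod[of "t\<^sup>2"] by (simp add: norm_power)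
    also have "\<dots> \<le> K\<^sup>2" using seg[OF t] by (intro power_mono) auto
    finally have 1: "Re (t\<^sup>2) \<le> K\<^sup>2" .
    have 2: "cmod \<kappa> * cmod t \<le> cmod \<kappa> * K" using seg[OF t] by (intro mult_left_mono) auto
    have "- Re (z * t) \<le> norm z * cmod t" using abs_Re_le_cmod[of "z * t"] by (simp add: norm_mult)
    also have "\<dots> \<le> norm z * K" using seg[OF t] by (intro mult_left_mono) auto
    finally have "Re (t\<^sup>2) / 2 + cmod \<kappa> * cmod t - Re (z * t) \<le> K\<^sup>2 / 2 + cmod \<kappa> * K + K * norm z"
      using 1 2 by (simp add: mult.commute)
    then have "M * exp (Re (t\<^sup>2) / 2 + cmod \<kappa> * cmod t - Re (z * t)) \<le> M * exp (K\<^sup>2 / 2 + cmod \<kappa> * K + K * norm z)"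
      using M by (intro mult_left_mono) auto
    then show "norm (integrand z t) \<le> M * exp (K\<^sup>2 / 2 + cmod \<kappa> * K + K * norm z)"
      using norm_integrand[of t z] seg[OF t] by linarith
  qed (use seg in auto)
  then show "norm (prim z q - prim z p) \<le> M * exp (K\<^sup>2 / 2 + cmod \<kappa> * K) * norm (q - p) * exp (K * norm z)"
    by (simp add: exp_add mult_ac)
qed

lemma corner_segments:
  assumes d: "d = \<i> \<or> d = - \<i>"
  shows "t \<in> closed_segment (d * of_real R) (of_real R + d * of_real R) \<Longrightarrow> t \<in> S \<and> R \<le> cmod t \<and> cmod t \<le> 2 * R"
    "t \<in> closed_segment (of_real R) (of_real R + d * of_real R) \<Longrightarrow> t \<in> S \<and> R \<le> cmod t \<and> cmod t \<le> 2 * R"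
proof -
  have Rp: "R > 0" using R R0 by simp
  {
    assume "t \<in> closed_segment (d * of_real R) (of_real R + d * of_real R)"
    then obtain u where u: "0 \<le> u" "u \<le> 1" "t = (1 - u) *\<^sub>R (d * of_real R) + u *\<^sub>R (of_real R + d * of_real R)"
      by (auto simp: in_segment)
    then have t: "t = of_real (u * R) + d * of_real R" by (simp add: scaleR_conv_of_real algebra_simps)
    have "cmod t \<le> \<bar>u * R\<bar> + R" using norm_triangle_ineq[of "of_real (u * R)" "d * of_real R"] d Rp by (auto simp: t norm_mult)
    moreover have "u * R \<le> 1 * R" "u * R \<ge> 0" using u Rp by (auto intro: mult_right_mono)
    ultimately show "t \<in> S \<and> R \<le> cmod t \<and> cmod t \<le> 2 * R"
      using vertical_in_S[OF d order_refl, of "u * R"] by (simp add: t)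
  }
  {
    assume "t \<in> closed_segment (of_real R) (of_real R + d * of_real R)"
    then obtain u where u: "0 \<le> u" "u \<le> 1" "t = (1 - u) *\<^sub>R (of_real R) + u *\<^sub>R (of_real R + d * of_real R)"
      by (auto simp: in_segment)
    then have t: "t = of_real R + d * of_real (u * R)" by (simp add: scaleR_conv_of_real algebra_simps)
    have "cmod t \<le> R + \<bar>u * R\<bar>" using norm_triangle_ineq[of "of_real R" "d * of_real (u * R)"] d Rp by (auto simp: t norm_mult)
    moreover have "u * R \<le> 1 * R" "u * R \<ge> 0" using u Rp by (auto intro: mult_right_mono)
    ultimately show "t \<in> S \<and> R \<le> cmod t \<and> cmod t \<le> 2 * R"
      using right_ray[OF order_refl d, of "u * R"] by (simp add: t)
  }
qed

text \<open>The quarter arc is replaced by two sides of a square, joined at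
  \<open>R + d * R\<close>, on which the integrand is controlled by the segment estimate.\<close>

lemma corner_exp_type:
  assumes d: "d = \<i> \<or> d = - \<i>"
  shows "exp_type_on UNIV (\<lambda>z. prim z (d * of_real R) - prim z (of_real R))"
proof -
  have 1: "exp_type_on UNIV (\<lambda>z. prim z (of_real R + d * of_real R) - prim z (d * of_real R))"
    by (rule segment_exp_type[OF corner_segments(1)[OF d]])
  have 2: "exp_type_on UNIV (\<lambda>z. prim z (of_real R + d * of_real R) - prim z (of_real R))"
    by (rule segment_exp_type[OF corner_segments(2)[OF d]])
  from exp_type_on_diff[OF 2 1] show ?thesis by simp
qed

text \<open>The segment at height \<open>R\<close> may be long, but
  \<open>u\<^sup>2 / 2 - x * u\<close> is a square centred at the end \<open>x\<close>, hence
  largest at the other end \<open>R\<close>. This prevents Gaussian growth.\<close>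

lemma horizontal_exp_type: "exp_type_on {z. Im z \<ge> 0} (\<lambda>z. prim z (of_real (Re z) + \<i> * of_real R) - prim z (of_real R + \<i> * of_real R))"
proof (rule exp_type_onI)
  fix z
  have Rp: "R > 0" using R R0 by simp
  define x where "x = Re z"
  define b where "b = cmod \<kappa>"
  define E where "E = R\<^sup>2 / 2 + 2 * b * R + (2 * R + b) * norm z"
  have x: "\<bar>x\<bar> \<le> norm z" unfolding x_def by (rule abs_Re_le_cmod)
  have seg: "\<exists>u. \<bar>u - x\<bar> \<le> \<bar>R - x\<bar> \<and> \<bar>u\<bar> \<le> norm z + R \<and> t = of_real u + \<i> * of_real R"
    if t: "t \<in> closed_segment (of_real R + \<i> * of_real R) (of_real x + \<i> * of_real R)" for t
  proof -
    from that obtain u where u: "0 \<le> u" "u \<le> 1" "t = (1 - u) *\<^sub>R (of_real R + \<i> * of_real R) + u *\<^sub>R (of_real x + \<i> * of_real R)"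
      by (auto simp: in_segment)
    define v where "v = (1 - u) * R + u * x"
    have "t = of_real v + \<i> * of_real R" using u(3) by (simp add: v_def scaleR_conv_of_real algebra_simps)
    moreover have "\<bar>v - x\<bar> \<le> \<bar>R - x\<bar>"
    proof -
      have "v - x = (1 - u) * (R - x)" by (simp add: v_def algebra_simps)
      then have "\<bar>v - x\<bar> = (1 - u) * \<bar>R - x\<bar>" using u by (simp add: abs_mult)
      also have "\<dots> \<le> 1 * \<bar>R - x\<bar>" using u by (intro mult_right_mono) auto
      finally show ?thesis by simp
    qed
    moreover have "\<bar>v\<bar> \<le> norm z + R"
    proof -
      have "\<bar>v\<bar> \<le> \<bar>(1 - u) * R\<bar> + \<bar>u * x\<bar>" unfolding v_def by (rule abs_triangle_ineq)
      also have "\<dots> \<le> 1 * R + 1 * \<bar>x\<bar>" unfolding abs_mult using u Rp by (intro add_mono mult_mono) auto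
      finally show ?thesis using x by simp
    qed
    ultimately show ?thesis by blast
  qed
  have "norm (prim z (of_real x + \<i> * of_real R) - prim z (of_real R + \<i> * of_real R)) \<le> (M * exp E) * norm (of_real x + \<i> * of_real R - (of_real R + \<i> * of_real R))"
  proof (rule prim_diff_bound)
    show "closed_segment (of_real R + \<i> * of_real R) (of_real x + \<i> * of_real R) \<subseteq> S"
      using seg vertical_in_S[of \<i> R] by blast
    fix t assume "t \<in> closed_segment (of_real R + \<i> * of_real R) (of_real x + \<i> * of_real R)"
    then obtain u where u: "\<bar>u - x\<bar> \<le> \<bar>R - x\<bar>" "\<bar>u\<bar> \<le> norm z + R" "t = of_real u + \<i> * of_real R" using seg by blast
    have "(u - x)\<^sup>2 \<le> (R - x)\<^sup>2" using u(1) by (simp add: abs_le_square_iff)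
    then have 1: "u\<^sup>2 / 2 - x * u \<le> R\<^sup>2 / 2 - x * R" by (simp add: power2_eq_square algebra_simps)
    have "(- x) * R \<le> norm z * R" using x Rp by (intro mult_right_mono) auto
    then have 2: "u\<^sup>2 / 2 - x * u \<le> R\<^sup>2 / 2 + norm z * R" using 1 by simp
    have 3: "Re (t\<^sup>2) = u\<^sup>2 - R\<^sup>2" by (simp add: u(3) power2_eq_square)
    have "cmod t \<le> \<bar>u\<bar> + R" using norm_triangle_ineq[of "of_real u" "\<i> * of_real R"] Rp by (simp add: u(3) norm_mult)
    then have "cmod t \<le> norm z + 2 * R" using u(2) by linarith
    then have 4: "b * cmod t \<le> b * (norm z + 2 * R)" by (intro mult_left_mono) (auto simp: b_def)
    have "Im z * R \<le> norm z * R" using abs_Im_le_cmod[of z] Rp by (intro mult_right_mono) auto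
    moreover have "Re (z * t) = x * u - Im z * R" by (simp add: u(3) x_def)
    ultimately have "- Re (z * t) \<le> - (x * u) + norm z * R" by simp
    then have "Re (t\<^sup>2) / 2 + b * cmod t - Re (z * t) \<le> (u\<^sup>2 / 2 - x * u) - R\<^sup>2 / 2 + b * (norm z + 2 * R) + norm z * R"
      using 3 4 by (simp add: diff_divide_distrib)
    also have "\<dots> = E + ((u\<^sup>2 / 2 - x * u) - (R\<^sup>2 / 2 + norm z * R)) - R\<^sup>2 / 2" by (simp add: E_def algebra_simps)
    also have "\<dots> \<le> E" using 2 zero_le_power2[of R] by linarith
    finally have "M * exp (Re (t\<^sup>2) / 2 + b * cmod t - Re (z * t)) \<le> M * exp E" using M by (intro mult_left_mono) auto
    moreover have "cmod t \<ge> R" using vertical_in_S[of \<i> R u] by (simp add: u(3))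
    ultimately show "norm (integrand z t) \<le> M * exp E" using norm_integrand[of t z] unfolding b_def by linarith
  qed
  also have "norm (of_real x + \<i> * of_real R - (of_real R + \<i> * of_real R)) \<le> exp (R + norm z)"
  proof -
    have "norm (of_real x + \<i> * of_real R - (of_real R + \<i> * of_real R)) = \<bar>x - R\<bar>" by (simp flip: of_real_diff)
    also have "\<dots> \<le> R + norm z" using x Rp by linarith
    also have "\<dots> \<le> exp (R + norm z)" using exp_ge_add_one_self[of "R + norm z"] by linarith
    finally show ?thesis .
  qed
  also have "M * exp E * exp (R + norm z) = M * exp (R\<^sup>2 / 2 + 2 * b * R + R) * exp ((2 * R + b + 1) * norm z)"
    by (simp add: E_def algebra_simps flip: exp_add)
  finally show "norm (prim z (of_real (Re z) + \<i> * of_real R) - prim z (of_real R + \<i> * of_real R)) \<le> M * exp (R\<^sup>2 / 2 + 2 * cmod \<kappa> * R + R) * exp ((2 * R + cmod \<kappa> + 1) * norm z)"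
    using M by (simp add: x_def b_def mult_left_mono)
qed

text \<open>The path from the lower end passes through the corners to the point of height
  \<open>R\<close> below or above \<open>z\<close>. In the upper half plane only the rest, the
  upward ray from there, can be of Gaussian size.\<close>

lemma lower_part_exp_type: "exp_type_on {z. Im z \<ge> 0} (\<lambda>z. end_value z (- \<i>) - prim z (of_real (Re z) + \<i> * of_real R))"
proof -
  have 1: "exp_type_on {z. Im z \<ge> 0} (\<lambda>z. LINT y:{R..}|lborel. integrand z ((- \<i>) * of_real y))"
    by (rule exp_type_on_subset[OF ray_exp_type[of "- \<i>" 0]]) auto
  have 2: "exp_type_on {z. Im z \<ge> 0} (\<lambda>z. prim z ((- \<i>) * of_real R) - prim z (of_real R))"
    by (rule exp_type_on_subset[OF corner_exp_type[of "- \<i>"]]) auto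
  have 3: "exp_type_on {z. Im z \<ge> 0} (\<lambda>z. prim z (of_real R + \<i> * of_real R) - prim z (of_real R))"
    by (rule exp_type_on_subset[OF segment_exp_type[OF corner_segments(2)[of \<i>]]]) auto
  from exp_type_on_diff[OF exp_type_on_diff[OF exp_type_on_add[OF exp_type_on_cmult[OF 1, of "- \<i>"] 2] 3] horizontal_exp_type]
  show ?thesis by (simp add: end_value_def algebra_simps)
qed

lemma upper_ray: "y \<ge> R \<Longrightarrow> of_real x + \<i> * of_real y \<in> S \<and> cmod (of_real x + \<i> * of_real y) \<ge> R"
  by (rule vertical_in_S) auto

lemma L_upper_bound_half: "\<exists>C\<ge>0. \<forall>z. Im z \<ge> 0 \<longrightarrow> norm (L z) \<le> exp (max 0 (- Re (z\<^sup>2) / 2) + C * (norm z + 1))"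
proof -
  define b where "b = cmod \<kappa>"
  define A where "A = M * exp (b\<^sup>2 / 2) * sqrt (2 * pi)"
  define mx where "mx = (\<lambda>z. max 0 (- Re (z\<^sup>2) / 2))"
  obtain C where C: "C \<ge> 0" "\<And>z. Im z \<ge> 0 \<Longrightarrow> norm (end_value z (- \<i>) - prim z (of_real (Re z) + \<i> * of_real R)) \<le> exp (C * (norm z + 1))"
    using lower_part_exp_type unfolding exp_type_on_def by auto
  \<comment> \<open>The Gaussian factor is divided out so that the remaining growth falls under
    \<open>exp_type_onI\<close>.\<close>
  have *: "norm (L z * of_real (exp (- mx z))) \<le> (exp C + A) * exp ((C + 2 * b) * norm z)" if z: "Im z \<ge> 0" for z
  proof -
    define p where "p = prim z (of_real (Re z) + \<i> * of_real R)"
    have Rp: "R \<ge> 0" using R R0 by simp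
    have "norm (2 * of_real pi * \<i> * L z) \<le> norm (end_value z (- \<i>) - p) + norm (end_value z \<i> - p)"
      unfolding L_eq_ends using norm_triangle_ineq4[of "end_value z (- \<i>) - p" "end_value z \<i> - p"] by simp
    moreover have "1 * norm (L z) \<le> 2 * pi * norm (L z)" using pi_gt3 by (intro mult_right_mono) auto
    ultimately have "norm (L z) \<le> norm (end_value z (- \<i>) - p) + norm (end_value z \<i> - p)" by (simp add: norm_mult)
    also have "norm (end_value z (- \<i>) - p) \<le> exp (mx z) * exp (C * (norm z + 1))"
    proof -
      have "1 * exp (C * (norm z + 1)) \<le> exp (mx z) * exp (C * (norm z + 1))" by (intro mult_right_mono) (auto simp: mx_def)
      then show ?thesis using C(2)[OF z] unfolding p_def by linarith
    qed
    also have "norm (end_value z \<i> - p) \<le> exp (mx z) * (A * exp (2 * b * norm z))"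
    proof -
      have "norm (end_value z \<i> - p) \<le> M * exp (- Re (z\<^sup>2) / 2 + b * (\<bar>Re z\<bar> + \<bar>Im z\<bar>) + b\<^sup>2 / 2) * sqrt (2 * pi)"
        unfolding p_def b_def by (rule norm_end_value_line[OF _ Rp upper_ray]) auto
      also have "\<dots> \<le> M * exp (mx z + 2 * b * norm z + b\<^sup>2 / 2) * sqrt (2 * pi)"
      proof -
        have "b * (\<bar>Re z\<bar> + \<bar>Im z\<bar>) \<le> b * (2 * norm z)"
          using abs_Re_le_cmod[of z] abs_Im_le_cmod[of z] by (intro mult_left_mono) (auto simp: b_def)
        moreover have "- Re (z\<^sup>2) / 2 \<le> mx z" by (simp add: mx_def)
        ultimately have "- Re (z\<^sup>2) / 2 + b * (\<bar>Re z\<bar> + \<bar>Im z\<bar>) + b\<^sup>2 / 2 \<le> mx z + 2 * b * norm z + b\<^sup>2 / 2" by linarith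
        then show ?thesis using M by (intro mult_right_mono mult_left_mono) auto
      qed
      also have "\<dots> = exp (mx z) * (A * exp (2 * b * norm z))" by (simp add: A_def exp_add)
      finally show ?thesis .
    qed
    finally have le: "norm (L z) \<le> exp (mx z) * (exp (C * (norm z + 1)) + A * exp (2 * b * norm z))" by (simp add: distrib_left)
    have "norm (L z * of_real (exp (- mx z))) = norm (L z) * exp (- mx z)" by (simp add: norm_mult)
    also have "\<dots> \<le> exp (mx z) * (exp (C * (norm z + 1)) + A * exp (2 * b * norm z)) * exp (- mx z)"
      using le by (intro mult_right_mono) auto
    also have "\<dots> = exp (C * (norm z + 1)) + A * exp (2 * b * norm z)" by (simp add: exp_minus)
    also have "\<dots> = exp C * exp (C * norm z) + A * exp (2 * b * norm z)" by (simp add: algebra_simps exp_add)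
    also have "\<dots> \<le> exp C * exp ((C + 2 * b) * norm z) + A * exp ((C + 2 * b) * norm z)"
    proof (intro add_mono mult_left_mono exp_le_cancel_iff[THEN iffD2] mult_right_mono)
      show "C \<le> C + 2 * b" "2 * b \<le> C + 2 * b" using C(1) by (auto simp: b_def)
    qed (use M in \<open>auto simp: A_def\<close>)
    finally show ?thesis by (simp add: distrib_right)
  qed
  have "exp_type_on {z. Im z \<ge> 0} (\<lambda>z. L z * of_real (exp (- mx z)))" by (rule exp_type_onI) (use * in auto)
  then obtain C' where C': "C' \<ge> 0" "\<And>z. Im z \<ge> 0 \<Longrightarrow> norm (L z * of_real (exp (- mx z))) \<le> exp (C' * (norm z + 1))"
    unfolding exp_type_on_def by auto
  have "norm (L z) \<le> exp (mx z + C' * (norm z + 1))" if "Im z \<ge> 0" for z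
    using le_exp_diff[of "norm (L z)" "- mx z" "C' * (norm z + 1)"] C'(2)[OF that] by (simp add: norm_mult add.commute)
  then show ?thesis using C'(1) unfolding mx_def by blast
qed

section \<open>Conjugate and reflected kernels\<close>

definition conj_coeff :: "complex \<Rightarrow> complex" where "conj_coeff = (\<lambda>s. cnj (U (cnj s)))"

lemma conj_instance: "gauss_laplace conj_coeff R0 R"
proof
  have "cnj ` ball 0 (1 / R0) = ball 0 (1 / R0)"
  proof -
    have "x \<in> cnj ` ball 0 (1 / R0)" if "x \<in> ball 0 (1 / R0)" for x
      using that by (intro image_eqI[of _ _ "cnj x"]) auto
    then show ?thesis by auto
  qed
  then have "cnj \<circ> U \<circ> cnj holomorphic_on ball 0 (1 / R0)" using U by (intro holomorphic_on_compose_cnj_cnj) auto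
  then show "conj_coeff holomorphic_on ball 0 (1 / R0)" by (simp add: conj_coeff_def o_def)
qed (use R0 R U0 in \<open>auto simp: conj_coeff_def\<close>)

lemma cnj_S: "t \<in> S \<Longrightarrow> cnj t \<in> S"
  by (auto simp: S_iff complex_nonpos_Reals_iff)

lemma conj_kernel:
  assumes "t \<in> S"
  shows "gauss_kernel (cnj \<kappa>) conj_coeff (cnj t) = cnj (gauss_kernel \<kappa> U t)"
proof -
  have "cnj t powr cnj \<kappa> = cnj (t powr \<kappa>)"
  proof -
    have "t \<noteq> 0" "t \<notin> \<real>\<^sub>\<le>\<^sub>0" using assms R0 by (auto simp: S_iff)
    then show ?thesis by (simp add: powr_def cnj_Ln exp_cnj)
  qed
  then show ?thesis by (simp add: gauss_kernel_def conj_coeff_def exp_cnj)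
qed

text \<open>Conjugation exchanges the two ends and also conjugates the factor
  \<open>2 * pi * \<i>\<close>, so the two signs cancel. The primitives on both sides differ by a
  constant, which drops out. Estimates on the upper half plane thus carry over to the lower
  one.\<close>

lemma L_cnj: "gauss_laplace.L (cnj \<kappa>) conj_coeff R (cnj z) = cnj (L z)"
proof -
  interpret c: gauss_laplace "cnj \<kappa>" conj_coeff R0 R by (rule conj_instance)
  have int: "c.integrand (cnj z) (cnj t) = cnj (integrand z t)" if "t \<in> S" for t
    using conj_kernel[OF that] by (simp add: integrand_def c.integrand_def exp_cnj)
  have "((\<lambda>t. c.prim (cnj z) t - cnj (prim z (cnj t))) has_field_derivative 0) (at t)" if t: "t \<in> S" for t
  proof -
    have "((cnj \<circ> prim z \<circ> cnj) has_field_derivative cnj (integrand z (cnj t))) (at t)"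
      using prim[OF cnj_S[OF t], of z] by (simp add: has_field_derivative_cnj_cnj)
    then have "((\<lambda>t. cnj (prim z (cnj t))) has_field_derivative c.integrand (cnj z) t) (at t)"
      using int[OF cnj_S[OF t]] by (simp add: o_def)
    from DERIV_diff[OF c.prim[OF t, of "cnj z"] this] show ?thesis by simp
  qed
  then obtain k where k: "\<And>t. t \<in> S \<Longrightarrow> c.prim (cnj z) t - cnj (prim z (cnj t)) = k"
    using slit_exterior_constant[OF R0] by blast
  have ev: "c.end_value (cnj z) (cnj d) = k + cnj (end_value z d)" if d: "d = \<i> \<or> d = - \<i>" for d
  proof -
    have m: "d * of_real y \<in> S" if "y \<ge> R" for y using vertical_in_S[OF d that, of 0] by simp
    have 1: "c.prim (cnj z) (cnj d * of_real R) = k + cnj (prim z (d * of_real R))"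
      using k[OF cnj_S[OF m[OF order_refl]]] by (simp add: algebra_simps)
    have 2: "(LINT y:{R..}|lborel. c.integrand (cnj z) (cnj d * of_real y)) = cnj (LINT y:{R..}|lborel. integrand z (d * of_real y))"
    proof -
      have "(LINT y:{R..}|lborel. c.integrand (cnj z) (cnj d * of_real y)) = (LINT y:{R..}|lborel. cnj (integrand z (d * of_real y)))"
        using int m by (intro set_lebesgue_integral_cong) (auto simp flip: int)
      also have "\<dots> = cnj (LINT y:{R..}|lborel. integrand z (d * of_real y))"
        unfolding set_lebesgue_integral_def by (subst Bochner_Integration.integral_cnj[symmetric]) simp
      finally show ?thesis .
    qed
    show ?thesis unfolding c.end_value_def end_value_def 1 2 by simp
  qed
  have "2 * of_real pi * \<i> * c.L (cnj z) = 2 * of_real pi * \<i> * cnj (L z)"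
  proof -
    have "2 * of_real pi * \<i> * c.L (cnj z) = cnj (end_value z \<i>) - cnj (end_value z (- \<i>))"
      unfolding c.L_eq_ends using ev[of \<i>] ev[of "- \<i>"] by simp
    also have "\<dots> = - cnj (2 * of_real pi * \<i> * L z)" unfolding L_eq_ends by simp
    finally show ?thesis by simp
  qed
  then show ?thesis by simp
qed

lemma L_upper_bound: "\<exists>C\<ge>0. \<forall>z. norm (L z) \<le> exp (max 0 (- Re (z\<^sup>2) / 2) + C * (norm z + 1))"
proof -
  interpret c: gauss_laplace "cnj \<kappa>" conj_coeff R0 R by (rule conj_instance)
  obtain C where C: "C \<ge> 0" "\<And>z. Im z \<ge> 0 \<Longrightarrow> norm (L z) \<le> exp (max 0 (- Re (z\<^sup>2) / 2) + C * (norm z + 1))"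
    using L_upper_bound_half by blast
  obtain D where D: "D \<ge> 0" "\<And>z. Im z \<ge> 0 \<Longrightarrow> norm (c.L z) \<le> exp (max 0 (- Re (z\<^sup>2) / 2) + D * (norm z + 1))"
    using c.L_upper_bound_half by blast
  have "norm (L z) \<le> exp (max 0 (- Re (z\<^sup>2) / 2) + (C + D) * (norm z + 1))" for z
  proof (cases "Im z \<ge> 0")
    case True
    have "C * (norm z + 1) \<le> (C + D) * (norm z + 1)" using D(1) by (intro mult_right_mono) auto
    then have "exp (max 0 (- Re (z\<^sup>2) / 2) + C * (norm z + 1)) \<le> exp (max 0 (- Re (z\<^sup>2) / 2) + (C + D) * (norm z + 1))" by simp
    then show ?thesis using C(2)[OF True] by linarith
  next
    case False
    have "D * (norm z + 1) \<le> (C + D) * (norm z + 1)" using C(1) by (intro mult_right_mono) auto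
    then have "exp (max 0 (- Re (z\<^sup>2) / 2) + D * (norm z + 1)) \<le> exp (max 0 (- Re (z\<^sup>2) / 2) + (C + D) * (norm z + 1))" by simp
    moreover have "norm (L z) \<le> exp (max 0 (- Re (z\<^sup>2) / 2) + D * (norm z + 1))"
      using D(2)[of "cnj z"] False L_cnj[of z] by (simp add: power2_eq_square)
    ultimately show ?thesis by linarith
  qed
  then show ?thesis using C(1) D(1) by (intro exI[of _ "C + D"]) auto
qed

text \<open>Replacing \<open>t\<close> by \<open>- t\<close> in the upper half plane changes
  \<open>Ln t\<close> by \<open>- \<i> * pi\<close>; the exponential factor undoes the effect on the
  power, and \<open>- s\<close> that on \<open>1 / t\<close>.\<close>

definition reflected_coeff :: "complex \<Rightarrow> complex" where
  "reflected_coeff = (\<lambda>s. exp (\<i> * of_real pi * \<kappa>) * U (- s))"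

lemma reflected_instance: "gauss_laplace reflected_coeff R0 R"
proof
  have "(\<lambda>s. U (- s)) holomorphic_on ball 0 (1 / R0)"
    by (rule holomorphic_on_compose_gen[OF _ U, unfolded o_def]) (auto intro!: holomorphic_intros)
  then show "reflected_coeff holomorphic_on ball 0 (1 / R0)" unfolding reflected_coeff_def by (intro holomorphic_intros)
qed (use R0 R U0 in \<open>auto simp: reflected_coeff_def\<close>)

text \<open>The reflected kernel continues the original one from the upper half plane across the
  negative real axis.\<close>

lemma reflected_kernel:
  assumes "Im t > 0"
  shows "gauss_kernel \<kappa> reflected_coeff (- t) = gauss_kernel \<kappa> U t"
proof -
  have t0: "t \<noteq> 0" using assms by auto
  have "Ln (- t) = Ln t - \<i> * of_real pi" using assms t0 by (simp add: Ln_minus)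
  then have e: "\<kappa> * Ln (- t) + \<i> * of_real pi * \<kappa> = \<kappa> * Ln t" by (simp only:) (simp add: algebra_simps)
  have "(- t) powr \<kappa> * exp (\<i> * of_real pi * \<kappa>) = exp (\<kappa> * Ln (- t) + \<i> * of_real pi * \<kappa>)"
    using t0 by (simp add: powr_def exp_add)
  then have "(- t) powr \<kappa> * exp (\<i> * of_real pi * \<kappa>) = t powr \<kappa>"
    unfolding e using t0 by (simp add: powr_def)
  then show ?thesis by (simp add: gauss_kernel_def reflected_coeff_def mult_ac)
qed

text \<open>The integrals along the ray through \<open>\<i>\<close>, which grow like \<open>exp (- z\<^sup>2/2)\<close>, cancel.\<close>

lemma reflected_diff_exp_type: "exp_type_on {z. Im z \<ge> - B} (\<lambda>z. L z - gauss_laplace.L \<kappa> reflected_coeff R (- z))"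
proof -
  interpret r: gauss_laplace \<kappa> reflected_coeff R0 R by (rule reflected_instance)
  have Rp: "R > 0" using R R0 by simp
  have swap: "(LINT y:{R..}|lborel. r.integrand (- z) (- \<i> * of_real y)) = (LINT y:{R..}|lborel. integrand z (\<i> * of_real y))" for z
  proof (rule set_lebesgue_integral_cong)
    show "\<forall>y. y \<in> {R..} \<longrightarrow> r.integrand (- z) (- \<i> * of_real y) = integrand z (\<i> * of_real y)"
    proof (intro allI impI)
      fix y assume "y \<in> {R..}"
      then have "Im (\<i> * of_real y) > 0" using Rp by auto
      from reflected_kernel[OF this] show "r.integrand (- z) (- \<i> * of_real y) = integrand z (\<i> * of_real y)"
        by (simp add: integrand_def r.integrand_def)
    qed
  qed auto
  define mid where "mid = (\<lambda>z. prim z ((- \<i>) * of_real R) - prim z (\<i> * of_real R))"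
  define mid' where "mid' = (\<lambda>z. r.prim (- z) ((- \<i>) * of_real R) - r.prim (- z) (\<i> * of_real R))"
  have m: "exp_type_on UNIV mid"
    using exp_type_on_diff[OF corner_exp_type[of "- \<i>"] corner_exp_type[of \<i>]] by (simp add: mid_def)
  have "exp_type_on UNIV (\<lambda>z. r.prim z ((- \<i>) * of_real R) - r.prim z (\<i> * of_real R))"
    using exp_type_on_diff[OF r.corner_exp_type[of "- \<i>"] r.corner_exp_type[of \<i>]] by simp
  then obtain D where "D \<ge> 0" "\<And>z. norm (r.prim z ((- \<i>) * of_real R) - r.prim z (\<i> * of_real R)) \<le> exp (D * (norm z + 1))"
    unfolding exp_type_on_def by auto
  then have m': "exp_type_on UNIV mid'" unfolding exp_type_on_def mid'_def by (metis norm_minus_cancel)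
  have low: "exp_type_on {z. Im z \<ge> - B} (\<lambda>z. LINT y:{R..}|lborel. integrand z ((- \<i>) * of_real y))"
    by (rule exp_type_on_subset[OF ray_exp_type[of "- \<i>" B]]) auto
  obtain E where "E \<ge> 0" "\<And>z. Im z \<ge> - B \<Longrightarrow> norm (LINT y:{R..}|lborel. r.integrand (- z) (\<i> * of_real y)) \<le> exp (E * (norm z + 1))"
  proof -
    obtain E where E: "E \<ge> 0" "\<And>z. Re (z * \<i>) \<ge> - B \<Longrightarrow> norm (LINT y:{R..}|lborel. r.integrand z (\<i> * of_real y)) \<le> exp (E * (norm z + 1))"
      using r.ray_exp_type[of \<i> B] unfolding exp_type_on_def by auto
    show thesis by (rule that[OF E(1)]) (use E(2)[of "- _"] in auto)
  qed
  then have up: "exp_type_on {z. Im z \<ge> - B} (\<lambda>z. LINT y:{R..}|lborel. r.integrand (- z) (\<i> * of_real y))"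
    unfolding exp_type_on_def by auto
  have "exp_type_on {z. Im z \<ge> - B} (\<lambda>z. (1 / (2 * of_real pi * \<i>)) * ((mid z - mid' z) + ((- \<i>) * (LINT y:{R..}|lborel. integrand z ((- \<i>) * of_real y))
      + \<i> * (LINT y:{R..}|lborel. r.integrand (- z) (\<i> * of_real y)))))"
    by (intro exp_type_on_cmult exp_type_on_add exp_type_on_diff low up exp_type_on_subset[OF m] exp_type_on_subset[OF m']) auto
  moreover have "L z - r.L (- z) = (1 / (2 * of_real pi * \<i>)) * ((mid z - mid' z) + ((- \<i>) * (LINT y:{R..}|lborel. integrand z ((- \<i>) * of_real y))
      + \<i> * (LINT y:{R..}|lborel. r.integrand (- z) (\<i> * of_real y))))" for z
  proof -
    have "2 * of_real pi * \<i> * (L z - r.L (- z)) = (mid z - mid' z) + ((- \<i>) * (LINT y:{R..}|lborel. integrand z ((- \<i>) * of_real y))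
      + \<i> * (LINT y:{R..}|lborel. r.integrand (- z) (\<i> * of_real y)))"
      unfolding right_diff_distrib L_eq_ends r.L_eq_ends end_value_def r.end_value_def mid_def mid'_def swap by (simp add: algebra_simps)
    then show ?thesis by (simp add: field_simps)
  qed
  ultimately show ?thesis by simp
qed

end

subsection \<open>Asymptotics in the right sector\<close>

definition half_gauss :: real where "half_gauss = (LINT s:{0..}|lborel. exp (- s\<^sup>2 / 2))"

lemma half_gauss_pos: "half_gauss > 0"
proof -
  have 1: "integrable lborel (\<lambda>s. indicator {0..1::real} s *\<^sub>R exp (- 1 / 2) :: real)"
    by (intro integrable_scaleR_left integrable_real_indicator) auto
  have 2: "integrable lborel (\<lambda>s. indicator {0..} s *\<^sub>R exp (- s\<^sup>2 / 2) :: real)"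
    using integrable_gaussian[of 0] by (intro integrable_mult_indicator) auto
  have "(LINT s|lborel. indicator {0..1::real} s *\<^sub>R exp (- 1 / 2) :: real) \<le> half_gauss"
    unfolding half_gauss_def set_lebesgue_integral_def
    by (rule integral_mono[OF 1 2]) (auto simp: indicator_def power_le_one)
  moreover have "(LINT s|lborel. indicator {0..1::real} s *\<^sub>R exp (- 1 / 2) :: real) = exp (- 1 / 2)" by simp
  ultimately show ?thesis using exp_gt_zero[of "- 1 / 2 :: real"] by linarith
qed

text \<open>Uniform limits at infinity are reduced to sequences, the form in which dominated
  convergence applies.\<close>

lemma sequential_limitI:
  fixes g :: "complex \<Rightarrow> complex"
  assumes "\<And>X. (\<And>n. X n \<in> S) \<Longrightarrow> filterlim (\<lambda>n. norm (X n)) at_top sequentially \<Longrightarrow> (\<lambda>n. g (X n)) \<longlonglongrightarrow> l" and e: "e > 0"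
  shows "\<exists>r0. \<forall>z\<in>S. norm z > r0 \<longrightarrow> dist (g z) l < e"
proof (rule ccontr)
  assume "\<not> ?thesis"
  then have "\<forall>n. \<exists>z. z \<in> S \<and> norm z > real n \<and> \<not> dist (g z) l < e" by (metis less_le_not_le)
  then obtain X where X: "\<And>n. X n \<in> S \<and> norm (X n) > real n \<and> \<not> dist (g (X n)) l < e" by metis
  have "filterlim (\<lambda>n. norm (X n)) at_top sequentially"
    by (rule filterlim_at_top_mono[OF filterlim_real_sequentially]) (use X in \<open>auto intro!: always_eventually less_imp_le\<close>)
  with assms(1)[of X] X have "(\<lambda>n. g (X n)) \<longlonglongrightarrow> l" by blast
  then have "\<forall>\<^sub>F n in sequentially. dist (g (X n)) l < e" using e by (rule tendstoD)
  then show False using X by (auto simp: eventually_sequentially)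
qed

context gauss_laplace
begin

text \<open>Formally \<open>(t / z) powr \<kappa> * U (1 / t)\<close>, with the branch fixed by the
  two logarithms. It is what remains of the integrand beside the Gaussian in \<open>t - z\<close>
  after the leading term in \<open>z\<close> is divided out.\<close>

definition ratio :: "complex \<Rightarrow> complex \<Rightarrow> complex" where
  "ratio z t = exp (\<kappa> * (Ln t - Ln z)) * U (1 / t)"

lemma integrand_ratio:
  assumes "z \<noteq> 0" "t \<noteq> 0"
  shows "integrand z t = exp (- z\<^sup>2 / 2) * z powr \<kappa> * (exp ((t - z)\<^sup>2 / 2) * ratio z t)"
proof -
  have e: "exp (t\<^sup>2 / 2) * exp (- z * t) = exp (- z\<^sup>2 / 2) * exp ((t - z)\<^sup>2 / 2)"
  proof -
    have "t\<^sup>2 / 2 + - z * t = - z\<^sup>2 / 2 + (t - z)\<^sup>2 / 2" by (simp add: power2_eq_square field_simps)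
    then show ?thesis by (simp only: exp_add[symmetric])
  qed
  have "t powr \<kappa> = z powr \<kappa> * exp (\<kappa> * (Ln t - Ln z))" using assms by (simp add: powr_def right_diff_distrib flip: exp_add)
  then have "integrand z t = (exp (t\<^sup>2 / 2) * exp (- z * t)) * (z powr \<kappa> * (exp (\<kappa> * (Ln t - Ln z)) * U (1 / t)))"
    by (simp add: integrand_def gauss_kernel_def mult_ac)
  then show ?thesis unfolding e ratio_def by (simp add: mult_ac)
qed

text \<open>Logarithms of moduli are Lipschitz with constant \<open>1 / R\<close> outside the disc
  and arguments differ by at most 2 pi. The resulting majorant depends on \<open>t - z\<close> only
  and is beaten by the Gaussian.\<close>

lemma ratio_bound: "\<exists>B>0. \<forall>z t. cmod z \<ge> R \<longrightarrow> cmod t \<ge> R \<longrightarrow> norm (ratio z t) \<le> B * exp (cmod \<kappa> / R * cmod (t - z))"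
proof -
  obtain B where B: "B > 0" "\<And>t. cmod t \<ge> R \<Longrightarrow> norm (U (1 / t)) \<le> B" using U_bounded by blast
  have Rp: "R > 0" using R R0 by simp
  have lnle: "ln (cmod p) - ln (cmod q) \<le> cmod (p - q) / R" if "cmod p \<ge> R" "cmod q \<ge> R" for p q :: complex
  proof -
    have pq: "cmod p > 0" "cmod q > 0" using that Rp by linarith+
    have "ln (cmod p) - ln (cmod q) = ln (cmod p / cmod q)" using pq by (simp add: ln_div)
    also have "\<dots> \<le> cmod p / cmod q - 1" using pq by (intro ln_le_minus_one) simp
    also have "\<dots> = (cmod p - cmod q) / cmod q" using pq by (simp add: diff_divide_distrib)
    also have "\<dots> \<le> cmod (p - q) / cmod q" using pq norm_triangle_ineq2[of p q] by (intro divide_right_mono) auto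
    also have "\<dots> \<le> cmod (p - q) / R" using that pq Rp by (intro divide_left_mono) auto
    finally show ?thesis .
  qed
  have "norm (ratio z t) \<le> (exp (cmod \<kappa> * (2 * pi)) * B) * exp (cmod \<kappa> / R * cmod (t - z))" if z: "cmod z \<ge> R" and t: "cmod t \<ge> R" for z t
  proof -
    have nz: "z \<noteq> 0" "t \<noteq> 0" using z t Rp by auto
    have "norm (Ln t - Ln z) \<le> \<bar>Re (Ln t - Ln z)\<bar> + \<bar>Im (Ln t - Ln z)\<bar>" by (rule cmod_le)
    also have "\<bar>Im (Ln t - Ln z)\<bar> \<le> 2 * pi"
      using Im_Ln_le_pi[OF nz(1)] mpi_less_Im_Ln[OF nz(1)] Im_Ln_le_pi[OF nz(2)] mpi_less_Im_Ln[OF nz(2)] by (simp add: abs_le_iff)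
    also have "\<bar>Re (Ln t - Ln z)\<bar> \<le> cmod (t - z) / R"
      using lnle[OF t z] lnle[OF z t] nz by (simp add: abs_le_iff norm_minus_commute)
    finally have "cmod \<kappa> * norm (Ln t - Ln z) \<le> cmod \<kappa> * (cmod (t - z) / R + 2 * pi)" by (intro mult_left_mono) auto
    moreover have "Re (\<kappa> * (Ln t - Ln z)) \<le> cmod \<kappa> * norm (Ln t - Ln z)" using complex_Re_le_cmod[of "\<kappa> * (Ln t - Ln z)"] by (simp add: norm_mult)
    ultimately have "norm (exp (\<kappa> * (Ln t - Ln z))) \<le> exp (cmod \<kappa> * (cmod (t - z) / R + 2 * pi))" by simp
    then have "norm (ratio z t) \<le> exp (cmod \<kappa> * (cmod (t - z) / R + 2 * pi)) * B"
      unfolding ratio_def norm_mult by (intro mult_mono B t) auto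
    also have "\<dots> = (exp (cmod \<kappa> * (2 * pi)) * B) * exp (cmod \<kappa> / R * cmod (t - z))"
      by (simp add: distrib_left exp_add mult_ac)
    finally show ?thesis .
  qed
  moreover have "exp (cmod \<kappa> * (2 * pi)) * B > 0" using B by simp
  ultimately show ?thesis by blast
qed

definition half_sector :: "real \<Rightarrow> complex set" where
  "half_sector k = {z. Im z \<ge> 0 \<and> Re z \<ge> - k * Im z \<and> cmod z > 0}"

text \<open>Left of abscissa \<open>R\<close> the height of \<open>z\<close> is comparable to its
  modulus. This gives the downward path its length and the leading term its size.\<close>

lemma half_sector_Im:
  assumes k: "0 < k" "k < 1" and z: "z \<in> half_sector k" "Re z < R"
  shows "cmod z \<le> R + 2 * Im z"
proof -
  have "\<bar>Re z\<bar> \<le> R + Im z"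
  proof -
    have "k * Im z \<le> 1 * Im z" using z k by (intro mult_right_mono) (auto simp: half_sector_def)
    then show ?thesis using z R R0 by (auto simp: half_sector_def abs_le_iff)
  qed
  then show ?thesis using cmod_le[of z] z by (simp add: half_sector_def)
qed

text \<open>For fixed \<open>s\<close> the vertical segment from \<open>z\<close> of length
  \<open>\<bar>s\<bar>\<close> stays far from 0 and off the slit once \<open>z\<close> is large, so
  the logarithms at its ends differ by \<open>O(1 / cmod z)\<close>.\<close>

lemma ratio_tendsto:
  assumes k: "0 < k" "k < 1" and X: "\<And>n. X n \<in> half_sector k" "filterlim (\<lambda>n. cmod (X n)) at_top sequentially"
  shows "(\<lambda>n. ratio (X n) (X n + \<i> * of_real s)) \<longlonglongrightarrow> U 0"
proof -
  have Rp: "R > 0" using R R0 by simp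
  have big: "\<forall>\<^sub>F n in sequentially. cmod (X n) > 2 * (\<bar>s\<bar> + 1) + R" using X(2) by (auto simp: filterlim_at_top_dense)
  have "filterlim (\<lambda>n. cmod (X n) - \<bar>s\<bar>) at_top sequentially"
    using filterlim_tendsto_add_at_top[OF tendsto_const X(2), of "- \<bar>s\<bar>"] by (simp add: add.commute)
  then have lim0: "(\<lambda>n. \<bar>s\<bar> / (cmod (X n) - \<bar>s\<bar>)) \<longlonglongrightarrow> 0" and lim1: "(\<lambda>n. 1 / (cmod (X n) - \<bar>s\<bar>)) \<longlonglongrightarrow> 0"
    by (intro tendsto_divide_0[OF tendsto_const] filterlim_at_top_imp_at_infinity; simp)+
  have L: "(\<lambda>n. Ln (X n + \<i> * of_real s) - Ln (X n)) \<longlonglongrightarrow> 0"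
  proof (rule Lim_null_comparison[OF _ lim0])
    show "\<forall>\<^sub>F n in sequentially. norm (Ln (X n + \<i> * of_real s) - Ln (X n)) \<le> \<bar>s\<bar> / (cmod (X n) - \<bar>s\<bar>)"
      using big
    proof eventually_elim
      case (elim n)
      define z where "z = X n"
      have zs: "z \<in> half_sector k" "cmod z > 2 * (\<bar>s\<bar> + 1) + R" using X(1) elim by (auto simp: z_def)
      have seg: "cmod w \<ge> cmod z - \<bar>s\<bar> \<and> w \<notin> \<real>\<^sub>\<le>\<^sub>0 \<and> w \<noteq> 0" if "w \<in> closed_segment z (z + \<i> * of_real s)" for w
      proof -
        from that obtain u where u: "0 \<le> u" "u \<le> 1" "w = (1 - u) *\<^sub>R z + u *\<^sub>R (z + \<i> * of_real s)"
          by (auto simp: in_segment)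
        then have w: "w = z + \<i> * of_real (u * s)" by (simp add: scaleR_conv_of_real algebra_simps)
        have us: "\<bar>u * s\<bar> \<le> \<bar>s\<bar>" using u by (simp add: abs_mult mult_left_le_one_le)
        have "cmod z \<le> cmod w + cmod (\<i> * of_real (u * s))" using norm_triangle_ineq4[of w "\<i> * of_real (u * s)"] by (simp add: w)
        then have n: "cmod w \<ge> cmod z - \<bar>s\<bar>" using us by (simp add: norm_mult)
        have "Re w > 0 \<or> Im w > 0"
        proof (cases "Re z \<ge> R")
          case True
          then show ?thesis using Rp by (simp add: w)
        next
          case False
          then have "cmod z \<le> R + 2 * Im z" using half_sector_Im[OF k zs(1)] by simp
          from less_le_trans[OF zs(2) this] have "Im z > \<bar>s\<bar>" by simp
          then show ?thesis using us by (simp add: w) linarith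
        qed
        then show ?thesis using n by (auto simp: complex_nonpos_Reals_iff)
      qed
      have pos: "cmod z - \<bar>s\<bar> > 0" using zs(2) Rp by (smt (verit))
      have "norm (Ln (z + \<i> * of_real s) - Ln z) \<le> (1 / (cmod z - \<bar>s\<bar>)) * norm (z + \<i> * of_real s - z)"
      proof (rule field_differentiable_bound[of "closed_segment z (z + \<i> * of_real s)" Ln inverse])
        fix w assume w: "w \<in> closed_segment z (z + \<i> * of_real s)"
        show "(Ln has_field_derivative inverse w) (at w within closed_segment z (z + \<i> * of_real s))"
          using seg[OF w] by (blast intro: has_field_derivative_at_within has_field_derivative_Ln)
        have "1 / cmod w \<le> 1 / (cmod z - \<bar>s\<bar>)" using seg[OF w] pos by (intro frac_le) simp_all
        then show "norm (inverse w) \<le> 1 / (cmod z - \<bar>s\<bar>)" by (simp add: norm_inverse divide_inverse)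
      qed auto
      then show ?case by (simp add: z_def norm_mult)
    qed
  qed
  have I: "(\<lambda>n. 1 / (X n + \<i> * of_real s)) \<longlonglongrightarrow> 0"
  proof (rule Lim_null_comparison[OF _ lim1])
    show "\<forall>\<^sub>F n in sequentially. norm (1 / (X n + \<i> * of_real s)) \<le> 1 / (cmod (X n) - \<bar>s\<bar>)"
      using big
    proof eventually_elim
      case (elim n)
      have "cmod (X n) - \<bar>s\<bar> \<le> cmod (X n + \<i> * of_real s)"
        using norm_triangle_ineq4[of "X n + \<i> * of_real s" "\<i> * of_real s"] by (simp add: norm_mult)
      then show ?case using elim Rp by (simp add: norm_divide) (intro divide_left_mono mult_pos_pos; linarith)
    qed
  qed
  have "isCont U 0" using U R0 by (metis centre_in_ball continuous_on_eq_continuous_at divide_pos_pos holomorphic_on_imp_continuous_on open_ball zero_less_one)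
  then have "(\<lambda>n. U (1 / (X n + \<i> * of_real s))) \<longlonglongrightarrow> U 0" using I by (rule isCont_tendsto_compose)
  moreover have "(\<lambda>n. exp (\<kappa> * (Ln (X n + \<i> * of_real s) - Ln (X n)))) \<longlonglongrightarrow> exp (\<kappa> * 0)"
    using L by (intro tendsto_intros)
  ultimately have "(\<lambda>n. exp (\<kappa> * (Ln (X n + \<i> * of_real s) - Ln (X n))) * U (1 / (X n + \<i> * of_real s))) \<longlonglongrightarrow> exp (\<kappa> * 0) * U 0"
    by (intro tendsto_mult)
  then show ?thesis by (simp add: ratio_def)
qed

text \<open>Dominated convergence on domains that may vary with \<open>n\<close> and eventually
  contain each point of the half line. Both signs of \<open>\<sigma>\<close> are covered, for the
  upward and the downward ray.\<close>

lemma ratio_integral_tendsto: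
  assumes k: "0 < k" "k < 1" and X: "\<And>n. X n \<in> half_sector k" "filterlim (\<lambda>n. cmod (X n)) at_top sequentially" "\<And>n. cmod (X n) \<ge> R"
    and \<sigma>: "\<sigma> = 1 \<or> \<sigma> = -1" and D: "\<And>n. D n \<in> sets borel" "\<And>n. D n \<subseteq> {0..}" "\<And>s. s \<ge> 0 \<Longrightarrow> \<forall>\<^sub>F n in sequentially. s \<in> D n"
    and DR: "\<And>n s. s \<in> D n \<Longrightarrow> cmod (X n + \<i> * of_real (\<sigma> * s)) \<ge> R"
    and meas: "\<And>n. continuous_on (D n) (\<lambda>s. ratio (X n) (X n + \<i> * of_real (\<sigma> * s)))"
  shows "(\<lambda>n. LINT s:D n|lborel. complex_of_real (exp (- s\<^sup>2 / 2)) * ratio (X n) (X n + \<i> * of_real (\<sigma> * s))) \<longlonglongrightarrow> of_real half_gauss * U 0"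
proof -
  obtain B where B: "B > 0" "\<And>z t. cmod z \<ge> R \<Longrightarrow> cmod t \<ge> R \<Longrightarrow> norm (ratio z t) \<le> B * exp (cmod \<kappa> / R * cmod (t - z))"
    using ratio_bound by blast
  define b where "b = cmod \<kappa> / R"
  define W where "W = (\<lambda>s. B * exp (b\<^sup>2 / 2) * exp (- (s - b)\<^sup>2 / 2))"
  have "(\<lambda>n. LINT s|lborel. indicator (D n) s *\<^sub>R (complex_of_real (exp (- s\<^sup>2 / 2)) * ratio (X n) (X n + \<i> * of_real (\<sigma> * s)))) \<longlonglongrightarrow>
      (LINT s|lborel. indicator {0..} s *\<^sub>R (complex_of_real (exp (- s\<^sup>2 / 2)) * U 0))"
  proof (rule integral_dominated_convergence[where w = W])
    show "integrable lborel W" unfolding W_def by (intro integrable_mult_right integrable_gaussian)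
    show "(\<lambda>s. indicator {0..} s *\<^sub>R (complex_of_real (exp (- s\<^sup>2 / 2)) * U 0)) \<in> borel_measurable lborel" by measurable
    show "(\<lambda>s. indicator (D n) s *\<^sub>R (complex_of_real (exp (- s\<^sup>2 / 2)) * ratio (X n) (X n + \<i> * of_real (\<sigma> * s)))) \<in> borel_measurable lborel" for n
    proof -
      have "continuous_on (D n) (\<lambda>s. complex_of_real (exp (- s\<^sup>2 / 2)) * ratio (X n) (X n + \<i> * of_real (\<sigma> * s)))"
        by (intro continuous_intros meas) auto
      from borel_measurable_continuous_on_indicator[OF D(1) this] show ?thesis by simp
    qed
    show "AE s in lborel. (\<lambda>n. indicator (D n) s *\<^sub>R (complex_of_real (exp (- s\<^sup>2 / 2)) * ratio (X n) (X n + \<i> * of_real (\<sigma> * s)))) \<longlonglongrightarrow> indicator {0..} s *\<^sub>R (complex_of_real (exp (- s\<^sup>2 / 2)) * U 0)"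
    proof (intro AE_I2)
      fix s :: real
      show "(\<lambda>n. indicator (D n) s *\<^sub>R (complex_of_real (exp (- s\<^sup>2 / 2)) * ratio (X n) (X n + \<i> * of_real (\<sigma> * s)))) \<longlonglongrightarrow> indicator {0..} s *\<^sub>R (complex_of_real (exp (- s\<^sup>2 / 2)) * U 0)"
      proof (cases "s \<ge> 0")
        case True
        have "(\<lambda>n. complex_of_real (exp (- s\<^sup>2 / 2)) * ratio (X n) (X n + \<i> * of_real (\<sigma> * s))) \<longlonglongrightarrow> complex_of_real (exp (- s\<^sup>2 / 2)) * U 0"
          by (intro tendsto_intros ratio_tendsto[OF k X(1,2)])
        then have "(\<lambda>n. indicator (D n) s *\<^sub>R (complex_of_real (exp (- s\<^sup>2 / 2)) * ratio (X n) (X n + \<i> * of_real (\<sigma> * s)))) \<longlonglongrightarrow> complex_of_real (exp (- s\<^sup>2 / 2)) * U 0"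
          by (rule Lim_transform_eventually) (use D(3)[OF True] in \<open>auto elim!: eventually_mono\<close>)
        then show ?thesis using True by simp
      next
        case False
        then have "s \<notin> D n" for n using D(2)[of n] by auto
        then show ?thesis using False by simp
      qed
    qed
    show "AE s in lborel. norm (indicator (D n) s *\<^sub>R (complex_of_real (exp (- s\<^sup>2 / 2)) * ratio (X n) (X n + \<i> * of_real (\<sigma> * s)))) \<le> W s" for n
    proof (intro AE_I2)
      fix s :: real
      show "norm (indicator (D n) s *\<^sub>R (complex_of_real (exp (- s\<^sup>2 / 2)) * ratio (X n) (X n + \<i> * of_real (\<sigma> * s)))) \<le> W s"
      proof (cases "s \<in> D n")
        case True
        then have s: "s \<ge> 0" using D(2)[of n] by auto
        have "cmod (X n + \<i> * of_real (\<sigma> * s) - X n) = s" using \<sigma> s by (auto simp: norm_mult)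
        then have "norm (ratio (X n) (X n + \<i> * of_real (\<sigma> * s))) \<le> B * exp (b * s)"
          using B(2)[OF X(3)[of n] DR[OF True]] by (simp add: b_def)
        then have "norm (complex_of_real (exp (- s\<^sup>2 / 2)) * ratio (X n) (X n + \<i> * of_real (\<sigma> * s))) \<le> exp (- s\<^sup>2 / 2) * (B * exp (b * s))"
          unfolding norm_mult by (intro mult_mono) auto
        also have "\<dots> = B * exp (- s\<^sup>2 / 2 + b * s)" by (simp only: exp_add mult_ac)
        also have "\<dots> = W s" unfolding gaussian_complete W_def by (simp only: exp_add mult.assoc)
        finally show ?thesis using True by simp
      qed (use B in \<open>simp add: W_def\<close>)
    qed
  qed
  moreover have "(LINT s|lborel. indicator {0..} s *\<^sub>R (complex_of_real (exp (- s\<^sup>2 / 2)) * U 0)) = of_real half_gauss * U 0"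
  proof -
    have "(LINT s|lborel. indicator {0..} s *\<^sub>R (complex_of_real (exp (- s\<^sup>2 / 2)) * U 0)) = (LINT s|lborel. complex_of_real (indicator {0..} s *\<^sub>R exp (- s\<^sup>2 / 2)) * U 0)"
      by (intro Bochner_Integration.integral_cong) (auto simp: scaleR_conv_of_real)
    also have "\<dots> = (LINT s|lborel. complex_of_real (indicator {0..} s *\<^sub>R exp (- s\<^sup>2 / 2))) * U 0"
      by (rule integral_mult_left_zero)
    also have "(LINT s|lborel. complex_of_real (indicator {0..} s *\<^sub>R exp (- s\<^sup>2 / 2))) = of_real half_gauss"
      unfolding half_gauss_def set_lebesgue_integral_def by (rule integral_complex_of_real)
    finally show ?thesis .
  qed
  ultimately show ?thesis unfolding set_lebesgue_integral_def by simp
qed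

definition main_term :: "complex \<Rightarrow> complex" where
  "main_term z = exp (- z\<^sup>2 / 2) * z powr \<kappa>"

lemma main_term_nonzero: "z \<noteq> 0 \<Longrightarrow> main_term z \<noteq> 0"
  by (simp add: main_term_def)

lemma integrand_main:
  assumes "z \<noteq> 0" "z + d * of_real s \<noteq> 0" "d = \<i> \<or> d = - \<i>"
  shows "integrand z (z + d * of_real s) = main_term z * (complex_of_real (exp (- s\<^sup>2 / 2)) * ratio z (z + d * of_real s))"
proof -
  have "(z + d * of_real s - z)\<^sup>2 = - (of_real s)\<^sup>2" using assms(3) by (auto simp: power_mult_distrib)
  then show ?thesis using integrand_ratio[OF assms(1,2)] by (simp add: main_term_def flip: exp_of_real)
qed

lemma end_value_at:
  assumes d: "d = \<i> \<or> d = - \<i>" and z: "cmod z \<ge> R"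
    and ray: "\<And>s. s \<ge> 0 \<Longrightarrow> z + d * of_real s \<in> S \<and> cmod (z + d * of_real s) \<ge> R"
  shows "end_value z d = prim z z + d * (main_term z * (LINT s:{0..}|lborel. complex_of_real (exp (- s\<^sup>2 / 2)) * ratio z (z + d * of_real s)))"
proof -
  obtain B where B: "B > 0" "\<And>z t. cmod z \<ge> R \<Longrightarrow> cmod t \<ge> R \<Longrightarrow> norm (ratio z t) \<le> B * exp (cmod \<kappa> / R * cmod (t - z))"
    using ratio_bound by blast
  have z0: "z \<noteq> 0" using z R R0 by auto
  have nz: "z + d * of_real s \<noteq> 0" if "s \<ge> 0" for s using ray[OF that] R R0 by auto
  have im: "integrand z (z + d * of_real s) = main_term z * (complex_of_real (exp (- s\<^sup>2 / 2)) * ratio z (z + d * of_real s))" if "s \<ge> 0" for s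
    using integrand_main[OF z0 nz[OF that] d] .
  define b where "b = cmod \<kappa> / R"
  have bd: "norm (integrand z (z + d * of_real s)) \<le> (norm (main_term z) * B * exp (b\<^sup>2 / 2)) * exp (- (s - b)\<^sup>2 / 2)" if s: "s \<ge> 0" for s
  proof -
    have "cmod (z + d * of_real s - z) = s" using d s by (auto simp: norm_mult)
    then have "norm (ratio z (z + d * of_real s)) \<le> B * exp (b * s)"
      using B(2)[OF z, of "z + d * of_real s"] ray[OF s] by (simp add: b_def)
    then have "norm (integrand z (z + d * of_real s)) \<le> norm (main_term z) * (exp (- s\<^sup>2 / 2) * (B * exp (b * s)))"
      unfolding im[OF s] norm_mult by (intro mult_left_mono) auto
    also have "\<dots> = norm (main_term z) * B * exp (- s\<^sup>2 / 2 + b * s)" by (simp only: exp_add mult_ac)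
    also have "\<dots> = (norm (main_term z) * B * exp (b\<^sup>2 / 2)) * exp (- (s - b)\<^sup>2 / 2)"
      unfolding gaussian_complete by (simp only: exp_add mult_ac)
    finally show ?thesis .
  qed
  have r: "z + d * of_real s \<in> S" if "s \<ge> 0" for s using ray[OF that] by blast
  note lim = ray_primitive_limit(2)[OF prim continuous_integrand r bd]
  \<comment> \<open>The height of \<open>z\<close> measured in the direction \<open>d\<close>: the
    ray from \<open>z\<close> is a reparametrised vertical ray from the real axis.\<close>
  define v where "v = Im z * Im d"
  have zv: "z + d * of_real N = of_real (Re z) + d * of_real (N + v)" for N
    using d by (auto simp: v_def complex_eq_iff)
  have "((\<lambda>N. prim z (of_real (Re z) + d * of_real (N + v))) \<longlongrightarrow> end_value z d) at_top"
    using filterlim_compose[OF vertical_limit(2)[OF d, of z "Re z"], of "\<lambda>N. N + v" at_top] filterlim_tendsto_add_at_top[OF tendsto_const[of v] filterlim_ident]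
    unfolding end_value_def by (simp add: add.commute)
  then have "((\<lambda>N. prim z (z + d * of_real N)) \<longlongrightarrow> end_value z d) at_top" unfolding zv .
  from tendsto_unique[OF _ this lim] 
  have "end_value z d = prim z z + d * (LINT s:{0..}|lborel. integrand z (z + d * of_real s))" by simp
  also have "(LINT s:{0..}|lborel. integrand z (z + d * of_real s)) = (LINT s:{0..}|lborel. main_term z * (complex_of_real (exp (- s\<^sup>2 / 2)) * ratio z (z + d * of_real s)))"
    by (intro set_lebesgue_integral_cong) (auto simp: im)
  also have "\<dots> = main_term z * (LINT s:{0..}|lborel. complex_of_real (exp (- s\<^sup>2 / 2)) * ratio z (z + d * of_real s))"
    by (rule set_integral_mult_right)
  finally show ?thesis .
qed

lemma prim_diff_at:
  assumes z: "z \<noteq> 0" and a: "a \<ge> 0" and ray: "\<And>s. 0 \<le> s \<Longrightarrow> s \<le> a \<Longrightarrow> z - \<i> * of_real s \<in> S"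
  shows "prim z (z - \<i> * of_real a) - prim z z = (- \<i>) * (main_term z * (LINT s:{0..a}|lborel. complex_of_real (exp (- s\<^sup>2 / 2)) * ratio z (z + (- \<i>) * of_real s)))"
proof -
  have nz: "z + (- \<i>) * of_real s \<noteq> 0" if "0 \<le> s" "s \<le> a" for s using ray[OF that] R0 by (auto simp: S_iff)
  have im: "integrand z (z + (- \<i>) * of_real s) = main_term z * (complex_of_real (exp (- s\<^sup>2 / 2)) * ratio z (z + (- \<i>) * of_real s))" if "0 \<le> s" "s \<le> a" for s
    using integrand_main[OF z nz[OF that]] by simp
  have "((\<lambda>s. (- \<i>) * integrand z (z + (- \<i>) * of_real s)) has_integral prim z (z + (- \<i>) * of_real a) - prim z (z + (- \<i>) * of_real 0)) {0..a}"
  proof (rule fundamental_theorem_of_calculus[OF a])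
    fix s assume s: "s \<in> {0..a}"
    have "((\<lambda>s. z + (- \<i>) * of_real s) has_vector_derivative (- \<i>)) (at s within {0..a})"
      by (auto intro!: derivative_eq_intros simp: has_vector_derivative_def scaleR_conv_of_real mult.commute)
    from field_vector_diff_chain_within[OF this, of "prim z" "integrand z (z + (- \<i>) * of_real s)"] prim[OF ray[of s], of z] s
    show "((\<lambda>s. prim z (z + (- \<i>) * of_real s)) has_vector_derivative (- \<i>) * integrand z (z + (- \<i>) * of_real s)) (at s within {0..a})"
      by (auto simp: o_def has_field_derivative_at_within)
  qed
  then have 1: "integral {0..a} (\<lambda>s. (- \<i>) * integrand z (z + (- \<i>) * of_real s)) = prim z (z + (- \<i>) * of_real a) - prim z (z + (- \<i>) * of_real 0)"
    by (rule integral_unique)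
  have "continuous_on {0..a} (\<lambda>s. integrand z (z + (- \<i>) * of_real s))"
    by (rule continuous_on_compose2[OF continuous_integrand]) (use ray in \<open>auto intro!: continuous_intros\<close>)
  then have "set_integrable lborel {0..a} (\<lambda>s. integrand z (z + (- \<i>) * of_real s))" by (rule borel_integrable_atLeastAtMost')
  then have "integral {0..a} (\<lambda>s. integrand z (z + (- \<i>) * of_real s)) = (LINT s:{0..a}|lborel. integrand z (z + (- \<i>) * of_real s))"
    by (simp add: set_borel_integral_eq_integral)
  also have "\<dots> = (LINT s:{0..a}|lborel. main_term z * (complex_of_real (exp (- s\<^sup>2 / 2)) * ratio z (z + (- \<i>) * of_real s)))"
    by (intro set_lebesgue_integral_cong) (auto simp: im[simplified])
  also have "\<dots> = main_term z * (LINT s:{0..a}|lborel. complex_of_real (exp (- s\<^sup>2 / 2)) * ratio z (z + (- \<i>) * of_real s))"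
    by (rule set_integral_mult_right)
  finally show ?thesis using 1 by simp
qed

text \<open>Each of the two half lines contributes \<open>- \<i> * half_gauss * U 0\<close>, and the
  sum is divided by \<open>2 * pi * \<i>\<close>. The sign reflects that the contour runs
  downwards.\<close>

definition lim_const :: complex where "lim_const = - (of_real half_gauss * U 0) / of_real pi"

lemma lim_const_nonzero: "lim_const \<noteq> 0"
  using half_gauss_pos U0 by (simp add: lim_const_def)

lemma continuous_ratio: "continuous_on S (ratio z)"
proof -
  have "ratio z t = integrand 0 t * exp (- t\<^sup>2 / 2) * exp (- \<kappa> * Ln z)" if "t \<in> S" for t
  proof -
    have t0: "t \<noteq> 0" using that R0 by (auto simp: S_iff)
    have "exp (t\<^sup>2 / 2) * exp (- t\<^sup>2 / 2) = 1" by (simp flip: exp_add)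
    moreover have "t powr \<kappa> * exp (- \<kappa> * Ln z) = exp (\<kappa> * (Ln t - Ln z))" using t0 by (simp add: powr_def algebra_simps flip: exp_add)
    ultimately show ?thesis unfolding ratio_def integrand_def gauss_kernel_def
      by (simp add: mult_ac)
  qed
  moreover have "continuous_on S (\<lambda>t. integrand 0 t * exp (- t\<^sup>2 / 2) * exp (- \<kappa> * Ln z))"
    by (intro continuous_intros continuous_integrand) auto
  ultimately show ?thesis by (simp cong: continuous_on_cong)
qed

lemma half_sector_S:
  assumes "z \<in> half_sector k" "cmod z \<ge> R" "s \<ge> 0"
  shows "z + \<i> * of_real s \<in> S" "cmod (z + \<i> * of_real s) \<ge> R"
proof -
  have "(cmod z)\<^sup>2 \<le> (cmod (z + \<i> * of_real s))\<^sup>2"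
    using assms by (simp add: cmod_power2 half_sector_def)
  then have "cmod z \<le> cmod (z + \<i> * of_real s)" by (rule power2_le_imp_le) simp
  then show n: "cmod (z + \<i> * of_real s) \<ge> R" using assms by simp
  have "Im (z + \<i> * of_real s) > 0 \<or> Re (z + \<i> * of_real s) > 0"
    using assms by (cases "Im z = 0") (auto simp: half_sector_def less_le cmod_def)
  then show "z + \<i> * of_real s \<in> S" using n R S_Im S_Re by auto
qed

text \<open>The downward vertical ray from \<open>z\<close> would meet the disc \<open>|t| < R\<close> if \<open>Re z < R\<close>. It is then stopped
  at height \<open>R\<close>, and \<open>rest\<close> is the contribution of the remaining path.\<close>

definition dn_domain :: "complex \<Rightarrow> real set" where
  "dn_domain z = (if Re z \<ge> R then {0..} else {0..Im z - R})"

definition rest :: "complex \<Rightarrow> complex" where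
  "rest z = (if Re z \<ge> R then 0 else end_value z (- \<i>) - prim z (of_real (Re z) + \<i> * of_real R))"

lemma dn_domain_S:
  assumes "s \<in> dn_domain z"
  shows "z - \<i> * of_real s \<in> S" "cmod (z - \<i> * of_real s) \<ge> R"
proof -
  have Rp: "R > 0" using R R0 by simp
  have "Re (z - \<i> * of_real s) \<ge> R \<or> Im (z - \<i> * of_real s) \<ge> R" using assms by (auto simp: dn_domain_def split: if_splits)
  then have "cmod (z - \<i> * of_real s) \<ge> R \<and> (Re (z - \<i> * of_real s) > 0 \<or> Im (z - \<i> * of_real s) \<noteq> 0)"
    using complex_Re_le_cmod[of "z - \<i> * of_real s"] abs_Im_le_cmod[of "z - \<i> * of_real s"] Rp by auto
  then show "z - \<i> * of_real s \<in> S" "cmod (z - \<i> * of_real s) \<ge> R" using S_Im[of "z - \<i> * of_real s"] S_Re[of "z - \<i> * of_real s"] R by auto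
qed

text \<open>Both ends are reached from \<open>z\<close> itself, so the values
  \<open>prim z z\<close> cancel and the common leading factor can be taken out.\<close>

lemma L_decomposition:
  assumes k: "0 < k" "k < 1" and z: "z \<in> half_sector k" "cmod z \<ge> 3 * R"
  shows "2 * of_real pi * \<i> * L z = main_term z * ((- \<i>) * (LINT s:dn_domain z|lborel. complex_of_real (exp (- s\<^sup>2 / 2)) * ratio z (z + (- \<i>) * of_real s))
     - \<i> * (LINT s:{0..}|lborel. complex_of_real (exp (- s\<^sup>2 / 2)) * ratio z (z + \<i> * of_real s))) + rest z"
proof -
  have Rp: "R > 0" using R R0 by simp
  have zR: "cmod z \<ge> R" "z \<noteq> 0" using z Rp by auto
  have up: "end_value z \<i> = prim z z + \<i> * (main_term z * (LINT s:{0..}|lborel. complex_of_real (exp (- s\<^sup>2 / 2)) * ratio z (z + \<i> * of_real s)))"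
    using half_sector_S[OF z(1) zR(1)] by (intro end_value_at zR) auto
  have dn: "end_value z (- \<i>) = prim z z + (- \<i>) * (main_term z * (LINT s:dn_domain z|lborel. complex_of_real (exp (- s\<^sup>2 / 2)) * ratio z (z + (- \<i>) * of_real s))) + rest z"
  proof (cases "Re z \<ge> R")
    case True
    then have "dn_domain z = {0..}" by (simp add: dn_domain_def)
    then show ?thesis using end_value_at[of "- \<i>" z] dn_domain_S[of _ z] zR True by (simp add: rest_def)
  next
    case False
    then have Iz: "Im z - R \<ge> 0" using half_sector_Im[OF k z(1)] z(2) by auto
    have dd: "dn_domain z = {0..Im z - R}" using False by (simp add: dn_domain_def)
    have "z - \<i> * of_real (Im z - R) = of_real (Re z) + \<i> * of_real R" by (simp add: complex_eq_iff)
    then have "prim z (of_real (Re z) + \<i> * of_real R) - prim z z = (- \<i>) * (main_term z * (LINT s:{0..Im z - R}|lborel. complex_of_real (exp (- s\<^sup>2 / 2)) * ratio z (z + (- \<i>) * of_real s)))"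
      using prim_diff_at[OF zR(2) Iz] dn_domain_S(1)[of _ z] unfolding dd by simp
    moreover have "end_value z (- \<i>) = prim z z + (prim z (of_real (Re z) + \<i> * of_real R) - prim z z) + rest z"
      using False by (simp add: rest_def)
    ultimately show ?thesis unfolding dd by simp
  qed
  show ?thesis unfolding L_eq_ends up dn by (simp add: algebra_simps)
qed

text \<open>\<open>rest\<close> is of exponential type, and it occurs only left of abscissa
  \<open>R\<close>, where \<open>- Re (z\<^sup>2)\<close> is at least
  \<open>(1 - k\<^sup>2) * (Im z)\<^sup>2 - R\<^sup>2\<close>; there the leading term is Gaussian
  large.\<close>

lemma rest_small:
  assumes k: "0 < k" "k < 1"
  shows "\<exists>C. \<forall>z\<in>half_sector k. cmod z \<ge> 3 * R \<longrightarrow> norm (rest z / main_term z) \<le> exp (C * (cmod z + 1) + R\<^sup>2 / 2 - (1 - k\<^sup>2) / 8 * (cmod z - R)\<^sup>2)"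
proof -
  have Rp: "R > 0" using R R0 by simp
  obtain C where C: "C \<ge> 0" "\<And>z. Im z \<ge> 0 \<Longrightarrow> norm (end_value z (- \<i>) - prim z (of_real (Re z) + \<i> * of_real R)) \<le> exp (C * (norm z + 1))"
    using lower_part_exp_type unfolding exp_type_on_def by auto
  define K where "K = \<bar>ln R\<bar> + pi + 1"
  have K: "K \<ge> 1" by (simp add: K_def)
  have "norm (rest z / main_term z) \<le> exp ((C + cmod \<kappa> * K) * (cmod z + 1) + R\<^sup>2 / 2 - (1 - k\<^sup>2) / 8 * (cmod z - R)\<^sup>2)"
    if z: "z \<in> half_sector k" "cmod z \<ge> 3 * R" for z
  proof (cases "Re z \<ge> R")
    case True
    then show ?thesis by (simp add: rest_def)
  next
    case False
    have nz: "cmod z > 0" "z \<noteq> 0" using z Rp by auto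
    have Im: "Im z \<ge> 0" "Re z \<ge> - k * Im z" using z by (auto simp: half_sector_def)
    have r: "norm (rest z) \<le> exp (C * (cmod z + 1))" using C(2)[OF Im(1)] False by (simp add: rest_def)
    have "norm (Ln z) \<le> \<bar>ln (cmod z)\<bar> + \<bar>Im (Ln z)\<bar>" using cmod_le[of "Ln z"] nz by simp
    also have "\<bar>Im (Ln z)\<bar> \<le> pi" using Im_Ln_le_pi[OF nz(2)] mpi_less_Im_Ln[OF nz(2)] by simp
    also have "\<bar>ln (cmod z)\<bar> \<le> cmod z + \<bar>ln R\<bar>"
    proof -
      have "ln (cmod z) \<le> cmod z" using ln_le_minus_one[OF nz(1)] by simp
      moreover have "ln R \<le> ln (cmod z)" using z Rp nz by (subst ln_le_cancel_iff) auto
      ultimately show ?thesis using nz by linarith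
    qed
    also have "cmod z + \<bar>ln R\<bar> + pi \<le> K * (cmod z + 1)"
    proof -
      have "1 * cmod z \<le> K * cmod z" using K by (intro mult_right_mono) auto
      then show ?thesis by (simp add: K_def distrib_left)
    qed
    finally have "cmod \<kappa> * norm (Ln z) \<le> cmod \<kappa> * (K * (cmod z + 1))" by (intro mult_left_mono) auto
    moreover have "- Re (\<kappa> * Ln z) \<le> cmod \<kappa> * norm (Ln z)" using abs_Re_le_cmod[of "\<kappa> * Ln z"] by (simp add: norm_mult)
    ultimately have ln: "- Re (\<kappa> * Ln z) \<le> cmod \<kappa> * K * (cmod z + 1)" by simp
    have sq: "Re (z\<^sup>2) / 2 \<le> R\<^sup>2 / 2 - (1 - k\<^sup>2) / 8 * (cmod z - R)\<^sup>2"
    proof -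
      have "(Re z)\<^sup>2 \<le> R\<^sup>2 + k\<^sup>2 * (Im z)\<^sup>2"
      proof (cases "Re z \<ge> 0")
        case True
        then have "(Re z)\<^sup>2 \<le> R\<^sup>2" using False by (intro power_mono) auto
        then show ?thesis by (simp add: add_increasing2)
      next
        case neg: False
        then have "(- Re z)\<^sup>2 \<le> (k * Im z)\<^sup>2" using Im by (intro power_mono) auto
        then show ?thesis by (simp add: power_mult_distrib add_increasing)
      qed
      then have "Re (z\<^sup>2) \<le> R\<^sup>2 - (1 - k\<^sup>2) * (Im z)\<^sup>2" by (simp add: power2_eq_square algebra_simps)
      moreover have "(1 - k\<^sup>2) * ((cmod z - R) / 2)\<^sup>2 \<le> (1 - k\<^sup>2) * (Im z)\<^sup>2"
      proof (intro mult_left_mono power_mono)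
        show "(cmod z - R) / 2 \<le> Im z" using half_sector_Im[OF k z(1)] False by simp
        show "0 \<le> 1 - k\<^sup>2" using k by (simp add: power_le_one)
      qed (use z Rp in auto)
      moreover have "(1 - k\<^sup>2) * ((cmod z - R) / 2)\<^sup>2 = (1 - k\<^sup>2) / 4 * (cmod z - R)\<^sup>2" by (simp add: power_divide)
      ultimately have "Re (z\<^sup>2) \<le> R\<^sup>2 - (1 - k\<^sup>2) / 4 * (cmod z - R)\<^sup>2" by linarith
      then show ?thesis by (simp add: field_simps)
    qed
    have "norm (rest z / main_term z) = norm (rest z) * exp (Re (z\<^sup>2) / 2 + - Re (\<kappa> * Ln z))"
    proof -
      have m: "main_term z = exp (- z\<^sup>2 / 2 + \<kappa> * Ln z)" using nz by (simp only: main_term_def powr_def exp_add if_False)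
      have "Re (- z\<^sup>2 / 2 + \<kappa> * Ln z) = - (Re (z\<^sup>2) / 2 + - Re (\<kappa> * Ln z))" by simp
      then show ?thesis unfolding m norm_divide norm_exp_eq_Re by (simp only: exp_minus divide_inverse inverse_inverse_eq)
    qed
    also have "\<dots> \<le> exp (C * (cmod z + 1)) * exp (R\<^sup>2 / 2 - (1 - k\<^sup>2) / 8 * (cmod z - R)\<^sup>2 + cmod \<kappa> * K * (cmod z + 1))"
    proof (rule mult_mono[OF r])
      have "Re (z\<^sup>2) / 2 + - Re (\<kappa> * Ln z) \<le> R\<^sup>2 / 2 - (1 - k\<^sup>2) / 8 * (cmod z - R)\<^sup>2 + cmod \<kappa> * K * (cmod z + 1)"
        using add_mono[OF sq ln] .
      then show "exp (Re (z\<^sup>2) / 2 + - Re (\<kappa> * Ln z)) \<le> exp (R\<^sup>2 / 2 - (1 - k\<^sup>2) / 8 * (cmod z - R)\<^sup>2 + cmod \<kappa> * K * (cmod z + 1))"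
        by (simp only: exp_le_cancel_iff)
    qed auto
    also have "\<dots> = exp ((C + cmod \<kappa> * K) * (cmod z + 1) + R\<^sup>2 / 2 - (1 - k\<^sup>2) / 8 * (cmod z - R)\<^sup>2)"
      unfolding exp_add[symmetric] by (simp add: algebra_simps)
    finally show ?thesis .
  qed
  then show ?thesis by blast
qed

lemma L_asymp_half:
  assumes k: "0 < k" "k < 1" and e: "e > 0"
  shows "\<exists>r0. \<forall>z\<in>half_sector k. cmod z > r0 \<longrightarrow> dist (L z / main_term z) lim_const < e"
proof -
  have Rp: "R > 0" using R R0 by simp
  obtain C where C: "\<And>z. z \<in> half_sector k \<Longrightarrow> cmod z \<ge> 3 * R \<Longrightarrow> norm (rest z / main_term z) \<le> exp (C * (cmod z + 1) + R\<^sup>2 / 2 - (1 - k\<^sup>2) / 8 * (cmod z - R)\<^sup>2)"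
    using rest_small[OF k] by blast
  have "\<exists>r0. \<forall>z\<in>{z \<in> half_sector k. cmod z \<ge> 3 * R}. norm z > r0 \<longrightarrow> dist (L z / main_term z) lim_const < e"
  proof (rule sequential_limitI[OF _ e])
    fix X assume X: "\<And>n. X n \<in> {z \<in> half_sector k. cmod z \<ge> 3 * R}" "filterlim (\<lambda>n. norm (X n)) at_top sequentially"
    have Xh: "X n \<in> half_sector k" and XR: "cmod (X n) \<ge> 3 * R" "cmod (X n) \<ge> R" for n using X(1)[of n] Rp by auto
    have rst: "(\<lambda>n. rest (X n) / main_term (X n)) \<longlonglongrightarrow> 0"
    proof (rule Lim_null_comparison)
      show "\<forall>\<^sub>F n in sequentially. norm (rest (X n) / main_term (X n)) \<le> exp (C * (cmod (X n) + 1) + R\<^sup>2 / 2 - (1 - k\<^sup>2) / 8 * (cmod (X n) - R)\<^sup>2)"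
        using C Xh XR by (intro always_eventually allI) auto
      define a where "a = (1 - k\<^sup>2) / 8"
      have "k\<^sup>2 < 1" using k by (simp add: power_less_one_iff)
      then have a: "a > 0" by (simp add: a_def)
      have "((\<lambda>r. exp (C * (r + 1) + R\<^sup>2 / 2 - a * (r - R)\<^sup>2)) \<longlongrightarrow> 0) at_top" using a by real_asymp
      then show "(\<lambda>n. exp (C * (cmod (X n) + 1) + R\<^sup>2 / 2 - (1 - k\<^sup>2) / 8 * (cmod (X n) - R)\<^sup>2)) \<longlonglongrightarrow> 0"
        using filterlim_compose[OF _ X(2)] unfolding a_def by fast
    qed
    have up: "(\<lambda>n. LINT s:{0..}|lborel. complex_of_real (exp (- s\<^sup>2 / 2)) * ratio (X n) (X n + \<i> * of_real (1 * s))) \<longlonglongrightarrow> of_real half_gauss * U 0"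
      by (rule ratio_integral_tendsto[OF k Xh X(2) XR(2)])
         (auto intro!: half_sector_S[OF Xh XR(2)] continuous_on_compose2[OF continuous_ratio] continuous_intros)
    have dn: "(\<lambda>n. LINT s:dn_domain (X n)|lborel. complex_of_real (exp (- s\<^sup>2 / 2)) * ratio (X n) (X n + \<i> * of_real ((- 1) * s))) \<longlonglongrightarrow> of_real half_gauss * U 0"
    proof (rule ratio_integral_tendsto[OF k Xh X(2) XR(2)])
      show "dn_domain (X n) \<in> sets borel" "dn_domain (X n) \<subseteq> {0..}" for n by (auto simp: dn_domain_def)
      show "\<forall>\<^sub>F n in sequentially. s \<in> dn_domain (X n)" if "s \<ge> 0" for s
      proof -
        have "\<forall>\<^sub>F n in sequentially. cmod (X n) > 3 * R + 2 * s" using X(2) by (auto simp: filterlim_at_top_dense)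
        then show ?thesis
        proof eventually_elim
          case (elim n)
          show ?case
          proof (cases "Re (X n) \<ge> R")
            case False
            then show ?thesis using half_sector_Im[OF k Xh, of n] elim that by (simp add: dn_domain_def)
          qed (use that in \<open>simp add: dn_domain_def\<close>)
        qed
      qed
      show "R \<le> cmod (X n + \<i> * of_real ((- 1) * s))" if "s \<in> dn_domain (X n)" for n s
        using dn_domain_S(2)[OF that] by simp
      show "continuous_on (dn_domain (X n)) (\<lambda>s. ratio (X n) (X n + \<i> * of_real ((- 1) * s)))" for n
        by (rule continuous_on_compose2[OF continuous_ratio]) (auto intro!: continuous_intros dn_domain_S(1))
    qed auto
    have eq: "L (X n) / main_term (X n) = (1 / (2 * of_real pi * \<i>)) * ((- \<i>) * (LINT s:dn_domain (X n)|lborel. complex_of_real (exp (- s\<^sup>2 / 2)) * ratio (X n) (X n + \<i> * of_real ((- 1) * s)))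
       - \<i> * (LINT s:{0..}|lborel. complex_of_real (exp (- s\<^sup>2 / 2)) * ratio (X n) (X n + \<i> * of_real (1 * s))) + rest (X n) / main_term (X n))" for n
    proof -
      have "X n \<noteq> 0" using XR(2)[of n] Rp by auto
      then have m: "main_term (X n) \<noteq> 0" by (rule main_term_nonzero)
      have "L (X n) = (1 / (2 * of_real pi * \<i>)) * (2 * of_real pi * \<i> * L (X n))" by simp
      then show ?thesis unfolding L_decomposition[OF k Xh XR(1)] using m by (simp add: field_simps)
    qed
    have "(\<lambda>n. L (X n) / main_term (X n)) \<longlonglongrightarrow> (1 / (2 * of_real pi * \<i>)) * ((- \<i>) * (of_real half_gauss * U 0) - \<i> * (of_real half_gauss * U 0) + 0)"
      unfolding eq by (intro tendsto_intros up dn rst)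
    moreover have "(1 / (2 * of_real pi * \<i>)) * ((- \<i>) * (of_real half_gauss * U 0) - \<i> * (of_real half_gauss * U 0) + 0) = lim_const"
      by (simp add: lim_const_def field_simps)
    ultimately show "(\<lambda>n. L (X n) / main_term (X n)) \<longlonglongrightarrow> lim_const" by simp
  qed
  then obtain r0 where "\<And>z. z \<in> half_sector k \<Longrightarrow> cmod z \<ge> 3 * R \<Longrightarrow> norm z > r0 \<Longrightarrow> dist (L z / main_term z) lim_const < e" by auto
  then show ?thesis by (intro exI[of _ "max r0 (3 * R)"]) auto
qed

theorem L_asymp:
  assumes k: "0 < k" "k < 1" and e: "e > 0"
  shows "\<exists>r0>0. \<forall>z. cmod z > r0 \<longrightarrow> Re z \<ge> - k * \<bar>Im z\<bar> \<longrightarrow> dist (L z / main_term z) lim_const < e"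
proof -
  interpret c: gauss_laplace "cnj \<kappa>" conj_coeff R0 R by (rule conj_instance)
  obtain r1 where r1: "\<And>z. z \<in> half_sector k \<Longrightarrow> cmod z > r1 \<Longrightarrow> dist (L z / main_term z) lim_const < e"
    using L_asymp_half[OF assms] by blast
  obtain r2 where r2: "\<And>z. z \<in> half_sector k \<Longrightarrow> cmod z > r2 \<Longrightarrow> dist (c.L z / c.main_term z) c.lim_const < e"
    using c.L_asymp_half[OF assms] by blast
  have "dist (L z / main_term z) lim_const < e" if z: "cmod z > max 1 (max r1 r2)" "Re z \<ge> - k * \<bar>Im z\<bar>" for z
  proof (cases "Im z \<ge> 0")
    case True
    then show ?thesis using z by (intro r1) (auto simp: half_sector_def)
  next
    case False
    then have "cnj z \<in> half_sector k" using z by (auto simp: half_sector_def)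
    then have d: "dist (c.L (cnj z) / c.main_term (cnj z)) c.lim_const < e" using z by (intro r2) auto
    have z0: "z \<noteq> 0" "z \<notin> \<real>\<^sub>\<le>\<^sub>0" using False by (auto simp: complex_nonpos_Reals_iff)
    have "c.main_term (cnj z) = cnj (main_term z)"
      using z0 by (simp add: c.main_term_def main_term_def powr_def exp_cnj cnj_Ln)
    moreover have conj0: "conj_coeff 0 = cnj (U 0)" by (simp add: conj_coeff_def)
    have "c.lim_const = cnj lim_const" unfolding c.lim_const_def lim_const_def by (simp add: conj0)
    ultimately have "c.L (cnj z) / c.main_term (cnj z) - c.lim_const = cnj (L z / main_term z - lim_const)" using L_cnj[of z] by simp
    then show ?thesis using d unfolding dist_norm by (simp only: complex_mod_cnj)
  qed
  then show ?thesis by (intro exI[of _ "max 1 (max r1 r2)"]) auto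
qed

end

subsection \<open>The kernel at infinity\<close>

text \<open>Three difference quotients at 0 give an exact remainder, holomorphic on the whole
  disc.\<close>

lemma holomorphic_taylor2:
  fixes Y :: "complex \<Rightarrow> complex"
  assumes Y: "Y holomorphic_on ball 0 r" and r: "r > 0"
  obtains y2 Y3 where "Y3 holomorphic_on ball 0 r"
    "\<And>s. s \<in> ball 0 r \<Longrightarrow> Y s = Y 0 + deriv Y 0 * s + y2 * s\<^sup>2 + s ^ 3 * Y3 s"
proof -
  define D where "D = (\<lambda>(f :: complex \<Rightarrow> complex) z. if z = 0 then deriv f 0 else (f z - f 0) / (z - 0))"
  have D: "D f holomorphic_on ball 0 r" if "f holomorphic_on ball 0 r" for f
    using pole_lemma_open[OF that open_ball, of 0] by (simp add: D_def)
  have D_eq: "f s = f 0 + s * D f s" for f s by (simp add: D_def)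
  have D0: "D f 0 = deriv f 0" for f by (simp add: D_def)
  show thesis
  proof
    show "D (D (D Y)) holomorphic_on ball 0 r" by (intro D Y)
    show "Y s = Y 0 + deriv Y 0 * s + D (D Y) 0 * s\<^sup>2 + s ^ 3 * D (D (D Y)) s" for s
    proof -
      have "Y s = Y 0 + s * (D Y 0 + s * (D (D Y) 0 + s * D (D (D Y)) s))"
        using D_eq[of Y s] D_eq[of "D Y" s] D_eq[of "D (D Y)" s] by simp
      then show ?thesis by (simp add: D0 algebra_simps power2_eq_square power3_eq_cube)
    qed
  qed
qed

text \<open>With \<open>s = 1 / t\<close> both symbols are powers of \<open>- t\<close> times
  polynomials in \<open>s\<close> equal to 1 at 0. The difference of derivatives is the first Taylor
  coefficient of \<open>V0 / V1\<close>.\<close>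

lemma symbol_at_infinity:
  assumes n: "n \<ge> 1" and b: "b (n - 1) = 1"
  obtains V0 V1 where "V0 holomorphic_on UNIV" "V1 holomorphic_on UNIV" "V0 0 = 1" "V1 0 = 1"
    "deriv V0 0 - deriv V1 0 = - linear_coeff n a b"
    "\<And>t. t \<noteq> 0 \<Longrightarrow> symbol_Q0 n a t = (- t) ^ n * V0 (1 / t)"
    "\<And>t. t \<noteq> 0 \<Longrightarrow> symbol_Q1 n b t = (- t) ^ (n - 1) * V1 (1 / t)"
proof -
  define V0 where "V0 = (\<lambda>s. 1 + (\<Sum>j<n. a j * (- s) ^ (n - j)))"
  define V1 where "V1 = (\<lambda>s. \<Sum>j<n. b j * (- s) ^ (n - 1 - j))"
  have pw: "(- t) ^ j = (- t) ^ m * (- (1 / t)) ^ (m - j)" if "t \<noteq> 0" "j \<le> m" for t :: complex and j m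
  proof -
    have "(- t) ^ m = (- t) ^ j * (- t) ^ (m - j)" using that by (simp flip: power_add)
    moreover have "(- t) ^ (m - j) * (- (1 / t)) ^ (m - j) = 1" using that by (simp flip: power_mult_distrib)
    ultimately show ?thesis by (simp add: mult.assoc)
  qed
  show thesis
  proof
    show "V0 holomorphic_on UNIV" "V1 holomorphic_on UNIV" unfolding V0_def V1_def by (intro holomorphic_intros)+
    have "(\<Sum>j<n. a j * 0 ^ (n - j)) = 0" by (intro sum.neutral) (auto simp: power_0_left)
    then show "V0 0 = 1" by (simp add: V0_def)
    have "(\<Sum>j<n. b j * 0 ^ (n - 1 - j)) = (\<Sum>j<n. if j = n - 1 then b j else 0)"
      by (intro sum.cong) (auto simp: power_0_left)
    also have "\<dots> = 1" using n b by (simp add: sum.delta)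
    finally show "V1 0 = 1" by (simp add: V1_def)
    have "(V0 has_field_derivative (\<Sum>j<n. a j * (- (of_nat (n - j) * 0 ^ (n - j - 1))))) (at 0)"
      unfolding V0_def by (auto intro!: derivative_eq_intros sum.cong simp: mult.assoc)
    then have "deriv V0 0 = (\<Sum>j<n. a j * (- (of_nat (n - j) * 0 ^ (n - j - 1))))" by (rule DERIV_imp_deriv)
    also have "\<dots> = (\<Sum>j<n. if j = n - 1 then - a j else 0)"
      by (intro sum.cong) (auto simp: power_0_left)
    also have "\<dots> = - a (n - 1)" using n by (simp add: sum.delta)
    finally have d0: "deriv V0 0 = - a (n - 1)" .
    have "(V1 has_field_derivative (\<Sum>j<n. b j * (- (of_nat (n - 1 - j) * 0 ^ (n - 1 - j - 1))))) (at 0)"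
      unfolding V1_def by (auto intro!: derivative_eq_intros sum.cong simp: mult.assoc)
    then have "deriv V1 0 = (\<Sum>j<n. b j * (- (of_nat (n - 1 - j) * 0 ^ (n - 1 - j - 1))))" by (rule DERIV_imp_deriv)
    \<comment> \<open>Truncated subtraction needs care. For \<open>j = n - 1\<close> the power is
      \<open>0 ^ 0 = 1\<close> but its factor is 0; for \<open>n = 1\<close> the index
      \<open>n - 2\<close> coincides with \<open>n - 1\<close>, hence the inner test.\<close>
    also have "\<dots> = (\<Sum>j<n. if j = n - 2 then (if n \<ge> 2 then - b j else 0) else 0)"
    proof (intro sum.cong refl)
      fix j assume "j \<in> {..<n}"
      then consider "j = n - 1" | "n - 1 - j = 1" "j = n - 2" "n \<ge> 2" | "n - 1 - j - 1 > 0" "j \<noteq> n - 2" by force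
      then show "b j * (- (of_nat (n - 1 - j) * 0 ^ (n - 1 - j - 1))) = (if j = n - 2 then (if n \<ge> 2 then - b j else 0) else 0)"
      proof cases
        case 1
        then show ?thesis using n by auto
      next
        case 2
        then show ?thesis by (simp only: diff_self_eq_0 power_0 of_nat_1 if_True) simp
      next
        case 3
        then show ?thesis by (simp only: zero_power mult_zero_right minus_zero if_False)
      qed
    qed
    also have "\<dots> = - (if n \<ge> 2 then b (n - 2) else 0)" using n by (simp add: sum.delta)
    finally show "deriv V0 0 - deriv V1 0 = - linear_coeff n a b" by (simp add: d0 linear_coeff_def)
    show "symbol_Q0 n a t = (- t) ^ n * V0 (1 / t)" if "t \<noteq> 0" for t
    proof -
      have "(\<Sum>j<n. a j * (- t) ^ j) = (- t) ^ n * (\<Sum>j<n. a j * (- (1 / t)) ^ (n - j))"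
        unfolding sum_distrib_left
      proof (rule sum.cong)
        fix j assume "j \<in> {..<n}"
        then have "(- t) ^ j = (- t) ^ n * (- (1 / t)) ^ (n - j)" by (intro pw that) auto
        then show "a j * (- t) ^ j = (- t) ^ n * (a j * (- (1 / t)) ^ (n - j))" by (simp only: mult_ac)
      qed simp
      then show ?thesis by (simp add: symbol_Q0_def V0_def distrib_left)
    qed
    show "symbol_Q1 n b t = (- t) ^ (n - 1) * V1 (1 / t)" if "t \<noteq> 0" for t
      unfolding symbol_Q1_def V1_def sum_distrib_left
    proof (rule sum.cong)
      fix j assume "j \<in> {..<n}"
      then have "(- t) ^ j = (- t) ^ (n - 1) * (- (1 / t)) ^ (n - 1 - j)" by (intro pw that) auto
      then show "b j * (- t) ^ j = (- t) ^ (n - 1) * (b j * (- (1 / t)) ^ (n - 1 - j))" by (simp only: mult_ac)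
    qed simp
  qed
qed

text \<open>The quotient of the symbols is \<open>- t + c - y2 / t - Y3 (1 / t) / t\<^sup>2\<close>.
  Its terms integrate to the Gaussian, to \<open>exp (- c * t)\<close>, to a power of
  \<open>t\<close> and to a function holomorphic in \<open>1 / t\<close>; any other primitive
  differs by a constant.\<close>

theorem laplace_kernel_gauss:
  assumes n: "n \<ge> 1" and b: "b (n - 1) = 1" and R0: "R0 \<ge> 0" and R1: "R1 > R0"
    and Q1: "\<And>t. symbol_Q1 n b t = 0 \<Longrightarrow> cmod t < R0" and ker: "laplace_kernel n a b R0 \<phi>"
  obtains \<kappa> U where "U holomorphic_on ball 0 (1 / R1)" "U 0 \<noteq> 0"
    "\<And>t. t \<in> slit_exterior R1 \<Longrightarrow> \<phi> t = gauss_kernel \<kappa> U t * exp (- linear_coeff n a b * t)"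
proof -
  define B where "B = ball (0 :: complex) (1 / R1)"
  define c where "c = linear_coeff n a b"
  have R1p: "R1 > 0" using R0 R1 by simp
  obtain V0 V1 where hV: "V0 holomorphic_on UNIV" "V1 holomorphic_on UNIV" and V00: "V0 0 = 1" and V10: "V1 0 = 1"
    and dV: "deriv V0 0 - deriv V1 0 = - c"
    and q0: "\<And>t. t \<noteq> 0 \<Longrightarrow> symbol_Q0 n a t = (- t) ^ n * V0 (1 / t)"
    and q1: "\<And>t. t \<noteq> 0 \<Longrightarrow> symbol_Q1 n b t = (- t) ^ (n - 1) * V1 (1 / t)"
    by (rule symbol_at_infinity[of n b a, OF n b, folded c_def]) blast
  have V1nz: "V1 s \<noteq> 0" if "s \<in> B" for s
  proof (cases "s = 0")
    case False
    then have "cmod (1 / s) > R1" using that R1p by (simp add: B_def norm_divide field_simps)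
    then have "symbol_Q1 n b (1 / s) \<noteq> 0" using Q1[of "1 / s"] R1 by force
    then show ?thesis using q1[of "1 / s"] False by auto
  qed (simp add: V10)
  define Y where "Y = (\<lambda>s. V0 s / V1 s)"
  have hB: "V0 holomorphic_on B" "V1 holomorphic_on B" using hV holomorphic_on_subset by auto
  have hY: "Y holomorphic_on ball 0 (1 / R1)" unfolding Y_def using hB V1nz by (intro holomorphic_intros) (auto simp: B_def)
  have "(V0 has_field_derivative deriv V0 0) (at 0)" "(V1 has_field_derivative deriv V1 0) (at 0)"
    using hV holomorphic_derivI[OF _ open_UNIV] by auto
  from DERIV_divide[OF this] have "deriv Y 0 = deriv V0 0 - deriv V1 0" 
    unfolding Y_def using V00 V10 by (intro DERIV_imp_deriv) simp
  then have dY: "deriv Y 0 = - c" and Y0: "Y 0 = 1" using dV V00 V10 by (auto simp: Y_def)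
  obtain y2 Y3 where Y3: "Y3 holomorphic_on B" and Y: "\<And>s. s \<in> B \<Longrightarrow> Y s = 1 + - c * s + y2 * s\<^sup>2 + s ^ 3 * Y3 s"
    using holomorphic_taylor2[OF hY] R1p unfolding dY Y0 B_def by (metis divide_pos_pos zero_less_one)
  obtain P where P: "\<And>s. s \<in> B \<Longrightarrow> (P has_field_derivative Y3 s) (at s)"
  proof (rule holomorphic_convex_primitive'[OF _ _ Y3])
    show "convex B" "open B" by (auto simp: B_def)
    fix g assume g: "\<And>x. x \<in> B \<Longrightarrow> (g has_field_derivative Y3 x) (at x within B)"
    show thesis by (rule that[of g]) (use g \<open>open B\<close> in \<open>auto simp: at_within_open[of _ B]\<close>)
  qed
  define G where "G = (\<lambda>t. - t\<^sup>2 / 2 + c * t - y2 * Ln t + P (1 / t))"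
  have sub: "t \<in> slit_exterior R0" if "t \<in> slit_exterior R1" for t using that R1 by (auto simp: slit_exterior_def)
  have t: "t \<noteq> 0" "t \<notin> \<real>\<^sub>\<le>\<^sub>0" "1 / t \<in> B" if "t \<in> slit_exterior R1" for t
  proof -
    have t: "cmod t > R1" "t \<notin> \<real>\<^sub>\<le>\<^sub>0" using that R1p slit_exterior_iff[of R1 t] by auto
    then show "t \<noteq> 0" "t \<notin> \<real>\<^sub>\<le>\<^sub>0" using R1p by auto
    have "1 / cmod t < 1 / R1" using t R1p by (intro divide_strict_left_mono mult_pos_pos) auto
    then show "1 / t \<in> B" by (simp add: B_def norm_divide)
  qed
  have G: "(G has_field_derivative symbol_Q0 n a t / symbol_Q1 n b t) (at t)" if "t \<in> slit_exterior R1" for t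
  proof -
    note t = t[OF that]
    have "((\<lambda>t. 1 / t) has_field_derivative - 1 / t\<^sup>2) (at t)"
      using t(1) by (auto intro!: derivative_eq_intros simp: power2_eq_square)
    then have P': "((\<lambda>t. P (1 / t)) has_field_derivative Y3 (1 / t) * (- 1 / t\<^sup>2)) (at t)"
      using DERIV_chain2[of P "Y3 (1 / t)" "\<lambda>t. 1 / t" t, OF P[OF t(3)]] by blast
    have "((\<lambda>t. - t\<^sup>2 / 2 + c * t) has_field_derivative - t + c) (at t)"
      by (auto intro!: derivative_eq_intros)
    from DERIV_add[OF DERIV_diff[OF this DERIV_cmult[OF has_field_derivative_Ln[OF t(2)], of y2]] P']
    have "(G has_field_derivative - t + c - y2 * (1 / t) + Y3 (1 / t) * (- 1 / t\<^sup>2)) (at t)"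
      unfolding G_def by (simp only: inverse_eq_divide)
    moreover have "- t + c - y2 * (1 / t) + Y3 (1 / t) * (- 1 / t\<^sup>2) = - t * Y (1 / t)"
      unfolding Y[OF t(3)] using t(1) by (simp add: field_simps power2_eq_square power3_eq_cube)
    moreover have "symbol_Q0 n a t / symbol_Q1 n b t = - t * Y (1 / t)"
    proof -
      have "(- t) ^ n = - t * (- t) ^ (n - 1)" using n by (metis power_Suc Suc_pred' less_le_trans zero_less_one)
      then show ?thesis unfolding q0[OF t(1)] q1[OF t(1)] Y_def using t(1) V1nz[OF t(3)] by simp
    qed
    ultimately show ?thesis by simp
  qed
  obtain F where F: "\<And>t. t \<in> slit_exterior R0 \<Longrightarrow> (F has_field_derivative symbol_Q0 n a t / symbol_Q1 n b t) (at t)"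
    and \<phi>: "\<And>t. t \<in> slit_exterior R0 \<Longrightarrow> \<phi> t = 1 / symbol_Q1 n b t * exp (- F t)"
    using ker unfolding laplace_kernel_def by blast
  obtain K where K: "\<And>t. t \<in> slit_exterior R1 \<Longrightarrow> F t - G t = K"
  proof (rule slit_exterior_constant[OF R1p, of "\<lambda>t. F t - G t"])
    show "((\<lambda>t. F t - G t) has_field_derivative 0) (at t)" if "t \<in> slit_exterior R1" for t
      using DERIV_diff[OF F[OF sub[OF that]] G[OF that]] by simp
    show thesis if "\<And>t. t \<in> slit_exterior R1 \<Longrightarrow> F t - G t = K" for K
      using that by (rule \<open>\<And>K. (\<And>t. t \<in> slit_exterior R1 \<Longrightarrow> F t - G t = K) \<Longrightarrow> thesis\<close>)
  qed
  define U where "U = (\<lambda>s. exp (- K) * (- 1) ^ (n - 1) * exp (- P s) / V1 s)"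
  show thesis
  proof
    have "P holomorphic_on B" using P by (auto simp: holomorphic_on_def field_differentiable_def intro: has_field_derivative_at_within)
    then show "U holomorphic_on ball 0 (1 / R1)" unfolding U_def B_def[symmetric] using hB V1nz by (intro holomorphic_intros) auto
    show "U 0 \<noteq> 0" by (simp add: U_def V10)
    \<comment> \<open>The factor \<open>1 / symbol_Q1\<close> lowers the exponent \<open>y2\<close>
      by its degree \<open>n - 1\<close> and leaves \<open>1 / V1\<close> in
      \<open>U\<close>.\<close>
    show "\<phi> t = gauss_kernel (y2 - of_nat (n - 1)) U t * exp (- linear_coeff n a b * t)" if "t \<in> slit_exterior R1" for t
    proof -
      note t = t[OF that]
      have "F t = G t + K" using K[OF that] by (simp add: algebra_simps)
      then have "- F t = t\<^sup>2 / 2 + - c * t + y2 * Ln t + - P (1 / t) + - K" by (simp add: G_def)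
      then have e: "exp (- F t) = exp (t\<^sup>2 / 2) * exp (- c * t) * t powr y2 * exp (- P (1 / t)) * exp (- K)"
        using t(1) by (simp only: exp_add powr_def if_False)
      have p: "t powr (y2 - of_nat (n - 1)) = t powr y2 / t ^ (n - 1)" using t(1) by (simp only: powr_diff powr_nat' simp_thms)
      have m: "1 / (- t) ^ (n - 1) = (- 1) ^ (n - 1) / t ^ (n - 1)"
        by (cases "even (n - 1)") auto
      have "1 / symbol_Q1 n b t = (- 1) ^ (n - 1) / t ^ (n - 1) / V1 (1 / t)"
        unfolding q1[OF t(1)] m[symmetric] by simp
      then show ?thesis unfolding \<phi>[OF sub[OF that]] e gauss_kernel_def p U_def c_def by (simp add: mult_ac)
    qed
  qed
qed

subsection \<open>The dichotomy\<close>

lemma norm_Ln_le: "cmod z \<ge> 1 \<Longrightarrow> norm (Ln z) \<le> cmod z + pi"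
proof -
  assume z: "cmod z \<ge> 1"
  then have "z \<noteq> 0" by auto
  then have "norm (Ln z) \<le> \<bar>ln (cmod z)\<bar> + \<bar>Im (Ln z)\<bar>" "\<bar>Im (Ln z)\<bar> \<le> pi"
    using cmod_le[of "Ln z"] Im_Ln_le_pi[of z] mpi_less_Im_Ln[of z] by auto
  moreover have "\<bar>ln (cmod z)\<bar> \<le> cmod z" using z ln_le_minus_one[of "cmod z"] ln_ge_zero[OF z] \<open>z \<noteq> 0\<close> by (simp only: zero_less_norm_iff) simp
  ultimately show ?thesis by linarith
qed

lemma Ln_near_one:
  assumes "dist q 1 < 1 / 2"
  shows "q \<notin> \<real>\<^sub>\<le>\<^sub>0" "q \<noteq> 0" "norm (Ln q) \<le> 1 + pi"
proof -
  have "\<bar>Re q - 1\<bar> < 1 / 2" using assms abs_Re_le_cmod[of "q - 1"] by (simp add: dist_norm)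
  then have Re: "Re q > 1 / 2" by linarith
  then show nz: "q \<notin> \<real>\<^sub>\<le>\<^sub>0" "q \<noteq> 0" by (auto simp: complex_nonpos_Reals_iff)
  have q: "cmod q \<ge> 1 / 2" "cmod q \<le> 3 / 2"
    using Re complex_Re_le_cmod[of q] norm_triangle_ineq2[of q 1] assms by (auto simp: dist_norm)
  have "ln (cmod q) \<le> 1" using ln_le_minus_one[of "cmod q"] nz q by simp
  moreover have "- ln (cmod q) \<le> 1"
  proof -
    have "inverse (cmod q) \<le> inverse (1 / 2)" using q by (intro le_imp_inverse_le) auto
    then have "ln (inverse (cmod q)) \<le> 1" using ln_le_minus_one[of "inverse (cmod q)"] nz by simp
    then show ?thesis using nz by (simp add: ln_inverse)
  qed
  ultimately have "\<bar>ln (cmod q)\<bar> \<le> 1" by linarith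
  then show "norm (Ln q) \<le> 1 + pi"
    using cmod_le[of "Ln q"] Im_Ln_le_pi[of q] mpi_less_Im_Ln[of q] nz by auto
qed

lemma norm_powr_le:
  assumes "cmod z \<ge> 1" "cmod \<kappa> \<le> of_nat m"
  shows "norm (z powr \<kappa>) \<le> exp (pi * cmod \<kappa>) * cmod z ^ m"
proof -
  have z: "z \<noteq> 0" "ln (cmod z) \<ge> 0" using assms by auto
  have "Re (\<kappa> * Ln z) = Re \<kappa> * ln (cmod z) - Im \<kappa> * Im (Ln z)" using z by simp
  moreover have "Re \<kappa> * ln (cmod z) \<le> of_nat m * ln (cmod z)"
    using complex_Re_le_cmod[of \<kappa>] assms z by (intro mult_right_mono) auto
  moreover have "\<bar>Im \<kappa>\<bar> * \<bar>Im (Ln z)\<bar> \<le> cmod \<kappa> * pi"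
    using abs_Im_le_cmod[of \<kappa>] Im_Ln_le_pi[of z] mpi_less_Im_Ln[of z] z by (intro mult_mono) auto
  then have "- (Im \<kappa> * Im (Ln z)) \<le> pi * cmod \<kappa>" by (simp add: mult.commute flip: abs_mult)
  ultimately have "Re (\<kappa> * Ln z) \<le> pi * cmod \<kappa> + of_nat m * ln (cmod z)" by linarith
  then have "exp (Re (\<kappa> * Ln z)) \<le> exp (pi * cmod \<kappa>) * exp (of_nat m * ln (cmod z))" by (simp flip: exp_add)
  also have "exp (of_nat m * ln (cmod z)) = cmod z ^ m" using z by (simp add: exp_of_nat_mult)
  finally show ?thesis using z by (simp add: powr_def)
qed

text \<open>The translation changes \<open>z\<^sup>2 / 2\<close> by terms linear in
  \<open>z\<close>, which are of exponential type; the bounds keep their form with a larger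
  constant.\<close>

lemma shift_bound:
  fixes C :: real
  assumes "C \<ge> 0"
  shows "- Re ((z + c)\<^sup>2) / 2 + C * (cmod (z + c) + 1) \<le> - Re (z\<^sup>2) / 2 + (cmod c + (cmod c)\<^sup>2 + C * (cmod c + 1)) * (cmod z + 1)"
    "C * (cmod (z + c) + 1) \<le> (cmod c + (cmod c)\<^sup>2 + C * (cmod c + 1)) * (cmod z + 1)"
proof -
  have p: "cmod c * cmod z \<ge> 0" "(cmod c)\<^sup>2 \<ge> 0" "(cmod c)\<^sup>2 * cmod z \<ge> 0" by auto
  have "cmod (z + c) + 1 \<le> (cmod c + 1) * (cmod z + 1)"
  proof -
    have "(cmod c + 1) * (cmod z + 1) = cmod c * cmod z + cmod c + cmod z + 1" by (simp add: algebra_simps)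
    then show ?thesis using norm_triangle_ineq[of z c] p(1) by linarith
  qed
  then have C: "C * (cmod (z + c) + 1) \<le> C * (cmod c + 1) * (cmod z + 1)"
    using mult_left_mono[OF _ assms] by (simp add: mult.assoc)
  moreover have "(cmod c + (cmod c)\<^sup>2) * (cmod z + 1) \<ge> 0" by simp
  ultimately show "C * (cmod (z + c) + 1) \<le> (cmod c + (cmod c)\<^sup>2 + C * (cmod c + 1)) * (cmod z + 1)"
    unfolding distrib_right[of "cmod c + (cmod c)\<^sup>2"] by linarith
  have "(z + c)\<^sup>2 = z\<^sup>2 + (2 * (c * z) + c\<^sup>2)" by (simp add: power2_eq_square algebra_simps)
  then have "- Re ((z + c)\<^sup>2) / 2 = - Re (z\<^sup>2) / 2 + - Re (2 * (c * z) + c\<^sup>2) / 2" by (simp only: plus_complex.sel) (simp add: field_simps)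
  moreover have "- Re (2 * (c * z) + c\<^sup>2) \<le> 2 * (cmod c * cmod z) + (cmod c)\<^sup>2"
    using abs_Re_le_cmod[of "2 * (c * z) + c\<^sup>2"] norm_triangle_ineq[of "2 * (c * z)" "c\<^sup>2"] by (simp add: norm_mult norm_power)
  moreover have "cmod c * cmod z + (cmod c)\<^sup>2 / 2 \<le> (cmod c + (cmod c)\<^sup>2) * (cmod z + 1)"
    using p by (simp add: algebra_simps)
  ultimately show "- Re ((z + c)\<^sup>2) / 2 + C * (cmod (z + c) + 1) \<le> - Re (z\<^sup>2) / 2 + (cmod c + (cmod c)\<^sup>2 + C * (cmod c + 1)) * (cmod z + 1)"
    unfolding distrib_right[of "cmod c + (cmod c)\<^sup>2"] using C by linarith
qed

text \<open>Widening the slope from \<open>k\<close> to its mean with 1 gains a distance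
  proportional to \<open>cmod z\<close>, which exceeds any fixed translation far out.\<close>

lemma sector_translate:
  assumes k: "0 < k" "k < 1" and z: "Re z > - k * \<bar>Im z\<bar>" "cmod z \<ge> 8 * cmod c / (1 - k)"
  shows "Re (z + c) \<ge> - ((1 + k) / 2) * \<bar>Im (z + c)\<bar>"
proof -
  define K where "K = (1 + k) / 2"
  have K: "K < 1" "K > 0" "K - k = (1 - k) / 2" "K \<ge> (1 - k) / 4" using k by (auto simp: K_def)
  have "8 * cmod c \<le> (1 - k) * cmod z" using z(2) k by (simp add: field_simps)
  have "Re z + K * \<bar>Im z\<bar> \<ge> (1 - k) / 4 * cmod z"
  proof (cases "Re z \<ge> 0")
    case True
    have "(1 - k) / 4 * cmod z \<le> K * (Re z + \<bar>Im z\<bar>)"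
      using K cmod_le[of z] True by (intro mult_mono) auto
    also have "\<dots> \<le> Re z + K * \<bar>Im z\<bar>" using mult_right_mono[of K 1 "Re z"] K True by (simp add: distrib_left)
    finally show ?thesis .
  next
    case False
    have "k * \<bar>Im z\<bar> \<le> 1 * \<bar>Im z\<bar>" using k by (intro mult_right_mono) auto
    then have "cmod z \<le> 2 * \<bar>Im z\<bar>" using cmod_le[of z] False z(1) by simp
    then have "(1 - k) / 4 * cmod z \<le> (1 - k) / 4 * (2 * \<bar>Im z\<bar>)" using k by (intro mult_left_mono) auto
    also have "\<dots> = K * \<bar>Im z\<bar> - k * \<bar>Im z\<bar>" unfolding left_diff_distrib[symmetric] K(3) by simp
    finally show ?thesis using z(1) by linarith
  qed
  then have "Re z + K * \<bar>Im z\<bar> \<ge> 2 * cmod c" using \<open>8 * cmod c \<le> _\<close> by simp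
  moreover have "K * \<bar>Im z\<bar> \<le> K * (\<bar>Im (z + c)\<bar> + \<bar>Im c\<bar>)" using K by (intro mult_left_mono) auto
  moreover have "K * \<bar>Im c\<bar> \<le> cmod c" using mult_mono[of K 1 "\<bar>Im c\<bar>" "cmod c"] K abs_Im_le_cmod[of c] by simp
  moreover have "- Re c \<le> cmod c" using abs_Re_le_cmod[of c] by simp
  ultimately have "Re (z + c) \<ge> - K * \<bar>Im (z + c)\<bar>" by (simp add: distrib_left)
  then show ?thesis by (simp add: K_def)
qed

context gauss_laplace
begin

lemma L_nonzero: "\<exists>w. L w \<noteq> 0"
proof -
  obtain r0 where r0: "r0 > 0" "\<And>z. cmod z > r0 \<Longrightarrow> Re z \<ge> - (1 / 2) * \<bar>Im z\<bar> \<Longrightarrow> dist (L z / main_term z) lim_const < cmod lim_const"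
    using L_asymp[of "1 / 2" "cmod lim_const"] lim_const_nonzero by auto
  have "dist (L (of_real (r0 + 1)) / main_term (of_real (r0 + 1))) lim_const < cmod lim_const"
    using r0(1) by (intro r0(2)) (auto simp del: of_real_add)
  then show ?thesis by (intro exI[of _ "of_real (r0 + 1)"]) (auto simp del: of_real_add)
qed

lemma L_right_growth:
  assumes m: "cmod \<kappa> \<le> of_nat m"
  obtains r0 A where "\<And>w. cmod w \<ge> r0 \<Longrightarrow> Re w \<ge> 0 \<Longrightarrow> norm (L w * exp (w\<^sup>2 / 2)) \<le> A * cmod w ^ m" "A \<ge> 0"
proof -
  obtain r0 where r0: "r0 > 0" "\<And>z. cmod z > r0 \<Longrightarrow> Re z \<ge> - (1 / 2) * \<bar>Im z\<bar> \<Longrightarrow> dist (L z / main_term z) lim_const < 1"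
    using L_asymp[of "1 / 2" 1] by auto
  define A where "A = (cmod lim_const + 1) * exp (pi * cmod \<kappa>)"
  have "norm (L w * exp (w\<^sup>2 / 2)) \<le> A * cmod w ^ m" if w: "cmod w \<ge> max 1 r0 + 1" "Re w \<ge> 0" for w
  proof -
    have w0: "w \<noteq> 0" using w by auto
    have "cmod w > r0" using w by simp
    then have "dist (L w / main_term w) lim_const < 1" using w by (intro r0(2)) auto
    then have q: "cmod (L w / main_term w) \<le> cmod lim_const + 1"
      using norm_triangle_ineq2[of "L w / main_term w" lim_const] by (simp add: dist_norm)
    have "main_term w * exp (w\<^sup>2 / 2) = w powr \<kappa>" by (simp add: main_term_def mult_exp_exp mult_ac flip: mult.assoc)
    then have "L w * exp (w\<^sup>2 / 2) = L w / main_term w * w powr \<kappa>" using main_term_nonzero[OF w0] by (simp add: field_simps)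
    then have "norm (L w * exp (w\<^sup>2 / 2)) = norm (L w / main_term w) * norm (w powr \<kappa>)" by (simp only: norm_mult)
    also have "\<dots> \<le> (cmod lim_const + 1) * (exp (pi * cmod \<kappa>) * cmod w ^ m)"
      using w q by (intro mult_mono norm_powr_le m) auto
    finally show ?thesis by (simp add: A_def)
  qed
  moreover have "A \<ge> 0" by (simp add: A_def)
  ultimately show thesis by (rule that)
qed

text \<open>The right half plane is governed by the asymptotics of \<open>L\<close>, the left one by
  those of the reflected transform, and together they leave no direction without polynomial
  growth.\<close>

lemma L_symmetric_imp_polynomial:
  assumes sym: "\<And>w. L w = gauss_laplace.L \<kappa> reflected_coeff R (- w)"
  shows "\<exists>p. p \<noteq> 0 \<and> (\<forall>w. L w = exp (- w\<^sup>2 / 2) * poly p w)"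
proof -
  interpret r: gauss_laplace \<kappa> reflected_coeff R0 R by (rule reflected_instance)
  obtain m where m: "cmod \<kappa> \<le> of_nat m" using real_arch_simple by blast
  obtain r1 A where A: "\<And>w. cmod w \<ge> r1 \<Longrightarrow> Re w \<ge> 0 \<Longrightarrow> norm (L w * exp (w\<^sup>2 / 2)) \<le> A * cmod w ^ m" "A \<ge> 0"
    using L_right_growth[OF m] by blast
  obtain r2 B where B: "\<And>w. cmod w \<ge> r2 \<Longrightarrow> Re w \<ge> 0 \<Longrightarrow> norm (r.L w * exp (w\<^sup>2 / 2)) \<le> B * cmod w ^ m" "B \<ge> 0"
    using r.L_right_growth[OF m] by blast
  define h where "h = (\<lambda>w. L w * exp (w\<^sup>2 / 2))"
  have hol: "h holomorphic_on UNIV" unfolding h_def by (intro holomorphic_intros L_entire) auto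
  have bd: "norm (h w) \<le> (A + B) * norm w ^ m" if w: "max r1 r2 \<le> norm w" for w
  proof (cases "Re w \<ge> 0")
    case True
    then have "norm (h w) \<le> A * norm w ^ m" using A(1)[of w] w by (simp add: h_def)
    also have "\<dots> \<le> (A + B) * norm w ^ m" using B(2) by (intro mult_right_mono) auto
    finally show ?thesis .
  next
    case False
    then have "norm (h w) \<le> B * norm w ^ m" using B(1)[of "- w"] w by (simp add: h_def sym[of w])
    also have "\<dots> \<le> (A + B) * norm w ^ m" using A(2) by (intro mult_right_mono) auto
    finally show ?thesis .
  qed
  define p where "p = (\<Sum>k\<le>m. monom ((deriv ^^ k) h 0 / fact k) k)"
  have hp: "h w = poly p w" for w
    unfolding p_def poly_sum poly_monom by (rule Liouville_polynomial[OF hol bd])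
  have Lp: "L w = exp (- w\<^sup>2 / 2) * poly p w" for w
  proof -
    have "exp (- w\<^sup>2 / 2) * exp (w\<^sup>2 / 2) = 1" by (simp add: mult_exp_exp)
    then show ?thesis unfolding hp[symmetric] h_def by (simp add: mult_ac)
  qed
  moreover have "p \<noteq> 0" using L_nonzero by (auto simp: Lp)
  ultimately show ?thesis by blast
qed

lemma L_translate_entire: "(\<lambda>z. L (z + c)) holomorphic_on UNIV"
proof -
  have "(\<lambda>z. z + c) holomorphic_on UNIV" by (intro holomorphic_intros)
  from holomorphic_on_compose_gen[OF this L_entire] show ?thesis by (simp add: o_def)
qed

text \<open>The quotient \<open>q\<close> of \<open>L\<close> by its leading term and its limit is
  eventually within 1/2 of 1, so the principal logarithm applies to it. The translation contributes
  only the terms \<open>c * z + c\<^sup>2 / 2\<close> to the exponent.\<close>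

lemma L_log_asymp:
  assumes k: "0 < k" "k < 1"
  shows "\<exists>r0>0. \<exists>E D. E holomorphic_on {z. norm z > r0 \<and> Re z > - k * \<bar>Im z\<bar>} \<and>
        (\<forall>z. norm z > r0 \<longrightarrow> Re z > - k * \<bar>Im z\<bar> \<longrightarrow> L (z + c) = exp (- z\<^sup>2 / 2 + E z) \<and> norm (E z) \<le> D * norm z)"
proof -
  have "0 < (1 + k) / 2" "(1 + k) / 2 < 1" "cmod lim_const / 2 > 0" using k lim_const_nonzero by auto
  from L_asymp[OF this] obtain r1 where "r1 > 0"
    and r1: "\<And>z. cmod z > r1 \<Longrightarrow> Re z \<ge> - ((1 + k) / 2) * \<bar>Im z\<bar> \<Longrightarrow> dist (L z / main_term z) lim_const < cmod lim_const / 2"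
    by blast
  define q where "q = (\<lambda>w. L w / main_term w / lim_const)"
  define r0 where "r0 = max (8 * cmod c / (1 - k)) (1 + r1 + cmod c)"
  define T where "T = {z. norm z > r0 \<and> Re z > - k * \<bar>Im z\<bar>}"
  define E where "E = (\<lambda>z. - (c * z + c\<^sup>2 / 2) + \<kappa> * Ln (z + c) + Ln lim_const + Ln (q (z + c)))"
  define D where "D = cmod c + (cmod c)\<^sup>2 / 2 + cmod \<kappa> * (1 + cmod c + pi) + cmod (Ln lim_const) + (1 + pi)"
  have "1 + r1 + cmod c \<le> r0" by (simp add: r0_def)
  then have r0: "r0 \<ge> 1" using \<open>r1 > 0\<close> norm_ge_zero[of c] by linarith
  have shift: "cmod (z + c) \<ge> 1" "z + c \<noteq> 0" "z + c \<notin> \<real>\<^sub>\<le>\<^sub>0" "dist (q (z + c)) 1 < 1 / 2" "cmod z \<ge> 1" if "z \<in> T" for z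
  proof -
    have z: "cmod z > r0" "Re z > - k * \<bar>Im z\<bar>" using that by (auto simp: T_def)
    have big: "cmod z > 8 * cmod c / (1 - k)" "cmod z > 1 + r1 + cmod c" using z(1) by (auto simp: r0_def)
    have sec: "Re (z + c) \<ge> - ((1 + k) / 2) * \<bar>Im (z + c)\<bar>" using big by (intro sector_translate k z(2)) auto
    have n: "cmod (z + c) > 1 + r1" using big norm_triangle_ineq[of "z + c" "- c"] by simp
    then show "cmod (z + c) \<ge> 1" using \<open>r1 > 0\<close> by simp
    then show nz: "z + c \<noteq> 0" by auto
    show "z + c \<notin> \<real>\<^sub>\<le>\<^sub>0"
    proof
      assume "z + c \<in> \<real>\<^sub>\<le>\<^sub>0"
      then have "Re (z + c) \<le> 0" "Im (z + c) = 0" by (auto simp: complex_nonpos_Reals_iff)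
      then have "z + c = 0" using sec by (intro complex_eqI) auto
      then show False using nz by simp
    qed
    have d: "dist (L (z + c) / main_term (z + c)) lim_const < cmod lim_const / 2" using n sec by (intro r1) auto
    have "q (z + c) - 1 = (L (z + c) / main_term (z + c) - lim_const) / lim_const"
      using lim_const_nonzero by (simp add: q_def field_simps)
    then have "dist (q (z + c)) 1 = dist (L (z + c) / main_term (z + c)) lim_const / cmod lim_const"
      by (simp add: dist_norm norm_divide)
    also have "\<dots> < 1 / 2" using d lim_const_nonzero by (simp add: field_simps)
    finally show "dist (q (z + c)) 1 < 1 / 2" .
    show "cmod z \<ge> 1" using z r0 by simp
  qed
  have "E holomorphic_on T"
  proof -
    have L: "(\<lambda>z. L (z + c)) holomorphic_on T"
      by (rule holomorphic_on_subset[OF L_translate_entire]) auto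
    have "(\<lambda>z. main_term (z + c)) holomorphic_on T"
      unfolding main_term_def using shift by (intro holomorphic_intros) auto
    then have "(\<lambda>z. q (z + c)) holomorphic_on T"
      unfolding q_def using shift lim_const_nonzero main_term_nonzero by (intro holomorphic_intros L) auto
    then show ?thesis unfolding E_def using shift Ln_near_one(1)[OF shift(4)] by (intro holomorphic_intros) auto
  qed
  moreover have "L (z + c) = exp (- z\<^sup>2 / 2 + E z) \<and> norm (E z) \<le> D * norm z" if zT: "z \<in> T" for z
  proof
    note s = shift[OF zT]
    have sq: "- z\<^sup>2 / 2 + E z = - (z + c)\<^sup>2 / 2 + \<kappa> * Ln (z + c) + Ln lim_const + Ln (q (z + c))"
      unfolding E_def by (simp add: power2_eq_square field_simps)
    have "exp (- z\<^sup>2 / 2 + E z) = main_term (z + c) * lim_const * q (z + c)"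
      unfolding sq exp_add using s(2) lim_const_nonzero Ln_near_one(2)[OF s(4)] by (simp only: exp_Ln main_term_def powr_def if_False not_False_eq_True)
    then show "L (z + c) = exp (- z\<^sup>2 / 2 + E z)"
      using main_term_nonzero[OF s(2)] lim_const_nonzero by (simp add: q_def)
    have "norm (Ln (z + c)) \<le> (1 + cmod c + pi) * cmod z"
    proof -
      have "norm (Ln (z + c)) \<le> cmod z + (cmod c + pi) * 1" using norm_Ln_le[OF s(1)] norm_triangle_ineq[of z c] by simp
      also have "(cmod c + pi) * 1 \<le> (cmod c + pi) * cmod z" using s(5) by (intro mult_left_mono) auto
      finally show ?thesis by (simp add: distrib_right)
    qed
    then have 1: "norm (\<kappa> * Ln (z + c)) \<le> cmod \<kappa> * (1 + cmod c + pi) * cmod z"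
      unfolding norm_mult mult.assoc by (intro mult_left_mono) auto
    have 2: "norm (- (c * z + c\<^sup>2 / 2)) \<le> (cmod c + (cmod c)\<^sup>2 / 2) * cmod z"
    proof -
      have "norm (- (c * z + c\<^sup>2 / 2)) \<le> cmod c * cmod z + (cmod c)\<^sup>2 / 2 * 1"
        using norm_triangle_ineq[of "c * z" "c\<^sup>2 / 2"] unfolding norm_minus_cancel by (simp add: norm_mult norm_divide norm_power)
      also have "(cmod c)\<^sup>2 / 2 * 1 \<le> (cmod c)\<^sup>2 / 2 * cmod z" using s(5) by (intro mult_left_mono) auto
      finally show ?thesis by (simp add: distrib_right)
    qed
    have 3: "norm (Ln lim_const) \<le> cmod (Ln lim_const) * cmod z"
      using mult_left_mono[OF s(5), of "cmod (Ln lim_const)"] by simp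
    have 4: "norm (Ln (q (z + c))) \<le> (1 + pi) * cmod z"
    proof -
      have "(1 + pi) * 1 \<le> (1 + pi) * cmod z" using s(5) by (intro mult_left_mono) auto
      then show ?thesis unfolding mult_1_right by (rule order_trans[OF Ln_near_one(3)[OF s(4)]])
    qed
    have "norm (E z) \<le> (cmod c + (cmod c)\<^sup>2 / 2) * cmod z + cmod \<kappa> * (1 + cmod c + pi) * cmod z + cmod (Ln lim_const) * cmod z + (1 + pi) * cmod z"
      unfolding E_def by (intro norm_triangle_mono 1 2 3 4)
    also have "\<dots> = D * norm z" by (simp only: D_def distrib_right)
    finally show "norm (E z) \<le> D * norm z" .
  qed
  ultimately show ?thesis unfolding T_def using r0 by (intro exI[of _ r0] conjI exI[of _ E] exI[of _ D]) auto
qed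

theorem L_translate_dichotomy:
  "(\<exists>p. p \<noteq> 0 \<and> (\<forall>w. L w = exp (- w\<^sup>2 / 2) * poly p w)) \<or> (\<exists>C. stokes_function (\<lambda>z. L (z + c)) C)"
proof -
  interpret r: gauss_laplace \<kappa> reflected_coeff R0 R by (rule reflected_instance)
  obtain C1 where C1: "C1 \<ge> 0" "\<And>z. norm (L z) \<le> exp (max 0 (- Re (z\<^sup>2) / 2) + C1 * (norm z + 1))"
    using L_upper_bound by blast
  obtain C2 where C2: "C2 \<ge> 0" "\<And>z. Re z \<ge> R \<Longrightarrow> norm (r.L z) \<le> exp (- Re (z\<^sup>2) / 2 + C2 * (norm z + 1))"
    using r.L_right_bound by blast
  \<comment> \<open>The half plane is enlarged by \<open>cmod c\<close> so that it contains
    \<open>z + c\<close> whenever \<open>Im z \<ge> 0\<close>.\<close>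
  obtain C3 where C3: "C3 \<ge> 0" "\<And>z. Im z \<ge> - cmod c \<Longrightarrow> norm (L z - r.L (- z)) \<le> exp (C3 * (norm z + 1))"
    using reflected_diff_exp_type[of "cmod c"] unfolding exp_type_on_def by auto
  define C where "C = cmod c + (cmod c)\<^sup>2 + (C1 + C2 + C3) * (cmod c + 1)"
  have Cp: "C \<ge> 0" using C1(1) C2(1) C3(1) by (simp add: C_def)
  have mono: "C' * (cmod w + 1) \<le> (C1 + C2 + C3) * (cmod w + 1)" if "C' \<in> {C1, C2, C3}" for C' w
    using that C1(1) C2(1) C3(1) by (intro mult_right_mono) auto
  note sh = shift_bound[of "C1 + C2 + C3" _ c, folded C_def]
  have S: "C1 + C2 + C3 \<ge> 0" using C1(1) C2(1) C3(1) by simp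
  define f where "f = (\<lambda>z. L (z + c))"
  define g where "g = (\<lambda>z. r.L (- (z + c)))"
  have hf: "f holomorphic_on UNIV" unfolding f_def by (rule L_translate_entire)
  have "(\<lambda>z. - (z + c)) holomorphic_on UNIV" by (intro holomorphic_intros)
  from holomorphic_on_compose_gen[OF this r.L_entire] have hg: "g holomorphic_on UNIV" by (simp add: g_def o_def)
  have upper: "norm (f z) \<le> exp (max 0 (- Re (z\<^sup>2) / 2) + C * (norm z + 1))" for z
  proof -
    have "max 0 (- Re ((z + c)\<^sup>2) / 2) + C1 * (norm (z + c) + 1) \<le> max 0 (- Re (z\<^sup>2) / 2) + C * (norm z + 1)"
      using sh(1)[OF S, of z] sh(2)[OF S, of z] mono[of C1 "z + c"] by (auto simp: max_def)
    then have "exp (max 0 (- Re ((z + c)\<^sup>2) / 2) + C1 * (norm (z + c) + 1)) \<le> exp (max 0 (- Re (z\<^sup>2) / 2) + C * (norm z + 1))" by (simp only: exp_le_cancel_iff)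
    then show ?thesis using C1(2)[of "z + c"] unfolding f_def by linarith
  qed
  have "nowhere_small f \<or> f = g"
  proof (rule nowhere_small_or_eq[OF hf hg Cp])
    fix z
    show "norm (f z) \<le> exp (C * (norm z + 1))" if "\<bar>Im z\<bar> \<le> - Re z"
    proof -
      have "\<bar>Im z\<bar> \<le> \<bar>Re z\<bar>" using that by linarith
      then have "(Im z)\<^sup>2 \<le> (Re z)\<^sup>2" by (simp add: abs_le_square_iff)
      then have "Re (z\<^sup>2) \<ge> 0" by (simp add: power2_eq_square)
      then show ?thesis using upper[of z] by simp
    qed
    show "norm (g z) \<le> exp (- Re (z\<^sup>2) / 2 + C * (norm z + 1))" if "Re z \<le> - (R + cmod c)"
    proof -
      have "Re (- (z + c)) \<ge> R" using that abs_Re_le_cmod[of c] by simp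
      from C2(2)[OF this] have "norm (g z) \<le> exp (- Re ((z + c)\<^sup>2) / 2 + C2 * (norm (z + c) + 1))"
        unfolding g_def norm_minus_cancel power2_minus .
      also have "\<dots> \<le> exp (- Re (z\<^sup>2) / 2 + C * (norm z + 1))"
        unfolding exp_le_cancel_iff using sh(1)[OF S, of z] mono[of C2 "z + c"] by simp
      finally show ?thesis .
    qed
    show "norm (f z - g z) \<le> exp (C * (norm z + 1))" if "Im z \<ge> 0"
    proof -
      have "Im (z + c) \<ge> - cmod c" using that abs_Im_le_cmod[of c] by simp
      from C3(2)[OF this] have "norm (f z - g z) \<le> exp (C3 * (norm (z + c) + 1))" unfolding f_def g_def .
      also have "\<dots> \<le> exp (C * (norm z + 1))"
        unfolding exp_le_cancel_iff using sh(2)[OF S, of z] mono[of C3 "z + c"] by simp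
      finally show ?thesis .
    qed
  qed
  then show ?thesis
  proof
    assume "f = g"
    then have "f (w - c) = g (w - c)" for w by (rule fun_cong)
    then have "L w = r.L (- w)" for w unfolding f_def g_def diff_add_cancel .
    then show ?thesis using L_symmetric_imp_polynomial by blast
  next
    assume ns: "nowhere_small f"
    have "stokes_function f C"
      by (rule stokes_function.intro[OF hf Cp upper _ ns]) (unfold f_def, rule L_log_asymp)
    then show ?thesis unfolding f_def by blast
  qed
qed

end

text \<open>The linear coefficient \<open>c\<close> is not normalised to 0, so the exceptional case
  carries the extra factor \<open>exp (- c * z)\<close>; the other assertions are insensitive to the
  translation.\<close>

theorem theorem5:
  fixes n :: nat and a b :: "nat \<Rightarrow> complex" and R0 R :: real
    and \<phi> \<Lambda> :: "complex \<Rightarrow> complex"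
  assumes "n \<ge> 1"
    and "\<exists>z. a 0 + b 0 * z \<noteq> 0"
    and "b (n - 1) = 1"
    and "R0 \<ge> 0"
    and "\<forall>t. symbol_Q1 n b t = 0 \<longrightarrow> cmod t < R0"
    and "laplace_kernel n a b R0 \<phi>"
    and "R > R0"
    and "\<Lambda> = laplace_contour_integral R \<phi>"
  shows
    "(\<exists>P :: complex poly. P \<noteq> 0 \<and>
        (\<forall>z. \<Lambda> z = exp (- (z ^ 2 / 2) - linear_coeff n a b * z) * poly P z)) \<or>
     ((\<forall>\<epsilon>>0. \<exists>r0>0. \<exists>logL.
         let S = {z. cmod z > r0 \<and> \<bar>Arg z\<bar> < 3 / 4 * pi - \<epsilon>} in
           logL holomorphic_on S \<and> (\<forall>z\<in>S. exp (logL z) = \<Lambda> z) \<and>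
           ((\<lambda>z. logL z / z ^ 2) \<longlongrightarrow> - 1 / 2) (inf at_infinity (principal S))) \<and>
      (\<forall>\<theta>. \<bar>\<theta>\<bar> < 3 / 4 * pi \<longrightarrow>
         pl_indicator 2 \<Lambda> \<theta> = ereal (- 1 / 2 * cos (2 * \<theta>))) \<and>
      (\<forall>\<theta>. 3 / 4 * pi \<le> \<bar>\<theta>\<bar> \<and> \<bar>\<theta>\<bar> \<le> pi \<longrightarrow> pl_indicator 2 \<Lambda> \<theta> = 0) \<and>
      (\<forall>\<epsilon>>0. finite {z. \<bar>Arg z\<bar> \<le> 3 / 4 * pi - \<epsilon> \<and> \<Lambda> z = 0}) \<and>
      (\<forall>\<epsilon>>0. (\<lambda>r. real (zero_count \<Lambda> {z. \<bar>Arg2pi z - pi\<bar> < pi / 4 - \<epsilon> \<and> cmod z < r}))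
                \<in> o[at_top](\<lambda>r. r ^ 2)) \<and>
      (\<lambda>r. nev_characteristic r \<Lambda>) \<sim>[at_top] (\<lambda>r. 1 / (2 * pi) * r ^ 2) \<and>
      (\<lambda>r. nev_counting r (\<lambda>z. 1 / \<Lambda> z)) \<sim>[at_top] (\<lambda>r. 1 / (4 * pi) * r ^ 2))"
proof -
  define c where "c = linear_coeff n a b"
  \<comment> \<open>Strictly between the two radii: positive even for \<open>R0 = 0\<close>, and
    smaller than \<open>R\<close>, as the transform requires.\<close>
  define R1 where "R1 = (R0 + R) / 2"
  have R1: "R1 > R0" "R1 < R" "R1 > 0" using assms(4,7) by (auto simp: R1_def)
  obtain \<kappa> U where U: "U holomorphic_on ball 0 (1 / R1)" "U 0 \<noteq> 0"
    and \<phi>: "\<And>t. t \<in> slit_exterior R1 \<Longrightarrow> \<phi> t = gauss_kernel \<kappa> U t * exp (- c * t)"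
  proof (rule laplace_kernel_gauss[OF assms(1,3,4) R1(1) _ assms(6)])
    show "cmod t < R0" if "symbol_Q1 n b t = 0" for t using assms(5) that by blast
    show thesis if "U holomorphic_on ball 0 (1 / R1)" "U 0 \<noteq> 0"
      "\<And>t. t \<in> slit_exterior R1 \<Longrightarrow> \<phi> t = gauss_kernel \<kappa> U t * exp (- linear_coeff n a b * t)" for U \<kappa>
      using that \<open>\<And>U \<kappa>. U holomorphic_on ball 0 (1 / R1) \<Longrightarrow> U 0 \<noteq> 0 \<Longrightarrow> (\<And>t. t \<in> slit_exterior R1 \<Longrightarrow> \<phi> t = gauss_kernel \<kappa> U t * exp (- c * t)) \<Longrightarrow> thesis\<close>
      unfolding c_def by blast
  qed
  interpret gauss_laplace \<kappa> U R1 R using R1 U by unfold_locales auto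
  have mem: "t \<in> slit_exterior R1" if "cmod t \<ge> R" "Im t \<noteq> 0 \<or> Re t > 0" for t
    using that R1 S_Im[of t] S_Re[of t] by auto
  \<comment> \<open>The factor \<open>exp (- c * t)\<close> merges with
    \<open>exp (- z * t)\<close>. Only values on the contour enter, and the contour lies in the slit
    exterior of radius \<open>R1\<close>, where the normal form of the kernel holds.\<close>
  have \<Lambda>: "\<Lambda> z = L (z + c)" for z
  proof -
    have eq: "\<phi> t * exp (- z * t) = gauss_kernel \<kappa> U t * exp (- (z + c) * t)" if "cmod t \<ge> R" "Im t \<noteq> 0 \<or> Re t > 0" for t
      unfolding \<phi>[OF mem[OF that]] by (simp add: algebra_simps flip: exp_add)
    have 1: "integral {R..} (\<lambda>r. \<phi> (\<i> * of_real r) * exp (- z * (\<i> * of_real r)) * \<i>)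
      = integral {R..} (\<lambda>r. gauss_kernel \<kappa> U (\<i> * of_real r) * exp (- (z + c) * (\<i> * of_real r)) * \<i>)"
      by (rule Henstock_Kurzweil_Integration.integral_cong, subst eq) (use R1 in \<open>auto simp: norm_mult\<close>)
    have 2: "integral {R..} (\<lambda>r. \<phi> (- \<i> * of_real r) * exp (- z * (- \<i> * of_real r)) * (- \<i>))
      = integral {R..} (\<lambda>r. gauss_kernel \<kappa> U (- \<i> * of_real r) * exp (- (z + c) * (- \<i> * of_real r)) * (- \<i>))"
      by (rule Henstock_Kurzweil_Integration.integral_cong, subst eq) (use R1 in \<open>auto simp: norm_mult\<close>)
    have 3: "contour_integral (part_circlepath 0 R (pi / 2) (- (pi / 2))) (\<lambda>t. \<phi> t * exp (- z * t))
      = contour_integral (part_circlepath 0 R (pi / 2) (- (pi / 2))) (\<lambda>t. gauss_kernel \<kappa> U t * exp (- (z + c) * t))"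
    proof (rule contour_integral_eq)
      fix t assume "t \<in> path_image (part_circlepath 0 R (pi / 2) (- (pi / 2)))"
      then obtain \<theta> where \<theta>: "- (pi / 2) \<le> \<theta>" "\<theta> \<le> pi / 2" "t = of_real R * cis \<theta>"
        using pi_gt_zero by (auto simp: path_image_part_circlepath' closed_segment_eq_real_ivl split: if_splits)
      have "Im t \<noteq> 0 \<or> Re t > 0"
      proof (cases "sin \<theta> = 0")
        case True
        then have "\<theta> = 0" using \<theta> sin_zero_pi_iff[of \<theta>] by (cases "\<bar>\<theta>\<bar> < pi") auto
        then show ?thesis using R1 \<theta> by simp
      qed (use R1 \<theta> in auto)
      then show "\<phi> t * exp (- z * t) = gauss_kernel \<kappa> U t * exp (- (z + c) * t)"
        using R1 \<theta> by (intro eq) (auto simp: norm_mult)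
    qed
    show ?thesis unfolding assms(8) L_def laplace_contour_integral_def 1 2 3 ..
  qed
  from L_translate_dichotomy[of c] show ?thesis
  proof
    assume "\<exists>p. p \<noteq> 0 \<and> (\<forall>w. L w = exp (- w\<^sup>2 / 2) * poly p w)"
    then obtain p where p: "p \<noteq> 0" "\<And>w. L w = exp (- w\<^sup>2 / 2) * poly p w" by blast
    \<comment> \<open>The constant \<open>exp (- c\<^sup>2 / 2)\<close> from expanding the
      translated Gaussian goes into the polynomial.\<close>
    define P where "P = smult (exp (- c\<^sup>2 / 2)) (pcompose p [:c, 1:])"
    have "P \<noteq> 0" using p(1) pcompose_eq_0[of p "[:c, 1:]"] by (auto simp: P_def)
    moreover have "\<Lambda> z = exp (- (z ^ 2 / 2) - linear_coeff n a b * z) * poly P z" for z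
    proof -
      have "- (z + c)\<^sup>2 / 2 = (- (z ^ 2 / 2) - c * z) + - c\<^sup>2 / 2" by (simp add: power2_eq_square field_simps)
      then have "exp (- (z + c)\<^sup>2 / 2) = exp (- (z ^ 2 / 2) - c * z) * exp (- c\<^sup>2 / 2)" by (simp only: exp_add)
      then show ?thesis unfolding \<Lambda> p(2) c_def[symmetric] by (simp add: P_def poly_pcompose add.commute mult.assoc)
    qed
    ultimately show ?thesis by blast
  next
    assume "\<exists>C. stokes_function (\<lambda>z. L (z + c)) C"
    then obtain C where "stokes_function \<Lambda> C" unfolding ext[of \<Lambda> "\<lambda>z. L (z + c)", OF \<Lambda>, symmetric] by blast
    then interpret s: stokes_function \<Lambda> C .
    show ?thesis
      using s.holomorphic_log_branch s.pl_indicator_right s.pl_indicator_left s.finite_zeros_sector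
        s.zero_count_left_sector s.nev_characteristic_asymp s.nev_counting_asymp by auto
  qed
qed

end
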